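(* Let $Q$ be a finite quiver without loops or oriented cycles, let $d\in\mathbb{Z}_{\ge 0}Q_0$ be a nonzero dimension vector and let $\zeta\in\mathbb{R}Q_0$ be a stability vector normalised for $d$, i.e. $\sum_{v\in Q_0}d_v\zeta_v=0$. Suppose that the lift $\tilde\zeta$ of $\zeta$ is regular with respect to the hyperplane arrangement defined by the dimension vector $d$. Then $$\frac{1}{d!}\,\mathrm{JK}^{\infty}_{ab}(\mathrm{Z}_Q(d),\zeta)=\bar\chi_Q(d,\zeta),$$ where $\mathrm{JK}^\infty_{ab}(\mathrm{Z}_Q(d),\zeta)$ is the abelianised Jeffrey-Kirwan residue in the limit of large $R$-charges and $\bar\chi_Q(d,\zeta)$ is the generalised Donaldson-Thomas invariant of $Q$.
   Context: **Conventions.** $t(\alpha),h(\alpha)$ are the tail and head of an arrow. $d!=\prod_{i\in Q_0}d_i!$. $\chi_Q(e,e')=\sum_i e_ie'_i-\sum_{\alpha\in Q_1}e_{t(\alpha)}e'_{h(\alpha)}$ and $D=1-\chi_Q(d,d)$. For $e\in\mathbb{Z}_{\ge0}Q_0$ write $\zeta(e)=\sum_ve_v\zeta_v$. When $\zeta(e)=0$, a representation of dimension $e$ is $\zeta$-semistable (stable) if $\zeta(\dim S)\le 0$ (resp. $<0$) for all proper nonzero subrepresentations $S$. **Regularity.** Consider coordinates $u_{v,k}$, $v\in Q_0$, $1\le k\le d_v$, fix a reference pair $(\bar v,\bar k)$ and let $\mathfrak a$ be the real vector space $\{u_{\bar v,\bar k}=0\}$, $V=\mathfrak a^*$, $n=\dim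 V=\sum_v d_v-1$. Let $\mathfrak A\subset V$ be the set of restrictions to $\mathfrak a$ of the roots $u_{v,j}-u_{v,i}$ ($v\in Q_0$, $i\ne j$) and of the weights $u_{h(\alpha),j}-u_{t(\alpha),i}$ ($\alpha\in Q_1$, $1\le i\le d_{t(\alpha)}$, $1\le j\le d_{h(\alpha)}$). For a finite $S\subset V$, a vector of $V$ is $S$-regular if it lies in no subspace spanned by $n-1$ elements of $S$; the connected components of the set of $S$-regular vectors are the $S$-chambers. The lift of $\zeta$ is $\tilde\zeta=\sum_{(v,k)\neq(\bar v,\bar k)}\zeta_v u_{v,k}\in V$; it is regular with respect to the arrangement defined by $d$ if it is $\mathfrak A$-regular. **Iterated residue.** For a germ $f$ at $0\in\mathbb{C}^n$ of meromorphic function, $\mathrm{Res}_{z_1=0}f$ is the coefficient of $z_1^{-1}$ in the Laurent expansion of $f$ in $z_1$ with coefficients germs of meromorphic functions of $z_2,\dots,z_n$; $\mathrm{IR}_0(f)=\mathrm{Res}_{z_n=0}\cdots\mathrm{Res}_{z_1=0}f$. **Local JK residue.** Let $V=\mathfrak a^*$ be a real $n$-dimensional vector space and $A\subset V$ a finite spanning set contained in an open half-space. Fix $d\mu=f_1\wedge\dots\wedge f_n$ with $f_i\in A$ a basis of $V$ (in all cases below the choice is irrelevant). $\Sigma A$ is the set of all sums of distinct elements of $A$. $\mathcal{FL}(A)$ is the set of complete flags $\mathfrak F=[0=F_0\subset\dots\subset F_n=V]$ with $\dim F_j=j$ and each $F_j$ spanned by elements of $A$. Put $\kappa_j^{\mathfrak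 F}=\sum_{\alpha\in A\cap F_j}\alpha$; $\nu(\mathfrak F)=0,+1,-1$ if $(\kappa^{\mathfrak F}_j)_j$ is respectively not a basis, a positively oriented basis, a negatively oriented basis with respect to $d\mu$. $\mathrm{Res}_{\mathfrak F}(f)=\mathrm{IR}_0$ of $f$ written in coordinates $z_i=\gamma_i$, where $\gamma$ is any basis of $V$ with $\gamma_1,\dots,\gamma_m$ spanning $F_m$ for all $m$ and $\gamma_1\wedge\dots\wedge\gamma_n=d\mu$. For a $\Sigma A$-regular $\xi$ put $\mathrm{JK}^{A}_\xi(f)=\sum_{\mathfrak F:\ \xi\in\sum_j\mathbb{R}_{>0}\kappa_j^{\mathfrak F}}\nu(\mathfrak F)\mathrm{Res}_{\mathfrak F}(f)$, for $f$ a meromorphic germ at $0\in\mathfrak a_{\mathbb C}$. **JK residue of an abelian quiver.** Let $Q'$ be a finite quiver without loops or oriented cycles, with dimension vector $\mathbb I=(1,\dots,1)$ and $\eta\in\mathbb{R}Q'_0$ with $\sum_v\eta_v=0$. Fix $v_0\in Q'_0$, $\mathfrak a=\mathbb{R}^{Q'_0\setminus\{v_0\}}$ with coordinates $u_v$ and $u_{v_0}:=0$, $V=\mathfrak a^*$. Let $\mathcal W\subset V$ be the set of functionals $\rho=u_{h(\alpha)}-u_{t(\alpha)}$, $\alpha\in Q'_1$, and $m_\rho$ the number of arrows giving $\rho$. Let $\tilde\eta=\sum_{v\ne v_0}\eta_vu_v$, assumed $\mathcal W$-regular. For $R\in\mathbb{R}^{\mathcal W}$ ($R$-charges) let $$\hat{\mathrm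 Z}_{Q',R}(u)=(-1)^{|Q'_0|-1}\prod_{\rho\in\mathcal W}\Big(\frac{\rho(u)+R_\rho-1}{\rho(u)+R_\rho}\Big)^{m_\rho}.$$ Let $\mathfrak M_{sing}\subset\mathfrak a_{\mathbb C}$ be the finite set of points at which $|Q_0'|-1$ linearly independent hyperplanes $H_\rho=\{\rho+R_\rho=0\}$ meet, and for $x\in\mathfrak M_{sing}$ let $\mathcal W_x=\{\rho: x\in H_\rho\}$. $R$ is generic if it lies in a dense open cone $\mathfrak P(Q')\subset\mathbb{R}^{\mathcal W}$ such that for every $R\in\mathfrak P(Q')$ no point of $\mathfrak M_{sing}$ lies on $|Q_0'|$ or more of the $H_\rho$. For generic $R$, $$\mathrm{JK}(\hat{\mathrm Z}_{Q',R},\eta)=\sum_{x\in\mathfrak M_{sing}}\mathrm{JK}^{\mathcal W_x}_\xi\big(\hat{\mathrm Z}_{Q',R}(\,\cdot+x)\big),$$ where $\xi$ is any $\Sigma\mathcal W$-regular vector in the same $\mathcal W$-chamber as $-\tilde\eta$. **Abelianised JK residue.** Let $\widehat Q$ be the quiver with vertices $i_{k,l}$, $i\in Q_0$, $k,l\ge1$, in which every arrow $i\to j$ of $Q$ is replaced by $ll'$ arrows $i_{k,l}\to j_{k',l'}$ for all $k,l,k',l'$. Write $m_*\vdash d$ for collections $m_{i,l}\in\mathbb{Z}_{\ge0}$ with $\sum_l l\,m_{i,l}=d_i$ for all $i$; let $Q'(m_* )$ be the full subquiver of $\widehat Q$ on the vertices $i_{k,l}$, $1\le k\le m_{i,l}$,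 and $\widehat\zeta_{i_{k,l}}=l\zeta_i$. For $R$-charges $R(m_* )$ of the quivers $Q'(m_* )$ put $$\mathrm{JK}_{ab}(\mathrm Z_Q(d),\zeta)=(-1)^D\,d!\sum_{m_*\vdash d}\ \prod_{i\in Q_0,\,l\ge1}\frac1{m_{i,l}!}\Big(\frac{(-1)^{l-1}}{l^2}\Big)^{m_{i,l}}\mathrm{JK}\big(\hat{\mathrm Z}_{Q'(m_* ),R(m_* )},\widehat\zeta\big).$$ $\mathrm{JK}^\infty_{ab}(\mathrm Z_Q(d),\zeta)$ is the limit for $\lambda\to+\infty$ of this quantity computed with $R(m_* )=\lambda\bar R(m_* )$, where $\bar R(m_* )\in\mathfrak P(Q'(m_* ))$ are fixed. **Generalised DT invariant.** For $e$ with $\zeta(e)=0$ let $a_e(q)$ be the rational function of $q$ giving the number of $\mathbb{F}_q$-points of the locus of $\zeta$-semistable representations of dimension $e$ divided by $\prod_i|GL_{e_i}(\mathbb{F}_q)|$. Set $$b_d(q)=\sum_{n\ge1}\frac{(-1)^{n-1}}{n}\sum_{\substack{e_1+\dots+e_n=d\\ e_i\ne0,\ \zeta(e_i)=0}}q^{-\sum_{i<j}\chi_Q(e_j,e_i)}\prod_ia_{e_i}(q).$$ Then $\bar\chi_Q(d,\zeta)=(-1)^{D}\lim_{q\to1}(q-1)b_d(q)\in\mathbb{Q}$ (the Joyce-Song/Kontsevich-Soibelman invariant). In particular $\bar\chi_Q(d,\zeta)=(-1)^D\chi(\mathcal M_d^{\zeta-st}(Q))$ if $\zeta$-semistability and $\zeta$-stability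 coincide in dimension $d$. *)

theory Defs
  imports
    "HOL-Complex_Analysis.Complex_Residues"
    "HOL-Library.Function_Algebras"
    "Graph_Theory.Arc_Walk"
    "Graph_Theory.Digraph_Component"
    "Jordan_Normal_Form.Determinant"
    "Jordan_Normal_Form.Missing_VectorSpace"
begin

section \<open>Quivers, dimension vectors, stability\<close>

text \<open>
  Quivers are multi-digraphs \<open>Q\<close>: vertices \<^term>\<open>verts Q\<close>, arrows \<^term>\<open>arcs Q\<close>.  A dimension vector
  vanishes outside \<^term>\<open>verts Q\<close>; of a stability vector only the values on \<^term>\<open>verts Q\<close> matter.
\<close>

definition dim_vectors :: "('v, 'a) pre_digraph \<Rightarrow> ('v \<Rightarrow> nat) set" where
  "dim_vectors Q = {e. \<forall>v. v \<notin> verts Q \<longrightarrow> e v = 0}"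

definition dim_fact :: "('v, 'a) pre_digraph \<Rightarrow> ('v \<Rightarrow> nat) \<Rightarrow> nat" where
  "dim_fact Q d = (\<Prod>v\<in>verts Q. fact (d v))"

definition euler_form :: "('v, 'a) pre_digraph \<Rightarrow> ('v \<Rightarrow> nat) \<Rightarrow> ('v \<Rightarrow> nat) \<Rightarrow> int" where
  "euler_form Q e e' = (\<Sum>i\<in>verts Q. int (e i) * int (e' i))
     - (\<Sum>\<alpha>\<in>arcs Q. int (e (tail Q \<alpha>)) * int (e' (head Q \<alpha>)))"

definition moduli_dim :: "('v, 'a) pre_digraph \<Rightarrow> ('v \<Rightarrow> nat) \<Rightarrow> int" where
  "moduli_dim Q d = 1 - euler_form Q d d"

definition stab_weight :: "('v, 'a) pre_digraph \<Rightarrow> ('v \<Rightarrow> real) \<Rightarrow> ('v \<Rightarrow> nat) \<Rightarrow> real" where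
  "stab_weight Q \<zeta> e = (\<Sum>v\<in>verts Q. real (e v) * \<zeta> v)"


section \<open>Generalised Donaldson--Thomas invariants\<close>

definition coord_vs :: "('k, 'b) ring_scheme \<Rightarrow> nat \<Rightarrow> ('k, nat \<Rightarrow> 'k) module" where
  "coord_vs F n = ring.func_space F {..<n}"

text \<open>Linear maps are made extensional on the source, so that each is counted once.\<close>

definition lin_maps :: "('k, 'b) ring_scheme \<Rightarrow> nat \<Rightarrow> nat \<Rightarrow> ((nat \<Rightarrow> 'k) \<Rightarrow> (nat \<Rightarrow> 'k)) set" where
  "lin_maps F m n =
     module_hom F (coord_vs F m) (coord_vs F n) \<inter> extensional (carrier (coord_vs F m))"

definition gen_lin :: "('k, 'b) ring_scheme \<Rightarrow> nat \<Rightarrow> ((nat \<Rightarrow> 'k) \<Rightarrow> (nat \<Rightarrow> 'k)) set" where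
  "gen_lin F n = {T \<in> lin_maps F n n. bij_betw T (carrier (coord_vs F n)) (carrier (coord_vs F n))}"

definition quiver_reps ::
  "('k, 'b) ring_scheme \<Rightarrow> ('v, 'a) pre_digraph \<Rightarrow> ('v \<Rightarrow> nat) \<Rightarrow>
   ('a \<Rightarrow> (nat \<Rightarrow> 'k) \<Rightarrow> (nat \<Rightarrow> 'k)) set" where
  "quiver_reps F Q e = (\<Pi>\<^sub>E \<alpha>\<in>arcs Q. lin_maps F (e (tail Q \<alpha>)) (e (head Q \<alpha>)))"

definition is_subrep ::
  "('k, 'b) ring_scheme \<Rightarrow> ('v, 'a) pre_digraph \<Rightarrow> ('v \<Rightarrow> nat) \<Rightarrow>
   ('a \<Rightarrow> (nat \<Rightarrow> 'k) \<Rightarrow> (nat \<Rightarrow> 'k)) \<Rightarrow> ('v \<Rightarrow> (nat \<Rightarrow> 'k) set) \<Rightarrow> bool" where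
  "is_subrep F Q e x U \<longleftrightarrow>
     (\<forall>v\<in>verts Q. VectorSpace.subspace F (U v) (coord_vs F (e v))) \<and>
     (\<forall>\<alpha>\<in>arcs Q. x \<alpha> ` U (tail Q \<alpha>) \<subseteq> U (head Q \<alpha>))"

definition subrep_dim ::
  "('k, 'b) ring_scheme \<Rightarrow> ('v, 'a) pre_digraph \<Rightarrow> ('v \<Rightarrow> nat) \<Rightarrow> ('v \<Rightarrow> (nat \<Rightarrow> 'k) set) \<Rightarrow>
   'v \<Rightarrow> nat" where
  "subrep_dim F Q e U =
     (\<lambda>v. if v \<in> verts Q then vectorspace.dim F ((coord_vs F (e v))\<lparr>carrier := U v\<rparr>) else 0)"

definition semistable_reps ::
  "('k, 'b) ring_scheme \<Rightarrow> ('v, 'a) pre_digraph \<Rightarrow> ('v \<Rightarrow> real) \<Rightarrow> ('v \<Rightarrow> nat) \<Rightarrow>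
   ('a \<Rightarrow> (nat \<Rightarrow> 'k) \<Rightarrow> (nat \<Rightarrow> 'k)) set" where
  "semistable_reps F Q \<zeta> e =
     {x \<in> quiver_reps F Q e. \<forall>U. is_subrep F Q e x U
        \<and> (\<exists>v\<in>verts Q. U v \<noteq> {\<zero>\<^bsub>coord_vs F (e v)\<^esub>})
        \<and> (\<exists>v\<in>verts Q. U v \<noteq> carrier (coord_vs F (e v)))
        \<longrightarrow> stab_weight Q \<zeta> (subrep_dim F Q e U) \<le> 0}"

definition rational_function :: "(real \<Rightarrow> real) \<Rightarrow> bool" where
  "rational_function f \<longleftrightarrow> (\<exists>p r :: real poly. r \<noteq> 0 \<and> f = (\<lambda>q. poly p q / poly r q))"

text \<open>
  Every finite field is isomorphic to one whose carrier is a set of natural numbers, so the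
  quantification over \<open>F :: nat ring\<close> covers all finite fields.  Two functions meeting the
  description agree off a finite set, so limits of expressions in \<open>semistable_count\<close> do not depend
  on the choice.
\<close>

definition semistable_count ::
  "('v, 'a) pre_digraph \<Rightarrow> ('v \<Rightarrow> real) \<Rightarrow> ('v \<Rightarrow> nat) \<Rightarrow> real \<Rightarrow> real" where
  "semistable_count Q \<zeta> e = (SOME f. rational_function f \<and>
     (\<forall>F :: nat ring. field F \<and> finite (carrier F) \<longrightarrow>
        f (real (card (carrier F))) =
          real (card (semistable_reps F Q \<zeta> e)) / (\<Prod>i\<in>verts Q. real (card (gen_lin F (e i))))))"

text \<open>The tuples \<open>(e\<^sub>1, \<dots>, e\<^sub>n)\<close>, over all \<open>n \<ge> 1\<close>, are the nonempty lists \<open>es\<close>.\<close>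

definition DT_coeff :: "('v, 'a) pre_digraph \<Rightarrow> ('v \<Rightarrow> real) \<Rightarrow> ('v \<Rightarrow> nat) \<Rightarrow> real \<Rightarrow> real" where
  "DT_coeff Q \<zeta> d q =
     (\<Sum>es | es \<noteq> [] \<and> set es \<subseteq> {e \<in> dim_vectors Q. e \<noteq> 0 \<and> stab_weight Q \<zeta> e = 0} \<and> sum_list es = d.
        (-1) ^ (length es - 1) / real (length es)
        * q powi (- (\<Sum>j<length es. \<Sum>i<j. euler_form Q (es ! j) (es ! i)))
        * (\<Prod>e\<leftarrow>es. semistable_count Q \<zeta> e q))"

definition DT_invariant :: "('v, 'a) pre_digraph \<Rightarrow> ('v \<Rightarrow> nat) \<Rightarrow> ('v \<Rightarrow> real) \<Rightarrow> real" where
  "DT_invariant Q d \<zeta> =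
     (-1) powi moduli_dim Q d * Lim (at 1) (\<lambda>q. (q - 1) * DT_coeff Q \<zeta> d q)"


section \<open>The spaces \<open>\<aa>\<close> and \<open>V = \<aa>\<^sup>*\<close>, regular vectors and chambers\<close>

instantiation "fun" :: (type, real_vector) real_vector
begin

definition scaleR_fun_def: "c *\<^sub>R f = (\<lambda>x. c *\<^sub>R f x)"

instance
  by standard (simp_all add: scaleR_fun_def fun_eq_iff scaleR_add_right scaleR_add_left)

end

text \<open>
  Let \<open>u\<^sub>x\<close> (\<open>x \<in> I\<close>) be coordinates, \<open>r \<in> I\<close> a reference index and \<open>\<aa> = {u\<^sub>r = 0}\<close>.  Points of the
  complexification of \<open>\<aa>\<close> are complex functions, and elements of \<open>V\<close> are real coefficient functions
  with respect to the basis \<open>(u\<^sub>x)\<close>, \<open>x \<noteq> r\<close>, of \<open>V\<close>; both vanish at \<open>r\<close> and outside \<open>I\<close>.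
\<close>

definition coord_space :: "'i set \<Rightarrow> 'i \<Rightarrow> ('i \<Rightarrow> 'b::zero) set" where
  "coord_space I r = {f. \<forall>x. x \<notin> I \<or> x = r \<longrightarrow> f x = 0}"

text \<open>The restriction of \<open>u\<^sub>x\<close> to \<open>\<aa>\<close>; in particular it is \<open>0\<close> for \<open>x = r\<close>.\<close>

definition coord_fun :: "'i \<Rightarrow> 'i \<Rightarrow> ('i \<Rightarrow> real)" where
  "coord_fun r x = (\<lambda>y. if y = x \<and> x \<noteq> r then 1 else 0)"

definition pairing :: "'i set \<Rightarrow> ('i \<Rightarrow> real) \<Rightarrow> ('i \<Rightarrow> complex) \<Rightarrow> complex" where
  "pairing I \<gamma> u = (\<Sum>x\<in>I. of_real (\<gamma> x) * u x)"

definition lift :: "'i set \<Rightarrow> 'i \<Rightarrow> ('i \<Rightarrow> real) \<Rightarrow> ('i \<Rightarrow> real)" where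
  "lift I r \<eta> = (\<Sum>x\<in>I - {r}. \<eta> x *\<^sub>R coord_fun r x)"

text \<open>
  \<open>n = dim V\<close> is \<^term>\<open>card (I - {r})\<close>.  For \<open>n = 0\<close> there is no \<open>T\<close> with \<open>n - 1\<close> elements and the
  vector \<open>0\<close> is regular, hence \<^term>\<open>card T + 1 = n\<close> and not truncated subtraction.
\<close>

definition regular_vectors :: "'i set \<Rightarrow> 'i \<Rightarrow> ('i \<Rightarrow> real) set \<Rightarrow> ('i \<Rightarrow> real) set" where
  "regular_vectors I r S =
     {\<xi> \<in> coord_space I r. \<forall>T\<subseteq>S. finite T \<and> card T + 1 = card (I - {r}) \<longrightarrow> \<xi> \<notin> span T}"

definition same_chamber ::
  "'i set \<Rightarrow> 'i \<Rightarrow> ('i \<Rightarrow> real) set \<Rightarrow> ('i \<Rightarrow> real) \<Rightarrow> ('i \<Rightarrow> real) \<Rightarrow> bool" where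
  "same_chamber I r S \<xi> \<xi>' \<longleftrightarrow> connected_component (regular_vectors I r S) \<xi> \<xi>'"

definition cartan_index :: "('v, 'a) pre_digraph \<Rightarrow> ('v \<Rightarrow> nat) \<Rightarrow> ('v \<times> nat) set" where
  "cartan_index Q d = {(v, k). v \<in> verts Q \<and> 1 \<le> k \<and> k \<le> d v}"

definition roots_weights ::
  "('v, 'a) pre_digraph \<Rightarrow> ('v \<Rightarrow> nat) \<Rightarrow> 'v \<times> nat \<Rightarrow> ('v \<times> nat \<Rightarrow> real) set" where
  "roots_weights Q d r =
     {coord_fun r (v, j) - coord_fun r (v, i) | v i j.
        v \<in> verts Q \<and> i \<in> {1..d v} \<and> j \<in> {1..d v} \<and> i \<noteq> j} \<union>
     {coord_fun r (head Q \<alpha>, j) - coord_fun r (tail Q \<alpha>, i) | \<alpha> i j.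
        \<alpha> \<in> arcs Q \<and> i \<in> {1..d (tail Q \<alpha>)} \<and> j \<in> {1..d (head Q \<alpha>)}}"

definition lift_regular ::
  "('v, 'a) pre_digraph \<Rightarrow> ('v \<Rightarrow> nat) \<Rightarrow> ('v \<Rightarrow> real) \<Rightarrow> 'v \<times> nat \<Rightarrow> bool" where
  "lift_regular Q d \<zeta> r \<longleftrightarrow>
     lift (cartan_index Q d) r (\<lambda>(v, k). \<zeta> v)
       \<in> regular_vectors (cartan_index Q d) r (roots_weights Q d r)"


section \<open>Local Jeffrey--Kirwan residues\<close>

text \<open>
  Coordinates are numbered from \<open>0\<close>.  The coefficient of \<open>z\<^sub>k\<^sup>-\<^sup>1\<close> in the Laurent expansion in \<open>z\<^sub>k\<close>
  is taken pointwise in the remaining variables, which represents the meromorphic germ of that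
  coefficient at all generic points; the residue in the next variable only sees a punctured
  neighbourhood of \<open>0\<close>.  After the last step the dependence on \<open>z\<close> is void.
\<close>

definition partial_residue :: "nat \<Rightarrow> ((nat \<Rightarrow> complex) \<Rightarrow> complex) \<Rightarrow> (nat \<Rightarrow> complex) \<Rightarrow> complex" where
  "partial_residue k f = (\<lambda>z. residue (\<lambda>w. f (z(k := w))) 0)"

definition iterated_residue :: "nat \<Rightarrow> ((nat \<Rightarrow> complex) \<Rightarrow> complex) \<Rightarrow> complex" where
  "iterated_residue n f = fold partial_residue [0..<n] f (\<lambda>_. 0)"

text \<open>Ordered bases \<open>g 0, \<dots>, g (n - 1)\<close> of \<open>V\<close>.\<close>

definition ordered_basis :: "'i set \<Rightarrow> 'i \<Rightarrow> (nat \<Rightarrow> 'i \<Rightarrow> real) \<Rightarrow> bool" where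
  "ordered_basis I r g \<longleftrightarrow> inj_on g {..<card (I - {r})} \<and> independent (g ` {..<card (I - {r})})
     \<and> span (g ` {..<card (I - {r})}) = coord_space I r"

text \<open>The \<open>c\<close> with \<open>g 0 \<and> \<dots> \<and> g (n - 1) = c (f 0 \<and> \<dots> \<and> f (n - 1))\<close>, for a basis \<open>f\<close>.\<close>

definition wedge_ratio :: "nat \<Rightarrow> (nat \<Rightarrow> 'i \<Rightarrow> real) \<Rightarrow> (nat \<Rightarrow> 'i \<Rightarrow> real) \<Rightarrow> real" where
  "wedge_ratio n f g = Determinant.det
     (THE M. M \<in> carrier_mat n n \<and> (\<forall>j<n. g j = (\<Sum>i<n. (M $$ (i, j)) *\<^sub>R f i)))"

definition complete_flags :: "'i set \<Rightarrow> 'i \<Rightarrow> ('i \<Rightarrow> real) set \<Rightarrow> ('i \<Rightarrow> real) set list set" where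
  "complete_flags I r A = {\<FF>. length \<FF> = card (I - {r}) + 1
     \<and> \<FF> ! 0 = {0} \<and> \<FF> ! card (I - {r}) = coord_space I r
     \<and> (\<forall>j<card (I - {r}). \<FF> ! j \<subseteq> \<FF> ! (j + 1))
     \<and> (\<forall>j\<le>card (I - {r}). dim (\<FF> ! j) = j \<and> (\<exists>B\<subseteq>A. \<FF> ! j = span B))}"

definition flag_kappa :: "('i \<Rightarrow> real) set \<Rightarrow> ('i \<Rightarrow> real) set list \<Rightarrow> nat \<Rightarrow> ('i \<Rightarrow> real)" where
  "flag_kappa A \<FF> j = \<Sum>(A \<inter> \<FF> ! j)"

text \<open>In the following definitions \<open>f\<close> is the ordered basis with \<open>d\<mu> = f 0 \<and> \<dots> \<and> f (n - 1)\<close>.\<close>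

definition flag_sign ::
  "'i set \<Rightarrow> 'i \<Rightarrow> ('i \<Rightarrow> real) set \<Rightarrow> (nat \<Rightarrow> 'i \<Rightarrow> real) \<Rightarrow> ('i \<Rightarrow> real) set list \<Rightarrow> real" where
  "flag_sign I r A f \<FF> =
     (if ordered_basis I r (\<lambda>j. flag_kappa A \<FF> (j + 1))
      then sgn (wedge_ratio (card (I - {r})) f (\<lambda>j. flag_kappa A \<FF> (j + 1))) else 0)"

definition adapted_basis ::
  "'i set \<Rightarrow> 'i \<Rightarrow> (nat \<Rightarrow> 'i \<Rightarrow> real) \<Rightarrow> ('i \<Rightarrow> real) set list \<Rightarrow> (nat \<Rightarrow> 'i \<Rightarrow> real) \<Rightarrow> bool" where
  "adapted_basis I r f \<FF> \<gamma> \<longleftrightarrow> ordered_basis I r \<gamma>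
     \<and> (\<forall>m\<le>card (I - {r}). span (\<gamma> ` {..<m}) = \<FF> ! m)
     \<and> wedge_ratio (card (I - {r})) f \<gamma> = 1"

definition flag_residue ::
  "'i set \<Rightarrow> 'i \<Rightarrow> (nat \<Rightarrow> 'i \<Rightarrow> real) \<Rightarrow> ('i \<Rightarrow> real) set list \<Rightarrow>
   (('i \<Rightarrow> complex) \<Rightarrow> complex) \<Rightarrow> complex" where
  "flag_residue I r f \<FF> \<phi> =
     (let \<gamma> = SOME \<gamma>. adapted_basis I r f \<FF> \<gamma>;
          n = card (I - {r})
      in iterated_residue n
           (\<lambda>z. \<phi> (THE u. u \<in> coord_space I r \<and> (\<forall>i<n. pairing I (\<gamma> i) u = z i))))"

definition JK_local ::
  "'i set \<Rightarrow> 'i \<Rightarrow> ('i \<Rightarrow> real) set \<Rightarrow> ('i \<Rightarrow> real) \<Rightarrow> (('i \<Rightarrow> complex) \<Rightarrow> complex) \<Rightarrow> complex" where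
  "JK_local I r A \<xi> \<phi> =
     (let n = card (I - {r});
          f = SOME f. ordered_basis I r f \<and> f ` {..<n} \<subseteq> A
      in \<Sum>\<FF> | \<FF> \<in> complete_flags I r A
             \<and> (\<exists>c. (\<forall>j\<in>{1..n}. c j > 0) \<and> \<xi> = (\<Sum>j=1..n. c j *\<^sub>R flag_kappa A \<FF> j)).
           of_real (flag_sign I r A f \<FF>) * flag_residue I r f \<FF> \<phi>)"

definition distinct_sums :: "('i \<Rightarrow> real) set \<Rightarrow> ('i \<Rightarrow> real) set" where
  "distinct_sums A = {\<Sum>B | B. B \<subseteq> A \<and> B \<noteq> {}}"


section \<open>Jeffrey--Kirwan residues of abelian quivers\<close>

text \<open>
  In this section \<open>Q\<close> is the abelian quiver \<open>Q'\<close> (dimension vector \<open>(1, \<dots>, 1)\<close>), the index set is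
  \<^term>\<open>verts Q\<close> and the reference index is the vertex \<open>v0\<close>.  An element of \<open>\<real>\<^sup>W\<close> (\<open>R\<close>-charges) is a function
  on functionals that vanishes outside \<open>W\<close>.
\<close>

definition arrow_fun :: "('i, 'b) pre_digraph \<Rightarrow> 'i \<Rightarrow> 'b \<Rightarrow> ('i \<Rightarrow> real)" where
  "arrow_fun Q v0 \<alpha> = coord_fun v0 (head Q \<alpha>) - coord_fun v0 (tail Q \<alpha>)"

definition quiver_weights :: "('i, 'b) pre_digraph \<Rightarrow> 'i \<Rightarrow> ('i \<Rightarrow> real) set" where
  "quiver_weights Q v0 = arrow_fun Q v0 ` arcs Q"

definition weight_mult :: "('i, 'b) pre_digraph \<Rightarrow> 'i \<Rightarrow> ('i \<Rightarrow> real) \<Rightarrow> nat" where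
  "weight_mult Q v0 \<rho> = card {\<alpha> \<in> arcs Q. arrow_fun Q v0 \<alpha> = \<rho>}"

definition Z_hat ::
  "('i, 'b) pre_digraph \<Rightarrow> 'i \<Rightarrow> (('i \<Rightarrow> real) \<Rightarrow> real) \<Rightarrow> ('i \<Rightarrow> complex) \<Rightarrow> complex" where
  "Z_hat Q v0 R u = (-1) ^ (card (verts Q) - 1) *
     (\<Prod>\<rho>\<in>quiver_weights Q v0.
        ((pairing (verts Q) \<rho> u + of_real (R \<rho>) - 1) / (pairing (verts Q) \<rho> u + of_real (R \<rho>)))
          ^ weight_mult Q v0 \<rho>)"

definition weights_at ::
  "('i, 'b) pre_digraph \<Rightarrow> 'i \<Rightarrow> (('i \<Rightarrow> real) \<Rightarrow> real) \<Rightarrow> ('i \<Rightarrow> complex) \<Rightarrow> ('i \<Rightarrow> real) set" where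
  "weights_at Q v0 R x =
     {\<rho> \<in> quiver_weights Q v0. pairing (verts Q) \<rho> x + of_real (R \<rho>) = 0}"

definition M_sing ::
  "('i, 'b) pre_digraph \<Rightarrow> 'i \<Rightarrow> (('i \<Rightarrow> real) \<Rightarrow> real) \<Rightarrow> ('i \<Rightarrow> complex) set" where
  "M_sing Q v0 R = {x \<in> coord_space (verts Q) v0.
     \<exists>B\<subseteq>weights_at Q v0 R x. independent B \<and> card B = card (verts Q) - 1}"

definition charge_space :: "('i, 'b) pre_digraph \<Rightarrow> 'i \<Rightarrow> (('i \<Rightarrow> real) \<Rightarrow> real) set" where
  "charge_space Q v0 = {R. \<forall>\<rho>. \<rho> \<notin> quiver_weights Q v0 \<longrightarrow> R \<rho> = 0}"

definition is_charge_cone :: "('i, 'b) pre_digraph \<Rightarrow> 'i \<Rightarrow> (('i \<Rightarrow> real) \<Rightarrow> real) set \<Rightarrow> bool" where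
  "is_charge_cone Q v0 P \<longleftrightarrow>
     openin (top_of_set (charge_space Q v0)) P \<and> charge_space Q v0 \<subseteq> closure P
     \<and> (\<forall>R\<in>P. \<forall>t>0. t *\<^sub>R R \<in> P)
     \<and> (\<forall>R\<in>P. \<forall>x\<in>M_sing Q v0 R. card (weights_at Q v0 R x) < card (verts Q))"

definition JK_quiver ::
  "('i, 'b) pre_digraph \<Rightarrow> 'i \<Rightarrow> (('i \<Rightarrow> real) \<Rightarrow> real) \<Rightarrow> ('i \<Rightarrow> real) \<Rightarrow> complex" where
  "JK_quiver Q v0 R \<eta> =
     (let W = quiver_weights Q v0;
          \<xi> = SOME \<xi>. \<xi> \<in> regular_vectors (verts Q) v0 (distinct_sums W)
                 \<and> same_chamber (verts Q) v0 W (- lift (verts Q) v0 \<eta>) \<xi>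
      in \<Sum>x\<in>M_sing Q v0 R.
           JK_local (verts Q) v0 (weights_at Q v0 R x) \<xi> (\<lambda>u. Z_hat Q v0 R (u + x)))"


section \<open>Abelianised Jeffrey--Kirwan residues\<close>

text \<open>
  The vertex \<open>i\<^sub>k\<^sub>,\<^sub>l\<close> is the triple \<open>(i, k, l)\<close>; the \<open>l l'\<close> arrows \<open>i\<^sub>k\<^sub>,\<^sub>l \<rightarrow> j\<^sub>k\<^sub>'\<^sub>,\<^sub>l\<^sub>'\<close> over an arrow \<open>\<alpha>\<close> are
  \<open>(\<alpha>, (k, l), (k', l'), c)\<close> with \<open>c < l l'\<close>.
\<close>

definition blowup_quiver ::
  "('v, 'a) pre_digraph \<Rightarrow>
   ('v \<times> nat \<times> nat, 'a \<times> (nat \<times> nat) \<times> (nat \<times> nat) \<times> nat) pre_digraph" where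
  "blowup_quiver Q =
     \<lparr>verts = {(i, k, l). i \<in> verts Q \<and> 1 \<le> k \<and> 1 \<le> l},
      arcs = {(\<alpha>, (k, l), (k', l'), c).
                \<alpha> \<in> arcs Q \<and> 1 \<le> k \<and> 1 \<le> l \<and> 1 \<le> k' \<and> 1 \<le> l' \<and> c < l * l'},
      tail = (\<lambda>(\<alpha>, (k, l), (k', l'), c). (tail Q \<alpha>, k, l)),
      head = (\<lambda>(\<alpha>, (k, l), (k', l'), c). (head Q \<alpha>, k', l'))\<rparr>"

text \<open>
  The collections \<open>m\<^sub>*\<close> with \<open>m\<^sub>* \<turnstile> d\<close>.  The condition \<open>l \<le> d i\<close> on the support is
  implied by \<open>\<Sum>\<^sub>l l m\<^sub>i\<^sub>,\<^sub>l = d\<^sub>i\<close>, and turns sums and products over all \<open>l \<ge> 1\<close> into finite ones.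
\<close>

definition multiplicity_vectors ::
  "('v, 'a) pre_digraph \<Rightarrow> ('v \<Rightarrow> nat) \<Rightarrow> ('v \<Rightarrow> nat \<Rightarrow> nat) set" where
  "multiplicity_vectors Q d =
     {m. (\<forall>i l. m i l \<noteq> 0 \<longrightarrow> i \<in> verts Q \<and> 1 \<le> l \<and> l \<le> d i)
       \<and> (\<forall>i\<in>verts Q. (\<Sum>l=1..d i. l * m i l) = d i)}"

definition MPS_quiver ::
  "('v, 'a) pre_digraph \<Rightarrow> ('v \<Rightarrow> nat \<Rightarrow> nat) \<Rightarrow>
   ('v \<times> nat \<times> nat, 'a \<times> (nat \<times> nat) \<times> (nat \<times> nat) \<times> nat) pre_digraph" where
  "MPS_quiver Q m =
     induce_subgraph (blowup_quiver Q) {(i, k, l). i \<in> verts Q \<and> 1 \<le> k \<and> k \<le> m i l \<and> 1 \<le> l}"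

definition zeta_hat :: "('v \<Rightarrow> real) \<Rightarrow> 'v \<times> nat \<times> nat \<Rightarrow> real" where
  "zeta_hat \<zeta> = (\<lambda>(i, k, l). real l * \<zeta> i)"

definition JK_ab ::
  "('v, 'a) pre_digraph \<Rightarrow> ('v \<Rightarrow> nat) \<Rightarrow> ('v \<Rightarrow> real) \<Rightarrow> (('v \<Rightarrow> nat \<Rightarrow> nat) \<Rightarrow> 'v \<times> nat \<times> nat) \<Rightarrow>
   (('v \<Rightarrow> nat \<Rightarrow> nat) \<Rightarrow> ('v \<times> nat \<times> nat \<Rightarrow> real) \<Rightarrow> real) \<Rightarrow> complex" where
  "JK_ab Q d \<zeta> v0 R =
     (-1) powi moduli_dim Q d * of_nat (dim_fact Q d) *
     (\<Sum>m\<in>multiplicity_vectors Q d.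
        (\<Prod>i\<in>verts Q. \<Prod>l=1..d i. 1 / fact (m i l) * ((-1) ^ (l - 1) / of_nat l ^ 2) ^ m i l)
        * JK_quiver (MPS_quiver Q m) (v0 m) (R m) (zeta_hat \<zeta>))"

definition JK_ab_infty ::
  "('v, 'a) pre_digraph \<Rightarrow> ('v \<Rightarrow> nat) \<Rightarrow> ('v \<Rightarrow> real) \<Rightarrow> (('v \<Rightarrow> nat \<Rightarrow> nat) \<Rightarrow> 'v \<times> nat \<times> nat) \<Rightarrow>
   (('v \<Rightarrow> nat \<Rightarrow> nat) \<Rightarrow> ('v \<times> nat \<times> nat \<Rightarrow> real) \<Rightarrow> real) \<Rightarrow> complex" where
  "JK_ab_infty Q d \<zeta> v0 Rbar = Lim at_top (\<lambda>t::real. JK_ab Q d \<zeta> v0 (\<lambda>m. t *\<^sub>R Rbar m))"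

end

theory Submission
  imports Defs
begin

text \<open>Both sides are rational numbers attached to the collections \<open>m\<^sub>* \<turnstile> d\<close>, and they agree collection by collection.

\<^bold>\<open>The invariant.\<close> Over a field with \<open>q\<close> elements a representation is semistable iff an alternating sum over
chains of destabilising subrepresentations is \<open>1\<close> and not \<open>0\<close> (\<open>chain_sum_modular\<close>). Exchanging the sums gives a
recursion in the dimension vector for the count (\<open>card_semistable_reps\<close>). Representations of the abelian quivers \<open>Q'(m)\<close>,
recorded by the set \<open>S\<close> of arrows on which they do not vanish, satisfy the same kind of recursion. The identity between
the \<open>q\<close>-exponential and the exponential of \<open>q\<close>-weighted parts (\<open>q_exp_coeff_eq_partition_sum\<close>) turns one recursion into the
other (\<open>rescaled_count_recursion\<close>). So the count becomes \<open>stack_function\<close>, a sum over \<open>m\<close> of weights times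
\<open>\<Sum>\<^sub>S (q - 1)^(|S| - |Q'(m)\<^sub>0|)\<close> over semistable supports \<open>S\<close>; when each \<open>S\<close> has at least \<open>|Q'(m)\<^sub>0| - 1\<close> arrows, the pole
at \<open>q = 1\<close> is simple and its residue counts the semistable \<open>S\<close> with exactly that number (\<open>stack_function_residue\<close>).

\<^bold>\<open>The residue.\<close> Expanding each factor of the integrand as \<open>1 - 1 / (\<rho> + R)\<close> gives a sum over sets \<open>S\<close> of arrows. At
a singular point \<open>x\<close> the forms vanishing at \<open>x\<close> are a basis, and the constant terms of all others grow with the charges.
A set with more than \<open>n\<close> arrows contributes a negative power of the scale, one with fewer contributes \<open>0\<close>, and one with
\<open>n\<close> arrows survives iff its weights are the basis at \<open>x\<close>; the flag selected by \<open>\<xi>\<close> exists iff \<open>\<xi>\<close> has positive coordinates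
(\<open>JK_local_large_charge\<close>). Hence the limit counts the sets \<open>S\<close> whose weights are a basis in which \<open>- \<eta>\<close> is positive
(\<open>JK_quiver_large_charge\<close>); these are the semistable spanning trees (\<open>semistable_iff_positive\<close>).

\<^bold>\<open>Regularity.\<close> A decomposition of \<open>d\<close> into two nonzero vectors, each of weight \<open>0\<close> on every union of components of its
support, puts the lift into the span of the roots and weights that respect the decomposition. For connected \<open>d\<close> this is
excluded by regularity (\<open>lift_regular_indecomposable\<close>), which makes every \<open>Q'(m)\<close> rigid and leaves one term in the
logarithm defining \<open>b\<^sub>d\<close>. If the support of \<open>d\<close> is disconnected both sides vanish: no singular point exists, and \<open>b\<^sub>d\<close> is the
linear coefficient of a product of two polynomials without constant term (\<open>log_coefficient_split\<close>).\<close>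

section \<open>Alternating sums over chains\<close>

definition chain_sum :: "'a::order set => real" where
 "chain_sum P =
   (SUM C | C \<subseteq> P & (ALL x:C. ALL y:C. x <= y \<or> y <= x). (-1) ^ card C)"

lemma chain_sum_rec:
 fixes P :: "'a::order set"
 assumes fin: "finite P"
 shows "chain_sum P = 1 - (SUM W:P. chain_sum {x:P. x < W})"
proof -
 define ch where "ch = (%P :: 'a set. {C. C \<subseteq> P & (ALL x:C. ALL y:C. x <= y \<or> y <= x)})"
 have fin_ch: "finite (ch P')" if "P' \<subseteq> P" for P' by (rule finite_subset[of _ "Pow P"]) (use that fin in "auto simp: ch_def")
 have alt: "chain_sum P' = (SUM C:ch P'. (-1) ^ card C)" for P' by (simp add: chain_sum_def ch_def)
 have split: "ch P = {{}} \<union> (UN W:P. insert W ` ch {x:P. x < W})"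
 proof (intro equalityI subsetI)
  fix C assume C: "C : ch P"
  show "C : {{}} \<union> (UN W:P. insert W ` ch {x:P. x < W})"
  proof (cases "C = {}")
   case False
   have "finite C" using C fin by (auto simp: ch_def intro: finite_subset)
   then obtain W where W: "W : C" "ALL y:C. W <= y --> W = y" using finite_has_maximal[OF _ False] by metis
   have less: "y < W" if "y : C" "y ~= W" for y
   proof -
    have "y <= W \<or> W <= y" using C W(1) that(1) unfolding ch_def by blast
    then show ?thesis using W(2) that by (metis order.not_eq_order_implies_strict)
   qed
   have "C = insert W (C - {W})" using W by auto
   moreover have "C - {W} : ch {x:P. x < W}" using C less by (auto simp: ch_def)
   moreover have "W : P" using W C by (auto simp: ch_def)
   ultimately show ?thesis by blast
  qed simp
 next
  fix C assume "C : {{}} \<union> (UN W:P. insert W ` ch {x:P. x < W})"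
  then consider "C = {}" | W C' where "W : P" "C = insert W C'" "C' : ch {x:P. x < W}" by blast
  then show "C : ch P"
  proof cases
   case 2
   then have "ALL x:C'. x : P & x < W" "ALL x:C'. ALL y:C'. x <= y \<or> y <= x" by (auto simp: ch_def)
   with 2 show ?thesis unfolding ch_def by (auto simp: less_imp_le)
  qed (simp add: ch_def)
 qed
 have top: "W = W'" if "insert W C = insert W' C'" "C : ch {x:P. x < W}" "C' : ch {x:P. x < W'}" for W W' C C'
 proof (rule ccontr)
  assume "W ~= W'"
  then have "W : C'" "W' : C" using that(1) by (metis insertCI insertE)+
  then have "W < W'" "W' < W" using that by (auto simp: ch_def)
  then show False by simp
 qed
 have notin: "W ~: C" "finite C" if "C : ch {x:P. x < W}" for W C using that fin by (auto simp: ch_def intro: finite_subset)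
 have "(SUM C:ch P. (-1::real) ^ card C) =
   1 + (SUM C:(UN W:P. insert W ` ch {x:P. x < W}). (-1) ^ card C)" unfolding split by (subst sum.union_disjoint) (use fin fin_ch in auto)
 also have "(SUM C:(UN W:P. insert W ` ch {x:P. x < W}). (-1::real) ^ card C)
   = (SUM W:P. SUM C:insert W ` ch {x:P. x < W}. (-1) ^ card C)"
 proof (rule sum.UNION_disjoint)
  show "ALL i:P. ALL j:P. i ~= j --> insert i ` ch {x:P. x < i} \<inter> insert j ` ch {x:P. x < j} = {}" using top by fastforce
 qed (use fin fin_ch in auto)
 also have "... = (SUM W:P. SUM C:ch {x:P. x < W}. (-1) ^ card (insert W C))"
 proof (rule sum.cong[OF refl])
  fix W
  have "inj_on (insert W) (ch {x:P. x < W})" by (rule inj_onI) (metis notin(1) Diff_insert_absorb)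
  then show "(SUM C:insert W ` ch {x:P. x < W}. (-1::real) ^ card C) =
    (SUM C:ch {x:P. x < W}. (-1) ^ card (insert W C))" by (simp add: sum.reindex)
 qed
 also have "... = (SUM W:P. - chain_sum {x:P. x < W})" unfolding alt sum_negf[symmetric] by (intro sum.cong refl) (simp add: notin)
 finally show ?thesis by (simp add: alt sum_negf)
qed

lemma chain_sum_empty [simp]: "chain_sum {} = 1"
 by (subst chain_sum_rec) auto

text \<open>The poset contracts along \<open>u \<ge> inf u Z \<le> Z\<close>, and the sum is minus its reduced Euler characteristic.\<close>
lemma chain_sum_cone:
 fixes P :: "'a::semilattice_inf set"
 assumes "finite P" "Z : P" "!!u. u : P ==> inf u Z : P"
 shows "chain_sum P = 0"
 using assms
proof (induction "card P" arbitrary: P Z rule: less_induct)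
 case less
 have below: "chain_sum {x:P. x < W} = 0" if W: "W : P" "\<not> W <= Z" for W
 proof (rule less.hyps)
  show "card {x:P. x < W} < card P" by (rule psubset_card_mono) (use less W in auto)
  show "inf W Z : {x:P. x < W}" using less.prems W by (auto simp: less_le) (metis inf_le2)
  fix u assume u: "u : {x:P. x < W}"
  then have "inf u (inf W Z) = inf u Z" by (simp add: inf.absorb1 inf_assoc[symmetric] order.strict_implies_order)
  moreover have "inf u Z : P" "inf u Z < W" using u less.prems by (auto intro: le_less_trans[OF inf_le1])
  ultimately show "inf u (inf W Z) : {x:P. x < W}" by simp
 qed (use less in auto)
 let ?L = "{x:P. x < Z}"
 have sub: "{x:{y:P. y <= Z}. x < W} = {x:P. x < W}" if "W <= Z" for W using that by auto
 have sub': "{x:?L. x < W} = {x:P. x < W}" if "W < Z" for W using that by auto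
 have finL: "finite ?L" using less.prems by simp
 have "(SUM W:P. chain_sum {x:P. x < W}) =
    (SUM W:{y:P. y <= Z}. chain_sum {x:P. x < W})" by (rule sum.mono_neutral_right) (use less below in auto)
 also have "{y:P. y <= Z} = insert Z ?L" using less.prems(2) by (auto simp: le_less)
 also have "(SUM W:insert Z ?L. chain_sum {x:P. x < W}) =
   chain_sum ?L + (SUM W:?L. chain_sum {x:?L. x < W})"
 proof -
  have "(SUM W:?L. chain_sum {x:P. x < W}) =
    (SUM W:?L. chain_sum {x:?L. x < W})"
  proof (rule sum.cong[OF refl])
   fix W assume "W : ?L"
   then have "W < Z" by simp
   from sub'[OF this] show "chain_sum {x:P. x < W} = chain_sum {x:?L. x < W}" by (rule arg_cong[OF sym])
  qed
  then show ?thesis using finL by (subst sum.insert) auto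
 qed
 also have "... = 1" using chain_sum_rec[OF finL] by linarith
 finally show ?case using chain_sum_rec[of P] less.prems by simp
qed

text \<open>If \<open>Z\<close> has maximal and positive weight, modularity gives \<open>inf u Z\<close> at least the weight of \<open>u\<close>, so \<open>Z\<close> is a cone point.\<close>
lemma chain_sum_modular:
 fixes L :: "'a::semilattice_inf set" and eta :: "'a => real"
 assumes fin: "finite L"
  and closed: "!!u w. u : L ==> w : L ==> inf u w : L"
  and modular: "!!u w. u : L ==> w : L ==> EX s:L. eta s + eta (inf u w) = eta u + eta w"
 shows "chain_sum {u:L. eta u > 0} = (if ALL u:L. eta u <= 0 then 1 else 0)"
proof (cases "ALL u:L. eta u <= 0")
 case True
 then have *: "{u:L. eta u > 0} = {}" by (auto simp: not_less)
 show ?thesis unfolding * using True by simp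
next
 case False
 then obtain u0 where u0: "u0 : L" "eta u0 > 0" by (auto simp: not_le)
 define Z where "Z = arg_max_on eta L"
 have Z: "Z : L" "!!u. u : L ==> eta u <= eta Z"
 proof -
  have "EX z:L. ALL u:L. eta u <= eta z" using u0 fin Max_in[of "eta ` L"] Max_ge[of "eta ` L"] by fastforce
  then have "is_arg_max eta (%x. x : L) Z" unfolding Z_def arg_max_on_def arg_max_def
   by (intro someI_ex[of "is_arg_max eta (%x. x : L)"]) (auto simp: is_arg_max_def not_less)
  then show "Z : L" "!!u. u : L ==> eta u <= eta Z" by (auto simp: is_arg_max_linorder)
 qed
 have "chain_sum {u:L. eta u > 0} = 0"
 proof (rule chain_sum_cone[of _ Z])
  show "Z : {u:L. eta u > 0}" using Z(1) Z(2)[OF u0(1)] u0(2) by auto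
  fix u assume u: "u : {u:L. eta u > 0}"
  obtain s where s: "s : L" "eta s + eta (inf u Z) = eta u + eta Z" using modular[of u Z] u Z by auto
  with Z(2)[OF s(1)] u have "eta (inf u Z) > 0" by simp
  then show "inf u Z : {u:L. eta u > 0}" using u closed Z by auto
 qed (use fin in auto)
 then show ?thesis using False by simp
qed

section \<open>Subspaces over a finite field\<close>

locale finite_vectorspace = vectorspace K V for K :: "('k, 'b) ring_scheme" (structure) and V :: "('k, 'c, 'd) module_scheme" +
 assumes finite_scalars: "finite (carrier K)" and finite_vectors: "finite (carrier V)"
begin

abbreviation q :: nat where "q \<equiv> card (carrier K)"

lemma q_ge_2: "2 <= q"
proof -
 have "{\<zero>\<^bsub>K\<^esub>, \<one>\<^bsub>K\<^esub>} \<subseteq> carrier K" by auto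
 from card_mono[OF finite_scalars this] show ?thesis by (simp only: card_2_iff'[symmetric] card_insert_if finite.intros zero_not_one singleton_iff if_False card.empty One_nat_def numeral_2_eq_2 empty_iff)
qed

lemma subspaceI: "submodule K U V ==> VectorSpace.subspace K U V"
 by (simp add: VectorSpace.subspace_def vectorspace_axioms)

lemma finite_subspace: "submodule K U V ==> finite U"
 by (rule finite_subset[OF submodule.subset finite_vectors])

lemma zero_subspace: "submodule K {\<zero>\<^bsub>V\<^esub>} V"
 by unfold_locales auto

lemma whole_subspace: "submodule K (carrier V) V"
 by unfold_locales auto

lemma subspace_vec: "submodule K U V ==> u : U ==> u : carrier V"
 using submodule.subset by blast

lemma subspace_neg:
 assumes U: "submodule K U V" and u: "u : U" shows "\<ominus>\<^bsub>V\<^esub> u : U"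
proof -
 have "\<ominus>\<^bsub>V\<^esub> u = (\<ominus> \<one>) \<odot>\<^bsub>V\<^esub> u" using subspace_vec[OF U u] smult_l_minus[of \<one> u] smult_one[of u] by simp
 moreover have "(\<ominus> \<one>) \<odot>\<^bsub>V\<^esub> u : U" by (rule submodule.smult_closed[OF U _ u]) simp
 ultimately show ?thesis by simp
qed

lemma submodule_inter: "submodule K U V ==> submodule K W V ==> submodule K (U \<inter> W) V"
 by (rule submodule.intro)
   (auto intro: submodule.m_closed submodule.smult_closed submodule.zero_closed
    dest: submodule.subset simp: module_axioms)

lemma vector_arith:
 assumes "a : carrier V" "b : carrier V" "u : carrier V" "w : carrier V"
 shows "u \<oplus>\<^bsub>V\<^esub> (a \<ominus>\<^bsub>V\<^esub> u) = a" "(u \<oplus>\<^bsub>V\<^esub> a) \<ominus>\<^bsub>V\<^esub> u = a" "w \<ominus>\<^bsub>V\<^esub> (w \<ominus>\<^bsub>V\<^esub> b) = b"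
  "(u \<oplus>\<^bsub>V\<^esub> a) \<oplus>\<^bsub>V\<^esub> (w \<ominus>\<^bsub>V\<^esub> a) = u \<oplus>\<^bsub>V\<^esub> w"
  "a \<oplus>\<^bsub>V\<^esub> b = u \<oplus>\<^bsub>V\<^esub> w ==> a \<ominus>\<^bsub>V\<^esub> u = w \<ominus>\<^bsub>V\<^esub> b"
proof -
 note [simp] = assms
 have 1: "u \<oplus>\<^bsub>V\<^esub> (a \<ominus>\<^bsub>V\<^esub> u) = a" if "a : carrier V" "u : carrier V" for a u using that by (simp add: a_minus_def M.a_lcomm[of u] M.r_neg)
 show "u \<oplus>\<^bsub>V\<^esub> (a \<ominus>\<^bsub>V\<^esub> u) = a" by (rule 1) simp_all
 show "(u \<oplus>\<^bsub>V\<^esub> a) \<ominus>\<^bsub>V\<^esub> u = a" by (simp add: a_minus_def M.a_comm[of u a] M.a_assoc M.r_neg)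
 show "w \<ominus>\<^bsub>V\<^esub> (w \<ominus>\<^bsub>V\<^esub> b) = b" by (simp add: a_minus_def M.minus_add M.r_neg2 M.r_neg1 M.a_assoc[symmetric] M.r_neg)
 show "(u \<oplus>\<^bsub>V\<^esub> a) \<oplus>\<^bsub>V\<^esub> (w \<ominus>\<^bsub>V\<^esub> a) = u \<oplus>\<^bsub>V\<^esub> w" by (simp add: M.a_assoc 1)
 assume *: "a \<oplus>\<^bsub>V\<^esub> b = u \<oplus>\<^bsub>V\<^esub> w"
 have "(a \<ominus>\<^bsub>V\<^esub> u) \<oplus>\<^bsub>V\<^esub> b = w"
 proof -
  have "(a \<ominus>\<^bsub>V\<^esub> u) \<oplus>\<^bsub>V\<^esub> b = (a \<oplus>\<^bsub>V\<^esub> b) \<oplus>\<^bsub>V\<^esub> \<ominus>\<^bsub>V\<^esub> u" by (simp add: a_minus_def M.a_ac)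
  also have "... = w" unfolding * by (simp add: M.a_comm[of u w] M.a_assoc M.r_neg)
  finally show ?thesis .
 qed
 then have "w \<ominus>\<^bsub>V\<^esub> b = ((a \<ominus>\<^bsub>V\<^esub> u) \<oplus>\<^bsub>V\<^esub> b) \<ominus>\<^bsub>V\<^esub> b" by simp
 also have "... = a \<ominus>\<^bsub>V\<^esub> u" by (simp add: a_minus_def M.a_assoc M.r_neg)
 finally show "a \<ominus>\<^bsub>V\<^esub> u = w \<ominus>\<^bsub>V\<^esub> b" by simp
qed

definition subspace_dim :: "'c set => nat" where
 "subspace_dim U = vectorspace.dim K (V\<lparr>carrier := U\<rparr>)"

lemma card_subspace:
 assumes U: "submodule K U V" shows "card U = q ^ subspace_dim U"
proof -
 interpret U: vectorspace K "V\<lparr>carrier := U\<rparr>" using subspace_is_vs[OF subspaceI[OF U]] .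
 have finU: "finite U" by (rule finite_subspace[OF U])
 have "U.span U = U" using U.in_own_span[of U] U.span_is_subset2[of U] by auto
 then have "U.fin_dim" unfolding U.fin_dim_def using finU by auto
 then obtain B where B: "finite B" "U.basis B" using U.finite_basis_exists by blast
 have BU: "B \<subseteq> U" using B unfolding U.basis_def by simp
 have crit: "ALL v:U. \<exists>!a. a : B \<rightarrow>\<^sub>E carrier K & U.lincomb a B = v" using U.basis_criterion[OF B(1)] BU B(2) by auto
 have "bij_betw (%a. U.lincomb a B) (B \<rightarrow>\<^sub>E carrier K) U"
 proof (rule bij_betwI')
  fix x y assume "x : B \<rightarrow>\<^sub>E carrier K" "y : B \<rightarrow>\<^sub>E carrier K"
  moreover from this(1) have "U.lincomb x B : U" using U.lincomb_closed[of B x] BU by (simp add: PiE_def)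
  ultimately show "(U.lincomb x B = U.lincomb y B) = (x = y)" using bspec[OF crit, of "U.lincomb x B"] by (metis (no_types, lifting))
 next
  fix x assume "x : B \<rightarrow>\<^sub>E carrier K" then show "U.lincomb x B : U" using U.lincomb_closed[of B x] BU by (simp add: PiE_def)
 next
  fix y assume "y : U" then show "EX x:B \<rightarrow>\<^sub>E carrier K. y = U.lincomb x B" using bspec[OF crit, of y] by (metis (no_types, lifting))
 qed
 then have "card U = card (B \<rightarrow>\<^sub>E carrier K)" by (simp add: bij_betw_same_card)
 also have "... = q ^ card B" by (simp add: card_PiE B(1))
 also have "card B = subspace_dim U" using U.dim_basis[OF B] by (simp add: subspace_dim_def)
 finally show ?thesis .
qed

lemma subspace_dim_eq: "submodule K U V ==> card U = q ^ k ==> subspace_dim U = k"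
 using card_subspace[of U] q_ge_2 by (simp add: power_inject_exp)

lemma subspace_dim_mono:
 "submodule K U V ==> submodule K W V ==> U \<subseteq> W ==> subspace_dim U <= subspace_dim W"
 using card_mono[of W U] card_subspace[of U] card_subspace[of W] q_ge_2 by (simp add: finite_subspace)

lemma subspace_dim_less:
 "submodule K U V ==> submodule K W V ==> U \<subset> W ==> subspace_dim U < subspace_dim W"
 using psubset_card_mono[of W U] card_subspace[of U] card_subspace[of W] q_ge_2 by (simp add: finite_subspace)

lemma subspace_dim_zero [simp]: "subspace_dim {\<zero>\<^bsub>V\<^esub>} = 0"
 by (rule subspace_dim_eq) (auto simp: zero_subspace)

definition adjoin :: "'c set => 'c => 'c set" where
 "adjoin U x = (%(u, a). u \<oplus>\<^bsub>V\<^esub> a \<odot>\<^bsub>V\<^esub> x) ` (U \<times> carrier K)"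

lemma adjoin_unique:
 assumes U: "submodule K U V" and x: "x : carrier V" "x ~: U"
  and "u : U" "u' : U" "a : carrier K" "a' : carrier K"
  and eq: "u \<oplus>\<^bsub>V\<^esub> a \<odot>\<^bsub>V\<^esub> x = u' \<oplus>\<^bsub>V\<^esub> a' \<odot>\<^bsub>V\<^esub> x"
 shows "u = u' & a = a'"
proof -
 note vec = subspace_vec[OF U]
 have aeq: "a = a'"
 proof (rule ccontr)
  assume ne: "a ~= a'"
  define b where "b = a \<ominus> a'"
  have b: "b : carrier K" "b ~= \<zero>" using ne assms by (auto simp: b_def)
  have "b \<odot>\<^bsub>V\<^esub> x = a \<odot>\<^bsub>V\<^esub> x \<ominus>\<^bsub>V\<^esub> a' \<odot>\<^bsub>V\<^esub> x"
   using assms by (simp add: b_def a_minus_def smult_l_distr smult_l_minus a_minus_def)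
  also have "... = u' \<ominus>\<^bsub>V\<^esub> u" using vector_arith(5)[of "a \<odot>\<^bsub>V\<^esub> x" u "a' \<odot>\<^bsub>V\<^esub> x" u'] eq assms vec by (simp add: M.a_comm)
  finally have "b \<odot>\<^bsub>V\<^esub> x : U" using submodule.m_closed[OF U] subspace_neg[OF U] assms by (simp add: a_minus_def)
  then have "inv b \<odot>\<^bsub>V\<^esub> (b \<odot>\<^bsub>V\<^esub> x) : U" using submodule.smult_closed[OF U] b field_Units by auto
  then show False using b x field_Units by (simp add: smult_assoc1[symmetric])
 qed
 then have "u = u'" using eq assms vec by (simp add: M.add.right_cancel)
 then show ?thesis using aeq by simp
qed

lemma adjoin_submodule:
 assumes U: "submodule K U V" and x: "x : carrier V"
 shows "submodule K (adjoin U x) V"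
proof (unfold_locales)
 note vec = subspace_vec[OF U]
 show "adjoin U x \<subseteq> carrier V" using vec x by (auto simp: adjoin_def)
 show "\<zero>\<^bsub>V\<^esub> : adjoin U x" unfolding adjoin_def by (rule image_eqI[of _ _ "(\<zero>\<^bsub>V\<^esub>, \<zero>)"]) (use x submodule.zero_closed[OF U] in auto)
 fix v w assume "v : adjoin U x" "w : adjoin U x"
 then obtain u a u' a' where *: "v = u \<oplus>\<^bsub>V\<^esub> a \<odot>\<^bsub>V\<^esub> x" "w = u' \<oplus>\<^bsub>V\<^esub> a' \<odot>\<^bsub>V\<^esub> x"
   "u : U" "u' : U" "a : carrier K" "a' : carrier K" by (auto simp: adjoin_def)
 then show "v \<oplus>\<^bsub>V\<^esub> w : adjoin U x" unfolding adjoin_def by (intro image_eqI[of _ _ "(u \<oplus>\<^bsub>V\<^esub> u', a \<oplus> a')"])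
    (use vec x submodule.m_closed[OF U] in "auto simp: smult_l_distr M.a_ac")
next
 note vec = subspace_vec[OF U]
 fix c v assume c: "c : carrier K" "v : adjoin U x"
 then obtain u a where *: "v = u \<oplus>\<^bsub>V\<^esub> a \<odot>\<^bsub>V\<^esub> x" "u : U" "a : carrier K" by (auto simp: adjoin_def)
 then show "c \<odot>\<^bsub>V\<^esub> v : adjoin U x" unfolding adjoin_def by (intro image_eqI[of _ _ "(c \<odot>\<^bsub>V\<^esub> u, c \<otimes> a)"])
    (use vec x c submodule.smult_closed[OF U] in "auto simp: smult_r_distr smult_assoc1")
qed

lemma adjoin_superset:
 assumes "submodule K U V" "x : carrier V"
 shows "U \<subseteq> adjoin U x" "x : adjoin U x"
proof -
 note vec = subspace_vec[OF assms(1)]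
 show "U \<subseteq> adjoin U x" unfolding adjoin_def
 proof
  fix u assume "u : U"
  then show "u : (%(u, a). u \<oplus>\<^bsub>V\<^esub> a \<odot>\<^bsub>V\<^esub> x) ` (U \<times> carrier K)" by (intro image_eqI[of _ _ "(u, \<zero>)"]) (use vec assms in auto)
 qed
 show "x : adjoin U x" unfolding adjoin_def by (rule image_eqI[of _ _ "(\<zero>\<^bsub>V\<^esub>, \<one>)"]) (use assms submodule.zero_closed[OF assms(1)] in auto)
qed

lemma adjoin_least:
 assumes "submodule K W V" "U \<subseteq> W" "x : W" shows "adjoin U x \<subseteq> W"
 using assms by (auto simp: adjoin_def intro!: submodule.m_closed submodule.smult_closed)

lemma card_adjoin:
 assumes U: "submodule K U V" and x: "x : carrier V" "x ~: U"
 shows "card (adjoin U x) = q * card U"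
proof -
 have "inj_on (%(u, a). u \<oplus>\<^bsub>V\<^esub> a \<odot>\<^bsub>V\<^esub> x) (U \<times> carrier K)" using adjoin_unique[OF U x] by (auto simp: inj_on_def)
 then show ?thesis unfolding adjoin_def by (subst card_image) (auto simp: card_cartesian_product)
qed

lemma subspace_extend_induct [consumes 3, case_names base step]:
 assumes U: "submodule K U V" and W: "submodule K W V" and sub: "U \<subseteq> W"
  and base: "P U"
  and step: "!!Y x. submodule K Y V ==> U \<subseteq> Y ==> Y \<subseteq> W ==> x : W ==> x ~: Y ==> P Y ==> P (adjoin Y x)"
 shows "P W"
proof -
 have "P W" if "submodule K Y V" "U \<subseteq> Y" "Y \<subseteq> W" "P Y" for Y using that
 proof (induction "card (W - Y)" arbitrary: Y rule: less_induct)
  case less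
  show ?case
  proof (cases "Y = W")
   case False
   then obtain x where x: "x : W" "x ~: Y" using less.prems by blast
   have xV: "x : carrier V" using x W subspace_vec by blast
   have sup: "Y \<subseteq> adjoin Y x" "x : adjoin Y x" using adjoin_superset less.prems xV by auto
   have "card (W - adjoin Y x) < card (W - Y)" by (rule psubset_card_mono) (use x sup finite_subspace[OF W] in auto)
   moreover have "submodule K (adjoin Y x) V" "adjoin Y x \<subseteq> W" "P (adjoin Y x)" using less.prems x xV adjoin_submodule adjoin_least[OF W] step by auto
   ultimately show ?thesis using less.hyps less.prems sup by auto
  qed (use less in simp)
 qed
 then show ?thesis using U base sub by blast
qed

fun indep_over :: "'c set => 'c set => 'c list => bool" where
 "indep_over U W [] \<longleftrightarrow> True"
| "indep_over U W (x # xs) \<longleftrightarrow> x : W - U & indep_over (adjoin U x) W xs"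

lemma finite_lists_independent:
 assumes "finite W" shows "finite {xs. length xs = k & indep_over U W xs}"
proof (rule finite_subset)
 have "indep_over U W xs ==> set xs \<subseteq> W" for U xs by (induction xs arbitrary: U) auto
 then show "{xs. length xs = k & indep_over U W xs} \<subseteq> {xs. set xs \<subseteq> W & length xs = k}" by auto
qed (rule finite_lists_length_eq[OF assms])

lemma card_independent_lists:
 assumes "submodule K U V" "submodule K W V" "U \<subseteq> W"
 shows "card {xs. length xs = k & indep_over U W xs} = (PROD i<k. card W - q ^ i * card U)"
 using assms
proof (induction k arbitrary: U)
 case 0
 have "{xs. length xs = 0 & indep_over U W xs} = {[]}" by auto
 then show ?case by simp
next
 case (Suc k)
 have finW: "finite W" using finite_subspace Suc by blast
 have "{xs. length xs = Suc k & indep_over U W xs} =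
   (UN x:W - U. (#) x ` {xs. length xs = k & indep_over (adjoin U x) W xs})" (is "_ = ?R")
 proof (intro equalityI subsetI)
  fix xs assume "xs : {xs. length xs = Suc k & indep_over U W xs}"
  then show "xs : ?R" by (cases xs) auto
 qed auto
 also have "card ... = (SUM x:W - U. card ((#) x ` {xs. length xs = k & indep_over (adjoin U x) W xs}))" by (rule card_UN_disjoint) (use finW finite_lists_independent in auto)
 also have "... = (SUM x:W - U. PROD i<k. card W - q ^ Suc i * card U)"
 proof (rule sum.cong[OF refl])
  fix x assume x: "x : W - U"
  then have xV: "x : carrier V" using subspace_vec Suc.prems by blast
  have "card ((#) x ` {xs. length xs = k & indep_over (adjoin U x) W xs}) =
    card {xs. length xs = k & indep_over (adjoin U x) W xs}" by (rule card_image) (auto simp: inj_on_def)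
  also have "... = (PROD i<k. card W - q ^ i * card (adjoin U x))" by (rule Suc.IH) (use adjoin_submodule adjoin_least Suc.prems x xV in auto)
  finally show "card ((#) x ` {xs. length xs = k & indep_over (adjoin U x) W xs}) = (PROD i<k. card W - q ^ Suc i * card U)" using card_adjoin[OF Suc.prems(1) xV] x by (simp add: mult_ac)
 qed
 also have "... = (card W - card U) * (PROD i<k. card W - q ^ Suc i * card U)" using Suc.prems finW by (simp add: card_Diff_subset finite_subset)
 also have "... = (PROD i<Suc k. card W - q ^ i * card U)" by (subst prod.lessThan_Suc_shift) simp
 finally show ?case .
qed

lemma independent_lists_span:
 assumes "submodule K U V" "submodule K W V" "U \<subseteq> W" "indep_over U W xs"
 shows "EX Y. submodule K Y V & Y \<subseteq> W & U \<subseteq> Y & card Y = q ^ length xs * card U & indep_over U Y xs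
   & (ALL Y'. submodule K Y' V --> U \<subseteq> Y' --> indep_over U Y' xs --> Y \<subseteq> Y')" using assms
proof (induction xs arbitrary: U)
 case Nil
 then show ?case by (intro exI[of _ U]) auto
next
 case (Cons x xs)
 have x: "x : carrier V" "x : W" "x ~: U" using Cons.prems subspace_vec by auto
 have "submodule K (adjoin U x) V" "adjoin U x \<subseteq> W" "indep_over (adjoin U x) W xs" using x adjoin_submodule adjoin_least Cons.prems by auto
 from Cons.IH[OF this(1) Cons.prems(2) this(2,3)]
 obtain Y where Y: "submodule K Y V" "Y \<subseteq> W" "adjoin U x \<subseteq> Y" "card Y = q ^ length xs * card (adjoin U x)"
   "indep_over (adjoin U x) Y xs"
   "!!Y'. submodule K Y' V ==> adjoin U x \<subseteq> Y' ==> indep_over (adjoin U x) Y' xs ==> Y \<subseteq> Y'" by blast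
 have sup: "U \<subseteq> adjoin U x" "x : adjoin U x" using adjoin_superset Cons.prems x by auto
 show ?case
 proof (intro exI[of _ Y] conjI allI impI)
  show "card Y = q ^ length (x # xs) * card U" using Y(4) card_adjoin[OF Cons.prems(1) x(1,3)] by simp
  show "indep_over U Y (x # xs)" using Y x sup by auto
  fix Y' assume "submodule K Y' V" "U \<subseteq> Y'" "indep_over U Y' (x # xs)"
  then show "Y \<subseteq> Y'" using Y(6)[of Y'] adjoin_least[of Y' U x] by auto
 qed (use Y sup in auto)
qed

text \<open>Count ordered bases: every subspace of dimension \<open>j\<close> is spanned by equally many independent lists.\<close>
lemma card_subspaces:
 assumes W: "submodule K W V"
 shows "card {Y. submodule K Y V & Y \<subseteq> W & card Y = q ^ j} * (PROD i<j. q ^ j - q ^ i) = (PROD i<j. card W - q ^ i)"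
proof -
 let ?G = "{Y. submodule K Y V & Y \<subseteq> W & card Y = q ^ j}"
 let ?L = "%W. {xs. length xs = j & indep_over {\<zero>\<^bsub>V\<^esub>} W xs}"
 have finW: "finite W" using finite_subspace W by blast
 have z: "{\<zero>\<^bsub>V\<^esub>} \<subseteq> Y" if "submodule K Y V" for Y using submodule.zero_closed[OF that] by simp
 have mono: "indep_over U Y xs ==> Y \<subseteq> W ==> indep_over U W xs" for U Y xs by (induction xs arbitrary: U) auto
 have eq: "?L W = (UN Y:?G. ?L Y)"
 proof (intro equalityI subsetI)
  fix xs assume xs: "xs : ?L W"
  from independent_lists_span[OF zero_subspace W z[OF W], of xs] xs
  show "xs : (UN Y:?G. ?L Y)" by auto
 qed (use mono in auto)
 have uniq: "Y = Y'" if Y: "Y : ?G" "Y' : ?G" and xs: "xs : ?L Y" "xs : ?L Y'" for Y Y' xs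
 proof -
  obtain Z where Z: "card Z = q ^ j" "!!Y'. submodule K Y' V ==> {\<zero>\<^bsub>V\<^esub>} \<subseteq> Y' ==> indep_over {\<zero>\<^bsub>V\<^esub>} Y' xs ==> Z \<subseteq> Y'"
   using independent_lists_span[OF zero_subspace W z[OF W], of xs] xs Y mono by auto
  have "Z = Y'" if "Y' : ?G" "xs : ?L Y'" for Y' by (rule card_subset_eq) (use that Z z finite_subspace in auto)
  from this[OF Y(1) xs(1)] this[OF Y(2) xs(2)] show ?thesis by simp
 qed
 have "(PROD i<j. card W - q ^ i) = card (?L W)" using card_independent_lists[OF zero_subspace W z[OF W]] by simp
 also have "... = (SUM Y:?G. card (?L Y))" unfolding eq
 proof (rule card_UN_disjoint)
  show "finite ?G" by (rule finite_subset[of _ "Pow W"]) (use finW in auto)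
  show "ALL Y:?G. finite (?L Y)" using finite_lists_independent finite_subspace by blast
  show "ALL Y:?G. ALL Y':?G. Y ~= Y' --> ?L Y \<inter> ?L Y' = {}" using uniq by blast
 qed
 also have "... = (SUM Y:?G. PROD i<j. q ^ j - q ^ i)"
 proof (rule sum.cong[OF refl])
  fix Y assume "Y : ?G"
  then have Y: "submodule K Y V" "card Y = q ^ j" by auto
  show "card (?L Y) = (PROD i<j. q ^ j - q ^ i)" using card_independent_lists[OF zero_subspace Y(1) z[OF Y(1)], of j] Y(2) by simp
 qed
 finally show ?thesis by simp
qed

text \<open>Sort the pairs in \<open>U \<times> W\<close> by their sum; every fibre is a coset of the intersection.\<close>
lemma subspace_sum_modular:
 assumes U: "submodule K U V" and W: "submodule K W V"
 shows "subspace_dim (submodule_sum U W) + subspace_dim (U \<inter> W) = subspace_dim U + subspace_dim W"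
proof -
 note S = sum_is_submodule[OF U W] and I = submodule_inter[OF U W]
 have "card U * card W = card (U \<times> W)" by (simp add: card_cartesian_product)
 also have "... = (SUM s:submodule_sum U W. card {p:U \<times> W. fst p \<oplus>\<^bsub>V\<^esub> snd p = s})"
 proof -
  have "U \<times> W = (UN s:submodule_sum U W. {p:U \<times> W. fst p \<oplus>\<^bsub>V\<^esub> snd p = s})" by (auto simp: submodule_sum_def)
  moreover have "card (UN s:submodule_sum U W. {p:U \<times> W. fst p \<oplus>\<^bsub>V\<^esub> snd p = s}) =
    (SUM s:submodule_sum U W. card {p:U \<times> W. fst p \<oplus>\<^bsub>V\<^esub> snd p = s})" by (rule card_UN_disjoint) (use finite_subspace U W S in auto)
  ultimately show ?thesis by simp
 qed
 also have "... = (SUM s:submodule_sum U W. card (U \<inter> W))"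
 proof (rule sum.cong[OF refl])
  fix s assume "s : submodule_sum U W"
  then obtain u w where uw: "u : U" "w : W" "s = u \<oplus>\<^bsub>V\<^esub> w" by (auto simp: submodule_sum_def)
  note vec = subspace_vec[OF U] subspace_vec[OF W]
  have "bij_betw (%z. (u \<oplus>\<^bsub>V\<^esub> z, w \<ominus>\<^bsub>V\<^esub> z)) (U \<inter> W) {p:U \<times> W. fst p \<oplus>\<^bsub>V\<^esub> snd p = s}"
  proof (rule bij_betw_byWitness[of _ "%p. fst p \<ominus>\<^bsub>V\<^esub> u"])
   have mU: "x \<ominus>\<^bsub>V\<^esub> y : U" if "x : U" "y : U" for x y using that subspace_neg[OF U] submodule.m_closed[OF U] by (auto simp: a_minus_def)
   have mW: "x \<ominus>\<^bsub>V\<^esub> y : W" if "x : W" "y : W" for x y using that subspace_neg[OF W] submodule.m_closed[OF W] by (auto simp: a_minus_def)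
   show "ALL a:U \<inter> W. fst (u \<oplus>\<^bsub>V\<^esub> a, w \<ominus>\<^bsub>V\<^esub> a) \<ominus>\<^bsub>V\<^esub> u = a" using uw vec vector_arith(2)[of _ u u u] by simp
   show "(%z. (u \<oplus>\<^bsub>V\<^esub> z, w \<ominus>\<^bsub>V\<^esub> z)) ` (U \<inter> W) \<subseteq> {p:U \<times> W. fst p \<oplus>\<^bsub>V\<^esub> snd p = s}"
   proof (rule subsetI, elim imageE IntE)
    fix x z assume "x = (u \<oplus>\<^bsub>V\<^esub> z, w \<ominus>\<^bsub>V\<^esub> z)" "z : U" "z : W"
    then show "x : {p:U \<times> W. fst p \<oplus>\<^bsub>V\<^esub> snd p = s}" using vector_arith(4)[of z z u w] uw vec mW[of w z] submodule.m_closed[OF U, of u z] by simp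
   qed
   have key: "a \<ominus>\<^bsub>V\<^esub> u = w \<ominus>\<^bsub>V\<^esub> b" if "a : U" "b : W" "a \<oplus>\<^bsub>V\<^esub> b = s" for a b
    using vector_arith(5)[of a b u w] that uw vec by simp
   show "(%p. fst p \<ominus>\<^bsub>V\<^esub> u) ` {p:U \<times> W. fst p \<oplus>\<^bsub>V\<^esub> snd p = s} \<subseteq> U \<inter> W"
   proof (rule subsetI, elim imageE CollectE conjE SigmaE)
    fix x p a b assume *: "x = fst p \<ominus>\<^bsub>V\<^esub> u" "fst p \<oplus>\<^bsub>V\<^esub> snd p = s" "a : U" "b : W" "p = (a, b)"
    then have "x = w \<ominus>\<^bsub>V\<^esub> b" "x = a \<ominus>\<^bsub>V\<^esub> u" using key[of a b] by auto
    then show "x : U \<inter> W" using mU[of a u] mW[of w b] * uw by simp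
   qed
   show "ALL p:{p:U \<times> W. fst p \<oplus>\<^bsub>V\<^esub> snd p = s}. (u \<oplus>\<^bsub>V\<^esub> (fst p \<ominus>\<^bsub>V\<^esub> u), w \<ominus>\<^bsub>V\<^esub> (fst p \<ominus>\<^bsub>V\<^esub> u)) = p"
   proof (rule ballI, elim CollectE conjE SigmaE)
    fix p a b assume *: "fst p \<oplus>\<^bsub>V\<^esub> snd p = s" "a : U" "b : W" "p = (a, b)"
    then have "a \<ominus>\<^bsub>V\<^esub> u = w \<ominus>\<^bsub>V\<^esub> b" using key[of a b] by auto
    then show "(u \<oplus>\<^bsub>V\<^esub> (fst p \<ominus>\<^bsub>V\<^esub> u), w \<ominus>\<^bsub>V\<^esub> (fst p \<ominus>\<^bsub>V\<^esub> u)) = p"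
     using vector_arith(1,3)[of a b u w] * uw vec by simp
   qed
  qed
  then show "card {p:U \<times> W. fst p \<oplus>\<^bsub>V\<^esub> snd p = s} = card (U \<inter> W)" by (simp add: bij_betw_same_card)
 qed
 finally have "card (submodule_sum U W) * card (U \<inter> W) = card U * card W" by simp
 then have "q ^ (subspace_dim (submodule_sum U W) + subspace_dim (U \<inter> W)) = q ^ (subspace_dim U + subspace_dim W)" by (simp add: card_subspace U W S I power_add)
 then show ?thesis using q_ge_2 by (simp add: power_inject_exp)
qed

end

section \<open>Linear maps over a finite field\<close>

definition hom_space ::
 "('k, 'b) ring_scheme => ('k, 'c, 'd) module_scheme => ('k, 'e, 'f) module_scheme =>
  'c set => 'e set => ('c => 'e) set" where
 "hom_space K V V' U W = module_hom K (V\<lparr>carrier := U\<rparr>) (V'\<lparr>carrier := W\<rparr>) \<inter> extensional U"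

locale finite_vectorspace_pair =
 A: finite_vectorspace K V + B: finite_vectorspace K V' for K :: "('k, 'b) ring_scheme" (structure)
  and V :: "('k, 'c, 'd) module_scheme" and V' :: "('k, 'e, 'f) module_scheme"
begin

abbreviation Hom where "Hom \<equiv> hom_space K V V'"

lemma in_Hom_iff:
 "f : Hom U W \<longleftrightarrow> f : extensional U & (ALL x:U. f x : W)
   & (ALL x:U. ALL y:U. f (x \<oplus>\<^bsub>V\<^esub> y) = f x \<oplus>\<^bsub>V'\<^esub> f y)
   & (ALL a:carrier K. ALL x:U. f (a \<odot>\<^bsub>V\<^esub> x) = a \<odot>\<^bsub>V'\<^esub> f x)" unfolding hom_space_def module_hom_def by auto

lemma finite_Hom:
 assumes "submodule K U V" "submodule K W V'" shows "finite (Hom U W)"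
proof (rule finite_subset)
 show "Hom U W \<subseteq> U \<rightarrow>\<^sub>E W" using in_Hom_iff by (auto simp: PiE_def)
 show "finite (U \<rightarrow>\<^sub>E W)" using assms A.finite_subspace B.finite_subspace by (intro finite_PiE) auto
qed

lemma Hom_zero:
 assumes U: "submodule K U V" and W: "submodule K W V'" and f: "f : Hom U W"
 shows "f \<zero>\<^bsub>V\<^esub> = \<zero>\<^bsub>V'\<^esub>"
proof -
 have z: "\<zero>\<^bsub>V\<^esub> : U" using submodule.zero_closed[OF U] .
 then have fz: "f \<zero>\<^bsub>V\<^esub> : carrier V'" using f W B.subspace_vec unfolding in_Hom_iff by blast
 have "f (\<zero> \<odot>\<^bsub>V\<^esub> \<zero>\<^bsub>V\<^esub>) = \<zero> \<odot>\<^bsub>V'\<^esub> f \<zero>\<^bsub>V\<^esub>" using f z unfolding in_Hom_iff by blast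
 then show ?thesis using fz by simp
qed

lemma Hom_restrict:
 assumes "submodule K U V" "U \<subseteq> Y" "f : Hom Y W" "f ` U \<subseteq> W'" shows "restrict f U : Hom U W'"
 using assms unfolding in_Hom_iff by (auto simp: submodule.m_closed submodule.smult_closed subset_iff)

lemma Hom_mono: "f : Hom U W ==> W \<subseteq> W' ==> f : Hom U W'"
 unfolding in_Hom_iff by blast

lemma Hom_adjoin_value:
 assumes U: "submodule K U V" and x: "x : carrier V"
  and f: "f : Hom (A.adjoin U x) W" and u: "u : U" "a : carrier K"
 shows "f (u \<oplus>\<^bsub>V\<^esub> a \<odot>\<^bsub>V\<^esub> x) = f u \<oplus>\<^bsub>V'\<^esub> a \<odot>\<^bsub>V'\<^esub> f x"
proof -
 note S = A.adjoin_submodule[OF U x] and sup = A.adjoin_superset[OF U x]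
 have "a \<odot>\<^bsub>V\<^esub> x : A.adjoin U x" "u : A.adjoin U x" using submodule.smult_closed[OF S] u sup by auto
 then show ?thesis using f sup u unfolding in_Hom_iff by simp
qed

definition extend_by :: "'c set => 'c => ('c => 'e) => 'e => 'c => 'e" where
 "extend_by U x g w = (\<lambda>v\<in>A.adjoin U x.
   THE y. EX u:U. EX a:carrier K. v = u \<oplus>\<^bsub>V\<^esub> a \<odot>\<^bsub>V\<^esub> x & y = g u \<oplus>\<^bsub>V'\<^esub> a \<odot>\<^bsub>V'\<^esub> w)"

lemma extend_by_value:
 assumes U: "submodule K U V" and x: "x : carrier V" "x ~: U" and u: "u : U" "a : carrier K"
 shows "extend_by U x g w (u \<oplus>\<^bsub>V\<^esub> a \<odot>\<^bsub>V\<^esub> x) = g u \<oplus>\<^bsub>V'\<^esub> a \<odot>\<^bsub>V'\<^esub> w"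
proof -
 have "u \<oplus>\<^bsub>V\<^esub> a \<odot>\<^bsub>V\<^esub> x : A.adjoin U x" using u by (auto simp: A.adjoin_def)
 moreover have "(THE y. EX u':U. EX a':carrier K. u \<oplus>\<^bsub>V\<^esub> a \<odot>\<^bsub>V\<^esub> x = u' \<oplus>\<^bsub>V\<^esub> a' \<odot>\<^bsub>V\<^esub> x
   & y = g u' \<oplus>\<^bsub>V'\<^esub> a' \<odot>\<^bsub>V'\<^esub> w) = g u \<oplus>\<^bsub>V'\<^esub> a \<odot>\<^bsub>V'\<^esub> w"
  by (rule the_equality) (use u A.adjoin_unique[OF U x u(1) _ u(2)] in blast)+
 ultimately show ?thesis by (simp add: extend_by_def)
qed

lemma extend_by_Hom:
 assumes U: "submodule K U V" and x: "x : carrier V" "x ~: U" and W: "submodule K W V'"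
  and g: "g : Hom U W" and w: "w : W"
 shows "extend_by U x g w : Hom (A.adjoin U x) W" "restrict (extend_by U x g w) U = g"
  "extend_by U x g w x = w"
proof -
 let ?f = "extend_by U x g w"
 note val = extend_by_value[OF U x, of _ _ g w]
 note vecU = A.subspace_vec[OF U] and vecW = B.subspace_vec[OF W]
 have gW: "!!u. u : U ==> g u : W" using g by (simp add: in_Hom_iff)
 have gV: "!!u. u : U ==> g u : carrier V'" using gW vecW by blast
 have wV: "w : carrier V'" using w vecW by blast
 have gadd: "!!u v. u : U ==> v : U ==> g (u \<oplus>\<^bsub>V\<^esub> v) = g u \<oplus>\<^bsub>V'\<^esub> g v"
  and gsm: "!!a u. a : carrier K ==> u : U ==> g (a \<odot>\<^bsub>V\<^esub> u) = a \<odot>\<^bsub>V'\<^esub> g u" using g by (simp_all add: in_Hom_iff)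
 note closed = submodule.m_closed[OF U] submodule.smult_closed[OF U]
 have dec: "EX u:U. EX a:carrier K. v = u \<oplus>\<^bsub>V\<^esub> a \<odot>\<^bsub>V\<^esub> x" if "v : A.adjoin U x" for v using that by (auto simp: A.adjoin_def)
 show "?f : Hom (A.adjoin U x) W" unfolding in_Hom_iff
 proof (intro conjI ballI)
  show "?f : extensional (A.adjoin U x)" by (simp add: extend_by_def)
  fix v assume "v : A.adjoin U x"
  then obtain u a where v: "u : U" "a : carrier K" "v = u \<oplus>\<^bsub>V\<^esub> a \<odot>\<^bsub>V\<^esub> x" using dec by blast
  show "?f v : W" unfolding v(3) val[OF v(1,2)] using gW w v submodule.m_closed[OF W] submodule.smult_closed[OF W] by simp
  {
   fix v' assume "v' : A.adjoin U x"
   then obtain u' a' where v': "u' : U" "a' : carrier K" "v' = u' \<oplus>\<^bsub>V\<^esub> a' \<odot>\<^bsub>V\<^esub> x" using dec by blast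
   have "v \<oplus>\<^bsub>V\<^esub> v' = (u \<oplus>\<^bsub>V\<^esub> u') \<oplus>\<^bsub>V\<^esub> (a \<oplus> a') \<odot>\<^bsub>V\<^esub> x"
    using v v' x vecU by (simp add: A.smult_l_distr A.M.a_ac)
   then have "?f (v \<oplus>\<^bsub>V\<^esub> v') = g (u \<oplus>\<^bsub>V\<^esub> u') \<oplus>\<^bsub>V'\<^esub> (a \<oplus> a') \<odot>\<^bsub>V'\<^esub> w"
    using val[of "u \<oplus>\<^bsub>V\<^esub> u'" "a \<oplus> a'"] v v' closed by simp
   also have "... = ?f v \<oplus>\<^bsub>V'\<^esub> ?f v'" unfolding v(3) v'(3) val[OF v(1,2)] val[OF v'(1,2)] using v v' gV wV gadd by (simp add: B.smult_l_distr B.M.a_ac)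
   finally show "?f (v \<oplus>\<^bsub>V\<^esub> v') = ?f v \<oplus>\<^bsub>V'\<^esub> ?f v'" .
  }
  fix v' c assume "v' : A.adjoin U x" "c : carrier K"
  then obtain u' a' where v': "u' : U" "a' : carrier K" "v' = u' \<oplus>\<^bsub>V\<^esub> a' \<odot>\<^bsub>V\<^esub> x" using dec by blast
  note c = \<open>c : carrier K\<close>
  have "c \<odot>\<^bsub>V\<^esub> v' = (c \<odot>\<^bsub>V\<^esub> u') \<oplus>\<^bsub>V\<^esub> (c \<otimes> a') \<odot>\<^bsub>V\<^esub> x"
   using c v' x vecU by (simp add: A.smult_r_distr A.smult_assoc1)
  then have "?f (c \<odot>\<^bsub>V\<^esub> v') = g (c \<odot>\<^bsub>V\<^esub> u') \<oplus>\<^bsub>V'\<^esub> (c \<otimes> a') \<odot>\<^bsub>V'\<^esub> w"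
   using val[of "c \<odot>\<^bsub>V\<^esub> u'" "c \<otimes> a'"] c v' closed by simp
  also have "... = c \<odot>\<^bsub>V'\<^esub> ?f v'" unfolding v'(3) val[OF v'(1,2)] using c v' gV wV gsm by (simp add: B.smult_r_distr B.smult_assoc1)
  finally show "?f (c \<odot>\<^bsub>V\<^esub> v') = c \<odot>\<^bsub>V'\<^esub> ?f v'" .
 qed
 show "restrict ?f U = g"
 proof
  fix u show "restrict ?f U u = g u"
  proof (cases "u : U")
   case True
   have "?f (u \<oplus>\<^bsub>V\<^esub> \<zero> \<odot>\<^bsub>V\<^esub> x) = g u \<oplus>\<^bsub>V'\<^esub> \<zero> \<odot>\<^bsub>V'\<^esub> w" by (rule val) (use True in auto)
   then show ?thesis using True x vecU gV wV by simp
  next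
   case False
   then show ?thesis using g by (auto simp: in_Hom_iff extensional_def)
  qed
 qed
 have "?f (\<zero>\<^bsub>V\<^esub> \<oplus>\<^bsub>V\<^esub> \<one> \<odot>\<^bsub>V\<^esub> x) = g \<zero>\<^bsub>V\<^esub> \<oplus>\<^bsub>V'\<^esub> \<one> \<odot>\<^bsub>V'\<^esub> w"
  by (rule val) (use submodule.zero_closed[OF U] in auto)
 then show "?f x = w" using Hom_zero[OF U W g] x wV by simp
qed

lemma Hom_adjoin_bij:
 assumes U: "submodule K U V" and x: "x : carrier V" "x ~: U" and W: "submodule K W V'"
 shows "bij_betw (%f. (restrict f U, f x)) (Hom (A.adjoin U x) W) (Hom U W \<times> W)"
proof (rule bij_betw_byWitness[of _ "%(g, w). extend_by U x g w"])
 note sup = A.adjoin_superset[OF U x(1)]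
 show sub: "(%f. (restrict f U, f x)) ` Hom (A.adjoin U x) W \<subseteq> Hom U W \<times> W"
 proof (rule image_subsetI)
  fix f assume f: "f : Hom (A.adjoin U x) W"
  then have "ALL v:A.adjoin U x. f v : W" by (simp add: in_Hom_iff)
  then have "f ` U \<subseteq> W" "f x : W" using sup by auto
  then show "(restrict f U, f x) : Hom U W \<times> W" using Hom_restrict[OF U sup(1) f] by simp
 qed
 show "(%(g, w). extend_by U x g w) ` (Hom U W \<times> W) \<subseteq> Hom (A.adjoin U x) W" using extend_by_Hom[OF U x W] by auto
 show "ALL p:Hom U W \<times> W. (restrict (case p of (g, w) => extend_by U x g w) U, (case p of (g, w) => extend_by U x g w) x) = p"
  using extend_by_Hom[OF U x W] by auto
 show "ALL f:Hom (A.adjoin U x) W. (case (restrict f U, f x) of (g, w) => extend_by U x g w) = f"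
 proof (rule ballI)
  fix f assume f: "f : Hom (A.adjoin U x) W"
  have "extend_by U x (restrict f U) (f x) v = f v" for v
  proof (cases "v : A.adjoin U x")
   case True
   then obtain u a where v: "u : U" "a : carrier K" "v = u \<oplus>\<^bsub>V\<^esub> a \<odot>\<^bsub>V\<^esub> x" by (auto simp: A.adjoin_def)
   show ?thesis unfolding v(3) extend_by_value[OF U x v(1,2)] Hom_adjoin_value[OF U x(1) f v(1,2)] using v by simp
  next
   case False
   then show ?thesis using f by (auto simp: extend_by_def in_Hom_iff extensional_def)
  qed
  then show "(case (restrict f U, f x) of (g, w) => extend_by U x g w) = f" by auto
 qed
qed

lemma dim_adjoin:
 "submodule K U V ==> x : carrier V ==> x ~: U ==> A.subspace_dim (A.adjoin U x) = Suc (A.subspace_dim U)"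
 using A.subspace_dim_eq[OF A.adjoin_submodule, of U x "Suc (A.subspace_dim U)"]
  A.card_adjoin[of U x] A.card_subspace[of U] by simp

text \<open>Adjoining one vector to the source gives one free value in the target, so each step multiplies the number of extensions by \<open>q\<close> to the dimension of the target.\<close>
lemma card_Hom_extending:
 assumes U: "submodule K U V" and Y: "submodule K Y V" and sub: "U \<subseteq> Y"
  and W: "submodule K W V'" and g: "g : Hom U W"
 shows "card {f:Hom Y W. restrict f U = g} = card W ^ (A.subspace_dim Y - A.subspace_dim U)"
 using U Y sub
proof (induction rule: A.subspace_extend_induct)
 case base
 have "restrict f U = f" if "f : Hom U W" for f using that by (auto simp: in_Hom_iff extensional_def)
 then have "{f:Hom U W. restrict f U = g} = {g}" using g by auto
 then show ?case by (simp only: card.insert card.empty finite.intros empty_iff simp_thms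
   diff_self_eq_0 power_0 One_nat_def if_False)
next
 case (step Y x)
 have x: "x : carrier V" using step A.subspace_vec \<open>submodule K Y V\<close> by (metis A.subspace_vec assms(2))
 let ?F = "%Y. {f:Hom Y W. restrict f U = g}"
 have restr: "restrict (restrict f Y) U = restrict f U" for f :: "'c => 'e" using step(2) by (auto simp: restrict_def fun_eq_iff)
 have bij: "bij_betw (%f. (restrict f Y, f x)) (?F (A.adjoin Y x)) (?F Y \<times> W)"
 proof (rule bij_betw_subset[OF Hom_adjoin_bij[OF step(1) x step(5) W]])
  show "(%f. (restrict f Y, f x)) ` ?F (A.adjoin Y x) = ?F Y \<times> W"
  proof (intro equalityI subsetI)
   fix p assume "p : (%f. (restrict f Y, f x)) ` ?F (A.adjoin Y x)"
   then obtain f where f: "f : Hom (A.adjoin Y x) W" "restrict f U = g" "p = (restrict f Y, f x)" by blast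
   moreover have "(restrict f Y, f x) : Hom Y W \<times> W" using bij_betwE[OF Hom_adjoin_bij[OF step(1) x step(5) W]] f by blast
   ultimately show "p : ?F Y \<times> W" using restr by simp
  next
   fix p assume p: "p : ?F Y \<times> W"
   then obtain f where f: "f : Hom (A.adjoin Y x) W" "p = (restrict f Y, f x)" using Hom_adjoin_bij[OF step(1) x step(5) W] unfolding bij_betw_def by blast
   with p restr[of f] have "restrict f U = g" by simp
   then show "p : (%f. (restrict f Y, f x)) ` ?F (A.adjoin Y x)" using f by blast
  qed
 qed simp
 have "card (?F (A.adjoin Y x)) = card (?F Y) * card W" using bij_betw_same_card[OF bij] by (simp add: card_cartesian_product)
 also have "... = card W ^ (A.subspace_dim (A.adjoin Y x) - A.subspace_dim U)" unfolding step(6) using A.subspace_dim_mono[OF U step(1,2)] dim_adjoin[OF step(1) x step(5)]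
  by (simp add: Suc_diff_le)
 finally show ?case .
qed

lemma Hom_zero_source:
 assumes W: "submodule K W V'"
 shows "Hom {\<zero>\<^bsub>V\<^esub>} W = {\<lambda>x\<in>{\<zero>\<^bsub>V\<^esub>}. \<zero>\<^bsub>V'\<^esub>}"
by (use Hom_zero A.zero_subspace W submodule.zero_closed in "auto simp: in_Hom_iff extensional_def fun_eq_iff")

lemma card_Hom:
 assumes Y: "submodule K Y V" and W: "submodule K W V'"
 shows "card (Hom Y W) = card W ^ A.subspace_dim Y"
proof -
 let ?g = "\<lambda>x\<in>{\<zero>\<^bsub>V\<^esub>}. \<zero>\<^bsub>V'\<^esub>"
 have sub: "{\<zero>\<^bsub>V\<^esub>} \<subseteq> Y" using submodule.zero_closed[OF Y] by simp
 have "restrict f {\<zero>\<^bsub>V\<^esub>} = ?g" if "f : Hom Y W" for f using Hom_zero[OF Y W that] by auto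
 then have "Hom Y W = {f:Hom Y W. restrict f {\<zero>\<^bsub>V\<^esub>} = ?g}" by auto
 also have "card ... = card W ^ A.subspace_dim Y" using card_Hom_extending[OF A.zero_subspace Y sub W] Hom_zero_source[OF W] by simp
 finally show ?thesis .
qed

lemma Hom_adjoin_inj_iff:
 assumes U: "submodule K U V" and x: "x : carrier V" "x ~: U" and W: "submodule K W V'"
  and f: "f : Hom (A.adjoin U x) W"
 shows "inj_on f (A.adjoin U x) \<longleftrightarrow> inj_on f U & f x ~: f ` U"
proof
 note sup = A.adjoin_superset[OF U x(1)]
 assume "inj_on f (A.adjoin U x)"
 then show "inj_on f U & f x ~: f ` U" using sup x by (auto simp: inj_on_def subset_iff)
next
 note sup = A.adjoin_superset[OF U x(1)]
 assume inj: "inj_on f U & f x ~: f ` U"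
 have g: "restrict f U : Hom U W" using Hom_adjoin_bij[OF U x W] f bij_betwE by fastforce
 have im: "submodule K (f ` U) V'"
 proof (unfold_locales)
  show "f ` U \<subseteq> carrier V'" using g B.subspace_vec[OF W] by (auto simp: in_Hom_iff)
  show "\<zero>\<^bsub>V'\<^esub> : f ` U" using Hom_zero[OF U W g] submodule.zero_closed[OF U] by (metis restrict_apply' image_eqI)
  fix v w assume "v : f ` U" "w : f ` U"
  then obtain a b where ab: "a : U" "b : U" "v = f a" "w = f b" by blast
  then have "f (a \<oplus>\<^bsub>V\<^esub> b) = v \<oplus>\<^bsub>V'\<^esub> w" using f sup(1) unfolding in_Hom_iff by (metis subsetD)
  then show "v \<oplus>\<^bsub>V'\<^esub> w : f ` U" using ab submodule.m_closed[OF U] by (metis imageI)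
 next
  fix c v assume "c : carrier K" "v : f ` U"
  then obtain a where ab: "a : U" "v = f a" by blast
  then have "f (c \<odot>\<^bsub>V\<^esub> a) = c \<odot>\<^bsub>V'\<^esub> v" using f sup \<open>c : carrier K\<close> by (auto simp: in_Hom_iff)
  then show "c \<odot>\<^bsub>V'\<^esub> v : f ` U" using ab submodule.smult_closed[OF U \<open>c : carrier K\<close>] by (metis imageI)
 qed
 have fx: "f x : carrier V'" using f sup B.subspace_vec[OF W] by (auto simp: in_Hom_iff)
 show "inj_on f (A.adjoin U x)"
 proof (rule inj_onI)
  fix v v' assume v: "v : A.adjoin U x" "v' : A.adjoin U x" "f v = f v'"
  obtain u a where u: "u : U" "a : carrier K" "v = u \<oplus>\<^bsub>V\<^esub> a \<odot>\<^bsub>V\<^esub> x" using v by (auto simp: A.adjoin_def)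
  obtain u' a' where u': "u' : U" "a' : carrier K" "v' = u' \<oplus>\<^bsub>V\<^esub> a' \<odot>\<^bsub>V\<^esub> x" using v by (auto simp: A.adjoin_def)
  have "f u \<oplus>\<^bsub>V'\<^esub> a \<odot>\<^bsub>V'\<^esub> f x = f u' \<oplus>\<^bsub>V'\<^esub> a' \<odot>\<^bsub>V'\<^esub> f x"
   using v(3) unfolding u(3) u'(3) Hom_adjoin_value[OF U x(1) f u(1,2)] Hom_adjoin_value[OF U x(1) f u'(1,2)] .
  from B.adjoin_unique[OF im fx _ _ _ u(2) u'(2) this] inj u u'
  have "f u = f u'" "a = a'" by auto
  then show "v = v'" using inj u u' by (auto dest: inj_onD)
 qed
qed

lemma card_Hom_injective:
 assumes Y: "submodule K Y V" and W: "submodule K W V'"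
 shows "card {f:Hom Y W. inj_on f Y} = (PROD i<A.subspace_dim Y. card W - A.q ^ i)"
proof -
 have sub: "{\<zero>\<^bsub>V\<^esub>} \<subseteq> Y" using submodule.zero_closed[OF Y] by simp
 show ?thesis using A.zero_subspace Y sub
 proof (induction rule: A.subspace_extend_induct)
  case base
  have "{f:Hom {\<zero>\<^bsub>V\<^esub>} W. inj_on f {\<zero>\<^bsub>V\<^esub>}} = {\<lambda>x\<in>{\<zero>\<^bsub>V\<^esub>}. \<zero>\<^bsub>V'\<^esub>}" unfolding Hom_zero_source[OF W] by auto
  then show ?case by simp
 next
  case (step U x)
  have x: "x : carrier V" using step A.subspace_vec[OF Y] by blast
  let ?F = "%Y. {f:Hom Y W. inj_on f Y}"
  note bij0 = Hom_adjoin_bij[OF step(1) x step(5) W]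
  have iff: "f : ?F (A.adjoin U x) \<longleftrightarrow> restrict f U : ?F U & f x : W - restrict f U ` U" if "f : Hom (A.adjoin U x) W" for f
   using bij_betwE[OF bij0] that Hom_adjoin_inj_iff[OF step(1) x step(5) W that] by (auto simp: inj_on_restrict_eq)
  have bij: "bij_betw (%f. (restrict f U, f x)) (?F (A.adjoin U x)) (SIGMA g:?F U. W - g ` U)"
  proof (rule bij_betw_subset[OF bij0])
   show "(%f. (restrict f U, f x)) ` ?F (A.adjoin U x) = (SIGMA g:?F U. W - g ` U)"
   proof (intro equalityI subsetI)
    fix p assume "p : (%f. (restrict f U, f x)) ` ?F (A.adjoin U x)"
    then show "p : (SIGMA g:?F U. W - g ` U)" using iff by auto
   next
    fix p assume p: "p : (SIGMA g:?F U. W - g ` U)"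
    then have "p : Hom U W \<times> W" by auto
    then obtain f where f: "f : Hom (A.adjoin U x) W" "p = (restrict f U, f x)" using bij0 unfolding bij_betw_def by blast
    with p iff[of f] have "f : ?F (A.adjoin U x)" by simp
    then show "p : (%f. (restrict f U, f x)) ` ?F (A.adjoin U x)" using f by blast
   qed
  qed simp
  have finU: "finite U" using A.finite_subspace step by blast
  have finW: "finite W" using B.finite_subspace W by blast
  have finF: "finite (?F U)" using finite_Hom[OF step(1) W] by simp
  have "card (?F (A.adjoin U x)) = (SUM g:?F U. card (W - g ` U))" using bij_betw_same_card[OF bij] finF finW by (simp add: card_SigmaI)
  also have "... = (SUM g:?F U. card W - A.q ^ A.subspace_dim U)"
  proof (rule sum.cong[OF refl])
   fix g assume g: "g : ?F U"
   then have "g ` U \<subseteq> W" by (auto simp: in_Hom_iff)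
   then show "card (W - g ` U) = card W - A.q ^ A.subspace_dim U" using g finU by (simp add: card_Diff_subset card_image A.card_subspace step(1))
  qed
  also have "... = (PROD i<A.subspace_dim (A.adjoin U x). card W - A.q ^ i)" using step(6) dim_adjoin[OF step(1) x step(5)] by simp
  finally show ?case .
 qed
qed

end

lemma coord_vs_finite_vectorspace:
 assumes "field F" "finite (carrier F)" shows "finite_vectorspace F (coord_vs F n)"
proof -
 interpret field F by fact
 have "module F (coord_vs F n)" unfolding coord_vs_def by (rule func_space_is_module)
 moreover have "finite (carrier (coord_vs F n))" unfolding coord_vs_def func_space_def using assms(2) by (simp add: finite_PiE)
 ultimately show ?thesis by (simp add: finite_vectorspace_def finite_vectorspace_axioms_def vectorspace_def assms)
qed

lemma card_coord_vs:
 assumes "field F" shows "card (carrier (coord_vs F n)) = card (carrier F) ^ n"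
proof -
 interpret field F by fact
 show ?thesis unfolding coord_vs_def func_space_def by (simp add: card_PiE)
qed

lemma lin_maps_eq_hom_space:
 "lin_maps F m n = hom_space F (coord_vs F m) (coord_vs F n) (carrier (coord_vs F m)) (carrier (coord_vs F n))" by (simp add: lin_maps_def hom_space_def)

lemma card_gen_lin:
 assumes F: "field F" "finite (carrier F)"
 shows "card (gen_lin F n) = (PROD i<n. card (carrier F) ^ n - card (carrier F) ^ i)"
proof -
 let ?V = "coord_vs F n"
 interpret A: finite_vectorspace F ?V by (rule coord_vs_finite_vectorspace[OF F])
 interpret finite_vectorspace_pair F ?V ?V ..
 have dim: "A.subspace_dim (carrier ?V) = n" by (rule A.subspace_dim_eq[OF A.whole_subspace card_coord_vs[OF F(1)]])
 have "gen_lin F n = {f:Hom (carrier ?V) (carrier ?V). inj_on f (carrier ?V)}" unfolding gen_lin_def lin_maps_eq_hom_space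
 proof (intro Collect_cong conj_cong refl)
  fix f assume "f : Hom (carrier ?V) (carrier ?V)"
  then have "f ` carrier ?V \<subseteq> carrier ?V" unfolding in_Hom_iff by blast
  then show "bij_betw f (carrier ?V) (carrier ?V) \<longleftrightarrow> inj_on f (carrier ?V)" using endo_inj_surj[OF A.finite_vectors, of f] unfolding bij_betw_def by blast
 qed
 then show ?thesis using card_Hom_injective[OF A.whole_subspace A.whole_subspace] dim card_coord_vs[OF F(1), of n] by simp
qed

section \<open>Counting semistable representations\<close>

text \<open>The number of graded subspaces of dimension \<open>c'\<close> in a graded space of dimension \<open>c\<close>.\<close>
definition subspace_ratio :: "('v, 'a) pre_digraph => real => ('v => nat) => ('v => nat) => real" where
 "subspace_ratio Q q c' c = (PROD v:verts Q. (PROD i<c' v. q ^ c v - q ^ i) / (PROD i<c' v. q ^ c' v - q ^ i))"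

definition destabilising :: "('v, 'a) pre_digraph => ('v => real) => ('v => nat) => ('v => nat) set" where
 "destabilising Q zeta c = {c' : dim_vectors Q. c' < c & stab_weight Q zeta c' > 0}"

text \<open>The recursion that results from sorting destabilising chains by their largest member; it determines all values up to \<open>e\<close>.\<close>
definition stable_recursion ::
 "('v, 'a) pre_digraph => ('v => real) => real => ('v => nat) => (('v => nat) => real) => bool" where
 "stable_recursion Q zeta q e a \<longleftrightarrow> (ALL c:dim_vectors Q. c <= e -->
   a c = (PROD al:arcs Q. q ^ (c (tail Q al) * c (head Q al)))
    - (SUM c':destabilising Q zeta c. a c' * subspace_ratio Q q c' c
      * (PROD al:arcs Q. q ^ ((c (tail Q al) - c' (tail Q al)) * c (head Q al)))))"

lemma finite_dim_vectors_le:
 assumes "finite (verts Q)" shows "finite {c' : dim_vectors Q. c' <= c}"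
proof (rule finite_subset)
 let ?g = "%f v. if v : verts Q then f v else 0"
 show "{c' : dim_vectors Q. c' <= c} \<subseteq> ?g ` (PiE (verts Q) (%v. {..c v}))"
 proof
  fix c' assume c': "c' : {c' : dim_vectors Q. c' <= c}"
  show "c' : ?g ` (PiE (verts Q) (%v. {..c v}))" by (rule image_eqI[of _ _ "restrict c' (verts Q)"])
     (use c' in "auto simp: dim_vectors_def fun_eq_iff le_fun_def")
 qed
 show "finite (?g ` (PiE (verts Q) (%v. {..c v})))" using assms by (intro finite_imageI finite_PiE) auto
qed

locale quiver_over_finite_field = fin_digraph Q for Q :: "('v, 'a) pre_digraph" +
 fixes F :: "'k ring" and e :: "'v => nat" and zeta :: "'v => real"
 assumes field: "field F" and finite_field: "finite (carrier F)" and e: "e : dim_vectors Q"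
begin

abbreviation V where "V v \<equiv> coord_vs F (e v)"
abbreviation q where "q \<equiv> card (carrier F)"
abbreviation sub where "sub v U \<equiv> submodule F U (V v)"

lemma fvs: "finite_vectorspace F (V v)"
 by (rule coord_vs_finite_vectorspace[OF field finite_field])

lemma fvs_pair: "finite_vectorspace_pair F (V v) (V w)"
 by (simp add: finite_vectorspace_pair_def fvs)

definition graded :: "('v => (nat => 'k) set) set" where
 "graded = {U. (ALL v:verts Q. sub v (U v)) & (ALL v. v ~: verts Q --> U v = {})}"

definition whole :: "'v => (nat => 'k) set" where
 "whole v = (if v : verts Q then carrier (V v) else {})"

abbreviation gdim where "gdim \<equiv> subrep_dim F Q e"

definition reps :: "('v => (nat => 'k) set) => ('a => (nat => 'k) => (nat => 'k)) set" where
 "reps U = (\<Pi>\<^sub>E al\<in>arcs Q. hom_space F (V (tail Q al)) (V (head Q al)) (U (tail Q al)) (U (head Q al)))"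

definition preserves :: "('a => (nat => 'k) => (nat => 'k)) => ('v => (nat => 'k) set) => bool" where
 "preserves x U \<longleftrightarrow> (ALL al:arcs Q. x al ` U (tail Q al) \<subseteq> U (head Q al))"

definition destab :: "('a => (nat => 'k) => (nat => 'k)) => ('v => (nat => 'k) set) => ('v => (nat => 'k) set) set" where
 "destab x U = {W:graded. W < U & stab_weight Q zeta (gdim W) > 0 & preserves x W}"

lemma gdim_vertex: "v : verts Q ==> gdim U v = finite_vectorspace.subspace_dim F (V v) (U v)"
 by (simp add: subrep_dim_def finite_vectorspace.subspace_dim_def[OF fvs])

lemma gdim_in_dim_vectors: "gdim U : dim_vectors Q"
 by (simp add: dim_vectors_def subrep_dim_def)

lemma graded_subspace: "U : graded ==> v : verts Q ==> sub v (U v)"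
 by (simp add: graded_def)

lemma card_graded: "U : graded ==> v : verts Q ==> card (U v) = q ^ gdim U v"
 using finite_vectorspace.card_subspace[OF fvs graded_subspace] by (simp add: gdim_vertex)

lemma graded_le_iff: "U : graded ==> U <= W \<longleftrightarrow> (ALL v:verts Q. U v \<subseteq> W v)"
 by (auto simp: le_fun_def graded_def)

lemma gdim_mono: "U : graded ==> W : graded ==> U <= W ==> gdim U <= gdim W"
 unfolding le_fun_def
proof
 fix v assume *: "U : graded" "W : graded" "ALL x. U x \<subseteq> W x"
 show "gdim U v <= gdim W v"
 proof (cases "v : verts Q")
  case True
  then show ?thesis using finite_vectorspace.subspace_dim_mono[OF fvs graded_subspace graded_subspace] * by (simp add: gdim_vertex)
 qed (simp add: subrep_dim_def)
qed

lemma gdim_strict_mono: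
 assumes "U : graded" "W : graded" "U < W" shows "gdim U < gdim W"
proof -
 have le: "U <= W" and ne: "U ~= W" using assms(3) by auto
 obtain v where v: "U v ~= W v" using ne by (meson ext)
 then have vQ: "v : verts Q" using assms by (auto simp: graded_def)
 have "U v \<subset> W v" using v le by (auto simp: le_fun_def)
 then have "gdim U v < gdim W v" using finite_vectorspace.subspace_dim_less[OF fvs graded_subspace graded_subspace] assms vQ by (simp add: gdim_vertex)
 then have "gdim U ~= gdim W" by auto
 then show ?thesis using gdim_mono[OF assms(1,2) le] by (simp add: less_le)
qed

lemma whole_graded: "whole : graded"
 using finite_vectorspace.whole_subspace[OF fvs] by (auto simp: graded_def whole_def)

lemma graded_le_whole: "U : graded ==> U <= whole"
 using submodule.subset[OF graded_subspace] by (auto simp: graded_le_iff whole_def)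

lemma gdim_whole: "gdim whole = e"
proof
 fix v show "gdim whole v = e v"
 proof (cases "v : verts Q")
  case True
  then show ?thesis using finite_vectorspace.subspace_dim_eq[OF fvs finite_vectorspace.whole_subspace[OF fvs] card_coord_vs[OF field]] by (simp add: gdim_vertex whole_def)
 next
  case False
  then show ?thesis using e by (simp add: dim_vectors_def subrep_dim_def)
 qed
qed

lemma finite_graded_subspaces: "finite graded"
proof (rule finite_subset)
 let ?g = "%f v. if v : verts Q then f v else {}"
 show "graded \<subseteq> ?g ` (\<Pi>\<^sub>E v\<in>verts Q. Pow (carrier (V v)))"
 proof
  fix U assume U: "U : graded"
  show "U : ?g ` (\<Pi>\<^sub>E v\<in>verts Q. Pow (carrier (V v)))" by (rule image_eqI[of _ _ "restrict U (verts Q)"])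
     (use U submodule.subset[OF graded_subspace[OF U]] in "auto simp: graded_def fun_eq_iff")
 qed
 show "finite (?g ` (\<Pi>\<^sub>E v\<in>verts Q. Pow (carrier (V v))))" using finite_vectorspace.finite_vectors[OF fvs] by (intro finite_imageI finite_PiE) auto
qed

lemma quiver_reps_eq: "quiver_reps F Q e = reps whole"
 unfolding quiver_reps_def reps_def lin_maps_eq_hom_space whole_def by (rule PiE_cong) simp

lemma finite_reps: "U : graded ==> finite (reps U)"
 unfolding reps_def by (intro finite_PiE finite_vectorspace_pair.finite_Hom[OF fvs_pair] graded_subspace) auto

lemma card_reps_extending:
 assumes U: "U : graded" and W: "W : graded" and le: "W <= U" and y: "y : reps W"
 shows "card {x:reps U. preserves x W & (\<lambda>al\<in>arcs Q. restrict (x al) (W (tail Q al))) = y}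
   = (PROD al:arcs Q. q ^ ((gdim U (tail Q al) - gdim W (tail Q al)) * gdim U (head Q al)))"
proof -
 let ?H = "%al. hom_space F (V (tail Q al)) (V (head Q al)) (U (tail Q al)) (U (head Q al))"
 let ?E = "%al. {f:?H al. restrict f (W (tail Q al)) = y al}"
 have "{x:reps U. preserves x W & (\<lambda>al\<in>arcs Q. restrict (x al) (W (tail Q al))) = y} = (\<Pi>\<^sub>E al\<in>arcs Q. ?E al)"
 proof (intro equalityI subsetI)
  fix x assume x: "x : {x:reps U. preserves x W & (\<lambda>al\<in>arcs Q. restrict (x al) (W (tail Q al))) = y}"
  show "x : (\<Pi>\<^sub>E al\<in>arcs Q. ?E al)"
  proof (rule PiE_I)
   fix al assume "al : arcs Q"
   moreover have "y = (\<lambda>al\<in>arcs Q. restrict (x al) (W (tail Q al)))" using x by simp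
   ultimately show "x al : ?E al" using x by (auto simp: reps_def)
  qed (use x in "auto simp: reps_def PiE_def extensional_def")
 next
  fix x assume x: "x : (\<Pi>\<^sub>E al\<in>arcs Q. ?E al)"
  have "x : reps U" using x unfolding reps_def by (auto simp: PiE_iff)
  moreover have "preserves x W" unfolding preserves_def
  proof (intro ballI image_subsetI)
   fix al u assume a: "al : arcs Q" "u : W (tail Q al)"
   then have "restrict (x al) (W (tail Q al)) u = y al u" using x by (auto simp: PiE_iff)
   then have "x al u = y al u" using a by simp
   moreover have "y al : hom_space F (V (tail Q al)) (V (head Q al)) (W (tail Q al)) (W (head Q al))" using y a by (auto simp: reps_def)
   ultimately show "x al u : W (head Q al)" using a by (simp add: finite_vectorspace_pair.in_Hom_iff[OF fvs_pair])
  qed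
  moreover have "(\<lambda>al\<in>arcs Q. restrict (x al) (W (tail Q al))) = y" using x y by (intro extensionalityI[where A = "arcs Q"]) (auto simp: PiE_iff reps_def)
  ultimately show "x : {x:reps U. preserves x W & (\<lambda>al\<in>arcs Q. restrict (x al) (W (tail Q al))) = y}" by blast
 qed
 then have "card {x:reps U. preserves x W & (\<lambda>al\<in>arcs Q. restrict (x al) (W (tail Q al))) = y}
   = (PROD al:arcs Q. card (?E al))" by (simp only: card_PiE[OF finite_arcs])
 also have "... = (PROD al:arcs Q. q ^ ((gdim U (tail Q al) - gdim W (tail Q al)) * gdim U (head Q al)))"
 proof (rule prod.cong[OF refl])
  fix al assume a: "al : arcs Q"
  then have th: "tail Q al : verts Q" "head Q al : verts Q" by auto
  have "y al : hom_space F (V (tail Q al)) (V (head Q al)) (W (tail Q al)) (W (head Q al))" using y a by (auto simp: reps_def)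
  then have ya: "y al : hom_space F (V (tail Q al)) (V (head Q al)) (W (tail Q al)) (U (head Q al))"
   by (rule finite_vectorspace_pair.Hom_mono[OF fvs_pair]) (use le in "auto simp: le_fun_def")
  show "card (?E al) = q ^ ((gdim U (tail Q al) - gdim W (tail Q al)) * gdim U (head Q al))"
   using finite_vectorspace_pair.card_Hom_extending[OF fvs_pair graded_subspace[OF W th(1)]
     graded_subspace[OF U th(1)] _ graded_subspace[OF U th(2)] ya] le
    card_graded[OF U th(2)] th by (simp add: le_fun_def gdim_vertex power_mult mult.commute)
 qed
 finally show ?thesis .
qed

lemma card_reps:
 assumes U: "U : graded"
 shows "card (reps U) = (PROD al:arcs Q. q ^ (gdim U (tail Q al) * gdim U (head Q al)))"
 unfolding reps_def card_PiE[OF finite_arcs]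
proof (rule prod.cong[OF refl])
 fix al assume "al : arcs Q"
 then have th: "tail Q al : verts Q" "head Q al : verts Q" by auto
 show "card (hom_space F (V (tail Q al)) (V (head Q al)) (U (tail Q al)) (U (head Q al)))
   = q ^ (gdim U (tail Q al) * gdim U (head Q al))" using finite_vectorspace_pair.card_Hom[OF fvs_pair graded_subspace[OF U th(1)] graded_subspace[OF U th(2)]]
   card_graded[OF U th(2)] th by (simp add: gdim_vertex power_mult[symmetric] mult.commute)
qed

definition chain_count :: "('v => (nat => 'k) set) => real" where
 "chain_count U = (SUM x:reps U. chain_sum (destab x U))"

lemma chain_count_rec:
 assumes U: "U : graded"
 shows "chain_count U = real (card (reps U))
   - (SUM W | W : graded & W < U & stab_weight Q zeta (gdim W) > 0. chain_count W
     * (PROD al:arcs Q. real q ^ ((gdim U (tail Q al) - gdim W (tail Q al)) * gdim U (head Q al))))"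
proof -
 let ?G = "{W. W : graded & W < U & stab_weight Q zeta (gdim W) > 0}"
 let ?r = "%W x. \<lambda>al\<in>arcs Q. restrict (x al) (W (tail Q al))"
 have finG: "finite ?G" using finite_graded_subspaces by simp
 have fin: "finite (destab x U)" for x using finite_graded_subspaces by (simp add: destab_def)
 have "chain_count U = (SUM x:reps U. 1 - (SUM W:destab x U. chain_sum {Y:destab x U. Y < W}))"
  unfolding chain_count_def by (intro sum.cong refl chain_sum_rec fin)
 also have "... = real (card (reps U)) - (SUM x:reps U. SUM W:destab x U. chain_sum {Y:destab x U. Y < W})" by (simp add: sum_subtractf)
 also have "(SUM x:reps U. SUM W:destab x U. chain_sum {Y:destab x U. Y < W})
   = (SUM x:reps U. SUM W:?G. if preserves x W then chain_sum (destab (?r W x) W) else 0)"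
 proof (rule sum.cong[OF refl])
  fix x assume x: "x : reps U"
  have "destab x U = {W:?G. preserves x W}" by (auto simp: destab_def)
  moreover have "{Y:destab x U. Y < W} = destab (?r W x) W" if "W < U" for W
  proof -
   have "preserves (?r W x) Y \<longleftrightarrow> preserves x Y" if "Y < W" for Y
   proof -
    have "?r W x al ` Y (tail Q al) = x al ` Y (tail Q al)" if "al : arcs Q" for al
     using \<open>Y < W\<close> that by (auto simp: less_fun_def le_fun_def subset_iff image_def)
    then show ?thesis by (simp add: preserves_def)
   qed
   then show ?thesis using \<open>W < U\<close> by (auto simp: destab_def)
  qed
  ultimately show "(SUM W:destab x U. chain_sum {Y:destab x U. Y < W}) =
    (SUM W:?G. if preserves x W then chain_sum (destab (?r W x) W) else 0)" by (simp add: sum.inter_filter[OF finG, symmetric])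
 qed
 also have "... = (SUM W:?G. SUM x:reps U. if preserves x W then chain_sum (destab (?r W x) W) else 0)" by (rule sum.swap)
 also have "... = (SUM W:?G. chain_count W
     * (PROD al:arcs Q. real q ^ ((gdim U (tail Q al) - gdim W (tail Q al)) * gdim U (head Q al))))"
 proof (rule sum.cong[OF refl])
  fix W assume "W : ?G"
  then have W: "W : graded" "W <= U" by auto
  let ?X = "{x:reps U. preserves x W}"
  have "(SUM x:reps U. if preserves x W then chain_sum (destab (?r W x) W) else 0)
    = (SUM x:?X. chain_sum (destab (?r W x) W))" by (rule sum.inter_filter[OF finite_reps[OF U], symmetric])
  also have "... = (SUM y:reps W. SUM x:{x:?X. ?r W x = y}. chain_sum (destab (?r W x) W))"
  proof (rule sum.group[symmetric])
   show "finite ?X" using finite_reps[OF U] by simp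
   show "finite (reps W)" by (rule finite_reps[OF W(1)])
   show "?r W ` ?X \<subseteq> reps W"
   proof (rule image_subsetI)
    fix x assume x: "x : ?X"
    show "?r W x : reps W" unfolding reps_def
    proof (rule PiE_I)
     fix al assume a: "al : arcs Q"
     then have th: "tail Q al : verts Q" by auto
     show "?r W x al : hom_space F (V (tail Q al)) (V (head Q al)) (W (tail Q al)) (W (head Q al))"
     proof -
      have "x al : hom_space F (V (tail Q al)) (V (head Q al)) (U (tail Q al)) (U (head Q al))" using x a by (auto simp: reps_def)
      moreover have "W (tail Q al) \<subseteq> U (tail Q al)" using W(2) by (simp add: le_fun_def)
      moreover have "x al ` W (tail Q al) \<subseteq> W (head Q al)" using x a by (simp add: preserves_def)
      ultimately show ?thesis using finite_vectorspace_pair.Hom_restrict[OF fvs_pair graded_subspace[OF W(1) th]] a by simp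
     qed
    qed simp
   qed
  qed
  also have "... = (SUM y:reps W. real (card {x:?X. ?r W x = y}) * chain_sum (destab y W))" by (intro sum.cong refl) simp
  also have "... = (SUM y:reps W. (PROD al:arcs Q. real q ^ ((gdim U (tail Q al) - gdim W (tail Q al)) * gdim U (head Q al)))
     * chain_sum (destab y W))" by (use sum.cong card_reps_extending U W in "auto")
  finally show "(SUM x:reps U. if preserves x W then chain_sum (destab (?r W x) W) else 0) =
   chain_count W * (PROD al:arcs Q. real q ^ ((gdim U (tail Q al) - gdim W (tail Q al)) * gdim U (head Q al)))"
   unfolding chain_count_def sum_distrib_right by (simp add: mult.commute)
 qed
 finally show ?thesis .
qed

lemma card_graded_of_dim:
 assumes U: "U : graded" and c: "c : dim_vectors Q" "c <= gdim U"
 shows "real (card {W:graded. W <= U & gdim W = c}) = subspace_ratio Q q c (gdim U)"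
proof -
 let ?E = "%v. {Y. sub v Y & Y \<subseteq> U v & card Y = q ^ c v}"
 have "bij_betw (%W. restrict W (verts Q)) {W:graded. W <= U & gdim W = c} (PiE (verts Q) ?E)"
 proof (rule bij_betw_byWitness[of _ "%f v. if v : verts Q then f v else {}"])
  show "ALL W:{W:graded. W <= U & gdim W = c}. (%v. if v : verts Q then restrict W (verts Q) v else {}) = W" by (auto simp: graded_def fun_eq_iff)
  show "ALL f:PiE (verts Q) ?E. restrict (%v. if v : verts Q then f v else {}) (verts Q) = f" by (auto simp: fun_eq_iff PiE_def extensional_def)
  show "(%W. restrict W (verts Q)) ` {W:graded. W <= U & gdim W = c} \<subseteq> PiE (verts Q) ?E"
  proof (rule image_subsetI)
   fix W assume W: "W : {W:graded. W <= U & gdim W = c}"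
   then have "W v \<subseteq> U v" for v by (simp add: le_fun_def)
   then show "restrict W (verts Q) : PiE (verts Q) ?E" using W card_graded[of W] graded_subspace[of W] by auto
  qed
  show "(%f v. if v : verts Q then f v else {}) ` PiE (verts Q) ?E \<subseteq> {W:graded. W <= U & gdim W = c}"
  proof (rule image_subsetI)
   fix f assume f: "f : PiE (verts Q) ?E"
   let ?W = "%v. if v : verts Q then f v else {}"
   have fv: "sub v (f v)" "f v \<subseteq> U v" "card (f v) = q ^ c v" if "v : verts Q" for v using PiE_mem[OF f that] by auto
   have W: "?W : graded" using fv by (simp add: graded_def)
   moreover have "?W <= U" using fv by (auto simp: le_fun_def)
   moreover have "gdim ?W = c"
   proof
    fix v show "gdim ?W v = c v"
    proof (cases "v : verts Q")
     case True
     then show ?thesis using finite_vectorspace.subspace_dim_eq[OF fvs fv(1,3)] by (simp add: gdim_vertex)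
    next
     case False
     then show ?thesis using c(1) by (simp add: dim_vectors_def subrep_dim_def)
    qed
   qed
   ultimately show "?W : {W:graded. W <= U & gdim W = c}" by simp
  qed
 qed
 from bij_betw_same_card[OF this]
 have "card {W:graded. W <= U & gdim W = c} = (PROD v:verts Q. card (?E v))" by (simp only: card_PiE[OF finite_verts])
 also have "real ... = subspace_ratio Q q c (gdim U)" unfolding subspace_ratio_def of_nat_prod
 proof (rule prod.cong[OF refl])
  fix v assume v: "v : verts Q"
  have q2: "2 <= q" by (rule finite_vectorspace.q_ge_2[OF fvs])
  have pw: "real (q ^ k - q ^ i) = real q ^ k - real q ^ i" if "i <= k" for i k using that q2 by (simp add: of_nat_diff power_increasing)
  have cv: "c v <= gdim U v" using c by (simp add: le_fun_def)
  have "real (card (?E v)) * (PROD i<c v. real (q ^ c v - q ^ i)) = (PROD i<c v. real (q ^ gdim U v - q ^ i))"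
   using finite_vectorspace.card_subspaces[OF fvs graded_subspace[OF U v], of "c v"] card_graded[OF U v] by (simp flip: of_nat_mult of_nat_prod)
  moreover have "(PROD i<c v. real (q ^ c v - q ^ i)) = (PROD i<c v. real q ^ c v - real q ^ i)" by (rule prod.cong[OF refl], rule pw) simp
  moreover have "(PROD i<c v. real (q ^ gdim U v - q ^ i)) = (PROD i<c v. real q ^ gdim U v - real q ^ i)" by (rule prod.cong[OF refl], rule pw) (use cv in simp)
  moreover have "(PROD i<c v. real q ^ c v - real q ^ i) ~= 0" using q2 by (auto simp: power_inject_exp)
  ultimately show "real (card (?E v)) = (PROD i<c v. real q ^ gdim U v - real q ^ i) / (PROD i<c v. real q ^ c v - real q ^ i)" by (simp add: field_simps)
 qed
 finally show ?thesis .
qed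

lemma chain_count_eq:
 assumes a: "stable_recursion Q zeta q e a" and U: "U : graded"
 shows "chain_count U = a (gdim U)"
 using U
proof (induction "SUM v:verts Q. gdim U v" arbitrary: U rule: less_induct)
 case less
 let ?c = "gdim U"
 let ?G = "{W. W : graded & W < U & stab_weight Q zeta (gdim W) > 0}"
 let ?w = "%c'. PROD al:arcs Q. real q ^ ((?c (tail Q al) - c' (tail Q al)) * ?c (head Q al))"
 have IH: "chain_count W = a (gdim W)" if "W : ?G" for W
 proof (rule less.hyps)
  have lt: "gdim W < ?c" using gdim_strict_mono that less.prems by simp
  then obtain v where "gdim W v < ?c v" by (auto simp: less_fun_def le_fun_def not_le)
  moreover from this have "v : verts Q" by (auto simp: subrep_dim_def split: if_splits)
  ultimately show "(SUM v:verts Q. gdim W v) < (SUM v:verts Q. ?c v)" using lt by (intro sum_strict_mono_ex1) (auto simp: less_fun_def le_fun_def)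
 qed (use that in simp)
 have "(SUM W:?G. chain_count W * ?w (gdim W)) = (SUM W:?G. a (gdim W) * ?w (gdim W))" using IH by simp
 also have "... = (SUM c':destabilising Q zeta ?c. SUM W:{W:?G. gdim W = c'}. a (gdim W) * ?w (gdim W))"
 proof (rule sum.group[symmetric])
  show "finite ?G" using finite_graded_subspaces by simp
  show "finite (destabilising Q zeta ?c)" by (rule finite_subset[OF _ finite_dim_vectors_le[OF finite_verts, of ?c]]) (auto simp: destabilising_def)
  show "gdim ` ?G \<subseteq> destabilising Q zeta ?c" using gdim_strict_mono less.prems gdim_in_dim_vectors by (auto simp: destabilising_def)
 qed
 also have "... = (SUM c':destabilising Q zeta ?c. a c' * subspace_ratio Q q c' ?c * ?w c')"
 proof (rule sum.cong[OF refl])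
  fix c' assume c': "c' : destabilising Q zeta ?c"
  then have c'': "c' : dim_vectors Q" "c' < ?c" "stab_weight Q zeta c' > 0" by (simp_all add: destabilising_def)
  have eq: "W : {W:?G. gdim W = c'} \<longleftrightarrow> W : {W:graded. W <= U & gdim W = c'}" for W
   using c''(2,3) by (cases "W = U") (auto simp: order.strict_iff_order)
  have "{W:?G. gdim W = c'} = {W:graded. W <= U & gdim W = c'}" by (rule Set.set_eqI) (rule eq)
  then have "real (card {W:?G. gdim W = c'}) = subspace_ratio Q q c' ?c" using card_graded_of_dim[OF less.prems c''(1)] c''(2) by simp
  then show "(SUM W:{W:?G. gdim W = c'}. a (gdim W) * ?w (gdim W)) = a c' * subspace_ratio Q q c' ?c * ?w c'" by simp
 qed
 finally show ?case using chain_count_rec[OF less.prems] a gdim_in_dim_vectors[of U]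
   gdim_mono[OF less.prems whole_graded graded_le_whole[OF less.prems]] unfolding stable_recursion_def gdim_whole by (simp add: card_reps[OF less.prems])
qed

lemma semistable_reps_eq:
 assumes zeta: "stab_weight Q zeta e = 0"
 shows "semistable_reps F Q zeta e = {x:reps whole. ALL W:graded. preserves x W --> stab_weight Q zeta (gdim W) <= 0}"
 unfolding semistable_reps_def quiver_reps_eq
proof (intro Collect_cong conj_cong refl iffI ballI allI impI)
 fix x W
 assume A: "ALL U. is_subrep F Q e x U & (EX v:verts Q. U v ~= {\<zero>\<^bsub>V v\<^esub>}) & (EX v:verts Q. U v ~= carrier (V v))
    --> stab_weight Q zeta (gdim U) <= 0"
  and W: "W : graded" "preserves x W"
 have "is_subrep F Q e x W" using W by (auto simp: is_subrep_def preserves_def graded_def finite_vectorspace.subspaceI[OF fvs])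
 moreover have "stab_weight Q zeta (gdim W) = 0" if "ALL v:verts Q. W v = {\<zero>\<^bsub>V v\<^esub>}"
  using that by (auto simp: stab_weight_def gdim_vertex finite_vectorspace.subspace_dim_zero[OF fvs])
 moreover have "stab_weight Q zeta (gdim W) = 0" if "ALL v:verts Q. W v = carrier (V v)"
 proof -
  have "W = whole" using that W by (auto simp: whole_def graded_def fun_eq_iff)
  then show ?thesis using zeta gdim_whole by simp
 qed
 ultimately show "stab_weight Q zeta (gdim W) <= 0" using A by (metis order.refl)
next
 fix x U
 assume A: "ALL W:graded. preserves x W --> stab_weight Q zeta (gdim W) <= 0"
  and U: "is_subrep F Q e x U & (EX v:verts Q. U v ~= {\<zero>\<^bsub>V v\<^esub>}) & (EX v:verts Q. U v ~= carrier (V v))"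
 let ?W = "%v. if v : verts Q then U v else {}"
 have "?W : graded" "preserves x ?W" using U by (auto simp: is_subrep_def preserves_def graded_def VectorSpace.subspace_def)
 moreover have "gdim ?W = gdim U" by (auto simp: subrep_dim_def)
 ultimately show "stab_weight Q zeta (gdim U) <= 0" using A by metis
qed

text \<open>Sum the alternating chain sum over all representations and sort by the largest member of the chain: representations preserving it are counted by extending linear maps.\<close>
theorem card_semistable_reps:
 assumes a: "stable_recursion Q zeta q e a" and zeta: "stab_weight Q zeta e = 0"
 shows "real (card (semistable_reps F Q zeta e)) = a e"
proof -
 let ?ss = "%x. ALL W:{W:graded. preserves x W}. stab_weight Q zeta (gdim W) <= 0"
 have "a e = chain_count whole" using chain_count_eq[OF a whole_graded] gdim_whole by simp
 also have "... = (SUM x:reps whole. if ?ss x then 1 else 0)" unfolding chain_count_def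
 proof (rule sum.cong[OF refl])
  fix x assume x: "x : reps whole"
  let ?L = "{W:graded. preserves x W}"
  have "destab x whole = {W:?L. stab_weight Q zeta (gdim W) > 0}" using graded_le_whole zeta gdim_whole by (auto simp: destab_def less_le)
  also have "chain_sum ... = (if ?ss x then 1 else 0)"
  proof (rule chain_sum_modular)
   show "finite ?L" using finite_graded_subspaces by simp
  next
   fix U W assume UW: "U : ?L" "W : ?L"
   note sU = graded_subspace[of U] and sW = graded_subspace[of W]
   show inf: "inf U W : ?L"
   proof -
    have "inf U W : graded" using UW finite_vectorspace.submodule_inter[OF fvs] by (auto simp: graded_def)
    moreover have "preserves x (inf U W)" using UW unfolding preserves_def by (fastforce simp: image_subset_iff)
    ultimately show ?thesis by simp
   qed
   let ?S = "%v. if v : verts Q then module.submodule_sum (V v) (U v) (W v) else {}"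
   have mods: "module F (V v)" for v using fvs unfolding finite_vectorspace_def vectorspace_def by blast
   have S: "?S : graded" using UW module.sum_is_submodule[OF mods] by (auto simp: graded_def)
   moreover have "preserves x ?S" unfolding preserves_def
   proof (intro ballI image_subsetI)
    fix al s assume al: "al : arcs Q" and "s : ?S (tail Q al)"
    then have th: "tail Q al : verts Q" "head Q al : verts Q" by auto
    then obtain u w where uw: "u : U (tail Q al)" "w : W (tail Q al)" "s = u \<oplus>\<^bsub>V (tail Q al)\<^esub> w"
     using \<open>s : ?S (tail Q al)\<close> by (auto simp: module.submodule_sum_def[OF mods])
    have "U (tail Q al) \<subseteq> whole (tail Q al)" "W (tail Q al) \<subseteq> whole (tail Q al)"
     using UW graded_le_whole[of U] graded_le_whole[of W] by (auto simp: le_fun_def)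
    then have "u : whole (tail Q al)" "w : whole (tail Q al)" using uw by auto
    moreover have "x al : hom_space F (V (tail Q al)) (V (head Q al)) (whole (tail Q al)) (whole (head Q al))" using x al by (auto simp: reps_def)
    ultimately have "x al s = x al u \<oplus>\<^bsub>V (head Q al)\<^esub> x al w" using uw by (simp add: finite_vectorspace_pair.in_Hom_iff[OF fvs_pair])
    moreover have "x al u : U (head Q al)" "x al w : W (head Q al)" using UW uw al unfolding preserves_def by blast+
    ultimately show "x al s : ?S (head Q al)" using th by (auto simp: module.submodule_sum_def[OF mods])
   qed
   moreover have "stab_weight Q zeta (gdim ?S) + stab_weight Q zeta (gdim (inf U W))
     = stab_weight Q zeta (gdim U) + stab_weight Q zeta (gdim W)" unfolding stab_weight_def sum.distrib[symmetric]
   proof (rule sum.cong[OF refl])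
    fix v assume v: "v : verts Q"
    have "gdim ?S v + gdim (inf U W) v = gdim U v + gdim W v" using finite_vectorspace.subspace_sum_modular[OF fvs graded_subspace[OF _ v] graded_subspace[OF _ v], of U W] UW v
     by (simp add: gdim_vertex)
    then have "real (gdim ?S v) + real (gdim (inf U W) v) = real (gdim U v) + real (gdim W v)" by (simp flip: of_nat_add)
    then show "real (gdim ?S v) * zeta v + real (gdim (inf U W) v) * zeta v = real (gdim U v) * zeta v + real (gdim W v) * zeta v" by (simp flip: distrib_right)
   qed
   ultimately show "EX S:?L. stab_weight Q zeta (gdim S) + stab_weight Q zeta (gdim (inf U W))
     = stab_weight Q zeta (gdim U) + stab_weight Q zeta (gdim W)" by (intro bexI[of _ ?S]) auto
  qed
  finally show "chain_sum (destab x whole) = (if ?ss x then 1 else 0)" .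
 qed
 also have "... = real (card (semistable_reps F Q zeta e))" unfolding semistable_reps_eq[OF zeta] using finite_reps[OF whole_graded] by (simp add: sum.If_cases Int_def Ball_def imp_conjL)
 finally show ?thesis by simp
qed

end

section \<open>Supports of abelian representations\<close>

definition arcs_within :: "('x, 'b) pre_digraph => 'x set => 'b set" where
 "arcs_within G X = {a:arcs G. tail G a : X & head G a : X}"

text \<open>For generic values on the arrows of \<open>S\<close> these are the vertex sets of the subrepresentations.\<close>
definition succ_closed :: "('x, 'b) pre_digraph => 'b set => 'x set => bool" where
 "succ_closed G S Y \<longleftrightarrow> (ALL a:S. tail G a : Y --> head G a : Y)"

definition semistable_support :: "('x, 'b) pre_digraph => ('x => real) => 'x set => 'b set => bool" where
 "semistable_support G eta X S \<longleftrightarrow> (\<forall>Y\<subseteq>X. succ_closed G S Y --> sum eta Y <= 0)"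

definition closed_pos ::
 "('x, 'b) pre_digraph => ('x => real) => 'x set => 'b set => 'x set set" where
 "closed_pos G eta X S = {Y. Y \<subset> X & succ_closed G S Y & sum eta Y > 0}"

definition abelian_sum :: "('x, 'b) pre_digraph => ('x => real) => real => 'x set => real" where
 "abelian_sum G eta q X = (SUM S:Pow (arcs_within G X).
   (q - 1) ^ card S * chain_sum (closed_pos G eta X S)) / (q - 1) ^ card X"

lemma sum_Pow_power_card:
 fixes r :: "'a::comm_ring_1"
 assumes "finite B" shows "(SUM S:Pow B. r ^ card S) = (r + 1) ^ card B"
 using prod_add[OF assms, of "%_. r" "%_. 1"] by simp

text \<open>Sort the chains by their largest member \<open>Y\<close>: the arrows whose tail lies outside \<open>Y\<close> are unconstrained.\<close>
lemma abelian_sum_rec: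
 assumes finX: "finite X" and finA: "finite (arcs_within G X)"
 shows "abelian_sum G eta q X = q ^ card (arcs_within G X) / (q - 1) ^ card X
  - (SUM Y | Y \<subset> X & sum eta Y > 0. abelian_sum G eta q Y
    * (q ^ card {a:arcs_within G X. tail G a ~: Y} / (q - 1) ^ card (X - Y)))"
proof -
 let ?P = "{Y. Y \<subset> X & sum eta Y > 0}"
 let ?A = "arcs_within G X"
 let ?t = "%X. SUM S:Pow (arcs_within G X). (q - 1) ^ card S * chain_sum (closed_pos G eta X S)"
 have finP: "finite ?P" by (rule finite_subset[of _ "Pow X"]) (use finX in auto)
 have finC: "finite (closed_pos G eta X S)" for S by (rule finite_subset[of _ "Pow X"]) (use finX in "auto simp: closed_pos_def")
 have "?t X = (SUM S:Pow ?A. (q - 1) ^ card S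
    - (SUM Y:?P. if succ_closed G S Y then (q - 1) ^ card S * chain_sum (closed_pos G eta Y S) else 0))"
 proof (rule sum.cong[OF refl])
  fix S assume "S : Pow ?A"
  have below: "{Z:closed_pos G eta X S. Z < Y} = closed_pos G eta Y S" if "Y : ?P" for Y using that by (auto simp: closed_pos_def)
  have cp: "closed_pos G eta X S = {Y:?P. succ_closed G S Y}" by (auto simp: closed_pos_def)
  have "(SUM Y:closed_pos G eta X S. chain_sum {Z:closed_pos G eta X S. Z < Y})
    = (SUM Y:{Y:?P. succ_closed G S Y}. chain_sum (closed_pos G eta Y S))" by (rule sum.cong[OF cp]) (simp only: below mem_Collect_eq)
  also have "... = (SUM Y:?P. if succ_closed G S Y then chain_sum (closed_pos G eta Y S) else 0)" by (rule sum.inter_filter[OF finP])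
  finally have "(SUM Y:closed_pos G eta X S. chain_sum {Z:closed_pos G eta X S. Z < Y})
    = (SUM Y:?P. if succ_closed G S Y then chain_sum (closed_pos G eta Y S) else 0)" .
  then show "(q - 1) ^ card S * chain_sum (closed_pos G eta X S) = (q - 1) ^ card S
    - (SUM Y:?P. if succ_closed G S Y then (q - 1) ^ card S * chain_sum (closed_pos G eta Y S) else 0)" by (subst chain_sum_rec[OF finC])
     (simp add: right_diff_distrib sum_distrib_left if_distrib cong: if_cong)
 qed
 also have "... = q ^ card ?A - (SUM Y:?P. SUM S:Pow ?A. if succ_closed G S Y then (q - 1) ^ card S * chain_sum (closed_pos G eta Y S) else 0)"
  by (simp add: sum_subtractf sum_Pow_power_card[OF finA] sum.swap[of _ ?P])
 also have "... = q ^ card ?A - (SUM Y:?P. ?t Y * q ^ card {a:?A. tail G a ~: Y})"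
 proof (intro arg_cong2[of _ _ _ _ minus] refl sum.cong)
  fix Y assume Y: "Y : ?P"
  let ?B = "arcs_within G Y" and ?C = "{a:?A. tail G a ~: Y}"
  have finBC: "finite ?B" "finite ?C" by (rule finite_subset[OF _ finA]; use Y in "auto simp: arcs_within_def")+
  have "(SUM S:Pow ?A. if succ_closed G S Y then (q - 1) ^ card S * chain_sum (closed_pos G eta Y S) else 0)
    = (SUM S:{S:Pow ?A. succ_closed G S Y}. (q - 1) ^ card S * chain_sum (closed_pos G eta Y S))" by (rule sum.inter_filter[symmetric]) (use finA in simp)
  also have "... = (SUM (S1, S2):Pow ?B \<times> Pow ?C. ((q - 1) ^ card S1 * chain_sum (closed_pos G eta Y S1)) * (q - 1) ^ card S2)"
  proof (rule sum.reindex_bij_witness[of _ "%(S1, S2). S1 \<union> S2" "%S. (S \<inter> ?B, S \<inter> ?C)"])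
   fix S assume S: "S : {S:Pow ?A. succ_closed G S Y}"
   have split: "S = (S \<inter> ?B) \<union> (S \<inter> ?C)" using S by (auto simp: arcs_within_def succ_closed_def)
   then show "(case (S \<inter> ?B, S \<inter> ?C) of (S1, S2) => S1 \<union> S2) = S" by auto
   show "(S \<inter> ?B, S \<inter> ?C) : Pow ?B \<times> Pow ?C" by auto
   have "card S = card (S \<inter> ?B) + card (S \<inter> ?C)" by (subst split, rule card_Un_disjoint) (use finBC in "auto simp: arcs_within_def")
   moreover have "closed_pos G eta Y S = closed_pos G eta Y (S \<inter> ?B)"
   proof -
    have "succ_closed G S Z \<longleftrightarrow> succ_closed G (S \<inter> ?B) Z" if "Z \<subset> Y" for Z using that S unfolding succ_closed_def arcs_within_def by blast
    then show ?thesis by (auto simp: closed_pos_def)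
   qed
   ultimately show "(case (S \<inter> ?B, S \<inter> ?C) of (S1, S2) => ((q - 1) ^ card S1 * chain_sum (closed_pos G eta Y S1)) * (q - 1) ^ card S2)
    = (q - 1) ^ card S * chain_sum (closed_pos G eta Y S)" by (simp add: power_add)
  next
   fix p assume "p : Pow ?B \<times> Pow ?C"
   then obtain S1 S2 where p: "p = (S1, S2)" "S1 \<subseteq> ?B" "S2 \<subseteq> ?C" by auto
   show "(case p of (S1, S2) => S1 \<union> S2) : {S:Pow ?A. succ_closed G S Y}" using p Y by (auto simp: arcs_within_def succ_closed_def)
   show "((case p of (S1, S2) => S1 \<union> S2) \<inter> ?B, (case p of (S1, S2) => S1 \<union> S2) \<inter> ?C) = p" using p by (auto simp: arcs_within_def)
  qed
  also have "... = ?t Y * q ^ card ?C" using sum_Pow_power_card[OF finBC(2), of "q - 1"] by (simp add: sum.cartesian_product[symmetric] sum_distrib_left[symmetric] sum_distrib_right[symmetric])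
  finally show "(SUM S:Pow ?A. if succ_closed G S Y then (q - 1) ^ card S * chain_sum (closed_pos G eta Y S) else 0)
   = ?t Y * q ^ card ?C" .
 qed
 finally have "?t X / (q - 1) ^ card X = q ^ card ?A / (q - 1) ^ card X
   - (SUM Y:?P. ?t Y * q ^ card {a:?A. tail G a ~: Y} / (q - 1) ^ card X)" by (simp add: diff_divide_distrib sum_divide_distrib)
 also have "(SUM Y:?P. ?t Y * q ^ card {a:?A. tail G a ~: Y} / (q - 1) ^ card X)
   = (SUM Y:?P. abelian_sum G eta q Y * (q ^ card {a:?A. tail G a ~: Y} / (q - 1) ^ card (X - Y)))"
 proof (rule sum.cong[OF refl])
  fix Y assume "Y : ?P"
  then have "Y \<subseteq> X" by auto
  then have "card X = card Y + card (X - Y)" using finX by (simp add: card_Diff_subset finite_subset card_mono)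
  then show "?t Y * q ^ card {a:?A. tail G a ~: Y} / (q - 1) ^ card X
   = abelian_sum G eta q Y * (q ^ card {a:?A. tail G a ~: Y} / (q - 1) ^ card (X - Y))" by (simp add: abelian_sum_def power_add)
 qed
 finally show ?thesis by (simp add: abelian_sum_def)
qed

text \<open>Vertex sets form a modular lattice, so the chain sum is the indicator of semistability.\<close>
lemma abelian_sum_semistable:
 assumes finX: "finite X" and finA: "finite (arcs_within G X)" and bal: "sum eta X = 0"
 shows "abelian_sum G eta q X =
  (SUM S | S \<subseteq> arcs_within G X & semistable_support G eta X S. (q - 1) ^ card S) / (q - 1) ^ card X"
proof -
 have "chain_sum (closed_pos G eta X S) = (if semistable_support G eta X S then 1 else 0)" for S
 proof -
  let ?L = "{Y. Y \<subseteq> X & succ_closed G S Y}"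
  have "closed_pos G eta X S = {Y:?L. sum eta Y > 0}" using bal by (auto simp: closed_pos_def)
  also have "chain_sum ... = (if ALL Y:?L. sum eta Y <= 0 then 1 else 0)"
  proof (rule chain_sum_modular)
   show "finite ?L" by (rule finite_subset[of _ "Pow X"]) (use finX in auto)
  next
   fix U W assume UW: "U : ?L" "W : ?L"
   show "inf U W : ?L" using UW by (auto simp: succ_closed_def)
   have fin: "finite U" "finite W" using UW finX by (auto intro: finite_subset)
   have "U \<union> W : ?L" using UW by (auto simp: succ_closed_def)
   then show "EX s:?L. sum eta s + sum eta (inf U W) = sum eta U + sum eta W" using sum.union_inter[OF fin, of eta] by (intro bexI[of _ "U \<union> W"]) auto
  qed
  finally show ?thesis by (simp add: semistable_support_def)
 qed
 then have "(SUM S:Pow (arcs_within G X). (q - 1) ^ card S * chain_sum (closed_pos G eta X S))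
   = (SUM S:Pow (arcs_within G X). if semistable_support G eta X S then (q - 1) ^ card S else 0)" by (intro sum.cong) auto
 also have "... = (SUM S | S \<subseteq> arcs_within G X & semistable_support G eta X S. (q - 1) ^ card S)"
  using sum.inter_filter[of "Pow (arcs_within G X)" "%S. (q - 1) ^ card S" "semistable_support G eta X"] finA by simp
 finally show ?thesis by (simp add: abelian_sum_def)
qed

section \<open>The quantum dilogarithm\<close>

definition wpartitions :: "nat => (nat => nat) set" where
 "wpartitions n = {f. (ALL l. f l ~= 0 --> 1 <= l & l <= n) & (SUM l=1..n. l * f l) = n}"

definition partition_sum :: "(nat => real) => nat => real" where
 "partition_sum a n = (SUM f:wpartitions n. PROD l=1..n. a l ^ f l / fact (f l))"

lemma wpartitions_le:
 assumes "f : wpartitions n" shows "l * f l <= n"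
proof (cases "l : {1..n}")
 case True
 then have "l * f l <= (SUM l=1..n. l * f l)" by (intro member_le_sum) auto
 then show ?thesis using assms by (simp add: wpartitions_def)
next
 case False
 then show ?thesis using assms by (cases "f l = 0") (auto simp: wpartitions_def)
qed

lemma finite_weighted_partitions: "finite (wpartitions n)"
proof (rule finite_subset)
 let ?g = "%f l. if l : {1..n} then f l else 0"
 show "wpartitions n \<subseteq> ?g ` (\<Pi>\<^sub>E l\<in>{1..n}. {..n})"
 proof
  fix f assume f: "f : wpartitions n"
  have "f l <= n" for l using wpartitions_le[OF f, of l] f by (cases "f l = 0") (auto simp: wpartitions_def intro: order.trans[of _ "l * f l"])
  then show "f : ?g ` (\<Pi>\<^sub>E l\<in>{1..n}. {..n})" using f by (intro image_eqI[of _ _ "restrict f {1..n}"]) (auto simp: wpartitions_def fun_eq_iff)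
 qed
 show "finite (?g ` (\<Pi>\<^sub>E l\<in>{1..n}. {..n}))" by (intro finite_imageI finite_PiE) auto
qed

lemma wpartitions_enlarge:
 assumes "n <= N"
 shows "f : wpartitions n \<longleftrightarrow>
  (ALL l. f l ~= 0 --> 1 <= l & l <= N) & (SUM l=1..N. l * f l) = n"
proof -
 have eq: "(SUM l=1..N. l * f l) = (SUM l=1..n. l * f l)" if "ALL l. f l ~= 0 --> 1 <= l & l <= n" by (rule sum.mono_neutral_right) (use that assms in auto)
 have "l <= n" if "f l ~= 0" "ALL l. f l ~= 0 --> 1 <= l & l <= N" "(SUM l=1..N. l * f l) = n" for l
 proof -
  have "l <= l * f l" using that(1) by simp
  also have "l * f l <= (SUM l=1..N. l * f l)" using that by (intro member_le_sum) auto
  finally show ?thesis using that by simp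
 qed
 then show ?thesis using eq assms unfolding wpartitions_def mem_Collect_eq by (smt (verit) order.trans)
qed

lemma weight_enlarge:
 fixes a :: "nat => real"
 assumes "n <= N" "f : wpartitions n"
 shows "(PROD l=1..n. a l ^ f l / fact (f l)) = (PROD l=1..N. a l ^ f l / fact (f l))"
proof (rule prod.mono_neutral_left)
 show "ALL l:{1..N} - {1..n}. a l ^ f l / fact (f l) = 1"
 proof
  fix l assume "l : {1..N} - {1..n}"
  then have "f l = 0" using assms by (auto simp: wpartitions_def)
  then show "a l ^ f l / fact (f l) = 1" by simp
 qed
qed (use assms in auto)

lemma partition_sum_0: "partition_sum a 0 = 1"
proof -
 have "wpartitions 0 = {%_. 0}" by (auto simp: wpartitions_def)
 then show ?thesis by (simp add: partition_sum_def)
qed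

text \<open>Logarithmic differentiation of the generating function, in coefficients: mark one part.\<close>
lemma partition_sum_rec:
 "real n * partition_sum a n = (SUM l=1..n. real l * a l * partition_sum a (n - l))"
proof -
 let ?W = "%f. PROD l=1..n. a l ^ f l / fact (f l)"
 have "real n * partition_sum a n = (SUM f:wpartitions n. (SUM l=1..n. real l * real (f l)) * ?W f)" unfolding partition_sum_def sum_distrib_left
 proof (rule sum.cong[OF refl])
  fix f assume "f : wpartitions n"
  then have "(SUM l=1..n. l * f l) = n" by (simp add: wpartitions_def)
  then have "real n = (SUM l=1..n. real l * real (f l))" by (metis (no_types, lifting) of_nat_mult of_nat_sum sum.cong)
  then show "real n * ?W f = (SUM l=1..n. real l * real (f l)) * ?W f" by simp
 qed
 also have "... = (SUM l=1..n. SUM f:wpartitions n. real l * real (f l) * ?W f)" unfolding sum_distrib_right by (rule sum.swap)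
 also have "... = (SUM l=1..n. real l * a l * partition_sum a (n - l))"
 proof (rule sum.cong[OF refl])
  fix l assume l: "l : {1..n}"
  have "(SUM f:wpartitions n. real l * real (f l) * ?W f)
    = (SUM f:{f:wpartitions n. f l ~= 0}. real l * real (f l) * ?W f)" by (rule sum.mono_neutral_right) (use finite_weighted_partitions in auto)
  also have "... = (SUM f:wpartitions (n - l). real l * a l * ?W f)"
  proof (rule sum.reindex_bij_witness[of _ "%f. f(l := Suc (f l))" "%f. f(l := f l - 1)"])
   have sum_upd: "(SUM k=1..n. k * (f(l := y)) k) + l * f l = (SUM k=1..n. k * f k) + l * y" for f :: "nat => nat" and y
   proof -
    have rem: "(SUM k=1..n. h k) = h l + (SUM k:{1..n}-{l}. h k)" for h :: "nat => nat" using l by (intro sum.remove) auto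
    show ?thesis unfolding rem by simp
   qed
   fix f assume f: "f : {f:wpartitions n. f l ~= 0}"
   show "(f(l := f l - 1))(l := Suc ((f(l := f l - 1)) l)) = f" using f by auto
   have "(SUM k=1..n. k * (f(l := f l - 1)) k) = n - l" using sum_upd[of f "f l - 1"] f l by (cases "f l") (auto simp: wpartitions_def algebra_simps)
   then show "f(l := f l - 1) : wpartitions (n - l)" using f wpartitions_enlarge[of "n - l" n] by (auto simp: wpartitions_def)
   have rem: "(PROD k=1..n. h k) = h l * (PROD k:{1..n}-{l}. h k)" for h :: "nat => real" using l by (intro prod.remove) auto
   let ?R = "PROD k:{1..n}-{l}. a k ^ f k / fact (f k)"
   have "?W f = (a l ^ f l / fact (f l)) * ?R" by (rule rem)
   moreover have "?W (f(l := f l - 1)) = (a l ^ (f l - 1) / fact (f l - 1)) * ?R" unfolding rem by simp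
   moreover obtain m where "f l = Suc m" using f by (cases "f l") auto
   moreover have "a l * (a l ^ m / fact m * ?R) = real (Suc m) * (a l ^ Suc m / fact (Suc m) * ?R)" by (simp add: fact_Suc divide_simps del: of_nat_Suc)
   ultimately show "real l * a l * ?W (f(l := f l - 1)) = real l * real (f l) * ?W f" by (simp add: mult.assoc)
  next
   have sum_upd: "(SUM k=1..n. k * (f(l := y)) k) + l * f l = (SUM k=1..n. k * f k) + l * y" for f :: "nat => nat" and y
   proof -
    have rem: "(SUM k=1..n. h k) = h l + (SUM k:{1..n}-{l}. h k)" for h :: "nat => nat" using l by (intro sum.remove) auto
    show ?thesis unfolding rem by simp
   qed
   fix f assume f: "f : wpartitions (n - l)"
   then have f': "ALL k. f k ~= 0 --> 1 <= k & k <= n" "(SUM k=1..n. k * f k) = n - l" using wpartitions_enlarge[of "n - l" n f] by auto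
   have "(SUM k=1..n. k * (f(l := Suc (f l))) k) = n" using sum_upd[of f "Suc (f l)"] f' l by simp
   then show "f(l := Suc (f l)) : {f:wpartitions n. f l ~= 0}" using f' l by (auto simp: wpartitions_def)
  qed auto
  also have "... = real l * a l * partition_sum a (n - l)" unfolding partition_sum_def sum_distrib_left by (intro sum.cong refl arg_cong2[of _ _ _ _ "(*)"] weight_enlarge[symmetric]) auto
  finally show "(SUM f:wpartitions n. real l * real (f l) * ?W f) = real l * a l * partition_sum a (n - l)" .
 qed
 finally show ?thesis .
qed

definition q_exp_coeff :: "real => nat => real" where
 "q_exp_coeff q n = 1 / (PROD j=1..n. q ^ j - 1)"

lemma q_exp_coeff_rec:
 assumes "q > 0" "q ~= 1"
 shows "real n * q_exp_coeff q n = (SUM l=1..n. (-1) ^ (l - 1) / (q ^ l - 1) * q_exp_coeff q (n - l))"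
proof -
 let ?S = "%f. f oo (fps_const q * fps_X) :: real fps"
 define G where "G = Abs_fps (q_exp_coeff q)"
 define D where "D = Abs_fps (%l. if l = 0 then 0 else (-1) ^ (l - 1) / (q ^ l - 1) :: real)"
 have qn: "q ^ n ~= 1" if "n > 0" for n using assms that power_eq_1_iff[of q n] by auto
 have S_nth: "fps_nth (?S f) n = q ^ n * fps_nth f n" for f :: "real fps" and n by (simp add: fps_compose_linear)
 have S_mult: "?S (f * g) = ?S f * ?S g" for f g :: "real fps" by (rule fps_compose_mult_distrib) simp
 have X1: "fps_nth ((1 + fps_X) * f) n = fps_nth f n + (if n = 0 then 0 else fps_nth f (n - 1))" for f :: "real fps" and n by (simp add: distrib_right)
 have SG: "?S G = (1 + fps_X) * G"
 proof (rule fps_ext)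
  fix n
  show "fps_nth (?S G) n = fps_nth ((1 + fps_X) * G) n"
  proof (cases n)
   case (Suc k)
   have "q_exp_coeff q (Suc k) = q_exp_coeff q k / (q ^ Suc k - 1)" by (simp add: q_exp_coeff_def)
   then have "q_exp_coeff q k = (q ^ Suc k - 1) * q_exp_coeff q (Suc k)" using qn[of "Suc k"] by simp
   then show ?thesis unfolding S_nth X1 by (simp add: Suc G_def algebra_simps)
  next
   case 0
   then show ?thesis unfolding S_nth X1 by simp
  qed
 qed
 have SD: "(1 + fps_X) * (?S D - D) = fps_X"
 proof (rule fps_ext)
  fix n
  have nth: "fps_nth (?S D - D) n = (if n = 0 then 0 else (-1) ^ (n - 1))" for n using qn[of n] unfolding fps_sub_nth S_nth by (simp add: D_def field_simps)
  have "(-1::real) ^ (n - Suc 0) + (-1) ^ (n - Suc (Suc 0)) = 0" if "n > 1"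
  proof -
   obtain k where "n = Suc (Suc k)" using \<open>n > 1\<close> by (auto simp: less_iff_Suc_add)
   then show ?thesis by simp
  qed
  then show "fps_nth ((1 + fps_X) * (?S D - D)) n = fps_nth fps_X n" unfolding X1 nth by (auto simp: fps_X_def)
 qed
 have Xd: "fps_nth (fps_X * fps_deriv f) n = real n * fps_nth f n" for f :: "real fps" and n by (cases n) auto
 define Y where "Y = fps_X * fps_deriv G - D * G"
 have SXG: "?S (fps_X * fps_deriv G) = fps_X * G + (1 + fps_X) * (fps_X * fps_deriv G)"
 proof (rule fps_ext)
  fix n
  have "fps_nth (?S (fps_X * fps_deriv G)) n = fps_nth (fps_X * fps_deriv ((1 + fps_X) * G)) n" unfolding S_nth Xd SG[symmetric] by simp
  also have "fps_X * fps_deriv ((1 + fps_X) * G) = fps_X * G + (1 + fps_X) * (fps_X * fps_deriv G)" by (simp add: algebra_simps)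
  finally show "fps_nth (?S (fps_X * fps_deriv G)) n = fps_nth (fps_X * G + (1 + fps_X) * (fps_X * fps_deriv G)) n" .
 qed
 have "?S Y = ?S (fps_X * fps_deriv G) - ?S D * ?S G" by (simp add: Y_def fps_compose_sub_distrib S_mult)
 also have "?S D * ?S G = D * ((1 + fps_X) * G) + fps_X * G"
 proof -
  have "?S D * ?S G = (D + (?S D - D)) * ((1 + fps_X) * G)" by (simp add: SG)
  also have "... = D * ((1 + fps_X) * G) + ((1 + fps_X) * (?S D - D)) * G" by (simp add: algebra_simps)
  finally show ?thesis by (simp only: SD)
 qed
 finally have "?S Y = fps_X * G + (1 + fps_X) * (fps_X * fps_deriv G) - (D * ((1 + fps_X) * G) + fps_X * G)" by (simp only: SXG)
 then have SY: "?S Y = (1 + fps_X) * Y" by (simp add: Y_def algebra_simps)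
 have Y0: "fps_nth Y n = 0" for n
 proof (induction n)
  case 0
  show ?case by (simp add: Y_def D_def)
 next
  case (Suc n)
  have "q ^ Suc n * fps_nth Y (Suc n) = fps_nth Y (Suc n) + fps_nth Y n" using arg_cong[OF SY, of "%f. fps_nth f (Suc n)"] unfolding S_nth X1 by simp
  then show ?case using Suc qn[of "Suc n"] by (simp add: algebra_simps)
 qed
 have "real n * fps_nth G n = fps_nth (D * G) n"
 proof -
  have "fps_nth (fps_X * fps_deriv G) n = real n * fps_nth G n" by (cases n) auto
  then show ?thesis using Y0[of n] by (simp add: Y_def)
 qed
 also have "fps_nth (D * G) n = (SUM l=0..n. fps_nth D l * fps_nth G (n - l))" by (simp add: fps_mult_nth)
 also have "... = (SUM l=1..n. fps_nth D l * fps_nth G (n - l))" by (rule sum.mono_neutral_right) (auto simp: D_def)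
 finally show ?thesis by (simp add: G_def D_def)
qed

text \<open>Both sides satisfy the recursion of \<open>exp(\<Sum>\<^sub>l (-1)^(l-1) x^l / (l (q^l - 1)))\<close>; this identity is the origin of the weights \<open>(-1)^(l-1) / l^2\<close>.\<close>
theorem q_exp_coeff_eq_partition_sum:
 assumes "q > 0" "q ~= 1"
 shows "q_exp_coeff q n = partition_sum (%l. (-1) ^ (l - 1) / (real l * (q ^ l - 1))) n"
proof (induction n rule: less_induct)
 case (less n)
 show ?case
 proof (cases "n = 0")
  case False
  let ?a = "%l. (-1) ^ (l - 1) / (real l * (q ^ l - 1))"
  have "real n * q_exp_coeff q n = (SUM l=1..n. real l * ?a l * partition_sum ?a (n - l))" unfolding q_exp_coeff_rec[OF assms] by (intro sum.cong refl) (use less in simp)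
  also have "... = real n * partition_sum ?a n" by (rule partition_sum_rec[symmetric])
  finally show ?thesis using False by simp
 qed (simp add: partition_sum_0 q_exp_coeff_def)
qed

section \<open>Abelianisation\<close>

locale abelianisation = fin_digraph Q for Q :: "('v, 'a) pre_digraph" +
 fixes d :: "'v => nat" and zeta :: "'v => real" and q :: real
 assumes d: "d : dim_vectors Q" and q: "q > 0" "q ~= 1"
begin

abbreviation B where "B \<equiv> blowup_quiver Q"

definition tdegree :: "('v \<times> nat \<times> nat) set => 'v => nat" where
 "tdegree X i = (SUM (j, k, l):X. if j = i then l else 0)"

definition type_of :: "('v \<times> nat \<times> nat) set => 'v => nat => nat" where
 "type_of X i l = card {k. (i, k, l) : X}"

definition types :: "('v => nat => nat) set" where
 "types = {m. ALL i l. m i l ~= 0 --> i : verts Q & 1 <= l & l <= d i}"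

definition model :: "('v => nat => nat) => ('v \<times> nat \<times> nat) set" where
 "model m = {(i, k, l). i : verts Q & 1 <= k & k <= m i l & 1 <= l}"

definition degree_of :: "('v => nat => nat) => 'v => nat" where
 "degree_of m i = (SUM l=1..d i. l * m i l)"

definition size_of :: "('v => nat => nat) => nat" where
 "size_of m = (SUM i:verts Q. SUM l=1..d i. m i l)"

definition choices :: "('v => nat => nat) => ('v => nat => nat) => nat" where
 "choices m m' = (PROD i:verts Q. PROD l=1..d i. m i l choose m' i l)"

lemma verts_B: "verts B = {(i, k, l). i : verts Q & 1 <= k & 1 <= l}"
 by (simp add: blowup_quiver_def)

lemma model_verts: "model m \<subseteq> verts B"
 by (auto simp: model_def verts_B)

lemma verts_MPS_quiver: "verts (MPS_quiver Q m) = model m"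
 by (simp add: MPS_quiver_def model_def)

lemma arcs_MPS_quiver: "arcs (MPS_quiver Q m) = arcs_within B (model m)"
 by (simp add: MPS_quiver_def model_def arcs_within_def)

definition index_set :: "('v \<times> nat) set" where "index_set = (SIGMA i:verts Q. {1..d i})"

lemma finite_index_set: "finite index_set" by (simp add: index_set_def)

lemma sum_index: "(SUM i:verts Q. SUM l=1..d i. f i l) = (SUM (i, l):index_set. f i l)"
 by (simp add: index_set_def sum.Sigma)

lemma prod_index: "(PROD i:verts Q. PROD l=1..d i. f i l) = (PROD (i, l):index_set. f i l)"
 by (simp add: index_set_def prod.Sigma)

lemma types_index: "m : types \<longleftrightarrow> (ALL i l. m i l ~= 0 --> (i, l) : index_set)"
 by (auto simp: types_def index_set_def)

lemma typed_subset:
 assumes X: "X \<subseteq> verts B" "finite X" and t: "type_of X : types" and x: "(i, k, l) : X"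
 shows "(i, l) : index_set"
proof -
 have "finite {k. (i, k, l) : X}" by (rule finite_subset[of _ "(%(i, k, l). k) ` X"]) (use X in "force+")
 then have "type_of X i l ~= 0" using x by (auto simp: type_of_def)
 then show ?thesis using t by (simp add: types_index)
qed

lemma decompose_typed:
 assumes X: "X \<subseteq> verts B" "finite X" and t: "type_of X : types"
 shows "(SUM (i, k, l):X. f i l) = (SUM (i, l):index_set. of_nat (type_of X i l) * f i l :: 'b::comm_semiring_1)"
proof -
 have "(SUM (i, k, l):X. f i l) = (SUM p:index_set. SUM x:{x:X. (fst x, snd (snd x)) = p}. f (fst x) (snd (snd x)))" unfolding case_prod_beta
  by (rule sum.group[symmetric]) (use X finite_index_set typed_subset[OF X t] in auto)
 also have "... = (SUM (i, l):index_set. of_nat (type_of X i l) * f i l)"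
 proof (rule sum.cong[OF refl], clarify)
  fix i l
  have "bij_betw (%k. (i, k, l)) {k. (i, k, l) : X} {x:X. (fst x, snd (snd x)) = (i, l)}" by (rule bij_betw_byWitness[of _ "%x. fst (snd x)"]) auto
  then have "card {x:X. (fst x, snd (snd x)) = (i, l)} = type_of X i l" by (simp add: type_of_def bij_betw_same_card)
  moreover have "(SUM x:{x:X. (fst x, snd (snd x)) = (i, l)}. f (fst x) (snd (snd x)))
    = (SUM x:{x:X. (fst x, snd (snd x)) = (i, l)}. f i l)" by (rule sum.cong) auto
  ultimately show "(SUM x:{x:X. (fst x, snd (snd x)) = (i, l)}. f (fst x) (snd (snd x))) = of_nat (type_of X i l) * f i l" by simp
 qed
 finally show ?thesis .
qed

lemma tdegree_typed:
 assumes X: "X \<subseteq> verts B" "finite X" and t: "type_of X : types"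
 shows "tdegree X = degree_of (type_of X)"
proof
 fix i
 have "tdegree X i = (SUM (j, l):index_set. type_of X j l * (if j = i then l else 0))"
  unfolding tdegree_def using decompose_typed[OF X t, of "%j l. if j = i then l else 0"] by simp
 also have "... = (SUM j:verts Q. if j = i then SUM l=1..d j. type_of X j l * l else 0)" unfolding sum_index[symmetric]
 proof (rule sum.cong[OF refl])
  fix j show "(SUM l=1..d j. type_of X j l * (if j = i then l else 0)) = (if j = i then SUM l=1..d j. type_of X j l * l else 0)" by (cases "j = i") auto
 qed
 also have "... = degree_of (type_of X) i" using d by (simp add: degree_of_def dim_vectors_def mult.commute)
 finally show "tdegree X i = degree_of (type_of X) i" .
qed

lemma card_typed:
 assumes X: "X \<subseteq> verts B" "finite X" and t: "type_of X : types"
 shows "card X = size_of (type_of X)"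
 using decompose_typed[OF X t, of "%_ _. 1 :: nat"] unfolding size_of_def sum_index by simp

lemma weight_typed:
 assumes "finite X" "X \<subseteq> verts B"
 shows "sum (zeta_hat zeta) X = stab_weight Q zeta (tdegree X)"
proof -
 have "stab_weight Q zeta (tdegree X) = (SUM i:verts Q. SUM x:X. (if fst x = i then real (snd (snd x)) else 0) * zeta i)" unfolding stab_weight_def tdegree_def
  by (intro sum.cong refl) (auto simp: sum_distrib_right case_prod_unfold intro!: sum.cong)
 also have "... = (SUM x:X. SUM i:verts Q. (if fst x = i then real (snd (snd x)) else 0) * zeta i)" by (rule sum.swap)
 also have "... = (SUM x:X. zeta_hat zeta x)"
 proof (rule sum.cong[OF refl])
  fix x assume "x : X"
  then have "fst x : verts Q" using assms by (auto simp: verts_B)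
  then show "(SUM i:verts Q. (if fst x = i then real (snd (snd x)) else 0) * zeta i) = zeta_hat zeta x"
   by (simp add: if_distrib[of "%y. y * _"] zeta_hat_def case_prod_unfold cong: if_cong)
 qed
 finally show ?thesis by simp
qed

lemma tdegree_Diff:
 assumes "finite X" "Y \<subseteq> X" shows "tdegree (X - Y) i = tdegree X i - tdegree Y i"
 unfolding tdegree_def by (rule sum_diff_nat) (use assms finite_subset in auto)

lemma card_arcs_between:
 assumes X: "finite X" "X \<subseteq> verts B" and Y: "finite Y" "Y \<subseteq> verts B"
 shows "finite {a:arcs B. tail B a : Y & head B a : X}"
  "card {a:arcs B. tail B a : Y & head B a : X}
   = (SUM al:arcs Q. tdegree Y (tail Q al) * tdegree X (head Q al))"
proof -
 let ?Y = "%al. {y:Y. fst y = tail Q al}" and ?X = "%al. {x:X. fst x = head Q al}"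
 let ?S = "SIGMA al:arcs Q. SIGMA y:?Y al. SIGMA x:?X al. {..<snd (snd y) * snd (snd x)}"
 let ?A = "{a:arcs B. tail B a : Y & head B a : X}"
 have bij: "bij_betw (%(al, y, x, c). (al, snd y, snd x, c)) ?S ?A"
 proof (rule bij_betw_byWitness[of _ "%(al, kl, kl', c). (al, (tail Q al, kl), (head Q al, kl'), c)"])
  show "(%(al, y, x, c). (al, snd y, snd x, c)) ` ?S \<subseteq> ?A" using X Y by (fastforce simp: blowup_quiver_def)
  show "(%(al, kl, kl', c). (al, (tail Q al, kl), (head Q al, kl'), c)) ` ?A \<subseteq> ?S" by (auto simp: blowup_quiver_def)
 qed (auto simp: blowup_quiver_def)
 have finS: "finite ?S" using X Y by (intro finite_SigmaI) auto
 show "finite ?A" using bij finS bij_betw_finite by blast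
 have "card ?A = card ?S" using bij by (simp add: bij_betw_same_card)
 also have "... = (SUM al:arcs Q. SUM y:?Y al. SUM x:?X al. snd (snd y) * snd (snd x))" using X Y by (simp add: card_SigmaI)
 also have "... = (SUM al:arcs Q. tdegree Y (tail Q al) * tdegree X (head Q al))"
 proof (rule sum.cong[OF refl])
  fix al
  have deg: "tdegree Z i = (SUM z:{z:Z. fst z = i}. snd (snd z))" if "finite Z" for Z i using that unfolding tdegree_def case_prod_unfold by (rule sum.inter_filter[symmetric])
  show "(SUM y:?Y al. SUM x:?X al. snd (snd y) * snd (snd x)) = tdegree Y (tail Q al) * tdegree X (head Q al)"
   unfolding deg[OF X(1)] deg[OF Y(1)] by (rule sum_product[symmetric])
 qed
 finally show "card ?A = (SUM al:arcs Q. tdegree Y (tail Q al) * tdegree X (head Q al))" .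
qed

lemma finite_arcs_within: "finite X ==> X \<subseteq> verts B ==> finite (arcs_within B X)"
 using card_arcs_between(1)[of X X] by (simp add: arcs_within_def)

abbreviation y :: "('v \<times> nat \<times> nat) set => real" where
 "y X \<equiv> abelian_sum B (zeta_hat zeta) q X"

definition transfer :: "('v => nat) => ('v => nat) => real" where
 "transfer c' c = (PROD al:arcs Q. q ^ ((c (tail Q al) - c' (tail Q al)) * c (head Q al)))"

lemma type_of_mono:
 assumes "Y \<subseteq> X" "finite X" shows "type_of Y <= type_of X"
proof -
 have "finite {k. (i, k, l) : X}" for i l by (rule finite_subset[of _ "(%(i, k, l). k) ` X"]) (use assms in "force+")
 then show ?thesis unfolding le_fun_def type_of_def using assms by (auto intro!: card_mono)
qed

lemma types_mono: "m : types ==> m' <= m ==> m' : types"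
 unfolding types_def le_fun_def mem_Collect_eq by (metis le_zero_eq)

lemma type_of_eqD:
 assumes "Y \<subseteq> X" "finite X" "type_of Y = type_of X" shows "Y = X"
proof -
 have "{k. (i, k, l) : Y} = {k. (i, k, l) : X}" for i l
 proof (rule card_subset_eq)
  show "finite {k. (i, k, l) : X}" by (rule finite_subset[of _ "(%(i, k, l). k) ` X"]) (use assms in "force+")
  show "card {k. (i, k, l) : Y} = card {k. (i, k, l) : X}" using fun_cong[OF fun_cong[OF assms(3)], of i l] by (simp add: type_of_def)
 qed (use assms in auto)
 then show ?thesis by (auto simp: set_eq_iff)
qed

lemma y_rec:
 assumes X: "X \<subseteq> verts B" "finite X" and t: "type_of X : types"
 shows "y X = transfer (%_. 0) (degree_of (type_of X)) / (q - 1) ^ size_of (type_of X)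
   - (SUM Y | Y \<subseteq> X & type_of Y ~= type_of X & stab_weight Q zeta (degree_of (type_of Y)) > 0.
     y Y * (transfer (degree_of (type_of Y)) (degree_of (type_of X))
      / (q - 1) ^ (size_of (type_of X) - size_of (type_of Y))))"
proof -
 have sub: "finite Y" "Y \<subseteq> verts B" "type_of Y : types" if "Y \<subseteq> X" for Y using that X t types_mono type_of_mono finite_subset by blast+
 have pw: "q ^ (SUM al:arcs Q. f al) = (PROD al:arcs Q. q ^ f al)" for f by (rule power_sum)
 have "card (arcs_within B X) = (SUM al:arcs Q. tdegree X (tail Q al) * tdegree X (head Q al))"
  using card_arcs_between(2)[OF X(2,1) X(2,1)] by (simp add: arcs_within_def)
 then have top: "q ^ card (arcs_within B X) = transfer (%_. 0) (degree_of (type_of X))" by (simp add: transfer_def pw tdegree_typed[OF X t])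
 have idx: "{Y. Y \<subset> X & sum (zeta_hat zeta) Y > 0} =
   {Y. Y \<subseteq> X & type_of Y ~= type_of X & stab_weight Q zeta (degree_of (type_of Y)) > 0}"
 proof (intro Collect_cong)
  fix Y
  show "(Y \<subset> X & sum (zeta_hat zeta) Y > 0) = (Y \<subseteq> X & type_of Y ~= type_of X & stab_weight Q zeta (degree_of (type_of Y)) > 0)"
   using sub[of Y] weight_typed[of Y] tdegree_typed[of Y] type_of_eqD[OF _ X(2), of Y] by auto
 qed
 have "y X = transfer (%_. 0) (degree_of (type_of X)) / (q - 1) ^ card X
  - (SUM Y | Y \<subset> X & sum (zeta_hat zeta) Y > 0. y Y
    * (q ^ card {a:arcs_within B X. tail B a ~: Y} / (q - 1) ^ card (X - Y)))" using abelian_sum_rec[OF X(2) finite_arcs_within[OF X(2,1)]] top by simp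
 also have "(SUM Y | Y \<subset> X & sum (zeta_hat zeta) Y > 0. y Y
    * (q ^ card {a:arcs_within B X. tail B a ~: Y} / (q - 1) ^ card (X - Y)))
   = (SUM Y | Y \<subseteq> X & type_of Y ~= type_of X & stab_weight Q zeta (degree_of (type_of Y)) > 0.
     y Y * (transfer (degree_of (type_of Y)) (degree_of (type_of X))
      / (q - 1) ^ (size_of (type_of X) - size_of (type_of Y))))"
 proof (rule sum.cong[OF idx])
  fix Y assume "Y : {Y. Y \<subseteq> X & type_of Y ~= type_of X & stab_weight Q zeta (degree_of (type_of Y)) > 0}"
  then have YX: "Y \<subseteq> X" by simp
  note Y = sub[OF YX]
  have "{a:arcs_within B X. tail B a ~: Y} = {a:arcs B. tail B a : X - Y & head B a : X}" by (auto simp: arcs_within_def)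
  then have "card {a:arcs_within B X. tail B a ~: Y}
    = (SUM al:arcs Q. tdegree (X - Y) (tail Q al) * tdegree X (head Q al))" using card_arcs_between(2)[OF X(2,1), of "X - Y"] X by (simp add: subset_iff)
  then have "q ^ card {a:arcs_within B X. tail B a ~: Y} = transfer (degree_of (type_of Y)) (degree_of (type_of X))"
   by (simp add: transfer_def pw tdegree_Diff[OF X(2) YX] tdegree_typed[OF X t]
     tdegree_typed[OF Y(2,1,3)])
  moreover have "card (X - Y) = size_of (type_of X) - size_of (type_of Y)" using card_typed[OF X t] card_typed[OF Y(2,1,3)] YX Y(1) by (simp add: card_Diff_subset)
  ultimately show "y Y * (q ^ card {a:arcs_within B X. tail B a ~: Y} / (q - 1) ^ card (X - Y))
   = y Y * (transfer (degree_of (type_of Y)) (degree_of (type_of X)) / (q - 1) ^ (size_of (type_of X) - size_of (type_of Y)))" by simp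
 qed
 finally show ?thesis using card_typed[OF X t] by simp
qed

lemma card_of_type:
 assumes X: "X \<subseteq> verts B" "finite X" and t: "type_of X : types" and m: "m : types"
 shows "card {Y. Y \<subseteq> X & type_of Y = m} = choices (type_of X) m"
proof -
 let ?E = "%(i, l). {K. K \<subseteq> {k. (i, k, l) : X} & card K = m i l}"
 have fin: "finite {k. (i, k, l) : X}" for i l by (rule finite_subset[of _ "(%(i, k, l). k) ` X"]) (use X in "force+")
 have "bij_betw (%Y. \<lambda>(i, l)\<in>index_set. {k. (i, k, l) : Y}) {Y. Y \<subseteq> X & type_of Y = m} (PiE index_set ?E)"
 proof (rule bij_betw_byWitness[of _ "%f. {(i, k, l). (i, l) : index_set & k : f (i, l)}"])
  show "ALL Y:{Y. Y \<subseteq> X & type_of Y = m}.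
    {(i, k, l). (i, l) : index_set & k : (\<lambda>(i, l)\<in>index_set. {k. (i, k, l) : Y}) (i, l)} = Y" using typed_subset[OF X t] by auto
  show "ALL f:PiE index_set ?E. (\<lambda>(i, l)\<in>index_set. {k. (i, k, l) : {(i, k, l). (i, l) : index_set & k : f (i, l)}}) = f"
   by (auto simp: fun_eq_iff PiE_def extensional_def)
  show "(%Y. \<lambda>(i, l)\<in>index_set. {k. (i, k, l) : Y}) ` {Y. Y \<subseteq> X & type_of Y = m} \<subseteq> PiE index_set ?E" by (auto simp: type_of_def)
  show "(%f. {(i, k, l). (i, l) : index_set & k : f (i, l)}) ` PiE index_set ?E \<subseteq> {Y. Y \<subseteq> X & type_of Y = m}"
  proof (rule image_subsetI)
   fix f assume f: "f : PiE index_set ?E"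
   let ?Y = "{(i, k, l). (i, l) : index_set & k : f (i, l)}"
   have fv: "f (i, l) \<subseteq> {k. (i, k, l) : X}" "card (f (i, l)) = m i l" if "(i, l) : index_set" for i l using PiE_mem[OF f that] by auto
   have "?Y \<subseteq> X" using fv by auto
   moreover have "type_of ?Y i l = m i l" for i l using fv[of i l] m by (cases "(i, l) : index_set") (auto simp: type_of_def types_index)
   ultimately show "?Y : {Y. Y \<subseteq> X & type_of Y = m}" by (auto simp: fun_eq_iff)
  qed
 qed
 then have "card {Y. Y \<subseteq> X & type_of Y = m} = card (PiE index_set ?E)" by (rule bij_betw_same_card)
 also have "... = (PROD (i, l):index_set. type_of X i l choose m i l)" unfolding card_PiE[OF finite_index_set] by (rule prod.cong[OF refl]) (auto simp: n_subsets[OF fin] type_of_def)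
 finally show ?thesis unfolding choices_def prod_index .
qed

lemma finite_types_le:
 assumes "m : types" shows "finite {m'. m' <= m}"
proof (rule finite_subset)
 let ?g = "%f i l. if (i, l) : index_set then f (i, l) else 0"
 show "{m'. m' <= m} \<subseteq> ?g ` (\<Pi>\<^sub>E (i, l)\<in>index_set. {..m i l})"
 proof
  fix m' assume m': "m' : {m'. m' <= m}"
  then have "m' : types" using types_mono assms by simp
  then have "m' = ?g (\<lambda>(i, l)\<in>index_set. m' i l)" by (auto simp: fun_eq_iff types_index)
  moreover have "(\<lambda>(i, l)\<in>index_set. m' i l) : (\<Pi>\<^sub>E (i, l)\<in>index_set. {..m i l})" using m' by (auto simp: le_fun_def)
  ultimately show "m' : ?g ` (\<Pi>\<^sub>E (i, l)\<in>index_set. {..m i l})" by blast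
 qed
 show "finite (?g ` (\<Pi>\<^sub>E (i, l)\<in>index_set. {..m i l}))" using finite_index_set by (intro finite_imageI finite_PiE) auto
qed

lemma sum_over_subsets:
 fixes f :: "('v => nat => nat) => real"
 assumes X: "X \<subseteq> verts B" "finite X" and t: "type_of X : types"
 shows "(SUM Y | Y \<subseteq> X & P (type_of Y). f (type_of Y))
   = (SUM m | m <= type_of X & P m. real (choices (type_of X) m) * f m)"
proof -
 have "(SUM Y | Y \<subseteq> X & P (type_of Y). f (type_of Y))
   = (SUM m | m <= type_of X & P m. SUM Y:{Y:{Y. Y \<subseteq> X & P (type_of Y)}. type_of Y = m}. f (type_of Y))"
 proof (rule sum.group[symmetric])
  show "finite {Y. Y \<subseteq> X & P (type_of Y)}" using X by simp
  show "finite {m. m <= type_of X & P m}" using finite_types_le[OF t] by simp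
  show "type_of ` {Y. Y \<subseteq> X & P (type_of Y)} \<subseteq> {m. m <= type_of X & P m}" using type_of_mono X by auto
 qed
 also have "... = (SUM m | m <= type_of X & P m. real (choices (type_of X) m) * f m)"
 proof (rule sum.cong[OF refl])
  fix m assume m: "m : {m. m <= type_of X & P m}"
  have "{Y:{Y. Y \<subseteq> X & P (type_of Y)}. type_of Y = m} = {Y. Y \<subseteq> X & type_of Y = m}" using m by auto
  then show "(SUM Y:{Y:{Y. Y \<subseteq> X & P (type_of Y)}. type_of Y = m}. f (type_of Y)) = real (choices (type_of X) m) * f m"
   using card_of_type[OF X t types_mono[OF t, of m]] m by simp
 qed
 finally show ?thesis .
qed

lemma type_of_model: "m : types ==> type_of (model m) = m"
proof (intro ext)
 fix i l assume m: "m : types"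
 have "{k. (i, k, l) : model m} = (if i : verts Q & 1 <= l then {1..m i l} else {})" by (auto simp: model_def)
 then show "type_of (model m) i l = m i l" using m by (auto simp: type_of_def types_def)
qed

lemma finite_model: "m : types ==> finite (model m)"
proof (rule finite_subset)
 assume m: "m : types"
 show "model m \<subseteq> (%((i, l), k). (i, k, l)) ` (SIGMA (i, l):index_set. {1..m i l})" using m by (force simp: model_def types_index image_iff)
 show "finite ((%((i, l), k). (i, k, l)) ` (SIGMA (i, l):index_set. {1..m i l}))" using finite_index_set by auto
qed

text \<open>The count on a vertex set of the blown-up quiver depends only on the number of vertices of each kind, since the recursion does.\<close>
lemma y_type_invariant:
 assumes "X \<subseteq> verts B" "finite X" "type_of X : types"
 shows "y X = y (model (type_of X))"
 using assms
proof (induction "card X" arbitrary: X rule: less_induct)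
 case less
 note X = less.prems
 let ?M = "model (type_of X)"
 have M: "?M \<subseteq> verts B" "finite ?M" "type_of ?M = type_of X" using X model_verts finite_model type_of_model by auto
 have cardM: "card ?M = card X" using card_typed[of X] card_typed[of ?M] X M by simp
 let ?c = "%Y. transfer (degree_of (type_of Y)) (degree_of (type_of X)) / (q - 1) ^ (size_of (type_of X) - size_of (type_of Y))"
 let ?P = "%m. m ~= type_of X & stab_weight Q zeta (degree_of m) > 0"
 have inv: "y Y = y (model (type_of Y))" if "Y \<subseteq> Z" "type_of Y ~= type_of X" "type_of Z = type_of X" "Z \<subseteq> verts B" "finite Z" "card Z = card X" for Y Z
 proof (rule less.hyps)
  have "Y \<subset> Z" using that by auto
  then show "card Y < card X" using psubset_card_mono[of Z Y] that by simp
  show "Y \<subseteq> verts B" "finite Y" using that finite_subset by auto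
  show "type_of Y : types" using types_mono type_of_mono that X by metis
 qed
 let ?f = "%m. y (model m) * (transfer (degree_of m) (degree_of (type_of X)) / (q - 1) ^ (size_of (type_of X) - size_of m))"
 have "(SUM Y | Y \<subseteq> X & ?P (type_of Y). y Y * ?c Y) = (SUM Y | Y \<subseteq> X & ?P (type_of Y). ?f (type_of Y))"
 proof (rule sum.cong[OF refl])
  fix Y assume "Y : {Y. Y \<subseteq> X & ?P (type_of Y)}"
  then show "y Y * ?c Y = ?f (type_of Y)" using inv[of Y X] X by simp
 qed
 also have "... = (SUM Y | Y \<subseteq> ?M & ?P (type_of Y). ?f (type_of Y))"
  using sum_over_subsets[OF X, where P = ?P and f = ?f] sum_over_subsets[of ?M, where P = ?P and f = ?f] M X by simp
 also have "... = (SUM Y | Y \<subseteq> ?M & ?P (type_of Y). y Y * ?c Y)"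
 proof (rule sum.cong[OF refl])
  fix Y assume "Y : {Y. Y \<subseteq> ?M & ?P (type_of Y)}"
  then show "?f (type_of Y) = y Y * ?c Y" using inv[of Y ?M] M cardM by simp
 qed
 finally show ?case using y_rec[OF X] y_rec[of ?M] M X by simp
qed

lemma y_model_rec:
 assumes m: "m : types"
 shows "y (model m) = transfer (%_. 0) (degree_of m) / (q - 1) ^ size_of m
   - (SUM m' | m' <= m & m' ~= m & stab_weight Q zeta (degree_of m') > 0.
     real (choices m m') * (y (model m') * (transfer (degree_of m') (degree_of m) / (q - 1) ^ (size_of m - size_of m'))))"
proof -
 have M: "model m \<subseteq> verts B" "finite (model m)" "type_of (model m) = m" using m model_verts finite_model type_of_model by auto
 let ?P = "%m'. m' ~= m & stab_weight Q zeta (degree_of m') > 0"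
 let ?f = "%m'. y (model m') * (transfer (degree_of m') (degree_of m) / (q - 1) ^ (size_of m - size_of m'))"
 have "(SUM Y | Y \<subseteq> model m & ?P (type_of Y). y Y * (transfer (degree_of (type_of Y)) (degree_of m) / (q - 1) ^ (size_of m - size_of (type_of Y))))
   = (SUM Y | Y \<subseteq> model m & ?P (type_of Y). ?f (type_of Y))"
 proof (rule sum.cong[OF refl])
  fix Y assume "Y : {Y. Y \<subseteq> model m & ?P (type_of Y)}"
  then have "Y \<subseteq> verts B" "finite Y" "type_of Y : types" using M m finite_subset types_mono type_of_mono by (blast, blast, metis (mono_tags, lifting) mem_Collect_eq)
  from y_type_invariant[OF this]
  show "y Y * (transfer (degree_of (type_of Y)) (degree_of m) / (q - 1) ^ (size_of m - size_of (type_of Y))) = ?f (type_of Y)" by simp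
 qed
 also have "... = (SUM m' | m' <= m & ?P m'. real (choices m m') * ?f m')" using sum_over_subsets[of "model m", where P = ?P and f = ?f] M m by simp
 finally show ?thesis using y_rec[of "model m"] M m by simp
qed

definition weight :: "('v => nat => nat) => real" where
 "weight m = (PROD i:verts Q. PROD l=1..d i.
   1 / fact (m i l) * ((-1) ^ (l - 1) * (q - 1) / (real l * (q ^ l - 1))) ^ m i l)"

definition types_of :: "('v => nat) => ('v => nat => nat) set" where
 "types_of c = {m:types. degree_of m = c}"

definition rescaled_count :: "('v => nat) => real" where
 "rescaled_count c = (SUM m:types_of c. weight m * y (model m))"

definition q_exp_vector :: "('v => nat) => real" where
 "q_exp_vector c = (PROD i:verts Q. q_exp_coeff q (c i))"

lemma q_power_ne_1: "n > 0 ==> q ^ n ~= 1"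
 using q power_eq_1_iff[of q n] by auto

lemma wpartitions_of_type:
 assumes c: "c <= d" and m: "m : types_of c" and i: "i : verts Q"
 shows "m i : wpartitions (c i)"
proof -
 have "c i <= d i" using c by (simp add: le_fun_def)
 from wpartitions_enlarge[OF this, of "m i"] show ?thesis using m i by (auto simp: types_of_def types_def degree_of_def)
qed

lemma types_of_bij:
 assumes c: "c : dim_vectors Q" "c <= d"
 shows "bij_betw (%m. restrict m (verts Q)) (types_of c) (\<Pi>\<^sub>E i\<in>verts Q. wpartitions (c i))"
proof (rule bij_betw_byWitness[of _ "%f i. if i : verts Q then f i else (%_. 0)"])
 show "ALL m:types_of c. (%i. if i : verts Q then restrict m (verts Q) i else (%_. 0)) = m"
 proof
  fix m assume "m : types_of c"
  then have "m i = (%_. 0)" if "i ~: verts Q" for i using that by (auto simp: types_of_def types_def)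
  then show "(%i. if i : verts Q then restrict m (verts Q) i else (%_. 0)) = m" by auto
 qed
 show "ALL f:(\<Pi>\<^sub>E i\<in>verts Q. wpartitions (c i)). restrict (%i. if i : verts Q then f i else (%_. 0)) (verts Q) = f"
  by (auto simp: fun_eq_iff PiE_def extensional_def)
 show "(%m. restrict m (verts Q)) ` types_of c \<subseteq> (\<Pi>\<^sub>E i\<in>verts Q. wpartitions (c i))" using wpartitions_of_type[OF c(2)] by auto
 show "(%f i. if i : verts Q then f i else (%_. 0)) ` (\<Pi>\<^sub>E i\<in>verts Q. wpartitions (c i)) \<subseteq> types_of c"
 proof (rule image_subsetI)
  fix f assume f: "f : (\<Pi>\<^sub>E i\<in>verts Q. wpartitions (c i))"
  let ?m = "%i. if i : verts Q then f i else (%_. 0)"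
  have fi: "(ALL l. f i l ~= 0 --> 1 <= l & l <= d i) & (SUM l=1..d i. l * f i l) = c i" if "i : verts Q" for i
   using wpartitions_enlarge[of "c i" "d i" "f i"] PiE_mem[OF f that] c by (auto simp: le_fun_def)
  have "?m : types" using fi by (auto simp: types_def)
  moreover have "degree_of ?m = c" by (use fi c d in "auto simp: degree_of_def dim_vectors_def")
  ultimately show "?m : types_of c" by (simp add: types_of_def)
 qed
qed

lemma finite_types_of_degree: "c : dim_vectors Q ==> c <= d ==> finite (types_of c)"
 using bij_betw_finite[OF types_of_bij] finite_weighted_partitions by (simp add: finite_PiE)

lemma sum_weight:
 assumes c: "c : dim_vectors Q" "c <= d"
 shows "(SUM m:types_of c. weight m / (q - 1) ^ size_of m) = q_exp_vector c"
proof -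
 let ?a = "%l. (-1) ^ (l - 1) / (real l * (q ^ l - 1))"
 have "weight m / (q - 1) ^ size_of m = (PROD i:verts Q. PROD l=1..c i. ?a l ^ restrict m (verts Q) i l / fact (restrict m (verts Q) i l))" if m: "m : types_of c" for m
 proof -
  have "weight m / (q - 1) ^ size_of m = (PROD i:verts Q. PROD l=1..d i. ?a l ^ m i l / fact (m i l))" unfolding weight_def size_of_def power_sum prod_dividef[symmetric]
  proof (intro prod.cong refl)
   fix i l assume "l : {1..d i}"
   show "1 / fact (m i l) * ((-1) ^ (l - 1) * (q - 1) / (real l * (q ^ l - 1))) ^ m i l / (q - 1) ^ m i l
     = ?a l ^ m i l / fact (m i l)"
   proof -
    have "((-1) ^ (l - 1) * (q - 1) / (real l * (q ^ l - 1))) ^ m i l = ?a l ^ m i l * (q - 1) ^ m i l" by (simp flip: power_mult_distrib)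
    then show ?thesis using q by simp
   qed
  qed
  also have "... = (PROD i:verts Q. PROD l=1..c i. ?a l ^ restrict m (verts Q) i l / fact (restrict m (verts Q) i l))"
  proof (rule prod.cong[OF refl])
   fix i assume i: "i : verts Q"
   show "(PROD l=1..d i. ?a l ^ m i l / fact (m i l)) = (PROD l=1..c i. ?a l ^ restrict m (verts Q) i l / fact (restrict m (verts Q) i l))"
    using weight_enlarge[OF _ wpartitions_of_type[OF c(2) m i], of "d i" ?a] c i by (simp add: le_fun_def)
  qed
  finally show ?thesis .
 qed
 then have "(SUM m:types_of c. weight m / (q - 1) ^ size_of m)
   = (SUM m:types_of c. PROD i:verts Q. PROD l=1..c i. ?a l ^ restrict m (verts Q) i l / fact (restrict m (verts Q) i l))" by (rule sum.cong[OF refl])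
 also have "... = (SUM f:(\<Pi>\<^sub>E i\<in>verts Q. wpartitions (c i)). PROD i:verts Q. PROD l=1..c i. ?a l ^ f i l / fact (f i l))"
  by (rule sum.reindex_bij_betw[OF types_of_bij[OF c]])
 also have "... = (PROD i:verts Q. partition_sum ?a (c i))" unfolding partition_sum_def by (rule prod_sum_PiE[symmetric]) (auto simp: finite_weighted_partitions)
 finally show ?thesis by (simp add: q_exp_vector_def q_exp_coeff_eq_partition_sum[OF q])
qed

lemma weight_choices:
 assumes "m' <= m"
 shows "weight m * real (choices m m') = weight m' * weight (m - m')"
 unfolding weight_def choices_def of_nat_prod prod.distrib[symmetric]
proof (intro prod.cong refl)
 fix i l
 let ?w = "(-1) ^ (l - 1) * (q - 1) / (real l * (q ^ l - 1))"
 have le: "m' i l <= m i l" using assms by (simp add: le_fun_def)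
 have b: "real (m i l choose m' i l) = fact (m i l) / (fact (m' i l) * fact (m i l - m' i l))" by (rule binomial_fact[OF le])
 have "?w ^ m i l = ?w ^ m' i l * ?w ^ (m i l - m' i l)" using le by (simp flip: power_add)
 then show "1 / fact (m i l) * ?w ^ m i l * real (m i l choose m' i l)
   = 1 / fact (m' i l) * ?w ^ m' i l * (1 / fact ((m - m') i l) * ?w ^ (m - m') i l)" unfolding b by simp
qed

lemma degree_of_add: "degree_of (m' + m'') = degree_of m' + degree_of m''"
 by (simp add: degree_of_def fun_eq_iff distrib_left sum.distrib)

lemma size_of_add: "size_of (m' + m'') = size_of m' + size_of m''"
 by (simp add: size_of_def sum.distrib)

lemma types_add: "m' : types ==> m'' : types ==> m' + m'' : types"
 by (auto simp: types_def)

lemma degree_zero_type: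
 assumes "m : types" "degree_of m = (%_. 0)" shows "m = (%_ _. 0)"
proof (intro ext)
 fix i l
 have "(SUM l=1..d i. l * m i l) = 0" using fun_cong[OF assms(2), of i] by (simp add: degree_of_def)
 then have *: "l * m i l = 0" if "l : {1..d i}" for l using that by (subst (asm) sum_eq_0_iff) auto
 show "m i l = 0"
 proof (rule ccontr)
  assume "m i l ~= 0"
  moreover from this have "1 <= l" "l <= d i" using assms(1) unfolding types_def by blast+
  ultimately show False using *[of l] by simp
 qed
qed

lemma degree_of_in_dim_vectors: "degree_of m : dim_vectors Q"
 using d by (simp add: degree_of_def dim_vectors_def)

text \<open>Vertex subsets of the model are grouped by type; the number of subsets of a type turns the weight of the whole into the product of the weights of the two parts, and the free part sums to a \<open>q\<close>-exponential.\<close>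
lemma rescaled_count_rec:
 assumes c: "c : dim_vectors Q" "c <= d"
 shows "rescaled_count c = transfer (%_. 0) c * q_exp_vector c
   - (SUM c':destabilising Q zeta c. rescaled_count c' * q_exp_vector (c - c') * transfer c' c)"
proof -
 let ?R = "%m. {m'. m' <= m & m' ~= m & stab_weight Q zeta (degree_of m') > 0}"
 let ?g = "%m m'. weight m' * y (model m') * (weight (m - m') / (q - 1) ^ size_of (m - m') * transfer (degree_of m') c)"
 have fin: "finite (types_of c)" by (rule finite_types_of_degree[OF c])
 have "rescaled_count c = (SUM m:types_of c. weight m / (q - 1) ^ size_of m * transfer (%_. 0) c - (SUM m':?R m. ?g m m'))" unfolding rescaled_count_def
 proof (rule sum.cong[OF refl])
  fix m assume m: "m : types_of c"
  have "weight m * (real (choices m m') * (y (model m') * (transfer (degree_of m') (degree_of m) / (q - 1) ^ (size_of m - size_of m')))) = ?g m m'" if "m' : ?R m" for m'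
  proof -
   have le: "m' <= m" using that by simp
   then have "m = m' + (m - m')" by (auto simp: le_fun_def fun_eq_iff)
   then have "size_of m = size_of m' + size_of (m - m')" by (metis size_of_add)
   moreover have "degree_of m = c" using m by (simp add: types_of_def)
   ultimately show ?thesis using weight_choices[OF le] by (simp add: mult_ac)
  qed
  then show "weight m * y (model m) = weight m / (q - 1) ^ size_of m * transfer (%_. 0) c - (SUM m':?R m. ?g m m')"
   using m by (subst y_model_rec) (auto simp: types_of_def right_diff_distrib sum_distrib_left)
 qed
 also have "... = transfer (%_. 0) c * q_exp_vector c - (SUM m:types_of c. SUM m':?R m. ?g m m')"
  unfolding sum_weight[OF c, symmetric] by (simp add: sum_subtractf sum_distrib_left mult.commute)
 also have "(SUM m:types_of c. SUM m':?R m. ?g m m') = (SUM (m, m'):(SIGMA m:types_of c. ?R m). ?g m m')"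
  by (rule sum.Sigma) (use fin finite_types_le in "auto simp: types_of_def")
 also have "... = (SUM (c', m', m''):(SIGMA c':destabilising Q zeta c. types_of c' \<times> types_of (c - c')).
    weight m' * y (model m') * (weight m'' / (q - 1) ^ size_of m'' * transfer c' c))"
 proof (rule sum.reindex_bij_witness[of _ "%(c', m', m''). (m' + m'', m')" "%(m, m'). (degree_of m', m', m - m')"])
  fix p assume "p : (SIGMA m:types_of c. ?R m)"
  then obtain m m' where p: "p = (m, m')" and m: "m : types" "degree_of m = c"
   and m': "m' <= m" "m' ~= m" "stab_weight Q zeta (degree_of m') > 0" by (auto simp: types_of_def)
  have split: "m = m' + (m - m')" using m'(1) by (auto simp: le_fun_def fun_eq_iff)
  have ty: "m' : types" "m - m' : types" using types_mono[OF m(1)] m'(1) by (auto simp: le_fun_def)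
  have dg: "c = degree_of m' + degree_of (m - m')" using m(2) split degree_of_add by metis
  have ne: "degree_of (m - m') ~= (%_. 0)"
  proof
   assume "degree_of (m - m') = (%_. 0)"
   from degree_zero_type[OF ty(2) this] have "m = m'" using split by (auto simp: fun_eq_iff)
   then show False using m'(2) by simp
  qed
  have "degree_of m' <= c" using dg by (simp add: le_fun_def)
  moreover have "degree_of m' ~= c" using dg ne by (auto simp: fun_eq_iff)
  ultimately have "degree_of m' : destabilising Q zeta c" using m'(3) degree_of_in_dim_vectors by (simp add: destabilising_def less_le)
  moreover have "c - degree_of m' = degree_of (m - m')" using dg by (auto simp: fun_eq_iff)
  ultimately show "(case p of (m, m') => (degree_of m', m', m - m')) : (SIGMA c':destabilising Q zeta c. types_of c' \<times> types_of (c - c'))"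
   using ty p by (simp add: types_of_def)
  show "(case (case p of (m, m') => (degree_of m', m', m - m')) of (c', m', m'') => (m' + m'', m')) = p" using p split by simp
  show "(case (case p of (m, m') => (degree_of m', m', m - m')) of (c', m', m'') =>
    weight m' * y (model m') * (weight m'' / (q - 1) ^ size_of m'' * transfer c' c)) = (case p of (m, m') => ?g m m')" using p by simp
 next
  fix p assume "p : (SIGMA c':destabilising Q zeta c. types_of c' \<times> types_of (c - c'))"
  then obtain c' m' m'' where p: "p = (c', m', m'')" and c': "c' : destabilising Q zeta c"
   and m': "m' : types" "degree_of m' = c'" and m'': "m'' : types" "degree_of m'' = c - c'" by (auto simp: types_of_def)
  have cc: "c' <= c" "c' ~= c" "stab_weight Q zeta c' > 0" using c' by (auto simp: destabilising_def)
  have dg: "degree_of (m' + m'') = c" using m' m'' cc(1) by (simp add: degree_of_add fun_eq_iff le_fun_def)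
  moreover have "m' ~= m' + m''" using dg m'(2) cc(2) by metis
  moreover have "m' <= m' + m''" by (simp add: le_fun_def)
  ultimately show "(case p of (c', m', m'') => (m' + m'', m')) : (SIGMA m:types_of c. ?R m)" using p m' m'' cc(3) types_add by (simp add: types_of_def)
  show "(case (case p of (c', m', m'') => (m' + m'', m')) of (m, m') => (degree_of m', m', m - m')) = p" using p m' by (auto simp: fun_eq_iff)
 qed
 also have "... = (SUM c':destabilising Q zeta c. rescaled_count c' * q_exp_vector (c - c') * transfer c' c)"
 proof -
  have cc: "c' : dim_vectors Q & c' <= d & c - c' : dim_vectors Q & c - c' <= d" if "c' : destabilising Q zeta c" for c'
  proof -
   have "c' v <= c v" "c v <= d v" for v using that c by (auto simp: destabilising_def less_le le_fun_def)
   then show ?thesis using that c unfolding le_fun_def by (auto simp: destabilising_def dim_vectors_def intro: order.trans[OF diff_le_self] order.trans)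
  qed
  have finD: "finite (destabilising Q zeta c)" by (rule finite_subset[OF _ finite_dim_vectors_le[OF finite_verts, of c]]) (auto simp: destabilising_def)
  have "(SUM (c', m', m''):(SIGMA c':destabilising Q zeta c. types_of c' \<times> types_of (c - c')).
    weight m' * y (model m') * (weight m'' / (q - 1) ^ size_of m'' * transfer c' c))
   = (SUM c':destabilising Q zeta c. SUM (m', m''):types_of c' \<times> types_of (c - c').
      weight m' * y (model m') * (weight m'' / (q - 1) ^ size_of m'' * transfer c' c))" by (subst sum.Sigma) (use finD cc finite_types_of_degree in auto)
  also have "... = (SUM c':destabilising Q zeta c. rescaled_count c' * q_exp_vector (c - c') * transfer c' c)"
  proof (rule sum.cong[OF refl])
   fix c' assume "c' : destabilising Q zeta c"
   note cc = cc[OF this]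
   have "q_exp_vector (c - c') = (SUM m:types_of (c - c'). weight m / (q - 1) ^ size_of m)" using sum_weight cc by simp
   then show "(SUM (m', m''):types_of c' \<times> types_of (c - c').
      weight m' * y (model m') * (weight m'' / (q - 1) ^ size_of m'' * transfer c' c))
     = rescaled_count c' * q_exp_vector (c - c') * transfer c' c" unfolding rescaled_count_def sum.cartesian_product[symmetric]
    by (subst sum.swap) (simp add: sum_distrib_left sum_distrib_right mult_ac)
  qed
  finally show ?thesis .
 qed
 finally show ?thesis .
qed

lemma subspace_ratio_eq:
 assumes c: "c' <= c"
 shows "subspace_ratio Q q c' c = q_exp_vector c' * q_exp_vector (c - c') / q_exp_vector c"
proof -
 have one: "(PROD i<j. q ^ n - q ^ i) = q ^ (SUM i<j. i) * (q_exp_coeff q (n - j) / q_exp_coeff q n)" if "j <= n" for j n using that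
 proof (induction j)
  case 0
  have "(PROD j=1..n. q ^ j - 1) ~= 0" using q_power_ne_1 by auto
  then show ?case by (simp add: q_exp_coeff_def)
 next
  case (Suc j)
  obtain k where k: "n - j = Suc k" "n - Suc j = k" using Suc.prems by (metis Suc_diff_Suc Suc_le_lessD)
  have "q_exp_coeff q (Suc k) = q_exp_coeff q k / (q ^ Suc k - 1)" by (simp add: q_exp_coeff_def)
  moreover have "q ^ n - q ^ j = q ^ j * (q ^ Suc k - 1)"
  proof -
   have "n = j + Suc k" using k(1) Suc.prems by simp
   then show ?thesis by (simp add: power_add algebra_simps)
  qed
  ultimately show ?case using Suc k q_power_ne_1[of "Suc k"] by (simp add: power_add)
 qed
 have pos: "q_exp_coeff q n ~= 0" for n using q_power_ne_1 by (auto simp: q_exp_coeff_def)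
 have "subspace_ratio Q q c' c = (PROD v:verts Q. q_exp_coeff q (c' v) * q_exp_coeff q ((c - c') v) / q_exp_coeff q (c v))" unfolding subspace_ratio_def
 proof (rule prod.cong[OF refl])
  fix v
  have "c' v <= c v" using c by (simp add: le_fun_def)
  then show "(PROD i<c' v. q ^ c v - q ^ i) / (PROD i<c' v. q ^ c' v - q ^ i)
    = q_exp_coeff q (c' v) * q_exp_coeff q ((c - c') v) / q_exp_coeff q (c v)" using q pos by (simp add: one q_exp_coeff_def[of q 0])
 qed
 then show ?thesis by (simp add: q_exp_vector_def prod.distrib prod_dividef)
qed

lemma q_exp_vector_ne_0: "q_exp_vector c ~= 0"
 using q_power_ne_1 by (auto simp: q_exp_vector_def q_exp_coeff_def)

lemma rescaled_count_recursion:
 "stable_recursion Q zeta q d (%c. rescaled_count c / q_exp_vector c)" unfolding stable_recursion_def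
proof (intro ballI impI)
 fix c assume c: "c : dim_vectors Q" "c <= d"
 have "rescaled_count c / q_exp_vector c = transfer (%_. 0) c
   - (SUM c':destabilising Q zeta c. rescaled_count c' * q_exp_vector (c - c') * transfer c' c) / q_exp_vector c"
  using q_exp_vector_ne_0[of c] by (subst rescaled_count_rec[OF c]) (simp add: diff_divide_distrib)
 also have "(SUM c':destabilising Q zeta c. rescaled_count c' * q_exp_vector (c - c') * transfer c' c) / q_exp_vector c
   = (SUM c':destabilising Q zeta c. rescaled_count c' / q_exp_vector c' * subspace_ratio Q q c' c * transfer c' c)" unfolding sum_divide_distrib
 proof (rule sum.cong[OF refl])
  fix c' assume "c' : destabilising Q zeta c"
  then have "c' <= c" by (auto simp: destabilising_def)
  then show "rescaled_count c' * q_exp_vector (c - c') * transfer c' c / q_exp_vector c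
    = rescaled_count c' / q_exp_vector c' * subspace_ratio Q q c' c * transfer c' c" using q_exp_vector_ne_0 by (simp add: subspace_ratio_eq)
 qed
 finally show "rescaled_count c / q_exp_vector c = (PROD al:arcs Q. q ^ (c (tail Q al) * c (head Q al)))
    - (SUM c':destabilising Q zeta c. rescaled_count c' / q_exp_vector c' * subspace_ratio Q q c' c
      * (PROD al:arcs Q. q ^ ((c (tail Q al) - c' (tail Q al)) * c (head Q al))))" by (simp add: transfer_def)
qed

end

section \<open>The stack function and its residue at 1\<close>

context abelianisation begin

lemma prod_q_power_diff:
 assumes "j <= n"
 shows "(PROD i<j. q ^ n - q ^ i) = q ^ (SUM i<j. i) * (q_exp_coeff q (n - j) / q_exp_coeff q n)"
 using assms
proof (induction j)
 case 0
 have "(PROD j=1..n. q ^ j - 1) ~= 0" using q_power_ne_1 by auto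
 then show ?case by (simp add: q_exp_coeff_def)
next
 case (Suc j)
 obtain k where k: "n - j = Suc k" "n - Suc j = k" using Suc.prems by (metis Suc_diff_Suc Suc_le_lessD)
 have "q_exp_coeff q (Suc k) = q_exp_coeff q k / (q ^ Suc k - 1)" by (simp add: q_exp_coeff_def)
 moreover have "q ^ n - q ^ j = q ^ j * (q ^ Suc k - 1)"
 proof -
  have "n = j + Suc k" using k(1) Suc.prems by simp
  then show ?thesis by (simp add: power_add algebra_simps)
 qed
 ultimately show ?case using Suc k q_power_ne_1[of "Suc k"] by (simp add: power_add)
qed

definition gl_shift :: real where "gl_shift = (PROD v:verts Q. q ^ (SUM i<d v. i))"

lemma multiplicity_vectors_eq: "multiplicity_vectors Q d = types_of d"
proof (intro equalityI subsetI)
 fix m assume m: "m : multiplicity_vectors Q d"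
 then have ty: "m : types" by (auto simp: multiplicity_vectors_def types_def)
 have "degree_of m i = d i" for i using m d by (cases "i : verts Q") (auto simp: multiplicity_vectors_def degree_of_def dim_vectors_def)
 then show "m : types_of d" using ty by (auto simp: types_of_def)
next
 fix m assume m: "m : types_of d"
 then have "degree_of m i = d i" for i by (simp add: types_of_def)
 then show "m : multiplicity_vectors Q d" using m unfolding multiplicity_vectors_def types_of_def types_def degree_of_def by auto
qed

definition semistable_supports :: "('v => nat => nat) => ('a \<times> (nat \<times> nat) \<times> (nat \<times> nat) \<times> nat) set set" where
 "semistable_supports m = {S. S \<subseteq> arcs_within B (model m) & semistable_support B (zeta_hat zeta) (model m) S}"

lemma weight_model:
 assumes "stab_weight Q zeta d = 0" "m : types_of d"
 shows "sum (zeta_hat zeta) (model m) = 0"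
 using weight_typed[OF finite_model model_verts, of m] tdegree_typed[OF model_verts finite_model, of m]
  type_of_model[of m] assms by (simp add: types_of_def)

lemma rescaled_count_explicit:
 assumes zeta: "stab_weight Q zeta d = 0"
 shows "rescaled_count d = (SUM m:multiplicity_vectors Q d. weight m *
   ((SUM S:semistable_supports m. (q - 1) ^ card S) / (q - 1) ^ card (model m)))" unfolding rescaled_count_def multiplicity_vectors_eq
proof (rule sum.cong[OF refl])
 fix m assume m: "m : types_of d"
 then have "m : types" by (simp add: types_of_def)
 then show "weight m * y (model m) = weight m * ((SUM S:semistable_supports m. (q - 1) ^ card S) / (q - 1) ^ card (model m))"
  using abelian_sum_semistable[OF finite_model finite_arcs_within[OF finite_model model_verts] weight_model[OF zeta m]] by (simp add: semistable_supports_def)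
qed

end

lemma semistable_point_count:
 fixes Q :: "('v, 'a) pre_digraph" and F :: "'k ring"
 assumes "fin_digraph Q" "d : dim_vectors Q" "stab_weight Q zeta d = 0" and F: "field F" "finite (carrier F)"
 shows "real (card (semistable_reps F Q zeta d)) / (PROD i:verts Q. real (card (gen_lin F (d i))))
   = abelianisation.rescaled_count Q d zeta (real (card (carrier F))) d / abelianisation.gl_shift Q d (real (card (carrier F)))"
proof -
 interpret FF: quiver_over_finite_field Q F d zeta using assms by (simp add: quiver_over_finite_field_def quiver_over_finite_field_axioms_def)
 have q2: "2 <= FF.q" by (rule finite_vectorspace.q_ge_2[OF FF.fvs])
 interpret A: abelianisation Q d zeta "real FF.q" by unfold_locales (use assms q2 in auto)
 have "real (card (semistable_reps F Q zeta d)) = A.rescaled_count d / A.q_exp_vector d" by (rule FF.card_semistable_reps[OF A.rescaled_count_recursion assms(3)])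
 moreover have "(PROD i:verts Q. real (card (gen_lin F (d i)))) = A.gl_shift / A.q_exp_vector d" unfolding A.gl_shift_def A.q_exp_vector_def prod_dividef[symmetric]
 by (use prod.cong F q2 of_nat_diff power_increasing A.prod_q_power_diff q_exp_coeff_def in "auto simp: card_gen_lin of_nat_prod")
 ultimately show ?thesis using A.q_exp_vector_ne_0[of d] by simp
qed

definition prime_field :: "nat => nat ring" where
 "prime_field p = \<lparr>carrier = {..<p}, mult = (%x y. x * y mod p), one = 1, zero = 0, add = (%x y. (x + y) mod p)\<rparr>"

lemma prime_field:
 assumes p: "prime p" shows "field (prime_field p)" "finite (carrier (prime_field p))" "card (carrier (prime_field p)) = p"
proof -
 have p2: "p \<ge> 2" using p by (rule prime_ge_2_nat)
 show "finite (carrier (prime_field p))" "card (carrier (prime_field p)) = p" by (auto simp: prime_field_def)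
 have ab: "abelian_group (prime_field p)"
 proof (rule abelian_groupI)
  fix x assume x: "x : carrier (prime_field p)"
  have "((p - x) mod p + x) mod p = (p - x + x) mod p" by (rule mod_add_left_eq)
  then have "((p - x) mod p + x) mod p = 0" using x by (simp add: prime_field_def)
  then show "EX y:carrier (prime_field p). y \<oplus>\<^bsub>prime_field p\<^esub> x = \<zero>\<^bsub>prime_field p\<^esub>"
   using p2 by (intro bexI[of _ "(p - x) mod p"]) (auto simp: prime_field_def)
 qed (use p2 in "auto simp: prime_field_def mod_add_left_eq mod_add_right_eq add_ac")
 have mo: "comm_monoid (prime_field p)" by (rule comm_monoidI) (use p2 in "auto simp: prime_field_def mod_mult_left_eq mod_mult_right_eq mult_ac")
 have cr: "cring (prime_field p)"
 proof (rule cringI[OF ab mo])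
  fix x y z assume "x : carrier (prime_field p)" "y : carrier (prime_field p)" "z : carrier (prime_field p)"
  show "(x \<oplus>\<^bsub>prime_field p\<^esub> y) \<otimes>\<^bsub>prime_field p\<^esub> z =
    x \<otimes>\<^bsub>prime_field p\<^esub> z \<oplus>\<^bsub>prime_field p\<^esub> y \<otimes>\<^bsub>prime_field p\<^esub> z"
   by (simp add: prime_field_def mod_mult_left_eq mod_add_eq distrib_right)
 qed
 show "field (prime_field p)"
 proof (rule cring.cring_fieldI2[OF cr])
  show "\<zero>\<^bsub>prime_field p\<^esub> ~= \<one>\<^bsub>prime_field p\<^esub>" by (simp add: prime_field_def)
  fix a assume a: "a : carrier (prime_field p)" "a ~= \<zero>\<^bsub>prime_field p\<^esub>"
  then have a': "0 < a" "a < p" by (auto simp: prime_field_def)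
  then have "coprime a p" using p by (metis coprime_commute nat_dvd_not_less prime_imp_coprime)
  moreover obtain b c where "a * b = p * c + gcd a p" using bezout_nat[of a p] a' by auto
  ultimately have b: "a * b = p * c + 1" by simp
  have "(p * c + 1) mod p = 1" using p2 by (simp only: mod_mult_self4) simp
  then have "a * (b mod p) mod p = 1" by (simp only: mod_mult_right_eq b)
  then show "EX b:carrier (prime_field p). a \<otimes>\<^bsub>prime_field p\<^esub> b = \<one>\<^bsub>prime_field p\<^esub>"
   using p2 by (intro bexI[of _ "b mod p"]) (auto simp: prime_field_def)
 qed
qed

lemma poly_nonzero_eventually:
 fixes r :: "real poly"
 assumes "r ~= 0" shows "\<forall>\<^sub>F x in at a. poly r x ~= 0"
proof -
 have "finite {x. poly r x = 0}" using poly_roots_finite assms by blast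
 then have "finite ({x. poly r x = 0} - {a})" by simp
 then have op: "open (- ({x. poly r x = 0} - {a}))" by (intro open_Compl finite_imp_closed)
 show ?thesis unfolding eventually_at_topological by (rule exI[of _ "- ({x. poly r x = 0} - {a})"]) (use op in blast)
qed

lemma rational_functions_agree:
 assumes "r ~= 0" "r' ~= 0"
  and agree: "!!x. prime x ==> poly p (real x) / poly r (real x) = poly p' (real x) / poly r' (real x)"
 shows "\<forall>\<^sub>F x in at a. poly p x / poly r x = poly p' x / poly r' x"
proof -
 let ?s = "(p * r' - p' * r) * (r * r')"
 have "infinite (real ` {x. prime x})" using primes_infinite by (simp add: finite_image_iff)
 moreover have "poly ?s (real x) = 0" if "prime x" for x :: nat using agree[OF that] by (cases "poly r (real x) = 0"; cases "poly r' (real x) = 0") (simp_all add: frac_eq_eq)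
 then have "real ` {x. prime x} \<subseteq> {x. poly ?s x = 0}" by auto
 ultimately have "?s = 0" using poly_roots_finite[of ?s] finite_subset by blast
 then have "p * r' = p' * r" using assms by simp
 then have eq: "poly p x * poly r' x = poly p' x * poly r x" for x by (metis poly_mult)
 show ?thesis using poly_nonzero_eventually[OF assms(1), of a] poly_nonzero_eventually[OF assms(2), of a] by eventually_elim (simp add: frac_eq_eq eq)
qed

definition rational1 :: "(real => real) => bool" where
 "rational1 f \<longleftrightarrow> (EX p r. \<forall>x>0. x ~= 1 --> poly r x ~= 0 & f x = poly p x / poly r x)"

lemma rational1_poly: "rational1 (%x. poly p x)"
 unfolding rational1_def by (intro exI[of _ p] exI[of _ 1]) simp

lemma rational1_const: "rational1 (%x. c)"
 using rational1_poly[of "[:c:]"] by simp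

lemma rational1_add: "rational1 f ==> rational1 g ==> rational1 (%x. f x + g x)"
 unfolding rational1_def
proof clarify
 fix p r p' r'
 assume "\<forall>x>0. x ~= 1 --> poly r x ~= 0 & f x = poly p x / poly r x"
  "\<forall>x>0. x ~= 1 --> poly r' x ~= 0 & g x = poly p' x / poly r' x"
 then show "EX p r. \<forall>x>0. x ~= 1 --> poly r x ~= 0 & f x + g x = poly p x / poly r x"
  by (intro exI[of _ "p * r' + p' * r"] exI[of _ "r * r'"]) (auto simp: field_simps)
qed

lemma rational1_mult: "rational1 f ==> rational1 g ==> rational1 (%x. f x * g x)"
 unfolding rational1_def
proof clarify
 fix p r p' r'
 assume "\<forall>x>0. x ~= 1 --> poly r x ~= 0 & f x = poly p x / poly r x"
  "\<forall>x>0. x ~= 1 --> poly r' x ~= 0 & g x = poly p' x / poly r' x"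
 then show "EX p r. \<forall>x>0. x ~= 1 --> poly r x ~= 0 & f x * g x = poly p x / poly r x" by (intro exI[of _ "p * p'"] exI[of _ "r * r'"]) auto
qed

lemma rational1_inverse:
 assumes f: "rational1 f" and nz: "!!x. x > 0 ==> x ~= 1 ==> f x ~= 0"
 shows "rational1 (%x. inverse (f x))"
proof -
 obtain p r where pr: "!!x. x > 0 ==> x ~= 1 ==> poly r x ~= 0 & f x = poly p x / poly r x" using f unfolding rational1_def by blast
 have "poly p x ~= 0 & inverse (f x) = poly r x / poly p x" if "x > 0" "x ~= 1" for x using pr[OF that] nz[OF that] by auto
 then show ?thesis unfolding rational1_def by blast
qed

lemma rational1_divide:
 "rational1 f ==> rational1 g ==> (!!x. x > 0 ==> x ~= 1 ==> g x ~= 0) ==> rational1 (%x. f x / g x)"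
 unfolding divide_inverse by (intro rational1_mult rational1_inverse)

lemma rational1_sum: "(!!i. i : A ==> rational1 (f i)) ==> rational1 (%x. SUM i:A. f i x)"
 by (induction A rule: infinite_finite_induct) (auto intro: rational1_const rational1_add)

lemma rational1_prod: "(!!i. i : A ==> rational1 (f i)) ==> rational1 (%x. PROD i:A. f i x)"
 by (induction A rule: infinite_finite_induct) (auto intro: rational1_const rational1_mult)

lemma rational1_power: "rational1 f ==> rational1 (%x. f x ^ n)"
 by (induction n) (auto intro: rational1_const rational1_mult)

lemma rational1_pole: "rational1 (%x. x ^ n - 1)"
 using rational1_poly[of "[:0, 1:] ^ n - 1"] by simp

lemma power_ne_1: "x > 0 ==> x ~= 1 ==> n > 0 ==> x ^ n - 1 ~= (0::real)"
 using power_eq_1_iff[of x n] by auto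

definition stack_function :: "('v, 'a) pre_digraph => ('v => nat) => ('v => real) => real => real" where
 "stack_function Q d zeta x = (SUM m:multiplicity_vectors Q d.
    (PROD i:verts Q. PROD l=1..d i. 1 / fact (m i l) * ((-1) ^ (l - 1) * (x - 1) / (real l * (x ^ l - 1))) ^ m i l)
    * ((SUM S | S \<subseteq> arcs (MPS_quiver Q m) & semistable_support (blowup_quiver Q) (zeta_hat zeta) (verts (MPS_quiver Q m)) S.
      (x - 1) ^ card S) / (x - 1) ^ card (verts (MPS_quiver Q m))))
   / (PROD v:verts Q. x ^ (SUM i<d v. i))"

lemma prod_nonzero:
 fixes f :: "'i => 'c::{semidom}"
 shows "(!!i. i : A ==> f i ~= 0) ==> prod f A ~= 0"
 by (induction A rule: infinite_finite_induct) auto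

lemma rational_stack_function: "rational1 (stack_function Q d zeta)"
proof -
 have id: "rational1 (%x. x)" using rational1_poly[of "[:0, 1:]"] by simp
 have pole: "rational1 (%x. x - 1)" using rational1_pole[of 1] by simp
 show ?thesis unfolding stack_function_def by (intro rational1_divide rational1_sum rational1_mult rational1_prod
     rational1_power rational1_const id pole rational1_pole)
    (use power_ne_1 in "auto intro!: prod_nonzero dest: prod_nonzero[THEN notE, rotated]")
qed

lemma rational1_fraction:
 assumes "rational1 f"
 shows "EX p r. r ~= 0 & (ALL x. x > 0 --> x ~= 1 --> f x = poly p x / poly r x)"
proof -
 obtain p r where *: "\<forall>x>0. x ~= 1 --> poly r x ~= 0 & f x = poly p x / poly r x" using assms unfolding rational1_def by blast
 then have "poly r 2 ~= 0" using spec[of _ "2::real"] by simp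
 then have "r ~= 0" by force
 with * show ?thesis by blast
qed

lemma field_card_ge_2:
 assumes "field F" "finite (carrier F)" shows "2 <= card (carrier F)"
 using finite_vectorspace.q_ge_2[OF coord_vs_finite_vectorspace[OF assms]] .

lemma stack_function_field:
 fixes F :: "'k ring"
 assumes Q: "fin_digraph Q" "d : dim_vectors Q" "stab_weight Q zeta d = 0" and F: "field F" "finite (carrier F)"
 shows "stack_function Q d zeta (real (card (carrier F)))
  = real (card (semistable_reps F Q zeta d)) / (PROD i:verts Q. real (card (gen_lin F (d i))))"
proof -
 have q2: "2 <= card (carrier F)" by (rule field_card_ge_2[OF F])
 interpret A: abelianisation Q d zeta "real (card (carrier F))" using assms q2 by (simp add: abelianisation_def abelianisation_axioms_def)
 show ?thesis unfolding semistable_point_count[OF assms] stack_function_def A.rescaled_count_explicit[OF Q(3)]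
   A.gl_shift_def A.weight_def A.semistable_supports_def A.verts_MPS_quiver A.arcs_MPS_quiver ..
qed

text \<open>The choice in the definition is inhabited because the stack function is rational and has the right values.\<close>
lemma semistable_count_spec:
 assumes Q: "fin_digraph Q" "d : dim_vectors Q" "stab_weight Q zeta d = 0"
 shows "rational_function (semistable_count Q zeta d)"
  and "!!F :: nat ring. field F ==> finite (carrier F) ==> semistable_count Q zeta d (real (card (carrier F))) =
     real (card (semistable_reps F Q zeta d)) / (PROD i:verts Q. real (card (gen_lin F (d i))))"
proof -
 let ?P = "%f. rational_function f & (\<forall>F :: nat ring. field F & finite (carrier F) -->
    f (real (card (carrier F))) = real (card (semistable_reps F Q zeta d)) / (PROD i:verts Q. real (card (gen_lin F (d i)))))"
 obtain p r where pr: "r ~= 0" "!!x. x > 0 ==> x ~= 1 ==> stack_function Q d zeta x = poly p x / poly r x"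
  using rational1_fraction[OF rational_stack_function, of Q d zeta] by blast
 have "?P (%x. poly p x / poly r x)"
 proof (intro conjI allI impI)
  show "rational_function (%x. poly p x / poly r x)" using pr(1) by (auto simp: rational_function_def)
  fix F :: "nat ring" assume F: "field F & finite (carrier F)"
  then have "2 <= card (carrier F)" using field_card_ge_2 by blast
  then show "poly p (real (card (carrier F))) / poly r (real (card (carrier F))) =
    real (card (semistable_reps F Q zeta d)) / (PROD i:verts Q. real (card (gen_lin F (d i))))" using pr(2)[of "real (card (carrier F))"] stack_function_field[OF Q, of F] F by simp
 qed
 then have "?P (semistable_count Q zeta d)" unfolding semistable_count_def by (rule someI[of ?P])
 then show "rational_function (semistable_count Q zeta d)"
  and "!!F :: nat ring. field F ==> finite (carrier F) ==> semistable_count Q zeta d (real (card (carrier F))) =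
     real (card (semistable_reps F Q zeta d)) / (PROD i:verts Q. real (card (gen_lin F (d i))))" by blast+
qed

text \<open>Prime fields already give infinitely many arguments.\<close>
lemma rational_function_determined:
 assumes "rational_function f" "rational1 g"
  and "!!p. prime p ==> f (real p) = g (real p)"
 shows "\<forall>\<^sub>F x in at 1. f x = g x"
proof -
 obtain p r where pr: "r ~= 0" "f = (%x. poly p x / poly r x)" using assms(1) unfolding rational_function_def by blast
 obtain p' r' where pr': "r' ~= 0" "!!x. x > 0 ==> x ~= 1 ==> g x = poly p' x / poly r' x" using rational1_fraction[OF assms(2)] by blast
 have "\<forall>\<^sub>F x in at 1. poly p x / poly r x = poly p' x / poly r' x"
 proof (rule rational_functions_agree[OF pr(1) pr'(1)])
  fix x :: nat assume x: "prime x"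
  then have "x \<ge> 2" by (rule prime_ge_2_nat)
  then show "poly p (real x) / poly r (real x) = poly p' (real x) / poly r' (real x)" using assms(3)[OF x] pr pr'(2)[of "real x"] by simp
 qed
 moreover have "\<forall>\<^sub>F x::real in at 1. x > 0 & x ~= 1" by (auto simp: eventually_at_topological intro!: exI[of _ "{0<..}"])
 ultimately show ?thesis by eventually_elim (simp add: pr pr')
qed

theorem semistable_count_eventually:
 assumes "fin_digraph Q" "d : dim_vectors Q" "stab_weight Q zeta d = 0"
 shows "\<forall>\<^sub>F x in at 1. semistable_count Q zeta d x = stack_function Q d zeta x"
proof (rule rational_function_determined[OF semistable_count_spec(1)[OF assms] rational_stack_function])
 fix p :: nat assume "prime p"
 note F = prime_field[OF this]
 show "semistable_count Q zeta d (real p) = stack_function Q d zeta (real p)" using semistable_count_spec(2)[OF assms F(1,2)] stack_function_field[OF assms F(1,2)] F(3) by simp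
qed

lemma tendsto_weight_factor:
 assumes "l > 0" shows "((%x::real. (-1) ^ (l - 1) * (x - 1) / (real l * (x ^ l - 1))) \<longlongrightarrow> (-1) ^ (l - 1) / real l ^ 2) (at 1)"
proof -
 have "((%x::real. (-1) ^ (l - 1) / (real l * (SUM i<l. x ^ i))) \<longlongrightarrow> (-1) ^ (l - 1) / (real l * (SUM i<l. 1 ^ i))) (at 1)" by (intro tendsto_intros) (use assms in auto)
 moreover have "\<forall>\<^sub>F x::real in at 1. (-1) ^ (l - 1) / (real l * (SUM i<l. x ^ i)) = (-1) ^ (l - 1) * (x - 1) / (real l * (x ^ l - 1))"
 proof -
  have "\<forall>\<^sub>F x::real in at 1. x ~= 1" by (simp add: eventually_at_filter)
  then show ?thesis
  proof eventually_elim
   case (elim x)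
   have "x ^ l - 1 = (x - 1) * (SUM i<l. x ^ i)" by (rule power_diff_1_eq)
   then show ?case using elim by simp
  qed
 qed
 ultimately show ?thesis by (simp add: tendsto_cong power2_eq_square)
qed

text \<open>Each semistable support contributes \<open>(x - 1)^(|S| - N + 1)\<close> with a nonnegative exponent, so that only exponent \<open>0\<close> survives at \<open>1\<close>.\<close>
theorem stack_function_residue:
 assumes Q: "fin_digraph Q" "d : dim_vectors Q"
  and ss: "!!m S. m : multiplicity_vectors Q d ==> S \<subseteq> arcs (MPS_quiver Q m) ==>
    semistable_support (blowup_quiver Q) (zeta_hat zeta) (verts (MPS_quiver Q m)) S ==>
    card (verts (MPS_quiver Q m)) <= Suc (card S)"
  and ne: "!!m. m : multiplicity_vectors Q d ==> verts (MPS_quiver Q m) ~= {}"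
 shows "((%x. (x - 1) * stack_function Q d zeta x) \<longlongrightarrow>
   (SUM m:multiplicity_vectors Q d.
    (PROD i:verts Q. PROD l=1..d i. 1 / fact (m i l) * ((-1) ^ (l - 1) / real l ^ 2) ^ m i l)
    * real (card {S. S \<subseteq> arcs (MPS_quiver Q m) & semistable_support (blowup_quiver Q) (zeta_hat zeta) (verts (MPS_quiver Q m)) S
      & Suc (card S) = card (verts (MPS_quiver Q m))}))) (at 1)"
proof -
 interpret A: abelianisation Q d zeta 2 using Q by (simp add: abelianisation_def abelianisation_axioms_def)
 let ?SS = "%m. {S. S \<subseteq> arcs (MPS_quiver Q m) & semistable_support (blowup_quiver Q) (zeta_hat zeta) (verts (MPS_quiver Q m)) S}"
 let ?N = "%m. card (verts (MPS_quiver Q m))"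
 let ?w = "%m x. PROD i:verts Q. PROD l=1..d i. 1 / fact (m i l) * ((-1) ^ (l - 1) * (x - 1) / (real l * (x ^ l - 1))) ^ m i l :: real"
 have fin: "finite (verts (MPS_quiver Q m))" "finite (?SS m)" if "m : multiplicity_vectors Q d" for m
 by (use A.multiplicity_vectors_eq A.types_of_def A.finite_model A.verts_MPS_quiver A.finite_arcs_within A.model_verts A.arcs_MPS_quiver that in "auto")
 let ?g = "%x. (SUM m:multiplicity_vectors Q d. ?w m x * (SUM S:?SS m. (x - 1) ^ (Suc (card S) - ?N m)))
    / (PROD v:verts Q. x ^ (SUM i<d v. i))"
 have "\<forall>\<^sub>F x in at 1. ?g x = (x - 1) * stack_function Q d zeta x"
 proof -
  have "\<forall>\<^sub>F x::real in at 1. x ~= 1" by (simp add: eventually_at_filter)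
  then show ?thesis
  proof eventually_elim
   case (elim x)
   have key: "(SUM S:?SS m. (x - 1) ^ (Suc (card S) - ?N m)) = (x - 1) * ((SUM S:?SS m. (x - 1) ^ card S) / (x - 1) ^ ?N m)" if m: "m : multiplicity_vectors Q d" for m
    unfolding sum_divide_distrib sum_distrib_left
   proof (rule sum.cong[OF refl])
    fix S assume "S : ?SS m"
    then have "?N m <= Suc (card S)" using ss[OF m, of S] by simp
    then show "(x - 1) ^ (Suc (card S) - ?N m) = (x - 1) * ((x - 1) ^ card S / (x - 1) ^ ?N m)" using elim by (simp add: power_diff)
   qed
   show ?case unfolding stack_function_def times_divide_eq_right[of "x - 1"] sum_distrib_left[of "x - 1"]
    by (intro arg_cong2[of _ _ _ _ "(/)"] sum.cong refl) (simp only: key mult.left_commute[of "x - 1"])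
  qed
 qed
 moreover have "(?g \<longlongrightarrow> (SUM m:multiplicity_vectors Q d.
    (PROD i:verts Q. PROD l=1..d i. 1 / fact (m i l) * ((-1) ^ (l - 1) / real l ^ 2) ^ m i l)
    * (SUM S:?SS m. (1 - 1) ^ (Suc (card S) - ?N m))) / (PROD v:verts Q. 1 ^ (SUM i<d v. i))) (at 1)" by (intro tendsto_intros tendsto_weight_factor) auto
 moreover have "(SUM S:?SS m. (1 - 1 :: real) ^ (Suc (card S) - ?N m)) =
   real (card {S. S \<subseteq> arcs (MPS_quiver Q m) & semistable_support (blowup_quiver Q) (zeta_hat zeta) (verts (MPS_quiver Q m)) S
      & Suc (card S) = ?N m})" if m: "m : multiplicity_vectors Q d" for m
 proof -
  have "(SUM S:?SS m. (1 - 1 :: real) ^ (Suc (card S) - ?N m)) = (SUM S:?SS m. if Suc (card S) = ?N m then 1 else 0)"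
  proof (rule sum.cong[OF refl])
   fix S assume "S : ?SS m"
   then have "?N m <= Suc (card S)" using ss[OF m, of S] by simp
   then show "(1 - 1 :: real) ^ (Suc (card S) - ?N m) = (if Suc (card S) = ?N m then 1 else 0)" by (auto simp: power_0_left)
  qed
  also have "... = real (card {S:?SS m. Suc (card S) = ?N m})" using sum.inter_filter[OF fin(2)[OF m], of "%_. 1::real" "%S. Suc (card S) = ?N m"] by simp
  finally show ?thesis by (simp add: conj_assoc)
 qed
 ultimately show ?thesis by (simp add: tendsto_cong cong: sum.cong)
qed

section \<open>Symbolic iterated residues\<close>

type_synonym affine_form = "complex \<times> (nat => complex)"
type_synonym pole_terms = "(complex \<times> affine_form list) list"

definition upd :: "(nat => complex) => nat => complex => nat => complex" where
 "upd z k w = z(k := w)"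

definition fvalue :: "nat => affine_form => (nat => complex) => complex" where
 "fvalue n f z = fst f + (SUM j<n. snd f j * z j)"

text \<open>A list of products of inverses of affine forms. This class of functions is closed under residues in one variable, so that iterated residues can be computed on lists.\<close>
definition tvalue :: "nat => pole_terms => (nat => complex) => complex" where
 "tvalue n ts z = (\<Sum>(C, fs)\<leftarrow>ts. C * (\<Prod>f\<leftarrow>fs. inverse (fvalue n f z)))"

definition terms_deriv :: "nat => pole_terms => pole_terms" where
 "terms_deriv k ts = concat (map (%(C, fs). map (%f. (- C * snd f k, f # fs)) fs) ts)"

definition pure_form :: "nat => nat => affine_form => bool" where
 "pure_form n k f \<longleftrightarrow> fst f = 0 & (\<forall>j<n. j ~= k --> snd f j = 0)"

definition restrict_form :: "nat => affine_form => affine_form" where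
 "restrict_form k f = (fst f, (snd f)(k := 0))"

text \<open>If \<open>m\<close> of the forms are multiples of the coordinate, the residue is the derivative of order \<open>m - 1\<close> of the rest at \<open>0\<close>, divided by \<open>(m - 1)!\<close>.\<close>
definition term_residue :: "nat => nat => complex \<times> affine_form list => pole_terms" where
 "term_residue n k = (%(C, fs).
   let P = filter (pure_form n k) fs; R = filter (%f. \<not> pure_form n k f) fs; m = length P
   in if m = 0 then [] else
    map (%(C', fs'). (C' / fact (m - 1), map (restrict_form k) fs'))
     ((terms_deriv k ^^ (m - 1)) [(C / (\<Prod>f\<leftarrow>P. snd f k), R)]))"

definition terms_residue :: "nat => nat => pole_terms => pole_terms" where
 "terms_residue n k ts = concat (map (term_residue n k) ts)"

lemma tvalue_simps [simp]:
 "tvalue n [] z = 0"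
 "tvalue n ((C, fs) # ts) z = C * (\<Prod>f\<leftarrow>fs. inverse (fvalue n f z)) + tvalue n ts z"
 "tvalue n (ts @ ts') z = tvalue n ts z + tvalue n ts' z" by (simp_all add: tvalue_def)

lemma fvalue_upd:
 assumes "k < n"
 shows "fvalue n f (upd z k w) = fvalue n f (upd z k 0) + snd f k * w"
proof -
 have "(SUM j<n. snd f j * (upd z k w) j) = snd f k * w + (SUM j:{..<n}-{k}. snd f j * z j)" for w using assms by (subst sum.remove[of _ k]) (auto simp: upd_def intro!: sum.cong)
 from this[of w] this[of 0] show ?thesis by (simp add: fvalue_def)
qed

lemma fvalue_upd_fun:
 assumes "k < n"
 shows "(%w. fvalue n f (upd z k w)) = (%w. fvalue n f (upd z k 0) + snd f k * w)"
 by (rule ext) (rule fvalue_upd[OF assms])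

lemma fvalue_restrict:
 assumes "k < n"
 shows "fvalue n (restrict_form k f) z = fvalue n f (upd z k 0)"
 unfolding fvalue_def restrict_form_def by (auto simp: upd_def intro!: sum.cong)

lemma has_field_derivative_term:
 assumes k: "k < n" and nz: "!!f. f : set fs ==> fvalue n f (upd z k w) ~= 0"
 shows "((%w. \<Prod>f\<leftarrow>fs. inverse (fvalue n f (upd z k w))) has_field_derivative
   (\<Sum>f\<leftarrow>fs. - snd f k * inverse (fvalue n f (upd z k w)) * (\<Prod>f\<leftarrow>fs. inverse (fvalue n f (upd z k w))))) (at w)" using nz
proof (induction fs)
 case (Cons f fs)
 let ?p = "%w. \<Prod>f\<leftarrow>fs. inverse (fvalue n f (upd z k w))"
 let ?v = "%w. fvalue n f (upd z k w)"
 have v: "(?v has_field_derivative snd f k) (at w)" unfolding fvalue_upd_fun[OF k] by (auto intro!: derivative_eq_intros)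
 have nz: "?v w ~= 0" using Cons.prems by simp
 have "((%w. inverse (?v w)) has_field_derivative - (inverse (?v w) * snd f k * inverse (?v w))) (at w)" using DERIV_inverse'[OF v nz] by simp
 from DERIV_mult[OF this Cons.IH] Cons.prems
 have "((%w. inverse (?v w) * ?p w) has_field_derivative
   - (inverse (?v w) * snd f k * inverse (?v w)) * ?p w
   + (\<Sum>f\<leftarrow>fs. - snd f k * inverse (fvalue n f (upd z k w)) * ?p w) * inverse (?v w)) (at w)" by simp
 then show ?case by (simp add: sum_list_const_mult[symmetric] sum_list_mult_const mult_ac)
qed simp

lemma has_field_derivative_terms:
 assumes k: "k < n" and nz: "!!C fs f. (C, fs) : set ts ==> f : set fs ==> fvalue n f (upd z k w) ~= 0"
 shows "((%w. tvalue n ts (upd z k w)) has_field_derivative tvalue n (terms_deriv k ts) (upd z k w)) (at w)"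
 using nz
proof (induction ts)
 case (Cons t ts)
 obtain C fs where t: "t = (C, fs)" by (cases t)
 let ?p = "%w. \<Prod>f\<leftarrow>fs. inverse (fvalue n f (upd z k w))"
 have "((%w. C * ?p w) has_field_derivative
   C * (\<Sum>f\<leftarrow>fs. - snd f k * inverse (fvalue n f (upd z k w)) * ?p w)) (at w)" by (intro DERIV_cmult has_field_derivative_term[OF k]) (use Cons.prems t in auto)
 moreover have "C * (\<Sum>f\<leftarrow>fs. - snd f k * inverse (fvalue n f (upd z k w)) * ?p w)
   = tvalue n (map (%f. (- C * snd f k, f # fs)) fs) (upd z k w)" by (simp add: tvalue_def sum_list_const_mult[symmetric] o_def mult_ac)
 ultimately have "((%w. C * ?p w) has_field_derivative tvalue n (map (%f. (- C * snd f k, f # fs)) fs) (upd z k w)) (at w)" by simp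
 moreover have "((%w. tvalue n ts (upd z k w)) has_field_derivative tvalue n (terms_deriv k ts) (upd z k w)) (at w)" by (rule Cons.IH) (use Cons.prems in auto)
 ultimately show ?case using DERIV_add by (fastforce simp: t terms_deriv_def)
qed (simp add: terms_deriv_def)

lemma set_terms_deriv:
 "set (terms_deriv k ts) = (UN (C, fs):set ts. (%f. (- C * snd f k, f # fs)) ` set fs)" by (auto simp: terms_deriv_def)

lemma forms_of_terms_deriv:
 assumes "!!C fs. (C, fs) : set ts ==> set fs \<subseteq> A" "(C, fs) : set ((terms_deriv k ^^ m) ts)"
 shows "set fs \<subseteq> A"
 using assms(2)
proof (induction m arbitrary: C fs)
 case (Suc m)
 then obtain C' fs' f where *: "(C', fs') : set ((terms_deriv k ^^ m) ts)" "f : set fs'" "fs = f # fs'" by (auto simp: set_terms_deriv)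
 with Suc.IH[OF *(1)] show ?case by auto
qed (use assms(1) in simp)

lemma higher_deriv_terms:
 assumes k: "k < n" and A: "open A" "!!w f. w : A ==> f : F ==> fvalue n f (upd z k w) ~= 0"
  and ts: "!!C fs. (C, fs) : set ts ==> set fs \<subseteq> F" and w: "w : A"
 shows "(deriv ^^ m) (%w. tvalue n ts (upd z k w)) w = tvalue n ((terms_deriv k ^^ m) ts) (upd z k w)"
 using w
proof (induction m arbitrary: w)
 case (Suc m)
 have "\<forall>\<^sub>F w in nhds w. w : A" using A(1) Suc.prems by (rule eventually_nhds_in_open)
 then have "\<forall>\<^sub>F w in nhds w. (deriv ^^ m) (%w. tvalue n ts (upd z k w)) w = tvalue n ((terms_deriv k ^^ m) ts) (upd z k w)" by eventually_elim (rule Suc.IH)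
 then have "deriv ((deriv ^^ m) (%w. tvalue n ts (upd z k w))) w = deriv (%w. tvalue n ((terms_deriv k ^^ m) ts) (upd z k w)) w" by (rule deriv_cong_ev) simp
 also have "... = tvalue n (terms_deriv k ((terms_deriv k ^^ m) ts)) (upd z k w)"
 proof (rule DERIV_imp_deriv, rule has_field_derivative_terms[OF k])
  fix C fs f assume "(C, fs) : set ((terms_deriv k ^^ m) ts)" "f : set fs"
  then show "fvalue n f (upd z k w) ~= 0" using A(2)[OF Suc.prems] forms_of_terms_deriv[of ts F C fs m k] ts by blast
 qed
 finally show ?case by simp
qed simp

lemma tvalue_map_restrict:
 assumes "k < n"
 shows "tvalue n (map (%(C', fs'). (C' / c, map (restrict_form k) fs')) ts) z = tvalue n ts (upd z k 0) / c"
 by (induction ts) (auto simp: fvalue_restrict[OF assms] o_def add_divide_distrib)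

lemma open_forms_nonzero:
 assumes "k < n" "finite F"
 shows "open {w. ALL f:F. fvalue n f (upd z k w) ~= 0}"
proof -
 have "open {w. fvalue n f (upd z k w) ~= 0}" for f by (intro open_Collect_neq) (simp_all only: fvalue_upd_fun[OF assms(1)], (intro continuous_intros)+)
 then have "open (\<Inter>f\<in>F. {w. fvalue n f (upd z k w) ~= 0})" using assms(2) by (intro open_INT) auto
 moreover have "(\<Inter>f\<in>F. {w. fvalue n f (upd z k w) ~= 0}) = {w. ALL f:F. fvalue n f (upd z k w) ~= 0}" by auto
 ultimately show ?thesis by simp
qed

lemma residue_term:
 assumes k: "k < n"
  and pure: "!!f. f : set fs ==> pure_form n k f ==> snd f k ~= 0"
  and rest: "!!f. f : set fs ==> \<not> pure_form n k f ==> fvalue n (restrict_form k f) z ~= 0"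
 defines "A \<equiv> {w. ALL f:{f:set fs. \<not> pure_form n k f}. fvalue n f (upd z k w) ~= 0}"
 shows "residue (%w. tvalue n [(C, fs)] (upd z k w)) 0 = tvalue n (term_residue n k (C, fs)) z"
  and "(%w. tvalue n [(C, fs)] (upd z k w)) holomorphic_on A - {0}"
proof -
 define P where "P = filter (pure_form n k) fs"
 define R where "R = filter (%f. \<not> pure_form n k f) fs"
 define D where "D = C / (\<Prod>f\<leftarrow>P. snd f k)"
 define m where "m = length P"
 define h where "h = (%w. tvalue n [(D, R)] (upd z k w))"
 have A: "open A" unfolding A_def by (rule open_forms_nonzero[OF k]) simp
 have A0: "0 : A" using rest by (auto simp: A_def fvalue_restrict[OF k])
 have h_holo: "h holomorphic_on A" unfolding holomorphic_on_open[OF A]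
 proof (intro ballI exI)
  fix w assume w: "w : A"
  show "(h has_field_derivative tvalue n (terms_deriv k [(D, R)]) (upd z k w)) (at w)" unfolding h_def by (rule has_field_derivative_terms[OF k]) (use w in "auto simp: A_def R_def")
 qed
 have pure_val: "fvalue n f (upd z k w) = snd f k * w" if "f : set P" for f w
 proof -
  have "pure_form n k f" using that by (simp add: P_def)
  then have "fvalue n f (upd z k 0) = 0" by (auto simp: fvalue_def pure_form_def upd_def intro!: sum.neutral)
  then show ?thesis using fvalue_upd[OF k, of f z w] by simp
 qed
 have "(\<Prod>f\<leftarrow>fs. inverse (fvalue n f (upd z k w))) =
   (\<Prod>f\<leftarrow>P. inverse (fvalue n f (upd z k w))) * (\<Prod>f\<leftarrow>R. inverse (fvalue n f (upd z k w)))" for w unfolding P_def R_def by (induction fs) auto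
 moreover have "(\<Prod>f\<leftarrow>P. inverse (fvalue n f (upd z k w))) = inverse (\<Prod>f\<leftarrow>P. snd f k) / w ^ m" for w
 proof -
  have "(\<Prod>f\<leftarrow>P. inverse (fvalue n f (upd z k w))) = (\<Prod>f\<leftarrow>P. inverse (snd f k * w))" using pure_val by (intro arg_cong[of _ _ prod_list] map_cong refl) simp
  also have "... = inverse (\<Prod>f\<leftarrow>P. snd f k) / w ^ m" unfolding m_def by (induction P) (auto simp: field_simps)
  finally show ?thesis .
 qed
 ultimately have eq: "(%w. tvalue n [(C, fs)] (upd z k w)) = (%w. h w / w ^ m)" by (auto simp: h_def D_def field_simps)
 show "(%w. tvalue n [(C, fs)] (upd z k w)) holomorphic_on A - {0}" unfolding eq by (intro holomorphic_intros holomorphic_on_subset[OF h_holo]) auto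
 show "residue (%w. tvalue n [(C, fs)] (upd z k w)) 0 = tvalue n (term_residue n k (C, fs)) z"
 proof (cases m)
  case 0
  then have "residue (%w. h w / w ^ m) 0 = 0" using residue_holo[OF A A0 h_holo] by simp
  moreover have "term_residue n k (C, fs) = []" using 0 by (simp add: term_residue_def m_def P_def Let_def)
  ultimately show ?thesis unfolding eq by simp
 next
  case (Suc l)
  have "residue (%w. h w / w ^ m) 0 = (deriv ^^ l) h 0 / fact l" unfolding Suc by (rule residue_holomorphic_over_power'[OF A A0 h_holo])
  also have "(deriv ^^ l) h 0 = tvalue n ((terms_deriv k ^^ l) [(D, R)]) (upd z k 0)" unfolding h_def by (rule higher_deriv_terms[OF k A _ _ A0, of "set R"]) (auto simp: A_def R_def)
  also have "... / fact l = tvalue n (term_residue n k (C, fs)) z" unfolding term_residue_def prod.case Let_def P_def[symmetric] R_def[symmetric] m_def[symmetric] D_def[symmetric]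
   using tvalue_map_restrict[OF k, where c = "fact l :: complex"] by (simp add: Suc)
  finally show ?thesis unfolding eq .
 qed
qed

lemma residue_terms:
 assumes k: "k < n"
  and pure: "!!C fs f. (C, fs) : set ts ==> f : set fs ==> pure_form n k f ==> snd f k ~= 0"
  and rest: "!!C fs f. (C, fs) : set ts ==> f : set fs ==> \<not> pure_form n k f ==> fvalue n (restrict_form k f) z ~= 0"
 shows "residue (%w. tvalue n ts (upd z k w)) 0 = tvalue n (terms_residue n k ts) z"
  and "EX A. open A & 0 : A & (%w. tvalue n ts (upd z k w)) holomorphic_on A - {0}"
proof -
 have "residue (%w. tvalue n ts (upd z k w)) 0 = tvalue n (terms_residue n k ts) z
  & (EX A. open A & 0 : A & (%w. tvalue n ts (upd z k w)) holomorphic_on A - {0})" using pure rest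
 proof (induction ts)
  case Nil
  show ?case by (auto simp: terms_residue_def residue_const intro!: exI[of _ UNIV])
 next
  case (Cons t ts)
  obtain C fs where t: "t = (C, fs)" by (cases t)
  have IH: "residue (%w. tvalue n ts (upd z k w)) 0 = tvalue n (terms_residue n k ts) z"
   "EX A. open A & 0 : A & (%w. tvalue n ts (upd z k w)) holomorphic_on A - {0}"
  proof -
   have "residue (%w. tvalue n ts (upd z k w)) 0 = tvalue n (terms_residue n k ts) z \<and>
    (EX A. open A & 0 : A & (%w. tvalue n ts (upd z k w)) holomorphic_on A - {0})"
   proof (rule Cons.IH)
    fix C fs f assume f: "(C, fs) : set ts" "f : set fs"
    then have f': "(C, fs) : set (t # ts)" by simp
    show "pure_form n k f ==> snd f k ~= 0" using Cons.prems(1)[OF f' f(2)] .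
    show "\<not> pure_form n k f ==> fvalue n (restrict_form k f) z ~= 0" using Cons.prems(2)[OF f' f(2)] .
   qed
   then show "residue (%w. tvalue n ts (upd z k w)) 0 = tvalue n (terms_residue n k ts) z"
    "EX A. open A & 0 : A & (%w. tvalue n ts (upd z k w)) holomorphic_on A - {0}" by blast+
  qed
  have p1: "snd f k ~= 0" if "f : set fs" "pure_form n k f" for f using Cons.prems(1)[of C fs f] t that by simp
  have p2: "fvalue n (restrict_form k f) z ~= 0" if "f : set fs" "\<not> pure_form n k f" for f using Cons.prems(2)[of C fs f] t that by simp
  obtain B where B: "open B" "0 : B" "(%w. tvalue n ts (upd z k w)) holomorphic_on B - {0}" using IH(2) by blast
  let ?A = "{w. ALL f:{f:set fs. \<not> pure_form n k f}. fvalue n f (upd z k w) ~= 0}"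
  have T: "residue (%w. tvalue n [(C, fs)] (upd z k w)) 0 = tvalue n (term_residue n k (C, fs)) z"
   "(%w. tvalue n [(C, fs)] (upd z k w)) holomorphic_on ?A - {0}" by (rule residue_term[OF k p1 p2]; assumption)+
  have A: "open ?A" by (rule open_forms_nonzero[OF k]) simp
  have A0: "0 : ?A" using Cons.prems(2)[of C fs] t by (auto simp: fvalue_restrict[OF k])
  have AB: "open (?A \<inter> B)" "0 : ?A \<inter> B" using A A0 B by auto
  have h1: "(%w. tvalue n [(C, fs)] (upd z k w)) holomorphic_on (?A \<inter> B) - {0}" by (rule holomorphic_on_subset[OF T(2)]) auto
  have h2: "(%w. tvalue n ts (upd z k w)) holomorphic_on (?A \<inter> B) - {0}" by (rule holomorphic_on_subset[OF B(3)]) auto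
  have eq: "tvalue n (t # ts) (upd z k w) = tvalue n [(C, fs)] (upd z k w) + tvalue n ts (upd z k w)" for w by (simp add: t)
  have "residue (%w. tvalue n (t # ts) (upd z k w)) 0 = tvalue n (terms_residue n k (t # ts)) z" unfolding eq residue_add[OF AB h1 h2] T(1) IH(1) by (simp add: terms_residue_def t)
  moreover have "(%w. tvalue n (t # ts) (upd z k w)) holomorphic_on (?A \<inter> B) - {0}" unfolding eq by (intro holomorphic_intros h1 h2)
  ultimately show ?case using AB by blast
 qed
 then show "residue (%w. tvalue n ts (upd z k w)) 0 = tvalue n (terms_residue n k ts) z"
  and "EX A. open A & 0 : A & (%w. tvalue n ts (upd z k w)) holomorphic_on A - {0}" by blast+
qed

text \<open>Genericity in the order in which the residues are taken: the last coordinate is chosen first, and each earlier one may have to be small depending on the later ones.\<close>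
definition nested_ev :: "nat => nat => ((nat => complex) => bool) => (nat => complex) => bool" where
 "nested_ev k m P = fold (%j R z. \<forall>\<^sub>F w in at 0. R (upd z j w)) [k..<m] P"

lemma nested_ev_base: "m <= k ==> nested_ev k m P = P"
 by (simp add: nested_ev_def)

lemma nested_ev_Suc:
 "k <= m ==> nested_ev k (Suc m) P = (%z. \<forall>\<^sub>F w in at 0. nested_ev k m P (upd z m w))" by (simp add: nested_ev_def)

lemma nested_ev_mono:
 assumes "nested_ev k m P z" "!!z. P z ==> R z" shows "nested_ev k m R z"
 using assms(1)
proof (induction m arbitrary: z)
 case (Suc m)
 show ?case
 proof (cases "k <= m")
  case True
  then show ?thesis using Suc.prems by (auto simp: nested_ev_Suc elim!: eventually_mono intro: Suc.IH)
 qed (use Suc assms(2) in "simp add: nested_ev_base")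
qed (use assms(2) in "simp add: nested_ev_base")

lemma nested_ev_conj:
 assumes "nested_ev k m P z" "nested_ev k m R z"
 shows "nested_ev k m (%z. P z & R z) z"
 using assms
proof (induction m arbitrary: z)
 case (Suc m)
 show ?case
 proof (cases "k <= m")
  case True
  have "\<forall>\<^sub>F w in at 0. nested_ev k m P (upd z m w)" "\<forall>\<^sub>F w in at 0. nested_ev k m R (upd z m w)"
   using Suc.prems by (simp_all add: nested_ev_Suc[OF True])
  then have "\<forall>\<^sub>F w in at 0. nested_ev k m (%z. P z & R z) (upd z m w)" by eventually_elim (rule Suc.IH)
  then show ?thesis by (simp add: nested_ev_Suc[OF True])
 qed (use Suc in "simp add: nested_ev_base")
qed (simp add: nested_ev_base)

lemma nested_ev_True: "(!!z. P z) ==> nested_ev k m P z"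
proof (induction m arbitrary: z)
 case (Suc m)
 then show ?case by (cases "k <= m") (auto simp: nested_ev_Suc nested_ev_base)
qed (simp add: nested_ev_base)

lemma nested_ev_ball:
 assumes "finite F" "!!f. f : F ==> nested_ev k m (P f) z"
 shows "nested_ev k m (%z. ALL f:F. P f z) z"
 using assms
proof (induction F rule: finite_induct)
 case empty
 show ?case by (rule nested_ev_True) simp
next
 case (insert f F)
 have "nested_ev k m (%z. P f z & (ALL f:F. P f z)) z" using insert by (intro nested_ev_conj) auto
 then show ?case by (rule nested_ev_mono) auto
qed

lemma nested_ev_form_nonzero:
 assumes "m <= n" and "(EX j. k <= j & j < m & snd f j ~= 0) \<or> fvalue n f z ~= 0"
 shows "nested_ev k m (%z. fvalue n f z ~= 0) z"
 using assms
proof (induction m arbitrary: z)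
 case (Suc m)
 show ?case
 proof (cases "k <= m")
  case True
  have mn: "m < n" using Suc.prems by simp
  show ?thesis
  proof (cases "EX j. k <= j & j < m & snd f j ~= 0")
   case True
   then show ?thesis using Suc.IH Suc.prems \<open>k <= m\<close> by (auto simp: nested_ev_Suc)
  next
   case False
   have "\<forall>\<^sub>F w in at 0. fvalue n f (upd z m w) ~= 0"
   proof (cases "snd f m = 0")
    case True
    then have "fvalue n f (upd z m w) = fvalue n f z" for w using fvalue_upd[OF mn, of f z w] fvalue_upd[OF mn, of f z "z m"] by (simp add: upd_def)
    moreover have "fvalue n f z ~= 0" using Suc.prems(2) False True by (auto simp: less_Suc_eq)
    ultimately show ?thesis by simp
   next
    case nz: False
    let ?c = "- fvalue n f (upd z m 0) / snd f m"
    have "\<forall>\<^sub>F w in at 0. w ~= ?c" by (rule eventually_neq_at_within)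
    then show ?thesis
    proof eventually_elim
     case (elim w)
     have "fvalue n f (upd z m w) = fvalue n f (upd z m 0) + snd f m * w" by (rule fvalue_upd[OF mn])
     moreover have "w = ?c" if "fvalue n f (upd z m 0) + snd f m * w = 0" using nz that by (simp add: field_simps add_eq_0_iff)
     ultimately show ?case using elim by auto
    qed
   qed
   then show ?thesis unfolding nested_ev_Suc[OF \<open>k <= m\<close>] by eventually_elim (rule Suc.IH; use Suc.prems in auto)
  qed
 qed (use Suc in "auto simp: nested_ev_base")
qed (auto simp: nested_ev_base)

lemma partial_residue_upd: "partial_residue k f z = residue (%w. f (upd z k w)) 0"
 by (simp add: partial_residue_def upd_def)

lemma iterated_residue_cong:
 assumes "nested_ev k m (%z. f z = g z) z"
 shows "fold partial_residue [k..<m] f z = fold partial_residue [k..<m] g z"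
 using assms
proof (induction m arbitrary: z)
 case (Suc m)
 show ?case
 proof (cases "k <= m")
  case True
  have "\<forall>\<^sub>F w in at 0. fold partial_residue [k..<m] f (upd z m w) = fold partial_residue [k..<m] g (upd z m w)"
   using Suc.prems unfolding nested_ev_Suc[OF True] by eventually_elim (rule Suc.IH)
  then have "residue (%w. fold partial_residue [k..<m] f (upd z m w)) 0
    = residue (%w. fold partial_residue [k..<m] g (upd z m w)) 0" by (rule residue_cong) simp
  moreover have "fold partial_residue [k..<Suc m] h z = partial_residue m (fold partial_residue [k..<m] h) z" for h using True by simp
  ultimately show ?thesis by (simp only: partial_residue_upd[of m])
 qed (use Suc in "simp add: nested_ev_base")
qed (simp add: nested_ev_base)

definition admissible_form :: "nat => nat => affine_form => bool" where
 "admissible_form n k f \<longleftrightarrow> (\<forall>j<k. snd f j = 0) & (fst f ~= 0 \<or> (\<exists>j<n. snd f j ~= 0))"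

definition admissible :: "nat => nat => pole_terms => bool" where
 "admissible n k ts \<longleftrightarrow> (ALL (C, fs):set ts. ALL f:set fs. admissible_form n k f)"

lemma forms_of_terms_residue:
 assumes "(C, fs) : set (terms_residue n k ts)" "f : set fs"
 obtains C' fs' f' where "(C', fs') : set ts" "f' : set fs'" "\<not> pure_form n k f'" "f = restrict_form k f'"
proof -
 obtain C' fs' where t: "(C', fs') : set ts" "(C, fs) : set (term_residue n k (C', fs'))" using assms(1) by (auto simp: terms_residue_def)
 let ?R = "filter (%f. \<not> pure_form n k f) fs'"
 obtain D m C1 fs1 where "(C1, fs1) : set ((terms_deriv k ^^ m) [(D, ?R)])" "fs = map (restrict_form k) fs1" using t(2) by (auto simp: term_residue_def Let_def split: if_splits)
 moreover have "set fs1 \<subseteq> set ?R" by (rule forms_of_terms_deriv[OF _ calculation(1)]) simp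
 ultimately show ?thesis using that t(1) assms(2) by auto
qed

lemma admissible_terms_residue:
 assumes "admissible n k ts" "k < n" shows "admissible n (Suc k) (terms_residue n k ts)"
 unfolding admissible_def
proof clarify
 fix C fs f0 f1 assume fs: "(C, fs) : set (terms_residue n k ts)" "(f0, f1) : set fs"
 from forms_of_terms_residue[OF this]
 obtain C' fs' f' where f': "(C', fs') : set ts" "f' : set fs'" "\<not> pure_form n k f'" "(f0, f1) = restrict_form k f'" .
 have "admissible_form n k f'" using assms f' by (auto simp: admissible_def)
 then show "admissible_form n (Suc k) (f0, f1)" using f'(3) unfolding f'(4) admissible_form_def restrict_form_def pure_form_def by (auto simp: less_Suc_eq)
qed

lemma partial_residue_terms:
 assumes adm: "admissible n k ts" and k: "k < n"
 shows "nested_ev (Suc k) n (%z. partial_residue k (tvalue n ts) z = tvalue n (terms_residue n k ts) z) z"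
proof -
 let ?F = "{f. EX C fs. (C, fs) : set ts & f : set fs & \<not> pure_form n k f}"
 have "finite ?F" by (rule finite_subset[of _ "\<Union>(set ` snd ` set ts)"]) force+
 moreover have "nested_ev (Suc k) n (%z. fvalue n (restrict_form k f) z ~= 0) z" if f: "f : ?F" for f
 proof (rule nested_ev_form_nonzero[OF order.refl])
  have af: "admissible_form n k f" and np: "\<not> pure_form n k f" using f adm by (auto simp: admissible_def)
  show "(\<exists>j\<ge>Suc k. j < n & snd (restrict_form k f) j ~= 0) \<or> fvalue n (restrict_form k f) z ~= 0"
  proof (cases "\<exists>j\<ge>Suc k. j < n & snd f j ~= 0")
   case True
   then obtain j where "j \<ge> Suc k" "j < n" "snd f j ~= 0" by blast
   then have "Suc k <= j & j < n & snd (restrict_form k f) j ~= 0" by (simp add: restrict_form_def)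
   then show ?thesis by blast
  next
   case False
   then have z: "snd f j = 0" if "j < n" "j ~= k" for j
   proof -
    have "j < k \<or> Suc k <= j" using that(2) by linarith
    then show ?thesis using af False that(1) by (elim disjE) (auto simp: admissible_form_def)
   qed
   then have "fst f ~= 0" using np by (auto simp: pure_form_def)
   moreover have "fvalue n (restrict_form k f) z = fst f" using z by (auto simp: fvalue_def restrict_form_def intro!: sum.neutral)
   ultimately show ?thesis by simp
  qed
 qed
 ultimately have "nested_ev (Suc k) n (%z. ALL f:?F. fvalue n (restrict_form k f) z ~= 0) z" by (rule nested_ev_ball)
 then show ?thesis
 proof (rule nested_ev_mono)
  fix z assume nz: "ALL f:?F. fvalue n (restrict_form k f) z ~= 0"
  show "partial_residue k (tvalue n ts) z = tvalue n (terms_residue n k ts) z" unfolding partial_residue_upd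
  proof (rule residue_terms(1)[OF k])
   fix C fs f assume f: "(C, fs) : set ts" "f : set fs" "pure_form n k f"
   then have "admissible_form n k f" using adm by (auto simp: admissible_def)
   then show "snd f k ~= 0" using f(3) by (auto simp: admissible_form_def pure_form_def)
  qed (use nz in blast)
 qed
qed

definition iterated_terms :: "nat => nat => pole_terms => pole_terms" where
 "iterated_terms n k ts = fold (terms_residue n) [k..<n] ts"

lemma fold_partial_residue_terms:
 assumes "admissible n k ts" "k <= n"
 shows "fold partial_residue [k..<n] (tvalue n ts) z = tvalue n (iterated_terms n k ts) z"
 using assms(2,1)
proof (induction k arbitrary: ts rule: inc_induct)
 case (step k)
 have "fold partial_residue [k..<n] (tvalue n ts) z
   = fold partial_residue [Suc k..<n] (partial_residue k (tvalue n ts)) z" using step.hyps by (simp add: upt_conv_Cons)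
 also have "... = fold partial_residue [Suc k..<n] (tvalue n (terms_residue n k ts)) z" by (rule iterated_residue_cong[OF partial_residue_terms]) (use step in auto)
 also have "... = tvalue n (iterated_terms n (Suc k) (terms_residue n k ts)) z" by (rule step.IH) (use admissible_terms_residue step in auto)
 finally show ?case using step.hyps by (simp add: iterated_terms_def upt_conv_Cons)
qed (simp add: iterated_terms_def)

text \<open>At generic later coordinates the remaining forms do not vanish on the coordinate hyperplane, so each step is an honest residue of a meromorphic function with one pole.\<close>
theorem iterated_residue_terms:
 assumes "admissible n 0 ts" "nested_ev 0 n (%z. f z = tvalue n ts z) (%_. 0)"
 shows "iterated_residue n f = tvalue n (iterated_terms n 0 ts) (%_. 0)"
 unfolding iterated_residue_def using fold_partial_residue_terms[OF assms(1)] iterated_residue_cong[OF assms(2)] by simp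

lemma terms_residue_append: "terms_residue n k (ts @ ts') = terms_residue n k ts @ terms_residue n k ts'"
 by (simp add: terms_residue_def)

lemma iterated_terms_append:
 "iterated_terms n k (ts @ ts') = iterated_terms n k ts @ iterated_terms n k ts'"
proof -
 have "fold (terms_residue n) ks (ts @ ts') = fold (terms_residue n) ks ts @ fold (terms_residue n) ks ts'" for ks by (induction ks arbitrary: ts ts') (simp_all add: terms_residue_append)
 then show ?thesis by (simp add: iterated_terms_def)
qed

lemma iterated_terms_Nil [simp]: "iterated_terms n k [] = []"
proof -
 have "fold (terms_residue n) ks [] = []" for ks by (induction ks) (simp_all add: terms_residue_def)
 then show ?thesis by (simp add: iterated_terms_def)
qed

lemma iterated_terms_step:
 "k < n ==> iterated_terms n k ts = iterated_terms n (Suc k) (terms_residue n k ts)" by (simp add: iterated_terms_def upt_conv_Cons)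

lemma iterated_terms_value:
 "tvalue n (iterated_terms n k ts) z = (\<Sum>t\<leftarrow>ts. tvalue n (iterated_terms n k [t]) z)"
proof (induction ts)
 case (Cons t ts)
 then show ?case using iterated_terms_append[of n k "[t]" ts] by simp
qed simp

definition scale_form :: "complex => affine_form => affine_form" where
 "scale_form t f = (t * fst f, snd f)"

definition scale_terms :: "complex => pole_terms => pole_terms" where
 "scale_terms t = map (%(C, fs). (C, map (scale_form t) fs))"

lemma terms_deriv_scale: "terms_deriv k (scale_terms t ts) = scale_terms t (terms_deriv k ts)"
 by (simp add: terms_deriv_def scale_terms_def map_concat o_def case_prod_unfold scale_form_def)

lemma pure_form_scale: "t ~= 0 ==> pure_form n k (scale_form t f) = pure_form n k f"
 by (simp add: pure_form_def scale_form_def)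

lemma term_residue_scale:
 assumes "t ~= 0"
 shows "term_residue n k (C, map (scale_form t) fs) = scale_terms t (term_residue n k (C, fs))"
proof -
 have f1: "filter (pure_form n k) (map (scale_form t) fs) = map (scale_form t) (filter (pure_form n k) fs)" using assms by (simp add: filter_map o_def pure_form_scale)
 have f2: "filter (%f. \<not> pure_form n k f) (map (scale_form t) fs) = map (scale_form t) (filter (%f. \<not> pure_form n k f) fs)"
  using assms by (simp add: filter_map o_def pure_form_scale)
 have it: "(terms_deriv k ^^ m) (scale_terms t ts) = scale_terms t ((terms_deriv k ^^ m) ts)" for m ts by (induction m) (simp_all add: terms_deriv_scale)
 have one: "[(D, map (scale_form t) R)] = scale_terms t [(D, R)]" for D R by (simp add: scale_terms_def)
 have r: "map (%(C', fs'). (C' / c, map (restrict_form k) fs')) (scale_terms t ts)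
   = scale_terms t (map (%(C', fs'). (C' / c, map (restrict_form k) fs')) ts)" for c ts by (simp add: scale_terms_def o_def case_prod_unfold restrict_form_def scale_form_def)
 have "snd (scale_form t f) = snd f" for f by (simp add: scale_form_def)
 then show ?thesis unfolding term_residue_def Let_def prod.case f1 f2 one it length_map r by (simp add: o_def scale_terms_def)
qed

lemma terms_residue_scale:
 assumes "t ~= 0" shows "terms_residue n k (scale_terms t ts) = scale_terms t (terms_residue n k ts)"
proof (induction ts)
 case (Cons a ts)
 obtain C fs where a: "a = (C, fs)" by (cases a)
 have "terms_residue n k (scale_terms t (a # ts)) = term_residue n k (C, map (scale_form t) fs) @ terms_residue n k (scale_terms t ts)" by (simp add: terms_residue_def scale_terms_def a)
 also have "... = scale_terms t (term_residue n k (C, fs) @ terms_residue n k ts)" using Cons by (simp add: term_residue_scale[OF assms] scale_terms_def)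
 finally show ?case by (simp add: terms_residue_def a)
qed (simp add: terms_residue_def scale_terms_def)

lemma iterated_terms_scale:
 assumes "t ~= 0" shows "iterated_terms n k (scale_terms t ts) = scale_terms t (iterated_terms n k ts)"
proof -
 have "fold (terms_residue n) ks (scale_terms t ts) = scale_terms t (fold (terms_residue n) ks ts)" for ks by (induction ks arbitrary: ts) (simp_all add: terms_residue_scale[OF assms])
 then show ?thesis by (simp add: iterated_terms_def)
qed

lemma length_terms_deriv:
 assumes "(C, fs) : set ((terms_deriv k ^^ m) [(D, R)])" shows "length fs = length R + m"
 using assms
proof (induction m arbitrary: C fs)
 case (Suc m)
 then obtain C' fs' f where *: "(C', fs') : set ((terms_deriv k ^^ m) [(D, R)])" "fs = f # fs'" by (auto simp: set_terms_deriv)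
 with Suc.IH[OF *(1)] show ?case by simp
qed simp

lemma length_terms_residue:
 assumes "(C', fs') : set (terms_residue n k ts)"
 shows "EX (C, fs):set ts. length fs = Suc (length fs')"
proof -
 obtain C fs where t: "(C, fs) : set ts" "(C', fs') : set (term_residue n k (C, fs))" using assms by (auto simp: terms_residue_def)
 let ?P = "filter (pure_form n k) fs" and ?R = "filter (%f. \<not> pure_form n k f) fs"
 from t(2) obtain C1 fs1 where *: "length ?P ~= 0" "(C1, fs1) : set ((terms_deriv k ^^ (length ?P - 1)) [(C / (\<Prod>f\<leftarrow>?P. snd f k), ?R)])"
  "fs' = map (restrict_form k) fs1" by (auto simp: term_residue_def Let_def split: if_splits)
 have "length fs' = length ?R + (length ?P - 1)" using length_terms_deriv[OF *(2)] *(3) by simp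
 moreover have "length fs = length ?P + length ?R" using sum_length_filter_compl[of "pure_form n k" fs] by simp
 ultimately have "length fs = Suc (length fs')" using *(1) by linarith
 then show ?thesis using t(1) by blast
qed

lemma length_iterated_terms_residue:
 assumes "k <= n" "(C', fs') : set (iterated_terms n k ts)"
 shows "EX (C, fs):set ts. length fs = length fs' + (n - k)"
 using assms
proof (induction k arbitrary: ts rule: inc_induct)
 case (step k)
 have "EX (C, fs):set (terms_residue n k ts). length fs = length fs' + (n - Suc k)" by (rule step.IH) (use step in "simp add: iterated_terms_step")
 then obtain C fs where *: "(C, fs) : set (terms_residue n k ts)" "length fs = length fs' + (n - Suc k)" by blast
 obtain C0 fs0 where "(C0, fs0) : set ts" "length fs0 = Suc (length fs)" using length_terms_residue[OF *(1)] by blast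
 moreover from this have "length fs0 = length fs' + (n - k)" using *(2) step.hyps by simp
 ultimately show ?case by blast
qed (force simp: iterated_terms_def)

text \<open>The iterated residue is homogeneous of degree \<open>n\<close> minus the number of forms in the constant terms.\<close>
theorem iterated_residue_scaled:
 fixes t :: complex
 assumes "t ~= 0"
 shows "tvalue n (iterated_terms n 0 [(C, map (scale_form t) fs)]) (%_. 0)
  = (if length fs < n then 0 else inverse t ^ (length fs - n)
    * tvalue n (iterated_terms n 0 [(C, fs)]) (%_. 0))"
proof -
 let ?T = "iterated_terms n 0 [(C, fs)]"
 have len: "length fs = length fs' + n" if "(C', fs') : set ?T" for C' fs' using length_iterated_terms_residue[OF _ that] by auto
 have "iterated_terms n 0 [(C, map (scale_form t) fs)] = scale_terms t ?T" using iterated_terms_scale[OF assms, of n 0 "[(C, fs)]"] by (simp add: scale_terms_def)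
 moreover have "tvalue n (scale_terms t ts) (%_. 0) = inverse t ^ m * tvalue n ts (%_. 0)" if "!!C' fs'. (C', fs') : set ts ==> length fs' = m" for ts m
  using that
 proof (induction ts)
  case (Cons a ts)
  obtain C' fs' where a: "a = (C', fs')" by (cases a)
  have "(\<Prod>f\<leftarrow>fs'. inverse (fvalue n (scale_form t f) (%_. 0))) = inverse t ^ length fs' * (\<Prod>f\<leftarrow>fs'. inverse (fvalue n f (%_. 0)))"
   by (induction fs') (simp_all add: fvalue_def scale_form_def)
  moreover have "length fs' = m" using Cons.prems a by auto
  moreover have "tvalue n (scale_terms t ts) (%_. 0) = inverse t ^ m * tvalue n ts (%_. 0)" by (rule Cons.IH) (use Cons.prems in "meson list.set_intros(2)")
  ultimately show ?case by (simp add: scale_terms_def a o_def distrib_left)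
 qed (simp add: scale_terms_def)
 moreover have "?T = []" if "length fs < n" using len that by (cases ?T) fastforce+
 moreover have "length fs' = length fs - n" if "(C', fs') : set ?T" for C' fs' using len[OF that] by simp
 ultimately show ?thesis by (auto simp: scale_terms_def)
qed

text \<open>The form becomes a multiple of the \<open>i\<close>-th coordinate exactly when the residues in the earlier coordinates have been taken.\<close>
definition leads :: "nat => nat => affine_form => bool" where
 "leads n i f \<longleftrightarrow> fst f = 0 & snd f i ~= 0 & (\<forall>j<n. i < j --> snd f j = 0)"

text \<open>Without such a form the function is regular in the \<open>i\<close>-th coordinate when its turn comes.\<close>
theorem iterated_residue_missing:
 assumes "i < n" "k <= i" "admissible n k ts"
  and "!!C fs f. (C, fs) : set ts ==> f : set fs ==> \<not> leads n i f"
 shows "iterated_terms n k ts = []"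
 using assms(2-)
proof (induction k arbitrary: ts rule: inc_induct)
 case base
 have "term_residue n i (C, fs) = []" if t: "(C, fs) : set ts" for C fs
 proof -
  have "\<not> pure_form n i f" if f: "f : set fs" for f
  proof
   assume p: "pure_form n i f"
   have "admissible_form n i f" using base(1) t f by (auto simp: admissible_def)
   then have "snd f i ~= 0" using p by (auto simp: admissible_form_def pure_form_def)
   then show False using p base(2)[OF t f] by (auto simp: pure_form_def leads_def)
  qed
  then have "filter (pure_form n i) fs = []" by (simp add: filter_empty_conv)
  then show ?thesis by (simp add: term_residue_def)
 qed
 then have "terms_residue n i ts = []" by (auto simp: terms_residue_def)
 then show ?case using assms(1) by (simp add: iterated_terms_step)
next
 case (step k)
 have "iterated_terms n (Suc k) (terms_residue n k ts) = []"
 proof (rule step.IH)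
  show "admissible n (Suc k) (terms_residue n k ts)" using admissible_terms_residue step assms(1) by auto
  fix C fs f assume "(C, fs) : set (terms_residue n k ts)" "f : set fs"
  from forms_of_terms_residue[OF this] obtain C' fs' f' where
   "(C', fs') : set ts" "f' : set fs'" "f = restrict_form k f'" by blast
  then show "\<not> leads n i f" using step.prems(2)[of C' fs' f'] step.hyps by (auto simp: leads_def restrict_form_def)
 qed
 then show ?case using step.hyps assms(1) by (simp add: iterated_terms_step)
qed

lemma filter_eq_singleton: "distinct xs ==> x : set xs ==> filter (%y. y = x) xs = [x]"
proof (induction xs)
 case (Cons y ys)
 have "filter (%y. y = x) ys = []" if "x ~: set ys" using that by (induction ys) auto
 then show ?case using Cons by auto
qed simp

text \<open>Every step meets one simple pole.\<close>
theorem iterated_residue_simple: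
 fixes F :: "nat => affine_form"
 assumes "k <= n" "distinct is" "set is = {k..<n}"
  and "!!i. i : {k..<n} ==> leads n i (F i)"
  and "!!i j. i : {k..<n} ==> j < k ==> snd (F i) j = 0"
 shows "tvalue n (iterated_terms n k [(C, map F is)]) z = C * (PROD i:{k..<n}. inverse (snd (F i) i))"
 using assms
proof (induction k arbitrary: F C "is" rule: inc_induct)
 case base
 then have "is = []" by simp
 then show ?case by (simp add: iterated_terms_def)
next
 case (step k)
 have pure: "pure_form n k (F i) \<longleftrightarrow> i = k" if i: "i : {k..<n}" for i
 proof
  have L: "leads n i (F i)" using step.prems(3) i by blast
  show "pure_form n k (F i) ==> i = k" using L i by (auto simp: pure_form_def leads_def)
  assume ik: "i = k"
  have "snd (F i) j = 0" if "j < n" "j ~= k" for j by (use step.prems(4) i L ik leads_def that in "auto")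
  then show "pure_form n k (F i)" using L by (simp add: pure_form_def leads_def)
 qed
 define R where "R = filter (%i. i ~= k) is"
 have "filter (pure_form n k) (map F is) = map F (filter (%i. i = k) is)" unfolding filter_map o_def using pure step.prems(2) by (auto intro!: arg_cong[of _ _ "map F"] filter_cong)
 also have "filter (%i. i = k) is = [k]" by (rule filter_eq_singleton) (use step in auto)
 finally have P: "filter (pure_form n k) (map F is) = [F k]" by simp
 have R: "filter (%f. \<not> pure_form n k f) (map F is) = map F R" unfolding filter_map o_def R_def using pure step.prems(2) by (auto intro!: arg_cong[of _ _ "map F"] filter_cong)
 have T: "terms_residue n k [(C, map F is)] = [(C / snd (F k) k, map (restrict_form k \<circ> F) R)]" by (simp add: terms_residue_def term_residue_def Let_def P R)
 have "tvalue n (iterated_terms n (Suc k) [(C / snd (F k) k, map (restrict_form k \<circ> F) R)]) z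
   = C / snd (F k) k * (PROD i:{Suc k..<n}. inverse (snd ((restrict_form k \<circ> F) i) i))"
 proof (rule step.IH)
  show "distinct R" "set R = {Suc k..<n}" using step.prems(1,2) by (auto simp: R_def)
  fix i assume i: "i : {Suc k..<n}"
  then have L: "leads n i (F i)" using step.prems(3)[of i] by simp
  then show "leads n i ((restrict_form k \<circ> F) i)" using i by (auto simp: leads_def restrict_form_def)
  fix j assume "j < Suc k"
  then show "snd ((restrict_form k \<circ> F) i) j = 0" using step.prems(4)[of i j] i by (auto simp: restrict_form_def less_Suc_eq)
 qed
 moreover have "(PROD i:{Suc k..<n}. inverse (snd ((restrict_form k \<circ> F) i) i)) = (PROD i:{Suc k..<n}. inverse (snd (F i) i))" by (rule prod.cong) (auto simp: restrict_form_def)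
 moreover have "(PROD i:{k..<n}. inverse (snd (F i) i)) = inverse (snd (F k) k) * (PROD i:{Suc k..<n}. inverse (snd (F i) i))" using step.hyps by (simp add: prod.atLeast_Suc_lessThan)
 ultimately show ?case using step.hyps by (simp add: iterated_terms_step T divide_inverse)
qed

section \<open>Bases and flags in the dual Cartan algebra\<close>

locale coordinate_space =
 fixes I :: "'i set" and r :: 'i
 assumes finite_I: "finite I"
begin

abbreviation n where "n \<equiv> card (I - {r})"
abbreviation V :: "('i => real) set" where "V \<equiv> coord_space I r"
abbreviation basis :: "(nat => 'i => real) => bool" where "basis \<equiv> ordered_basis I r"

lemma subspace_V: "Real_Vector_Spaces.subspace V"
 by (auto simp: real_vector.subspace_def coord_space_def scaleR_fun_def)

lemma coord_fun_V: "x : I ==> coord_fun r x : V"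
 by (auto simp: coord_space_def coord_fun_def)

lemma sum_apply: "(SUM i:A. f i) x = (SUM i:A. f i x :: 'b::comm_monoid_add)"
 by (induction A rule: infinite_finite_induct) auto

lemma V_expand: "v : V ==> v = (SUM x:I - {r}. v x *\<^sub>R coord_fun r x)"
proof
 fix y assume v: "v : V"
 have "(SUM x:I - {r}. v x *\<^sub>R coord_fun r x) y = (SUM x:I - {r}. if x = y then v y else 0)" unfolding sum_apply by (rule sum.cong) (auto simp: scaleR_fun_def coord_fun_def)
 also have "... = v y" using v finite_I by (auto simp: coord_space_def)
 finally show "v y = (SUM x:I - {r}. v x *\<^sub>R coord_fun r x) y" by simp
qed

lemma V_spanned: "V \<subseteq> span (coord_fun r ` (I - {r}))"
proof
 fix v assume v: "v : V"
 show "v : span (coord_fun r ` (I - {r}))" by (subst V_expand[OF v]) (intro span_sum span_scale span_base imageI)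
qed

lemma independent_card_le: "independent B ==> B \<subseteq> V ==> finite B & card B <= n"
proof -
 assume B: "independent B" "B \<subseteq> V"
 have "finite B & card B <= card (coord_fun r ` (I - {r}))" by (rule independent_span_bound) (use B V_spanned finite_I in auto)
 moreover have "card (coord_fun r ` (I - {r})) <= n" using finite_I by (intro card_image_le) auto
 ultimately show ?thesis by linarith
qed

lemma independent_spans:
 assumes B: "independent B" "B \<subseteq> V" "card B = n" shows "span B = V"
proof
 show "span B \<subseteq> V" using B subspace_V by (simp add: span_minimal)
 show "V \<subseteq> span B"
 proof (rule ccontr)
  assume "\<not> V \<subseteq> span B"
  then obtain v where v: "v : V" "v ~: span B" by blast
  have "v ~: B" using v(2) span_base by blast
  moreover have "finite B" using independent_card_le B by blast
  ultimately have "card (insert v B) = Suc n" using B(3) by simp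
  moreover have "card (insert v B) <= n" using independent_card_le[of "insert v B"] independent_insertI[OF v(2) B(1)] B(2) v(1) by auto
  ultimately show False by simp
 qed
qed

lemma spanning_card_ge:
 assumes "V \<subseteq> span B" "finite B" shows "n <= card B"
proof -
 have inj: "inj_on (coord_fun r) (I - {r})"
 proof (rule inj_onI)
  fix x y assume xy: "x : I - {r}" "y : I - {r}" "coord_fun r x = coord_fun r y"
  have "coord_fun r y x = 1" unfolding xy(3)[symmetric] using xy(1) by (simp add: coord_fun_def)
  then show "x = y" by (simp add: coord_fun_def split: if_splits)
 qed
 have ind: "independent (coord_fun r ` (I - {r}))" unfolding independent_explicit_module
 proof (intro allI impI)
  fix T u v assume T: "finite T" "T \<subseteq> coord_fun r ` (I - {r})" "(SUM v:T. u v *\<^sub>R v) = 0" "v : T"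
  then obtain x where x: "x : I - {r}" "v = coord_fun r x" by blast
  have "0 = (SUM v:T. u v *\<^sub>R v) x" using T(3) by simp
  also have "... = (SUM w:T. if w = v then u v else 0)" unfolding sum_apply
  proof (rule sum.cong[OF refl])
   fix w assume "w : T"
   then obtain y where "y : I - {r}" "w = coord_fun r y" using T(2) by blast
   then show "(u w *\<^sub>R w) x = (if w = v then u v else 0)" using x inj by (auto simp: scaleR_fun_def coord_fun_def inj_on_def)
  qed
  also have "... = u v" using T by simp
  finally show "u v = 0" by simp
 qed
 have "card (coord_fun r ` (I - {r})) <= card B" using independent_span_bound[OF assms(2) ind] assms(1) coord_fun_V by blast
 then show ?thesis using card_image[OF inj] by simp
qed

lemma basisI:
 assumes "inj_on g {..<n}" "independent (g ` {..<n})" "g ` {..<n} \<subseteq> V" shows "basis g"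
 unfolding ordered_basis_def
proof (intro conjI)
 show "span (g ` {..<n}) = V" by (rule independent_spans[OF assms(2,3)]) (simp only: card_image[OF assms(1)] card_lessThan)
 show "inj_on g {..<n}" by (rule assms(1))
 show "independent (g ` {..<n})" by (rule assms(2))
qed

lemma basis_in_V: "basis g ==> j < n ==> g j : V"
 unfolding ordered_basis_def by (metis imageI lessThan_iff span_base)

definition coef :: "(nat => 'i => real) => ('i => real) => nat => real" where
 "coef g v j = representation (g ` {..<n}) v (g j)"

lemma coef_expand:
 assumes "basis g" "v : V" shows "v = (SUM j<n. coef g v j *\<^sub>R g j)"
proof -
 have g: "inj_on g {..<n}" "independent (g ` {..<n})" "span (g ` {..<n}) = V" using assms(1) by (auto simp: ordered_basis_def)
 have "(SUM b:g ` {..<n}. representation (g ` {..<n}) v b *\<^sub>R b) = v" by (rule real_vector.sum_representation_eq) (use g assms in auto)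
 then show ?thesis using g(1) by (simp add: sum.reindex coef_def)
qed

lemma basis_coeffs_unique:
 assumes "basis g" "(SUM j<n. c j *\<^sub>R g j) = (SUM j<n. c' j *\<^sub>R g j)" "j < n" shows "c j = c' j"
proof -
 have g: "inj_on g {..<n}" "independent (g ` {..<n})" using assms(1) by (auto simp: ordered_basis_def)
 let ?u = "%v. c (the_inv_into {..<n} g v) - c' (the_inv_into {..<n} g v)"
 have "(SUM v:g ` {..<n}. ?u v *\<^sub>R v) = (SUM j<n. (c j - c' j) *\<^sub>R g j)" using g(1) by (simp add: sum.reindex the_inv_into_f_f)
 also have "... = 0" using assms(2) by (simp add: scaleR_diff_left sum_subtractf)
 finally have z: "(SUM v:g ` {..<n}. ?u v *\<^sub>R v) = 0" .
 have "ALL v:g ` {..<n}. ?u v = 0" using independentD[OF g(2) _ order.refl z] by blast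
 then show ?thesis using assms(3) g(1) by (auto simp: the_inv_into_f_f)
qed

lemma coef_unique:
 assumes "basis g" "v = (SUM j<n. c j *\<^sub>R g j)" "j < n" shows "coef g v j = c j"
proof -
 have "v : V" unfolding assms(2) using basis_in_V[OF assms(1)] subspace_V by (intro real_vector.subspace_sum real_vector.subspace_scale) auto
 then show ?thesis using basis_coeffs_unique[OF assms(1) _ assms(3), of "coef g v" c] coef_expand[OF assms(1)] assms(2) by metis
qed

definition change :: "(nat => 'i => real) => (nat => 'i => real) => real mat" where
 "change f g = mat n n (%(i, j). coef f (g j) i)"

lemma change_carrier [simp]: "change f g : carrier_mat n n"
 by (simp add: change_def)

lemma wedge_ratio_eq:
 assumes f: "basis f" and g: "!!j. j < n ==> g j : V"
 shows "wedge_ratio n f g = Determinant.det (change f g)"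
proof -
 have "(THE M. M : carrier_mat n n & (\<forall>j<n. g j = (SUM i<n. (M $$ (i, j)) *\<^sub>R f i))) = change f g"
 proof (rule the_equality)
  show "change f g : carrier_mat n n & (\<forall>j<n. g j = (SUM i<n. (change f g $$ (i, j)) *\<^sub>R f i))" using coef_expand[OF f g] by (auto simp: change_def)
  fix M assume M: "M : carrier_mat n n & (\<forall>j<n. g j = (SUM i<n. (M $$ (i, j)) *\<^sub>R f i))"
  show "M = change f g" by (rule eq_matI) (use M coef_unique[OF f] in "auto simp: change_def")
 qed
 then show ?thesis by (simp add: wedge_ratio_def)
qed

lemma change_mult:
 assumes f: "basis f" and g: "basis g" and h: "!!j. j < n ==> h j : V"
 shows "change f h = change f g * change g h"
proof (rule eq_matI)
 show "dim_row (change f h) = dim_row (change f g * change g h)" "dim_col (change f h) = dim_col (change f g * change g h)" by (simp_all add: change_def)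
 fix i j assume "i < dim_row (change f g * change g h)" "j < dim_col (change f g * change g h)"
 then have ij: "i < n" "j < n" by (simp_all add: change_def)
 have "h j = (SUM k<n. coef g (h j) k *\<^sub>R g k)" by (rule coef_expand[OF g h[OF ij(2)]])
 also have "... = (SUM k<n. coef g (h j) k *\<^sub>R (SUM i<n. coef f (g k) i *\<^sub>R f i))"
  using coef_expand[OF f basis_in_V[OF g]] by (intro sum.cong refl arg_cong2[of _ _ _ _ scaleR]) auto
 also have "... = (SUM i<n. (SUM k<n. coef f (g k) i * coef g (h j) k) *\<^sub>R f i)" unfolding scaleR_sum_right scaleR_sum_left by (subst sum.swap) (simp add: mult.commute)
 finally have "coef f (h j) i = (SUM k<n. coef f (g k) i * coef g (h j) k)" by (rule coef_unique[OF f _ ij(1)])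
 then show "change f h $$ (i, j) = (change f g * change g h) $$ (i, j)" using ij by (simp add: change_def scalar_prod_def atLeast0LessThan)
qed

lemma det_change_mult:
 assumes f: "basis f" and g: "basis g" and h: "!!j. j < n ==> h j : V"
 shows "Determinant.det (change f h) = Determinant.det (change f g) * Determinant.det (change g h)"
 using Determinant.det_mult[OF change_carrier[of f g] change_carrier[of g h]] by (simp only: change_mult[OF f g h])

lemma det_change_triangular:
 assumes "!!i j. i < n ==> j < i ==> coef f (g j) i = 0"
 shows "Determinant.det (change f g) = (PROD i<n. coef f (g i) i)"
proof -
 have "upper_triangular (change f g)" using assms by (auto simp: upper_triangular_def change_def)
 then have "Determinant.det (change f g) = prod_list (diag_mat (change f g))" by (rule det_upper_triangular[OF _ change_carrier])
 also have "... = prod_list (map (%i. coef f (g i) i) [0..<n])" unfolding diag_mat_def by (intro arg_cong[of _ _ prod_list]) (auto simp: change_def)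
 also have "... = (PROD i<n. coef f (g i) i)" by (subst prod.distinct_set_conv_list[symmetric]) (auto simp: atLeast0LessThan)
 finally show ?thesis .
qed

lemma coef_basis: "basis g ==> j < n ==> i < n ==> coef g (g j) i = (if i = j then 1 else 0)"
 by (rule coef_unique) (auto simp: if_distrib[of "%c. c *\<^sub>R _"] cong: if_cong)

text \<open>The matrix is a permutation matrix, and its determinant squares to \<open>1\<close> by orthogonality.\<close>
lemma det_change_reorder:
 assumes f: "basis f" and a: "basis a" and same: "f ` {..<n} = a ` {..<n}"
 shows "Determinant.det (change f a) : {1, -1}"
proof -
 let ?M = "change f a"
 have fi: "inj_on f {..<n}" "inj_on a {..<n}" using f a by (auto simp: ordered_basis_def)
 have entry: "coef f (a j) i = (if f i = a j then 1 else 0)" if ij: "i < n" "j < n" for i j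
 proof -
  obtain k where k: "k < n" "a j = f k" using same ij(2) by blast
  show ?thesis unfolding k(2) coef_basis[OF f k(1) ij(1)] using fi(1) ij k by (auto dest: inj_onD)
 qed
 have "transpose_mat ?M * ?M = 1\<^sub>m n"
 proof (rule eq_matI)
  fix j k assume "j < dim_row (1\<^sub>m n)" "k < dim_col (1\<^sub>m n)"
  then have jk: "j < n" "k < n" by simp_all
  have "(transpose_mat ?M * ?M) $$ (j, k) = (SUM i<n. coef f (a j) i * coef f (a k) i)" using jk by (simp add: change_def scalar_prod_def atLeast0LessThan)
  also have "... = (SUM i<n. if f i = a j then (if j = k then 1 else 0) else 0)" using jk fi(2) by (intro sum.cong refl) (auto simp: entry dest: inj_onD)
  also have "... = (if j = k then 1 else 0)"
  proof -
   obtain l where l: "l < n" "a j = f l" using same jk(1) by blast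
   have "(SUM i<n. if f i = a j then (if j = k then 1 else 0) else 0 :: real) = (SUM i<n. if i = l then (if j = k then 1 else 0) else 0)"
    using l fi(1) by (intro sum.cong refl) (auto dest: inj_onD)
   then show ?thesis using l by simp
  qed
  finally show "(transpose_mat ?M * ?M) $$ (j, k) = 1\<^sub>m n $$ (j, k)" using jk by simp
 qed (simp_all add: change_def)
 then have "Determinant.det (transpose_mat ?M) * Determinant.det ?M = 1" by (metis change_carrier Determinant.det_mult det_one transpose_carrier_mat)
 then have "Determinant.det ?M * Determinant.det ?M = 1" by (simp add: det_transpose[of _ n])
 then show ?thesis by (simp add: square_eq_1_iff)
qed

definition point :: "(nat => 'i => real) => (nat => complex) => 'i => complex" where
 "point g z = (THE u. u : coord_space I r & (\<forall>i<n. pairing I (g i) u = z i))"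

lemma pairing_scale: "pairing I (c *\<^sub>R v) u = of_real c * pairing I v u"
 by (simp add: pairing_def scaleR_fun_def sum_distrib_left mult.assoc)

lemma pairing_sum: "pairing I (SUM j:A. v j) u = (SUM j:A. pairing I (v j) u)"
 unfolding pairing_def sum_apply of_real_sum sum_distrib_right by (rule sum.swap)

lemma pairing_coord_fun: "x : I - {r} ==> pairing I (coord_fun r x) u = u x"
 using finite_I by (simp add: pairing_def coord_fun_def if_distrib[of of_real] if_distrib[of "%c. c * _"] cong: if_cong)

lemma pairing_expand:
 assumes "basis g" "v : V" shows "pairing I v u = (SUM j<n. of_real (coef g v j) * pairing I (g j) u)"
 by (subst coef_expand[OF assms]) (simp add: pairing_sum pairing_scale)

lemma point:
 assumes g: "basis g"
 shows "point g z : coord_space I r" "!!i. i < n ==> pairing I (g i) (point g z) = z i"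
proof -
 define u where "u = (%x. if x : I - {r} then SUM j<n. of_real (coef g (coord_fun r x) j) * z j else 0)"
 have u1: "u : coord_space I r" by (auto simp: u_def coord_space_def)
 have u2: "pairing I (g i) u = z i" if i: "i < n" for i
 proof -
  have gi: "g i : V" by (rule basis_in_V[OF g i])
  have "pairing I (g i) u = (SUM x:I - {r}. of_real (g i x) * u x)" unfolding pairing_def by (rule sum.mono_neutral_right) (use finite_I gi in "auto simp: coord_space_def")
  also have "... = (SUM x:I - {r}. SUM j<n. of_real (g i x * coef g (coord_fun r x) j) * z j)" by (rule sum.cong) (auto simp: u_def sum_distrib_left mult.assoc)
  also have "... = (SUM j<n. of_real (SUM x:I - {r}. g i x * coef g (coord_fun r x) j) * z j)" by (subst sum.swap) (simp add: sum_distrib_right)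
  also have "... = (SUM j<n. (if j = i then 1 else 0) * z j)"
  proof (rule sum.cong[OF refl])
   fix j assume j: "j : {..<n}"
   have "g i = (SUM x:I - {r}. g i x *\<^sub>R (SUM j<n. coef g (coord_fun r x) j *\<^sub>R g j))"
    by (subst (1) V_expand[OF gi]) (intro sum.cong refl arg_cong2[of _ _ _ _ scaleR] coef_expand[OF g coord_fun_V]; simp)
   also have "... = (SUM j<n. (SUM x:I - {r}. g i x * coef g (coord_fun r x) j) *\<^sub>R g j)" unfolding scaleR_sum_right scaleR_sum_left by (subst sum.swap) simp
   finally have "coef g (g i) j = (SUM x:I - {r}. g i x * coef g (coord_fun r x) j)" by (rule coef_unique[OF g]) (use j in simp)
   then show "of_real (SUM x:I - {r}. g i x * coef g (coord_fun r x) j) * z j = (if j = i then 1 else 0) * z j" using coef_basis[OF g i, of j] j by simp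
  qed
  also have "... = z i" using i by (simp add: if_distrib[of "%c. c * _"] cong: if_cong)
  finally show ?thesis .
 qed
 have "point g z = u" unfolding point_def
 proof (rule the_equality)
  show "u : coord_space I r & (\<forall>i<n. pairing I (g i) u = z i)" using u1 u2 by blast
  fix w :: "'i => complex" assume w: "w : coord_space I r & (\<forall>i<n. pairing I (g i) w = z i)"
  show "w = u"
  proof
   fix x show "w x = u x"
   proof (cases "x : I - {r}")
    case True
    then have "w x = pairing I (coord_fun r x) w" by (simp add: pairing_coord_fun)
    also have "... = u x" using pairing_expand[OF g coord_fun_V, of x w] True w by (simp add: u_def)
    finally show ?thesis .
   qed (use w u1 in "auto simp: coord_space_def")
  qed
 qed
 then show "point g z : coord_space I r" "!!i. i < n ==> pairing I (g i) (point g z) = z i" using u1 u2 by auto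
qed

end

context coordinate_space begin

lemma basis_if_spanning:
 assumes g: "g ` {..<n} \<subseteq> V" and sp: "V \<subseteq> span (g ` {..<n})" shows "basis g"
proof -
 let ?B = "g ` {..<n}"
 have "n <= card ?B" by (rule spanning_card_ge[OF sp]) simp
 moreover have "card ?B <= n" using card_image_le[of "{..<n}" g] by simp
 ultimately have cB: "card ?B = n" by simp
 then have inj: "inj_on g {..<n}" by (intro eq_card_imp_inj_on) auto
 have "independent ?B"
 proof
  assume "dependent ?B"
  then obtain b where b: "b : ?B" "b : span (?B - {b})" by (auto simp: dependent_def)
  have "?B \<subseteq> span (?B - {b})"
  proof
   fix v assume "v : ?B"
   then show "v : span (?B - {b})" using b(2) span_base[of v "?B - {b}"] by (cases "v = b") auto
  qed
  then have "span ?B \<subseteq> span (?B - {b})" by (simp add: span_minimal)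
  then have "n <= card (?B - {b})" by (intro spanning_card_ge) (use sp in auto)
  also have "... < card ?B" by (rule psubset_card_mono) (use b(1) in auto)
  finally show False using cB by simp
 qed
 then show ?thesis using basisI[OF inj _ g] by blast
qed

lemma enumeration_basis:
 assumes A: "independent A" "A \<subseteq> V" "card A = n" and a: "a ` {..<n} = A"
 shows "basis a"
proof -
 have "inj_on a {..<n}" by (rule eq_card_imp_inj_on) (simp_all only: a A(3) finite_lessThan card_lessThan)
 then show ?thesis using basisI[of a] A a by simp
qed

lemma flag_enumeration:
 assumes A: "independent A" "A \<subseteq> V" "card A = n" and F: "F : complete_flags I r A"
 obtains a where "a ` {..<n} = A" "!!j. j <= n ==> F ! j = span (a ` {..<j})" "!!j. j <= n ==> A \<inter> F ! j = a ` {..<j}"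
proof -
 let ?B = "%j. A \<inter> F ! j"
 have finA: "finite A" using independent_card_le A by blast
 have B: "span (?B j) = F ! j & card (?B j) = j" if j: "j <= n" for j
 proof -
  have "\<forall>j\<le>n. dim (F ! j) = j & (\<exists>B\<subseteq>A. F ! j = span B)" using F unfolding complete_flags_def mem_Collect_eq by (elim conjE)
  then have "dim (F ! j) = j & (\<exists>B\<subseteq>A. F ! j = span B)" using j by (elim allE impE)
  then obtain B where B: "B \<subseteq> A" "F ! j = span B" and d: "dim (F ! j) = j" by (elim conjE exE) metis
  have "A \<inter> span B \<subseteq> B"
  proof
   fix v assume v: "v : A \<inter> span B"
   show "v : B"
   proof (rule ccontr)
    assume "v ~: B"
    then have "span B \<subseteq> span (A - {v})" using B(1) by (intro span_mono) auto
    then show False using A(1) v by (auto simp: dependent_def)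
   qed
  qed
  then have "A \<inter> span B = B" using B(1) span_superset by blast
  moreover have "card B = j" using d dim_span_eq_card_independent[OF independent_mono[OF A(1) B(1)]] B(2) by simp
  ultimately show ?thesis using B(2) by simp
 qed
 have mono: "?B j \<subseteq> ?B (Suc j)" if "j < n" for j using F that unfolding complete_flags_def by auto
 define a where "a = (%j. SOME v. v : ?B (Suc j) - ?B j)"
 have step: "?B (Suc j) = insert (a j) (?B j)" if j: "j < n" for j
 proof -
  have "card (?B (Suc j) - ?B j) = 1" using B[of j] B[of "Suc j"] j mono[OF j] finA by (subst card_Diff_subset) auto
  then obtain v where v: "?B (Suc j) - ?B j = {v}" by (auto simp: card_1_singleton_iff)
  then have "a j = v" unfolding a_def by (simp only: v singleton_iff some_eq_trivial)
  then show ?thesis using v mono[OF j] by blast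
 qed
 have im: "?B j = a ` {..<j}" if "j <= n" for j using that
 proof (induction j)
  case 0
  have "card (?B 0) = 0" "finite (?B 0)" using B[of 0] finA by auto
  then show ?case by simp
 next
  case (Suc j)
  then show ?case using step[of j] by (simp add: lessThan_Suc)
 qed
 have "a ` {..<n} \<subseteq> A" using im[of n] by blast
 moreover have "card (a ` {..<n}) = card A" using im[of n] B[of n] A(3) by simp
 ultimately have "a ` {..<n} = A" using card_subset_eq[OF finA] by blast
 moreover have "F ! j = span (a ` {..<j})" if "j <= n" for j using im[OF that] B[OF that] by metis
 ultimately show ?thesis using that im by blast
qed

lemma kappa_combination:
 fixes a :: "nat => 'i => real"
 shows "(SUM j<N. c (Suc j) *\<^sub>R (SUM i<Suc j. a i)) = (SUM i<N. (SUM j:{i..<N}. c (Suc j)) *\<^sub>R a i)"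
proof (induction N)
 case (Suc N)
 have "(SUM i<Suc N. (SUM j:{i..<Suc N}. c (Suc j)) *\<^sub>R a i) = (SUM i<Suc N. (SUM j:{i..<N}. c (Suc j)) *\<^sub>R a i + c (Suc N) *\<^sub>R a i)"
  by (rule sum.cong) (auto simp: scaleR_left_distrib)
 also have "... = (SUM i<Suc N. (SUM j:{i..<N}. c (Suc j)) *\<^sub>R a i) + c (Suc N) *\<^sub>R (SUM i<Suc N. a i)" by (simp only: sum.distrib scaleR_sum_right)
 also have "(SUM i<Suc N. (SUM j:{i..<N}. c (Suc j)) *\<^sub>R a i) = (SUM i<N. (SUM j:{i..<N}. c (Suc j)) *\<^sub>R a i)" by simp
 finally show ?case using Suc by (simp only: sum.lessThan_Suc)
qed simp

definition decreasing_enumeration :: "('i => real) set => (('i => real) => real) => (nat => 'i => real) => bool" where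
 "decreasing_enumeration A x a \<longleftrightarrow> a ` {..<n} = A & (\<forall>i<n. \<forall>j<i. x (a i) < x (a j))"

lemma decreasing_enumeration_unique:
 assumes a: "decreasing_enumeration A x a" and j: "j <= n"
 shows "a ` {..<j} = {v:A. card {w:A. x v < x w} < j}"
proof -
 have A: "a ` {..<n} = A" and dec: "!!i j. i < n ==> j < i ==> x (a i) < x (a j)" using a by (auto simp: decreasing_enumeration_def)
 have inj: "inj_on a {..<n}" by (rule linorder_inj_onI) (auto dest: dec simp: not_le)
 have rank: "card {w:A. x (a i) < x w} = i" if i: "i < n" for i
 proof -
  have "{w:A. x (a i) < x w} = a ` {..<i}"
  proof (intro equalityI subsetI)
   fix w assume w: "w : {w:A. x (a i) < x w}"
   then obtain k where k: "k < n" "w = a k" using A by blast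
   then have "k < i" using dec[of k i] w by (cases k i rule: linorder_cases) auto
   then show "w : a ` {..<i}" using k by simp
  qed (use A dec i in auto)
  moreover have "inj_on a {..<i}" using inj i by (auto intro: inj_on_subset)
  ultimately show ?thesis by (simp add: card_image)
 qed
 show ?thesis
 proof (intro equalityI subsetI)
  fix v assume "v : a ` {..<j}"
  then obtain i where "i < j" "v = a i" by blast
  then show "v : {v:A. card {w:A. x v < x w} < j}" using A rank[of i] j by auto
 next
  fix v assume v: "v : {v:A. card {w:A. x v < x w} < j}"
  then obtain i where "i < n" "v = a i" using A by blast
  then show "v : a ` {..<j}" using rank[of i] v by auto
 qed
qed

lemma decreasing_enumeration_exists:
 assumes A: "finite A" "card A = n" and x: "inj_on x A"
 shows "EX a. decreasing_enumeration A x a"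
proof -
 let ?xs = "sorted_list_of_set (x ` A)"
 have xs: "sorted_wrt (<) ?xs" "set ?xs = x ` A" "length ?xs = n" using A x by (auto simp: card_image)
 define a where "a = (%i. the_inv_into A x (?xs ! (n - Suc i)))"
 have mem: "?xs ! (n - Suc i) : x ` A" if "i < n" for i using xs that by (metis diff_Suc_less gr_implies_not0 gr0I nth_mem)
 have xa: "x (a i) = ?xs ! (n - Suc i)" "a i : A" if "i < n" for i using mem[OF that] x by (auto simp: a_def f_the_inv_into_f intro: the_inv_into_into)
 have dec: "x (a i) < x (a j)" if "i < n" "j < i" for i j using that xs sorted_wrt_nth_less[OF xs(1), of "n - Suc i" "n - Suc j"] by (simp add: xa)
 have inj: "inj_on a {..<n}" by (rule linorder_inj_onI) (auto dest: dec simp: not_le)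
 have "a ` {..<n} = A" by (rule card_subset_eq[OF A(1)]) (use xa(2) inj A(2) in "auto simp: card_image")
 then show ?thesis using dec by (auto simp: decreasing_enumeration_def)
qed

abbreviation cone_cond :: "('i => real) set => ('i => real) => ('i => real) set list => bool" where
 "cone_cond A xi F \<equiv> EX c. (ALL j:{1..n}. c j > 0) & xi = (SUM j=1..n. c j *\<^sub>R flag_kappa A F j)"

lemma kappa_enumeration:
 assumes A: "independent A" "A \<subseteq> V" "card A = n" and a: "a ` {..<n} = A"
  and F: "!!j. j <= n ==> A \<inter> F ! j = a ` {..<j}" and j: "j <= n"
 shows "flag_kappa A F j = (SUM i<j. a i)"
proof -
 have "inj_on a {..<n}" using enumeration_basis[OF A a] by (simp add: ordered_basis_def)
 then have "inj_on a {..<j}" using j by (auto intro: inj_on_subset)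
 then show ?thesis unfolding flag_kappa_def F[OF j] by (simp add: sum.reindex)
qed

text \<open>For a basis the flag has to list the elements by decreasing coordinates of \<open>\<xi>\<close>, since the partial sums turn positive coefficients into decreasing ones.\<close>
lemma flags_of_basis:
 assumes A: "independent A" "A \<subseteq> V" "card A = n" and xi: "xi : V"
  and inj: "inj_on (representation A xi) A" and nz: "!!v. v : A ==> representation A xi v ~= 0"
 defines "Fs \<equiv> {F. F : complete_flags I r A & cone_cond A xi F}"
 shows "(EX v:A. representation A xi v < 0) ==> Fs = {}"
  and "(ALL v:A. representation A xi v > 0) ==>
   EX a F. a ` {..<n} = A & Fs = {F} & (\<forall>j\<le>n. F ! j = span (a ` {..<j}) & A \<inter> F ! j = a ` {..<j})"
proof -
 let ?x = "representation A xi"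
 have finA: "finite A" using independent_card_le A by blast
 have dec: "EX a. decreasing_enumeration A ?x a & (ALL v:A. ?x v > 0) & (\<forall>j\<le>n. F ! j = span (a ` {..<j}) & A \<inter> F ! j = a ` {..<j})"
  if F: "F : Fs" for F
 proof -
  have F1: "F : complete_flags I r A" using F by (simp add: Fs_def)
  obtain a where a: "a ` {..<n} = A" "!!j. j <= n ==> F ! j = span (a ` {..<j})" "!!j. j <= n ==> A \<inter> F ! j = a ` {..<j}"
   using flag_enumeration[OF A F1] by blast
  have "cone_cond A xi F" using F unfolding Fs_def by (elim CollectE conjE)
  then obtain c where c: "!!j. j : {1..n} ==> c j > 0" "xi = (SUM j=1..n. c j *\<^sub>R flag_kappa A F j)" by (elim exE conjE) (metis)
  have "xi = (SUM j<n. c (Suc j) *\<^sub>R flag_kappa A F (Suc j))" unfolding c(2) by (simp add: sum.atLeast1_atMost_eq)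
  also have "... = (SUM j<n. c (Suc j) *\<^sub>R (SUM i<Suc j. a i))" by (use sum.cong arg_cong2 kappa_enumeration A a(1,3) in "auto")
  finally have eq: "xi = (SUM i<n. (SUM j:{i..<n}. c (Suc j)) *\<^sub>R a i)" unfolding kappa_combination .
  have x: "?x (a i) = (SUM j:{i..<n}. c (Suc j))" if "i < n" for i using coef_unique[OF enumeration_basis[OF A a(1)] eq that] by (simp add: coef_def a(1))
  have pos: "?x (a i) > 0" if "i < n" for i unfolding x[OF that] by (rule sum_pos) (use that c(1) in auto)
  have "?x (a i) < ?x (a j)" if "i < n" "j < i" for i j
  proof -
   have "(SUM k:{j..<n}. c (Suc k)) = (SUM k:{j..<i}. c (Suc k)) + (SUM k:{i..<n}. c (Suc k))" using that by (subst sum.atLeastLessThan_concat) auto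
   moreover have "(SUM k:{j..<i}. c (Suc k)) > 0" by (rule sum_pos) (use that c(1) in auto)
   ultimately show ?thesis using that by (simp add: x)
  qed
  then have "decreasing_enumeration A ?x a" using a(1) by (simp add: decreasing_enumeration_def)
  moreover have "ALL v:A. ?x v > 0" using pos a(1) by blast
  ultimately show ?thesis using a(2,3) by blast
 qed
 show "(EX v:A. ?x v < 0) ==> Fs = {}" using dec by fastforce
 assume pos: "ALL v:A. ?x v > 0"
 obtain a where a: "decreasing_enumeration A ?x a" using decreasing_enumeration_exists[OF finA A(3) inj] by blast
 have aA: "a ` {..<n} = A" using a by (simp add: decreasing_enumeration_def)
 have ba: "basis a" by (rule enumeration_basis[OF A aA])
 have inja: "inj_on a {..<n}" using ba by (simp add: ordered_basis_def)
 define F where "F = map (%j. span (a ` {..<j})) [0..<Suc n]"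
 have Fj: "F ! j = span (a ` {..<j})" if "j <= n" for j using that by (simp add: F_def del: upt_Suc)
 have sub: "a ` {..<j} \<subseteq> A" if "j <= n" for j using aA that by auto
 have AF: "A \<inter> F ! j = a ` {..<j}" if j: "j <= n" for j
 proof
  show "a ` {..<j} \<subseteq> A \<inter> F ! j" unfolding Fj[OF j] using sub[OF j] span_superset[of "a ` {..<j}"] by (rule Int_greatest)
  show "A \<inter> F ! j \<subseteq> a ` {..<j}"
  proof
   fix v assume v: "v : A \<inter> F ! j"
   show "v : a ` {..<j}"
   proof (rule ccontr)
    assume "v ~: a ` {..<j}"
    then have "span (a ` {..<j}) \<subseteq> span (A - {v})" using sub[OF j] by (intro span_mono) auto
    then show False using A(1) v Fj[OF j] by (auto simp: dependent_def)
   qed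
  qed
 qed
 have F1: "F : complete_flags I r A" unfolding complete_flags_def
 proof (intro CollectI conjI allI impI)
  show "length F = n + 1" by (simp add: F_def)
  show "F ! 0 = {0}" using Fj[of 0] by simp
  show "F ! n = V" using Fj[of n] ba by (simp add: ordered_basis_def)
  fix j
  show "j < n ==> F ! j \<subseteq> F ! (j + 1)" using Fj[of j] Fj[of "j + 1"] by (auto intro!: span_mono)
  assume j: "j <= n"
  have "inj_on a {..<j}" using inja j by (auto intro: inj_on_subset)
  then show "dim (F ! j) = j" using dim_span_eq_card_independent[OF independent_mono[OF A(1) sub[OF j]]] Fj[OF j] by (simp add: card_image)
  show "\<exists>B\<subseteq>A. F ! j = span B" using Fj[OF j] sub[OF j] by blast
 qed
 have cone: "cone_cond A xi F"
 proof -
  define y where "y = (%i. if i < n then ?x (a i) else 0)"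
  define c where "c = (%j. y (j - 1) - y j)"
  have cpos: "c j > 0" if "j : {1..n}" for j using a pos that aA unfolding c_def y_def decreasing_enumeration_def by (cases "j < n") auto
  have "(SUM j:{i..<n}. c (Suc j)) = y i" if "i < n" for i
  proof -
   have "(SUM j:{i..<n}. c (Suc j)) = (SUM j:{i..<n}. y j - y (Suc j))" by (simp add: c_def)
   also have "... = y i - y n" using that by (subst sum_Suc_diff'[of i n "%j. - y j", simplified]) auto
   finally show ?thesis by (simp add: y_def)
  qed
  then have "xi = (SUM i<n. (SUM j:{i..<n}. c (Suc j)) *\<^sub>R a i)" using coef_expand[OF ba xi] by (simp add: coef_def aA y_def)
  also have "... = (SUM j<n. c (Suc j) *\<^sub>R (SUM i<Suc j. a i))" by (rule kappa_combination[symmetric])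
  also have "... = (SUM j<n. c (Suc j) *\<^sub>R flag_kappa A F (Suc j))" by (use sum.cong arg_cong2 kappa_enumeration A aA AF in "auto")
  also have "... = (SUM j=1..n. c j *\<^sub>R flag_kappa A F j)" by (simp add: sum.atLeast1_atMost_eq)
  finally show ?thesis using cpos by blast
 qed
 have "F' = F" if F': "F' : Fs" for F'
 proof (rule nth_equalityI)
  have len: "length F' = Suc n" using F' by (simp add: Fs_def complete_flags_def)
  then show "length F' = length F" by (simp add: F_def)
  fix j assume "j < length F'"
  then have j: "j <= n" using len by simp
  obtain b where b: "decreasing_enumeration A ?x b" "F' ! j = span (b ` {..<j})" using dec[OF F'] j by blast
  show "F' ! j = F ! j" using b Fj[OF j] decreasing_enumeration_unique[OF a j] decreasing_enumeration_unique[OF b(1) j] by simp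
 qed
 moreover have "F : Fs" unfolding Fs_def using F1 cone by (intro CollectI conjI)
 ultimately have FsF: "Fs = {F}" by (metis is_singletonI' is_singleton_the_elem singletonD empty_iff)
 show "EX a F. a ` {..<n} = A & Fs = {F} & (\<forall>j\<le>n. F ! j = span (a ` {..<j}) & A \<inter> F ! j = a ` {..<j})"
  by (intro exI[of _ a] exI[of _ F] conjI aA FsF allI impI Fj AF)
qed

end

section \<open>The local residue for large charges\<close>

definition listing :: "'e set => 'e list" where
 "listing S = (SOME xs. set xs = S & distinct xs)"

lemma listing: "finite S ==> set (listing S) = S & distinct (listing S)"
 unfolding listing_def by (rule someI_ex) (rule finite_distinct_list)

lemma length_listing: "finite S ==> length (listing S) = card S"
 using listing[of S] distinct_card[of "listing S"] by simp

text \<open>The coefficient of a support \<open>S\<close> in the residue, up to the power of the scale.\<close>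
definition leading_residue :: "nat => ('e => affine_form) => ('e set => complex) => 'e set => complex" where
 "leading_residue n h K S = tvalue n (iterated_terms n 0 [(K S, map h (listing S))]) (%_. 0)"

lemma iterated_residue_scaled_sum:
 fixes h :: "'e => affine_form" and t :: complex
 assumes E: "finite E" and t: "t ~= 0"
  and adm: "!!e. e : E ==> admissible_form n 0 (h e)"
  and f: "!!z. (ALL e:E. fvalue n (scale_form t (h e)) z ~= 0) ==>
   f z = (SUM S:Pow E. K S * (PROD e:S. inverse (fvalue n (scale_form t (h e)) z)))"
 shows "iterated_residue n f
  = (SUM S:Pow E. if card S < n then 0 else inverse t ^ (card S - n) * leading_residue n h K S)"
proof -
 define ts where "ts = map (%S. (K S, map (scale_form t) (map h (listing S)))) (listing (Pow E))"
 have Pow: "set (listing (Pow E)) = Pow E" "distinct (listing (Pow E))" using listing[of "Pow E"] E by auto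
 have fin: "finite S" if "S : Pow E" for S using that E by (auto intro: finite_subset)
 have sumP: "sum_list (map g (listing (Pow E))) = sum g (Pow E)" for g :: "'e set => complex" using sum.distinct_set_conv_list[OF Pow(2), of g] Pow(1) by simp
 have prodP: "prod_list (map g (listing S)) = prod g S" if "S : Pow E" for g :: "'e => complex" and S
  using prod.distinct_set_conv_list[of "listing S" g] listing[OF fin[OF that]] by simp
 have val: "tvalue n ts z = (SUM S:Pow E. K S * (PROD e:S. inverse (fvalue n (scale_form t (h e)) z)))" for z
 by (use o_def sumP sum.cong arg_cong2 prodP in "auto simp: tvalue_def ts_def")
 have admS: "admissible_form n 0 (scale_form t (h e))" if "e : E" for e using adm[OF that] t by (simp add: admissible_form_def scale_form_def)
 have admts: "admissible n 0 ts" unfolding admissible_def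
 proof (intro ballI, clarify)
  fix C fs x y assume a: "(C, fs) : set ts" "(x, y) : set fs"
  then obtain S where S: "S : Pow E" "fs = map (scale_form t) (map h (listing S))" unfolding ts_def using Pow(1) by auto
  then obtain e where "e : S" "(x, y) = scale_form t (h e)" using a(2) listing[OF fin[OF S(1)]] by auto
  then show "admissible_form n 0 (x, y)" using admS S(1) by auto
 qed
 have ne: "nested_ev 0 n (%z. f z = tvalue n ts z) (%_. 0)"
 proof (rule nested_ev_mono)
  show "nested_ev 0 n (%z. ALL e:E. fvalue n (scale_form t (h e)) z ~= 0) (%_. 0)"
  proof (rule nested_ev_ball[OF E])
   fix e assume "e : E"
   from admS[OF this] show "nested_ev 0 n (%z. fvalue n (scale_form t (h e)) z ~= 0) (%_. 0)"
    by (intro nested_ev_form_nonzero) (auto simp: admissible_form_def fvalue_def)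
  qed
  show "f z = tvalue n ts z" if "ALL e:E. fvalue n (scale_form t (h e)) z ~= 0" for z using f[OF that] val by simp
 qed
 have "iterated_residue n f = tvalue n (iterated_terms n 0 ts) (%_. 0)" by (rule iterated_residue_terms[OF admts ne])
 also have "... = (SUM S:Pow E. tvalue n (iterated_terms n 0 [(K S, map (scale_form t) (map h (listing S)))]) (%_. 0))"
  by (subst iterated_terms_value) (simp only: ts_def map_map o_def sumP)
 also have "... = (SUM S:Pow E. if card S < n then 0 else inverse t ^ (card S - n) * leading_residue n h K S)"
  by (intro sum.cong refl) (simp only: iterated_residue_scaled[OF t] length_map length_listing[OF fin] leading_residue_def)
 finally show ?thesis .
qed

lemma leading_residue_missing:
 assumes S: "finite S" and i: "i < n" "!!e. e : S ==> \<not> leads n i (h e)"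
  and adm: "!!e. e : S ==> admissible_form n 0 (h e)"
 shows "leading_residue n h K S = 0"
proof -
 have "iterated_terms n 0 [(K S, map h (listing S))] = []" by (rule iterated_residue_missing[OF i(1)]) (use i(2) adm listing[OF S] in "auto simp: admissible_def")
 then show ?thesis by (simp add: leading_residue_def)
qed

lemma leading_residue_simple:
 fixes h :: "'e => affine_form"
 assumes S: "finite S" and p: "bij_betw p S {..<n}" and lead: "!!e. e : S ==> leads n (p e) (h e)"
 shows "leading_residue n h K S = K S * (PROD e:S. inverse (snd (h e) (p e)))"
proof -
 let ?q = "the_inv_into S p"
 have inj: "inj_on p S" and im: "p ` S = {..<n}" using p by (auto simp: bij_betw_def)
 have q: "?q (p e) = e" if "e : S" for e using the_inv_into_f_f[OF inj that] .
 have l: "map h (listing S) = map (%i. h (?q i)) (map p (listing S))" using q listing[OF S] by (simp add: o_def)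
 have "leading_residue n h K S = K S * (PROD i:{0..<n}. inverse (snd (h (?q i)) i))" unfolding leading_residue_def l
 proof (rule iterated_residue_simple)
  show "distinct (map p (listing S))" using listing[OF S] inj by (simp add: distinct_map)
  show "set (map p (listing S)) = {0..<n}" using listing[OF S] im by (simp add: atLeast0LessThan)
  show "leads n i (h (?q i))" if "i : {0..<n}" for i
  proof -
   have "i : p ` S" using that im by (simp add: atLeast0LessThan)
   then obtain e where "e : S" "i = p e" by blast
   then show ?thesis using lead q by simp
  qed
 qed auto
 also have "(PROD i:{0..<n}. inverse (snd (h (?q i)) i)) = (PROD e:S. inverse (snd (h e) (p e)))" unfolding atLeast0LessThan im[symmetric] by (simp add: prod.reindex[OF inj] q)
 finally show ?thesis .
qed

context coordinate_space begin

lemma coef_zero_beyond: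
 assumes g: "basis g" and m: "m <= j" "j < n" and v: "v : span (g ` {..<m})"
 shows "coef g v j = 0"
proof -
 have gi: "inj_on g {..<n}" "independent (g ` {..<n})" using g by (auto simp: ordered_basis_def)
 have sub: "g ` {..<m} \<subseteq> g ` {..<n}" using m by auto
 have "representation (g ` {..<n}) v = representation (g ` {..<m}) v" by (rule real_vector.representation_extend[OF gi(2) v sub])
 moreover have "g j ~: g ` {..<m}" using gi(1) m by (auto dest: inj_onD)
 ultimately show ?thesis unfolding coef_def using real_vector.representation_ne_zero[of "g ` {..<m}" v "g j"] by auto
qed

text \<open>The partial sums are unitriangular in the enumeration.\<close>
lemma flag_sign_enumeration:
 assumes A: "independent A" "A \<subseteq> V" "card A = n" and a: "a ` {..<n} = A" and f: "basis f"
  and F: "!!j. j <= n ==> A \<inter> F ! j = a ` {..<j}"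
 shows "flag_sign I r A f F = sgn (Determinant.det (change f a))"
proof -
 let ?k = "%j. flag_kappa A F (j + 1)"
 have ba: "basis a" by (rule enumeration_basis[OF A a])
 have k: "?k j = (SUM i<Suc j. a i)" if "j < n" for j using kappa_enumeration[OF A a F, of "Suc j"] that by simp
 have kV: "?k j : V" if "j < n" for j unfolding k[OF that] using that by (intro real_vector.subspace_sum[OF subspace_V] basis_in_V[OF ba]) auto
 have bk: "basis ?k"
 proof (rule basis_if_spanning)
  show "?k ` {..<n} \<subseteq> V" using kV by blast
  have "a j : span (?k ` {..<n})" if j: "j < n" for j
  proof (cases j)
   case 0
   then have "a j = ?k j" using k[OF j] by simp
   then show ?thesis using j by (simp only:) (intro span_base imageI; simp)
  next
   case (Suc i)
   have i: "i < n" using Suc j by simp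
   have e: "a j = ?k j - ?k i" unfolding k[OF j] k[OF i] by (simp add: Suc)
   show ?thesis unfolding e using i j by (intro span_diff span_base imageI) auto
  qed
  then have "span (a ` {..<n}) \<subseteq> span (?k ` {..<n})" by (intro span_minimal) auto
  then show "V \<subseteq> span (?k ` {..<n})" using ba by (simp add: ordered_basis_def)
 qed
 have co: "coef a (?k j) i = (if i <= j then 1 else 0)" if "j < n" "i < n" for i j
 proof (rule coef_unique[OF ba _ that(2)])
  have "(SUM i<n. (if i <= j then 1 else 0) *\<^sub>R a i) = (SUM i:{..<n} \<inter> {..j}. a i)" by (subst sum.inter_restrict) (auto intro!: sum.cong)
  also have "{..<n} \<inter> {..j} = {..<Suc j}" using that by auto
  finally show "?k j = (SUM i<n. (if i <= j then 1 else 0) *\<^sub>R a i)" by (simp only: k[OF that(1)])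
 qed
 have "wedge_ratio n f ?k = Determinant.det (change f ?k)" by (rule wedge_ratio_eq[OF f kV])
 also have "... = Determinant.det (change f a) * Determinant.det (change a ?k)" by (rule det_change_mult[OF f ba kV])
 also have "Determinant.det (change a ?k) = (PROD i<n. coef a (?k i) i)" by (rule det_change_triangular) (use co in "simp del: Suc_eq_plus1 add_Suc_right")
 also have "... = 1" by (rule prod.neutral) (use co in "simp del: Suc_eq_plus1 add_Suc_right")
 finally show ?thesis using bk by (simp add: flag_sign_def)
qed

text \<open>Only the orientation of the enumeration may be wrong; a sign on the first vector corrects it.\<close>
lemma adapted_basis_exists:
 assumes A: "independent A" "A \<subseteq> V" "card A = n" and a: "a ` {..<n} = A"
  and f: "basis f" "f ` {..<n} = A"
  and F: "!!j. j <= n ==> F ! j = span (a ` {..<j})"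
 shows "\<exists>\<gamma>. adapted_basis I r f F \<gamma>"
proof -
 define s where "s = Determinant.det (change f a)"
 have ba: "basis a" by (rule enumeration_basis[OF A a])
 have s: "s = 1 \<or> s = -1" using det_change_reorder[OF f(1) ba] a f(2) by (simp add: s_def)
 define \<gamma> where "\<gamma> = (%j::nat. if j = 0 then s *\<^sub>R a 0 else a j)"
 have sp: "span (\<gamma> ` {..<m}) = span (a ` {..<m})" for m
 proof (rule subset_antisym)
  have "\<gamma> j : span (a ` {..<m})" if "j < m" for j
  proof -
   have "\<gamma> j = (if j = 0 then s else 1) *\<^sub>R a j" by (simp add: \<gamma>_def)
   then show ?thesis using that by (metis span_scale span_base imageI lessThan_iff)
  qed
  then show "span (\<gamma> ` {..<m}) \<subseteq> span (a ` {..<m})" by (intro span_minimal) auto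
  have "a j : span (\<gamma> ` {..<m})" if "j < m" for j
  proof -
   have "a j = (if j = 0 then s else 1) *\<^sub>R \<gamma> j" using s by (auto simp: \<gamma>_def)
   then show ?thesis using that by (metis span_scale span_base imageI lessThan_iff)
  qed
  then show "span (a ` {..<m}) \<subseteq> span (\<gamma> ` {..<m})" by (intro span_minimal) auto
 qed
 have V: "span (a ` {..<n}) = V" using ba by (simp add: ordered_basis_def)
 have b\<gamma>: "basis \<gamma>" by (rule basis_if_spanning) (use sp[of n] V span_superset[of "\<gamma> ` {..<n}"] in auto)
 have \<gamma>V: "\<gamma> j : V" if "j < n" for j using basis_in_V[OF b\<gamma> that] .
 have co: "coef a (\<gamma> j) i = (if i = j then if j = 0 then s else 1 else 0)" if "j < n" "i < n" for i j
 proof (rule coef_unique[OF ba _ that(2)])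
  show "\<gamma> j = (SUM i<n. (if i = j then if j = 0 then s else 1 else 0) *\<^sub>R a i)" using that by (simp add: \<gamma>_def if_distrib[of "%c. c *\<^sub>R _"] cong: if_cong)
 qed
 have "wedge_ratio n f \<gamma> = Determinant.det (change f \<gamma>)" by (rule wedge_ratio_eq[OF f(1) \<gamma>V])
 also have "... = s * Determinant.det (change a \<gamma>)" unfolding s_def by (rule det_change_mult[OF f(1) ba \<gamma>V])
 also have "Determinant.det (change a \<gamma>) = (PROD i<n. coef a (\<gamma> i) i)" by (rule det_change_triangular) (simp add: co)
 also have "... = (PROD i<n. if i = 0 then s else 1)" by (rule prod.cong) (simp_all add: co)
 also have "... = (if n = 0 then 1 else s)" by (simp add: prod.delta)
 also have "s * ... = 1" by (use det_change_triangular s in "auto simp: s_def")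
 finally show ?thesis using b\<gamma> sp F unfolding adapted_basis_def by metis
qed

text \<open>In an adapted basis the elements of \<open>A\<close> are triangular, so a support with \<open>n\<close> forms has a leading form for every coordinate iff it maps onto \<open>A\<close>. The product of the diagonal entries is the sign of the flag, hence the two signs cancel.\<close>
theorem JK_local_large_charge:
 fixes rho :: "'e => 'i => real" and c :: "'e => complex" and K :: "'e set => complex"
 assumes A: "independent A" "A \<subseteq> V" "card A = n" and xi: "xi : V"
  and inj: "inj_on (representation A xi) A" and nz: "!!v. v : A ==> representation A xi v ~= 0"
  and E: "finite E" and rho: "!!e. e : E ==> rho e : V & rho e ~= 0"
  and c: "!!e. e : E ==> c e = 0 \<longleftrightarrow> rho e : A"
  and \<phi>: "!!(t::real) u. t > 0 ==> u : coord_space I r ==> (ALL e:E. pairing I (rho e) u + of_real t * c e ~= 0) ==>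
   \<phi> t u = (SUM S:Pow E. K S * (PROD e:S. inverse (pairing I (rho e) u + of_real t * c e)))"
 shows "((%t. JK_local I r A xi (\<phi> t)) \<longlongrightarrow>
  (SUM S:Pow E. if card S = n & rho ` S = A & (ALL v:A. representation A xi v > 0) then K S else 0)) at_top"
proof -
 let ?x = "representation A xi"
 define Fs where "Fs = {F. F : complete_flags I r A & cone_cond A xi F}"
 have JK: "JK_local I r A xi \<psi> = (let f = SOME f. basis f & f ` {..<n} \<subseteq> A in
   SUM F:Fs. of_real (flag_sign I r A f F) * flag_residue I r f F \<psi>)" for \<psi> by (simp add: JK_local_def Let_def Fs_def)
 show ?thesis
 proof (cases "ALL v:A. ?x v > 0")
  case False
  then have "EX v:A. ?x v < 0" using nz by (meson linorder_less_linear)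
  then have "Fs = {}" using flags_of_basis(1)[OF A xi inj nz] by (simp add: Fs_def)
  then have "JK_local I r A xi \<psi> = 0" for \<psi> by (simp add: JK)
  moreover have "(SUM S:Pow E. if card S = n & rho ` S = A & (ALL v:A. ?x v > 0) then K S else 0) = 0" using False by (intro sum.neutral) auto
  ultimately show ?thesis by simp
 next
  case True
  have "EX a F. a ` {..<n} = A & Fs = {F} & (\<forall>j\<le>n. F ! j = span (a ` {..<j}) & A \<inter> F ! j = a ` {..<j})"
   unfolding Fs_def by (rule flags_of_basis(2)[OF A xi inj _ True]) (rule nz)
  then obtain a F where a: "a ` {..<n} = A" and Fs: "Fs = {F}"
   and F: "\<forall>j\<le>n. F ! j = span (a ` {..<j}) & A \<inter> F ! j = a ` {..<j}" by (elim exE conjE) metis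
  have ba: "basis a" by (rule enumeration_basis[OF A a])
  define f where "f = (SOME f. basis f & f ` {..<n} \<subseteq> A)"
  have "basis f & f ` {..<n} \<subseteq> A" unfolding f_def by (rule someI[of "%f. basis f & f ` {..<n} \<subseteq> A" a]) (simp add: ba a)
  then have f: "basis f" "f ` {..<n} \<subseteq> A" by auto
  have finA: "finite A" using independent_card_le A by blast
  have "card (f ` {..<n}) = card A" using f(1) A(3) by (simp add: ordered_basis_def card_image)
  then have fA: "f ` {..<n} = A" using card_subset_eq[OF finA f(2)] by blast
  define s where "s = Determinant.det (change f a)"
  have s: "s = 1 \<or> s = -1" using det_change_reorder[OF f(1) ba] a fA by (simp add: s_def)
  define \<gamma> where "\<gamma> = (SOME \<gamma>. adapted_basis I r f F \<gamma>)"
  have "adapted_basis I r f F \<gamma>" unfolding \<gamma>_def by (rule someI_ex[OF adapted_basis_exists[OF A a f(1) fA]]) (use F in blast)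
  then have \<gamma>: "basis \<gamma>" "!!m. m <= n ==> span (\<gamma> ` {..<m}) = span (a ` {..<m})" "wedge_ratio n f \<gamma> = 1" using F by (auto simp: adapted_basis_def)
  have aV: "a j : V" if "j < n" for j using basis_in_V[OF ba that] .
  have tri: "coef \<gamma> (a j) i = 0" if "i < n" "j < i" for i j
  proof (rule coef_zero_beyond[OF \<gamma>(1), of "Suc j"])
   show "a j : span (\<gamma> ` {..<Suc j})" using \<gamma>(2)[of "Suc j"] that by (simp add: span_base)
  qed (use that in auto)
  have diag: "(PROD i<n. coef \<gamma> (a i) i) = s"
  proof -
   have "Determinant.det (change f \<gamma>) = 1" using wedge_ratio_eq[OF f(1) basis_in_V[OF \<gamma>(1)]] \<gamma>(3) by simp
   then have "s = Determinant.det (change \<gamma> a)" using det_change_mult[OF f(1) \<gamma>(1) aV] by (simp add: s_def)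
   then show ?thesis using det_change_triangular[OF tri] by simp
  qed
  have diag_nz: "coef \<gamma> (a i) i ~= 0" if "i < n" for i
  proof
   assume "coef \<gamma> (a i) i = 0"
   then have "(PROD i<n. coef \<gamma> (a i) i) = 0" using that by (intro prod_zero) auto
   then show False using diag s by auto
  qed
  define h where "h = (%e. (c e, %j. if j < n then complex_of_real (coef \<gamma> (rho e) j) else 0))"
  have sh: "scale_form (of_real t) (h e) = (of_real t * c e, %j. if j < n then complex_of_real (coef \<gamma> (rho e) j) else 0)" for t e by (simp add: scale_form_def h_def)
  have fv: "fvalue n (scale_form (of_real t) (h e)) z = pairing I (rho e) (point \<gamma> z) + of_real t * c e" if "e : E" for t e z
  proof -
   have "pairing I (rho e) (point \<gamma> z) = (SUM j<n. of_real (coef \<gamma> (rho e) j) * z j)"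
    using pairing_expand[OF \<gamma>(1), of "rho e" "point \<gamma> z"] rho[OF that] point(2)[OF \<gamma>(1)] by simp
   then show ?thesis by (simp add: fvalue_def sh)
  qed
  have adm: "admissible_form n 0 (h e)" if "e : E" for e
  proof -
   have "\<exists>j<n. coef \<gamma> (rho e) j ~= 0"
   proof (rule ccontr)
    assume "\<not> (\<exists>j<n. coef \<gamma> (rho e) j ~= 0)"
    then have "rho e = (SUM j<n. 0)" using coef_expand[OF \<gamma>(1), of "rho e"] rho[OF that] by simp
    then show False using rho[OF that] by simp
   qed
   then show ?thesis by (auto simp: admissible_form_def h_def)
  qed
  have leads: "leads n i (h e) \<longleftrightarrow> rho e = a i" if e: "e : E" and i: "i < n" for e i
  proof
   assume l: "leads n i (h e)"
   then have "rho e : A" using c[OF e] by (simp add: leads_def h_def)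
   then obtain k where k: "k < n" "rho e = a k" using a by blast
   have "\<not> k < i" using l tri[OF i, of k] k i by (auto simp: leads_def h_def)
   moreover have "\<not> i < k" using l diag_nz[OF k(1)] k by (auto simp: leads_def h_def)
   ultimately show "rho e = a i" using k by simp
  next
   assume "rho e = a i"
   moreover from this have "c e = 0" using c[OF e] a i by auto
   ultimately show "leads n i (h e)" using diag_nz[OF i] tri i by (auto simp: leads_def h_def)
  qed
  have JKt: "JK_local I r A xi (\<phi> t) = of_real s *
    (SUM S:Pow E. if card S < n then 0 else inverse (of_real t) ^ (card S - n) * leading_residue n h K S)" if t: "t > 0" for t
  proof -
   have "sgn s = s" using s by auto
   then have sign: "flag_sign I r A f F = s" using flag_sign_enumeration[OF A a f(1), of F] F unfolding s_def by metis
   have "flag_residue I r f F (\<phi> t) = iterated_residue n (%z. \<phi> t (point \<gamma> z))" by (simp add: flag_residue_def Let_def \<gamma>_def point_def)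
   also have "... = (SUM S:Pow E. if card S < n then 0 else inverse (of_real t) ^ (card S - n) * leading_residue n h K S)"
   proof (rule iterated_residue_scaled_sum[OF E])
    show "complex_of_real t ~= 0" using t by simp
    fix z assume z: "ALL e:E. fvalue n (scale_form (of_real t) (h e)) z ~= 0"
    have "\<phi> t (point \<gamma> z) = (SUM S:Pow E. K S * (PROD e:S. inverse (pairing I (rho e) (point \<gamma> z) + of_real t * c e)))"
     by (rule \<phi>[OF t point(1)[OF \<gamma>(1)]]) (use z fv in auto)
    also have "... = (SUM S:Pow E. K S * (PROD e:S. inverse (fvalue n (scale_form (of_real t) (h e)) z)))"
     by (intro sum.cong refl arg_cong2[of _ _ _ _ "(*)"] prod.cong arg_cong[of _ _ inverse]) (use fv in auto)
    finally show "\<phi> t (point \<gamma> z) = (SUM S:Pow E. K S * (PROD e:S. inverse (fvalue n (scale_form (of_real t) (h e)) z)))" .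
   qed (rule adm)
   finally show ?thesis by (simp add: JK f_def[symmetric] Fs sign)
  qed
  have G: "leading_residue n h K S = (if rho ` S = A then K S * of_real s else 0)" if S: "S : Pow E" "card S = n" for S
  proof -
   have finS: "finite S" using S E by (auto intro: finite_subset)
   show ?thesis
   proof (cases "rho ` S = A")
    case True
    have "inj_on rho S" by (rule eq_card_imp_inj_on[OF finS]) (simp add: True A(3) S(2))
    then have b1: "bij_betw rho S A" using True by (simp add: bij_betw_def)
    have b2: "bij_betw a {..<n} A" using ba a by (simp add: bij_betw_def ordered_basis_def)
    define p where "p = the_inv_into {..<n} a \<circ> rho"
    have p: "bij_betw p S {..<n}" unfolding p_def by (rule bij_betw_trans[OF b1 bij_betw_the_inv_into[OF b2]])
    have ap: "a (p e) = rho e" if "e : S" for e using f_the_inv_into_f_bij_betw[OF b2] that True unfolding p_def by auto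
    have pn: "p e < n" if "e : S" for e using p that by (auto simp: bij_betw_def)
    have "leading_residue n h K S = K S * (PROD e:S. inverse (snd (h e) (p e)))" by (rule leading_residue_simple[OF finS p]) (use leads pn ap S(1) in auto)
    also have "(PROD e:S. inverse (snd (h e) (p e))) = (PROD e:S. inverse (of_real (coef \<gamma> (a (p e)) (p e))))" by (rule prod.cong) (auto simp: h_def pn ap)
    also have "... = (PROD i<n. inverse (of_real (coef \<gamma> (a i) i)))" by (rule prod.reindex_bij_betw[OF p])
    also have "... = of_real (inverse s)" unfolding diag[symmetric] by (simp add: prod_inversef[symmetric] o_def)
    also have "inverse s = s" using s by auto
    finally show ?thesis using True by simp
   next
    case False
    have "EX v:A. v ~: rho ` S"
    proof (rule ccontr)
     assume "\<not> (EX v:A. v ~: rho ` S)"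
     then have "A \<subseteq> rho ` S" by blast
     moreover have "card (rho ` S) <= card A" using card_image_le[OF finS, of rho] S(2) A(3) by simp
     ultimately show False using card_seteq[of "rho ` S" A] finS False by auto
    qed
    then obtain i where i: "i < n" "a i ~: rho ` S" using a by blast
    have "leading_residue n h K S = 0"
    proof (rule leading_residue_missing[OF finS i(1)])
     fix e assume e: "e : S"
     then have eE: "e : E" using S(1) by blast
     have "rho e ~= a i" using e i(2) by (metis imageI)
     then show "\<not> leads n i (h e)" using leads[OF eE i(1)] by simp
     show "admissible_form n 0 (h e)" by (rule adm[OF eE])
    qed
    then show ?thesis using False by simp
   qed
  qed
  have lim: "((%t. if card S < n then 0 else inverse (complex_of_real t) ^ (card S - n) * leading_residue n h K S)
   \<longlongrightarrow> (if card S = n & rho ` S = A then K S * of_real s else 0)) at_top" if S: "S : Pow E" for S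
  proof -
   consider "card S < n" | "card S = n" | "card S > n" by linarith
   then show ?thesis
   proof cases
    case 3
    have "((%t. complex_of_real (inverse t)) \<longlongrightarrow> of_real 0) at_top" by (intro tendsto_of_real tendsto_inverse_0_at_top filterlim_ident)
    then have i0: "((%t. inverse (complex_of_real t)) \<longlongrightarrow> 0) at_top" by simp
    have "((%t. inverse (complex_of_real t) ^ (card S - n) * leading_residue n h K S) \<longlongrightarrow> 0 ^ (card S - n) * leading_residue n h K S) at_top" by (intro tendsto_intros i0)
    then show ?thesis using 3 by (simp add: power_0_left)
   qed (use G[OF S] in auto)
  qed
  have "((%t. of_real s * (SUM S:Pow E. if card S < n then 0 else inverse (complex_of_real t) ^ (card S - n) * leading_residue n h K S))
   \<longlongrightarrow> of_real s * (SUM S:Pow E. if card S = n & rho ` S = A then K S * of_real s else 0)) at_top" by (intro tendsto_mult tendsto_const tendsto_sum lim)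
  also have "of_real s * (SUM S:Pow E. if card S = n & rho ` S = A then K S * of_real s else 0)
   = (SUM S:Pow E. if card S = n & rho ` S = A & (ALL v:A. ?x v > 0) then K S else 0)" unfolding sum_distrib_left by (rule sum.cong) (use s True in auto)
  finally show ?thesis by (rule Lim_transform_eventually) (use JKt in "auto intro: eventually_mono[OF eventually_gt_at_top[of 0]]")
 qed
qed

end

section \<open>The residue of an abelian quiver for large charges\<close>

lemma finite_line_meets_subspace:
 fixes v w :: "'a::real_vector"
 assumes U: "Real_Vector_Spaces.subspace U" and w: "w ~: U"
 shows "finite {c. v + c *\<^sub>R w : U}"
proof -
 have "c = c'" if "v + c *\<^sub>R w : U" "v + c' *\<^sub>R w : U" for c c'
 proof (rule ccontr)
  assume ne: "c ~= c'"
  have "(v + c *\<^sub>R w) - (v + c' *\<^sub>R w) : U" by (rule real_vector.subspace_diff[OF U that])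
  then have "(c - c') *\<^sub>R w : U" by (simp add: scaleR_diff_left)
  then have "inverse (c - c') *\<^sub>R ((c - c') *\<^sub>R w) : U" by (rule real_vector.subspace_scale[OF U])
  then show False using w ne by simp
 qed
 then have "{c. v + c *\<^sub>R w : U} = {} \<or> (EX c. {c. v + c *\<^sub>R w : U} = {c})" by blast
 then show ?thesis by (metis finite.emptyI finite.insertI)
qed

context coordinate_space begin

text \<open>A line in a suitable direction meets each further subspace at most once.\<close>
lemma avoid_subspaces:
 assumes "finite \<U>" "!!U. U : \<U> ==> Real_Vector_Spaces.subspace U & U \<subseteq> V & U ~= V"
 shows "EX w:V. ALL U:\<U>. w ~: U"
 using assms
proof (induction \<U>)
 case empty
 show ?case using subspace_V by (auto intro: real_vector.subspace_0)
next
 case (insert U \<U>)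
 obtain w where w: "w : V" "ALL U:\<U>. w ~: U" using insert by blast
 have U: "Real_Vector_Spaces.subspace U" "U \<subseteq> V" "U ~= V" using insert.prems by auto
 then obtain v where v: "v : V" "v ~: U" by blast
 have bad: "finite {c. v + c *\<^sub>R w : U'}" if "U' : \<U>" for U'
 proof -
  have "Real_Vector_Spaces.subspace U'" "w ~: U'" using insert.prems w that by auto
  then show ?thesis by (rule finite_line_meets_subspace)
 qed
 show ?case
 proof (cases "w : U")
  case True
  have "finite (UN U':\<U>. {c. v + c *\<^sub>R w : U'})" using bad insert.hyps by blast
  then obtain c where c: "c ~: (UN U':\<U>. {c. v + c *\<^sub>R w : U'})" using ex_new_if_finite[OF infinite_UNIV_char_0] by blast
  have "v + c *\<^sub>R w ~: U"
  proof
   assume "v + c *\<^sub>R w : U"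
   then have "(v + c *\<^sub>R w) - c *\<^sub>R w : U" using U(1) True by (intro real_vector.subspace_diff real_vector.subspace_scale)
   then show False using v(2) by simp
  qed
  moreover have "v + c *\<^sub>R w : V" using v(1) w(1) subspace_V by (intro real_vector.subspace_add real_vector.subspace_scale)
  ultimately show ?thesis using c by blast
 qed (use w in blast)
qed

lemma span_proper:
 assumes "T \<subseteq> V" "finite T" "card T + 1 = n" shows "span T \<subseteq> V" "span T ~= V"
proof -
 show "span T \<subseteq> V" by (rule span_minimal[OF assms(1) subspace_V])
 show "span T ~= V" using spanning_card_ge[of T] assms by auto
qed

text \<open>A short segment in a generic direction stays in the chamber and leaves all finitely many hyperplanes.\<close>
lemma regular_perturbation:
 assumes S: "finite S" "W \<subseteq> S" "S \<subseteq> V" and zeta: "zeta : regular_vectors I r W"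
 shows "\<exists>xi. xi : regular_vectors I r S & same_chamber I r W zeta xi"
proof -
 let ?T = "%S. {T. T \<subseteq> S & card T + 1 = n}"
 have finT: "finite (?T S)" using S(1) by simp
 have T: "Real_Vector_Spaces.subspace (span T) & span T \<subseteq> V & span T ~= V" if "T : ?T S" for T using span_proper[of T] that S(1,3) finite_subset[of T S] by auto
 have "EX w:V. ALL U:span ` ?T S. w ~: U"
 proof (rule avoid_subspaces)
  show "finite (span ` ?T S)" by (rule finite_imageI[OF finT])
  fix U assume "U : span ` ?T S"
  then obtain T where t: "T : ?T S" "U = span T" by (elim imageE)
  show "Real_Vector_Spaces.subspace U & U \<subseteq> V & U ~= V" unfolding t(2) by (rule T[OF t(1)])
 qed
 then obtain w where w1: "w : V" and w2: "ALL U:span ` ?T S. w ~: U" by (elim bexE)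
 have w: "w : V" "!!T. T : ?T S ==> w ~: span T" using w1 bspec[OF w2 imageI] .
 define bad where "bad = (UN T:?T S. {c. zeta + c *\<^sub>R w : span T})"
 have finb: "finite bad" unfolding bad_def using finT w(2) by (intro finite_UN_I finite_line_meets_subspace) auto
 have "\<exists>e>0. ALL c:bad. c > 0 --> e < c"
 proof (cases "{c:bad. c > 0} = {}")
  case True
  then show ?thesis by (intro exI[of _ 1]) auto
 next
  case False
  have f: "finite {c:bad. c > 0}" using finb by simp
  have "Min {c:bad. c > 0} > 0" using Min_in[OF f False] by simp
  then show ?thesis using Min_le[OF f] by (intro exI[of _ "Min {c:bad. c > 0} / 2"]) force
 qed
 then obtain e where e: "e > 0" "!!c. c : bad ==> c > 0 ==> e < c" by blast
 have zV: "zeta : V" using zeta by (simp add: regular_vectors_def)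
 have inV: "zeta + c *\<^sub>R w : V" for c using zV w(1) subspace_V by (intro real_vector.subspace_add real_vector.subspace_scale)
 have good: "zeta + c *\<^sub>R w : regular_vectors I r S" if "0 < c" "c <= e" for c
 proof -
  have "c ~: bad" using e(2)[of c] that by auto
  then show ?thesis using inV unfolding regular_vectors_def bad_def by blast
 qed
 have mono: "regular_vectors I r S \<subseteq> regular_vectors I r W" using S(2) unfolding regular_vectors_def by blast
 let ?L = "(%c. zeta + c *\<^sub>R w) ` {0..e}"
 have "continuous_on {0..e} (%c. zeta + c *\<^sub>R w)" by (rule continuous_on_coordinatewise_then_product) (auto simp: scaleR_fun_def intro!: continuous_intros)
 then have "Topological_Spaces.connected ?L" by (rule connected_continuous_image) simp
 moreover have "?L \<subseteq> regular_vectors I r W"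
 proof
  fix x assume "x : ?L"
  then obtain c where c: "0 <= c" "c <= e" "x = zeta + c *\<^sub>R w" by auto
  show "x : regular_vectors I r W" using zeta good[of c] c mono by (cases "c = 0") auto
 qed
 moreover have "zeta : ?L" using e(1) by (intro image_eqI[of _ _ 0]) auto
 moreover have "zeta + e *\<^sub>R w : ?L" using e(1) by auto
 ultimately have "same_chamber I r W zeta (zeta + e *\<^sub>R w)" unfolding same_chamber_def connected_component_def by blast
 then show ?thesis using good[of e] e(1) by auto
qed

text \<open>A vanishing coordinate would put the vector into the span of the remaining \<open>n - 1\<close> elements.\<close>
lemma representation_regular_nonzero:
 assumes W: "xi : regular_vectors I r W" and B: "B \<subseteq> W" "B \<subseteq> V" "independent B" "card B = n" and b: "b : B"
 shows "representation B xi b ~= 0"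
proof
 assume z: "representation B xi b = 0"
 have finB: "finite B" using independent_card_le B by blast
 have xi: "xi : V" using W by (simp add: regular_vectors_def)
 have "xi = (SUM v:B. representation B xi v *\<^sub>R v)" using real_vector.sum_representation_eq[of B xi B] B(3) finB independent_spans[OF B(3,2,4)] xi by simp
 also have "... = (SUM v:B - {b}. representation B xi v *\<^sub>R v)" using z finB b by (simp add: sum.remove)
 also have "... : span (B - {b})" by (intro span_sum span_scale span_base)
 finally have "xi : span (B - {b})" .
 moreover have "card (B - {b}) + 1 = n" using b finB B(4) by (simp add: card_Diff_singleton) (metis One_nat_def Suc_pred card_gt_0_iff empty_iff)
 moreover have "B - {b} \<subseteq> W" "finite (B - {b})" using B(1) finB by auto
 ultimately show False using W unfolding regular_vectors_def by blast
qed

text \<open>Two equal coordinates would put the vector into a span of \<open>n - 1\<close> elements, one of which is the sum of two basis vectors.\<close>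
lemma representation_distinct:
 assumes W: "xi : regular_vectors I r (distinct_sums W)" and B: "B \<subseteq> W" "B \<subseteq> V" "independent B" "card B = n"
 shows "inj_on (representation B xi) B"
proof (rule inj_onI, rule ccontr)
 fix b b' assume b: "b : B" "b' : B" "representation B xi b = representation B xi b'" "b ~= b'"
 have finB: "finite B" using independent_card_le B by blast
 have xi: "xi : V" using W by (simp add: regular_vectors_def)
 let ?x = "representation B xi"
 let ?C = "B - {b, b'}"
 have split: "B = insert b (insert b' ?C)" using b by blast
 have "xi = (SUM v:B. ?x v *\<^sub>R v)" using real_vector.sum_representation_eq[of B xi B] B(3) finB independent_spans[OF B(3,2,4)] xi by simp
 also have "... = ?x b *\<^sub>R b + (?x b' *\<^sub>R b' + (SUM v:?C. ?x v *\<^sub>R v))" using finB b(4) by (subst (1) split) simp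
 also have "... = ?x b *\<^sub>R (b + b') + (SUM v:?C. ?x v *\<^sub>R v)" using b(3) by (simp add: scaleR_add_right add.assoc)
 also have "... : span (insert (b + b') ?C)" by (intro span_add span_scale span_sum span_base) auto
 finally have xiT: "xi : span (insert (b + b') ?C)" .
 have "b + b' ~: ?C"
 proof
  assume c: "b + b' : ?C"
  have "b = (b + b') - b'" by simp
  also have "... : span (B - {b})" using c b by (intro span_diff span_base) auto
  finally show False using B(3) b(1) by (auto simp: dependent_def)
 qed
 moreover have "card B = Suc (Suc (card ?C))" using finB b(4) by (subst (1) split) simp
 ultimately have "card (insert (b + b') ?C) + 1 = n" using finB B(4) by simp
 moreover have "insert (b + b') ?C \<subseteq> distinct_sums W"
 proof -
  have "b + b' = \<Sum>{b, b'}" using b(4) by simp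
  then have "b + b' : distinct_sums W" using b B(1) unfolding distinct_sums_def by blast
  moreover have "v : distinct_sums W" if "v : ?C" for v
  proof -
   have "v = \<Sum>{v}" "{v} \<subseteq> W" using that B(1) by auto
   then show ?thesis unfolding distinct_sums_def by blast
  qed
  ultimately show ?thesis by blast
 qed
 moreover have "finite (insert (b + b') ?C)" using finB by simp
 ultimately show False using W xiT unfolding regular_vectors_def by blast
qed

text \<open>Coordinates are continuous and do not vanish on the connected chamber.\<close>
lemma representation_sign_chamber:
 assumes ch: "same_chamber I r W zeta xi" and B: "B \<subseteq> W" "B \<subseteq> V" "independent B" "card B = n" and b: "b : B"
  and pos: "representation B zeta b > 0"
 shows "representation B xi b > 0"
proof (rule ccontr)
 assume neg: "\<not> representation B xi b > 0"
 obtain C where C: "Topological_Spaces.connected C" "C \<subseteq> regular_vectors I r W" "zeta : C" "xi : C" using ch unfolding same_chamber_def connected_component_def by blast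
 have CV: "C \<subseteq> V" using C(2) by (auto simp: regular_vectors_def)
 have sp: "span B = V" by (rule independent_spans[OF B(3,2,4)])
 let ?l = "%v. SUM x:I - {r}. v x * representation B (coord_fun r x) b"
 have l: "?l v = representation B v b" if v: "v : V" for v
 proof -
  have "representation B v b = representation B (SUM x:I - {r}. v x *\<^sub>R coord_fun r x) b" using V_expand[OF v] by simp
  also have "... = (SUM x:I - {r}. representation B (v x *\<^sub>R coord_fun r x) b)" by (subst real_vector.representation_sum[OF B(3)])
    (use sp coord_fun_V subspace_V in "auto intro!: real_vector.subspace_scale")
  also have "... = ?l v" by (intro sum.cong refl) (use sp coord_fun_V in "simp add: real_vector.representation_scale[OF B(3)]")
  finally show ?thesis by simp
 qed
 have "continuous_on C ?l" by (intro continuous_on_sum continuous_on_mult_right continuous_on_subset[OF continuous_on_product_coordinates]) auto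
 then have conn: "Topological_Spaces.connected (?l ` C)" using C(1) by (rule connected_continuous_image)
 have "0 : ?l ` C" by (rule connectedD_interval[OF conn, of "?l xi" "?l zeta"]) (use C pos neg l CV in auto)
 then obtain v where "v : C" "representation B v b = 0" using l CV by auto
 then show False using representation_regular_nonzero[OF _ B b] C(2) by blast
qed

lemma point_unique:
 fixes u w :: "'i => complex"
 assumes g: "basis g" and u: "u : coord_space I r" "w : coord_space I r"
  and eq: "!!i. i < n ==> pairing I (g i) u = pairing I (g i) w"
 shows "u = w"
proof
 fix x show "u x = w x"
 proof (cases "x : I - {r}")
  case True
  have "pairing I (coord_fun r x) u = pairing I (coord_fun r x) w" using pairing_expand[OF g coord_fun_V] eq True by simp
  then show ?thesis using True by (simp add: pairing_coord_fun)
 qed (use u in "auto simp: coord_space_def")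
qed

lemma enumerate_independent:
 assumes A: "independent A" "A \<subseteq> V" "card A = n"
 obtains g where "basis g" "g ` {..<n} = A"
proof -
 have "finite A" using independent_card_le A by blast
 then obtain g where "bij_betw g {0..<n} A" using ex_bij_betw_nat_finite[of A] unfolding A(3) by blast
 then have "g ` {..<n} = A" by (simp add: bij_betw_def atLeast0LessThan)
 then show ?thesis using that enumeration_basis[OF A] by blast
qed

end

locale abelian_quiver =
 fixes G :: "('i, 'b) pre_digraph" and v0 :: 'i
 assumes finite_verts: "finite (verts G)" and finite_arcs: "finite (arcs G)" and v0: "v0 : verts G"
  and arc_ends: "a : arcs G ==> tail G a : verts G & head G a : verts G & tail G a ~= head G a"
begin

sublocale coordinate_space "verts G" v0 by unfold_locales (rule finite_verts)

abbreviation rho where "rho \<equiv> arrow_fun G v0"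
abbreviation W where "W \<equiv> quiver_weights G v0"

lemma card_n: "n = card (verts G) - 1"
 using v0 finite_verts by (simp add: card_Diff_singleton)

lemma card_n': "Suc n = card (verts G)"
 using v0 finite_verts by (metis card_Suc_Diff1)

lemma arrow_V: "a : arcs G ==> rho a : V"
 unfolding arrow_fun_def using arc_ends subspace_V by (intro real_vector.subspace_diff coord_fun_V) auto

lemma arrow_nonzero: assumes "a : arcs G" shows "rho a ~= 0"
proof
 assume z: "rho a = 0"
 have "rho a (head G a) = 0" "rho a (tail G a) = 0" unfolding z by simp_all
 then show False using arc_ends[OF assms] by (auto simp: arrow_fun_def coord_fun_def split: if_splits)
qed

lemma W_V: "W \<subseteq> V" and finite_W: "finite W"
 using arrow_V finite_arcs by (auto simp: quiver_weights_def)

lemma Z_hat_arrows: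
 "Z_hat G v0 R u = (-1) ^ n * (PROD a:arcs G. (pairing (verts G) (rho a) u + of_real (R (rho a)) - 1) / (pairing (verts G) (rho a) u + of_real (R (rho a))))"
proof -
 let ?g = "%w. (pairing (verts G) w u + of_real (R w) - 1) / (pairing (verts G) w u + of_real (R w))"
 have "(PROD a:arcs G. ?g (rho a)) = (PROD w:W. PROD a:{a:arcs G. rho a = w}. ?g (rho a))" unfolding quiver_weights_def by (rule prod.image_gen[OF finite_arcs])
 also have "... = (PROD w:W. ?g w ^ weight_mult G v0 w)" by (rule prod.cong) (simp_all add: weight_mult_def)
 finally show ?thesis by (simp add: Z_hat_def card_n)
qed

lemma Z_hat_expand:
 assumes "!!a. a : arcs G ==> pairing (verts G) (rho a) u + of_real (R (rho a)) ~= 0"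
 shows "Z_hat G v0 R u = (SUM S:Pow (arcs G). (-1) ^ n * (-1) ^ card S * (PROD a:S. inverse (pairing (verts G) (rho a) u + of_real (R (rho a)))))"
proof -
 let ?y = "%a. pairing (verts G) (rho a) u + of_real (R (rho a))"
 have "(PROD a:arcs G. (?y a - 1) / ?y a) = (PROD a:arcs G. - inverse (?y a) + 1)" by (rule prod.cong[OF refl]) (use assms in "simp add: field_simps")
 also have "... = (SUM S:Pow (arcs G). (-1) ^ card S * (PROD a:S. inverse (?y a)))" unfolding prod_add[OF finite_arcs] by (simp only: prod_uminus prod.neutral_const mult_1_right)
 finally show ?thesis by (simp add: Z_hat_arrows sum_distrib_left mult.assoc)
qed

lemma M_sing_weights:
 assumes P: "is_charge_cone G v0 P" "R : P" and x: "x : M_sing G v0 R"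
 shows "independent (weights_at G v0 R x)" "weights_at G v0 R x \<subseteq> W" "card (weights_at G v0 R x) = n"
proof -
 let ?A = "weights_at G v0 R x"
 show AW: "?A \<subseteq> W" by (auto simp: weights_at_def)
 have finA: "finite ?A" using finite_subset[OF AW finite_W] .
 obtain B where B: "B \<subseteq> ?A" "independent B" "card B = n" using x unfolding M_sing_def card_n by blast
 have "card ?A < card (verts G)" using P x unfolding is_charge_cone_def by blast
 then have "card ?A <= card B" using card_n' B(3) by simp
 then have "B = ?A" using card_seteq[OF finA B(1)] by blast
 then show "independent ?A" "card ?A = n" using B by auto
qed

lemma M_sing_of_basis:
 assumes B: "B \<subseteq> W" "independent B" "card B = n"
 shows "EX x:M_sing G v0 R. B \<subseteq> weights_at G v0 R x"
proof -
 obtain g where g: "basis g" "g ` {..<n} = B" using enumerate_independent[OF B(2) _ B(3)] B(1) W_V by blast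
 let ?x = "point g (%i. - of_real (R (g i)))"
 have "b : weights_at G v0 R ?x" if "b : B" for b by (use g(2) imageE point(2) g(1) B(1) that in "auto simp: weights_at_def")
 then have "B \<subseteq> weights_at G v0 R ?x" by blast
 moreover from this have "?x : M_sing G v0 R" unfolding M_sing_def card_n[symmetric] using point(1)[OF g(1)] B by blast
 ultimately show ?thesis by blast
qed

text \<open>A singular point is the unique solution of the linear system given by its basis of weights.\<close>
lemma M_sing_inj:
 assumes P: "is_charge_cone G v0 P" "R : P"
 shows "inj_on (weights_at G v0 R) (M_sing G v0 R)"
proof (rule inj_onI)
 fix x y assume xy: "x : M_sing G v0 R" "y : M_sing G v0 R" and eq: "weights_at G v0 R x = weights_at G v0 R y"
 let ?A = "weights_at G v0 R x"
 note A = M_sing_weights[OF P xy(1)]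
 obtain g where g: "basis g" "g ` {..<n} = ?A" using enumerate_independent[OF A(1) _ A(3)] A(2) W_V by blast
 show "x = y"
 proof (rule point_unique[OF g(1)])
  show "x : coord_space (verts G) v0" "y : coord_space (verts G) v0" using xy by (auto simp: M_sing_def)
  fix i assume "i < n"
  then have "g i : ?A" "g i : weights_at G v0 R y" using g(2) eq by auto
  then have "pairing (verts G) (g i) x + of_real (R (g i)) = 0" "pairing (verts G) (g i) y + of_real (R (g i)) = 0" by (auto simp: weights_at_def)
  then show "pairing (verts G) (g i) x = pairing (verts G) (g i) y" by (metis add_right_cancel)
 qed
qed

lemma pairing_mult: "pairing (verts G) v (%i. t * x i) = t * pairing (verts G) v x"
 by (simp add: pairing_def sum_distrib_left mult_ac)

lemma pairing_plus: "pairing (verts G) v (x + y) = pairing (verts G) v x + pairing (verts G) v y"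
 by (simp add: pairing_def sum.distrib distrib_left)

lemma weights_at_scale:
 assumes "t ~= 0" shows "weights_at G v0 (t *\<^sub>R R) (%i. of_real t * x i) = weights_at G v0 R x"
proof -
 have "of_real t * pairing (verts G) w x + of_real (t * R w) = of_real t * (pairing (verts G) w x + of_real (R w))" for w by (simp add: algebra_simps)
 then show ?thesis using assms by (simp add: weights_at_def pairing_mult scaleR_fun_def)
qed

lemma M_sing_scale:
 assumes t: "t ~= 0" shows "M_sing G v0 (t *\<^sub>R R) = (%x i. of_real t * x i) ` M_sing G v0 R"
proof (intro equalityI subsetI)
 have *: "(%i. of_real t * x i) : M_sing G v0 (t *\<^sub>R R)" if "x : M_sing G v0 R" "t ~= 0" for x t R
  using that unfolding M_sing_def mem_Collect_eq weights_at_scale[OF that(2)] by (simp add: coord_space_def)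
 show "y : M_sing G v0 (t *\<^sub>R R)" if "y : (%x i. of_real t * x i) ` M_sing G v0 R" for y using * that t by blast
 fix y assume "y : M_sing G v0 (t *\<^sub>R R)"
 from *[OF this, of "inverse t"] have "(%i. of_real (inverse t) * y i) : M_sing G v0 R" using t by simp
 moreover have "y = (%i. of_real t * (of_real (inverse t) * y i))" using t by (simp add: mult.assoc[symmetric] flip: of_real_mult)
 ultimately show "y : (%x i. of_real t * x i) ` M_sing G v0 R" by (intro image_eqI)
qed

lemma finite_distinct_sums: "finite (distinct_sums W)"
proof -
 have "distinct_sums W \<subseteq> Sum ` Pow W" by (auto simp: distinct_sums_def)
 then show ?thesis using finite_W by (meson finite_Pow_iff finite_imageI finite_subset)
qed

lemma W_distinct_sums: "W \<subseteq> distinct_sums W"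
proof
 fix w assume "w : W"
 then have "w = \<Sum>{w}" "{w} \<subseteq> W" by auto
 then show "w : distinct_sums W" unfolding distinct_sums_def by blast
qed

lemma distinct_sums_V: "distinct_sums W \<subseteq> V"
 unfolding distinct_sums_def using W_V by (auto intro!: real_vector.subspace_sum[OF subspace_V])

text \<open>Scaling the charges scales the singular points and keeps their weights. The sum over singular points of the local limits runs over the bases among the weights, each arising from exactly one point.\<close>
theorem JK_quiver_large_charge:
 assumes P: "is_charge_cone G v0 P" "R : P"
  and reg: "- lift (verts G) v0 eta : regular_vectors (verts G) v0 W"
 shows "((%t. JK_quiver G v0 (t *\<^sub>R R) eta) \<longlongrightarrow>
  of_nat (card {S. S \<subseteq> arcs G & card S = n & independent (rho ` S) & card (rho ` S) = n
   & (ALL v:rho ` S. representation (rho ` S) (- lift (verts G) v0 eta) v > 0)})) at_top"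
proof -
 let ?z = "- lift (verts G) v0 eta"
 let ?M = "M_sing G v0 R"
 let ?A = "weights_at G v0 R"
 define xi where "xi = (SOME xi. xi : regular_vectors (verts G) v0 (distinct_sums W) & same_chamber (verts G) v0 W ?z xi)"
 have xi: "xi : regular_vectors (verts G) v0 (distinct_sums W)" "same_chamber (verts G) v0 W ?z xi"
  using someI_ex[OF regular_perturbation[OF finite_distinct_sums W_distinct_sums distinct_sums_V reg]] unfolding xi_def by blast+
 have xiW: "xi : regular_vectors (verts G) v0 W" using xi(1) W_distinct_sums unfolding regular_vectors_def by blast
 have finM: "finite ?M" by (rule finite_imageD[OF _ M_sing_inj[OF P]], rule finite_subset[of _ "Pow W"])
   (use M_sing_weights(2)[OF P] finite_W in auto)
 have sgn: "representation B xi v > 0 \<longleftrightarrow> representation B ?z v > 0" if B: "B \<subseteq> W" "independent B" "card B = n" and v: "v : B" for B v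
 proof
  have BV: "B \<subseteq> V" using B(1) W_V by blast
  have "same_chamber (verts G) v0 W xi ?z" using xi(2) unfolding same_chamber_def by (rule connected_component_sym)
  then show "representation B xi v > 0 ==> representation B ?z v > 0" by (rule representation_sign_chamber[OF _ B(1) BV B(2,3) v])
  show "representation B ?z v > 0 ==> representation B xi v > 0" by (rule representation_sign_chamber[OF xi(2) B(1) BV B(2,3) v])
 qed
 let ?p = "%B. ALL v:B. representation B xi v > 0"
 let ?K = "%S :: 'b set. (-1) ^ n * (-1) ^ card S :: complex"
 let ?\<phi> = "%x t u. Z_hat G v0 (t *\<^sub>R R) (u + (%i. of_real t * x i))"
 have JK: "JK_quiver G v0 (t *\<^sub>R R) eta = (SUM x:?M. JK_local (verts G) v0 (?A x) xi (?\<phi> x t))" if t: "t > 0" for t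
 proof -
  have inj: "inj_on (%x i. complex_of_real t * x i) ?M" using t by (intro inj_onI) (auto simp: fun_eq_iff)
  show ?thesis using t unfolding JK_quiver_def Let_def xi_def[symmetric] by (simp add: M_sing_scale sum.reindex[OF inj] weights_at_scale)
 qed
 have local: "((%t. JK_local (verts G) v0 (?A x) xi (?\<phi> x t)) \<longlongrightarrow>
   (SUM S:Pow (arcs G). if card S = n & rho ` S = ?A x & ?p (?A x) then ?K S else 0)) at_top" if x: "x : ?M" for x
 proof -
  note A = M_sing_weights[OF P x]
  have AV: "?A x \<subseteq> V" using A(2) W_V by blast
  show ?thesis
  proof (rule JK_local_large_charge[OF A(1) AV A(3), where c = "%a. pairing (verts G) (rho a) x + of_real (R (rho a))"])
   show "xi : V" using xi(1) by (simp add: regular_vectors_def)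
   show "inj_on (representation (?A x) xi) (?A x)" by (rule representation_distinct[OF xi(1) A(2) AV A(1,3)])
   show "representation (?A x) xi v ~= 0" if "v : ?A x" for v by (rule representation_regular_nonzero[OF xiW A(2) AV A(1,3) that])
   show "finite (arcs G)" by (rule finite_arcs)
   show "rho e : V & rho e ~= 0" if "e : arcs G" for e using arrow_V arrow_nonzero that by blast
   show "pairing (verts G) (rho e) x + of_real (R (rho e)) = 0 \<longleftrightarrow> rho e : ?A x" if "e : arcs G" for e using that by (auto simp: weights_at_def quiver_weights_def)
   fix t :: real and u :: "'i => complex"
   have eq: "pairing (verts G) (rho e) (u + (%i. of_real t * x i)) + of_real ((t *\<^sub>R R) (rho e))
     = pairing (verts G) (rho e) u + of_real t * (pairing (verts G) (rho e) x + of_real (R (rho e)))" for e by (simp add: pairing_plus pairing_mult scaleR_fun_def algebra_simps)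
   assume "ALL e:arcs G. pairing (verts G) (rho e) u + of_real t * (pairing (verts G) (rho e) x + of_real (R (rho e))) ~= 0"
   then have "Z_hat G v0 (t *\<^sub>R R) (u + (%i. of_real t * x i)) = (SUM S:Pow (arcs G). ?K S *
     (PROD a:S. inverse (pairing (verts G) (rho a) (u + (%i. of_real t * x i)) + of_real ((t *\<^sub>R R) (rho a)))))" by (intro Z_hat_expand) (simp only: eq, blast)
   then show "?\<phi> x t u = (SUM S:Pow (arcs G). ?K S *
     (PROD e:S. inverse (pairing (verts G) (rho e) u + of_real t * (pairing (verts G) (rho e) x + of_real (R (rho e))))))" by (simp only: eq)
  qed
 qed
 let ?F = "{S. S \<subseteq> arcs G & card S = n & independent (rho ` S) & card (rho ` S) = n & (ALL v:rho ` S. representation (rho ` S) ?z v > 0)}"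
 have "((%t. SUM x:?M. JK_local (verts G) v0 (?A x) xi (?\<phi> x t)) \<longlongrightarrow>
   (SUM x:?M. SUM S:Pow (arcs G). if card S = n & rho ` S = ?A x & ?p (?A x) then ?K S else 0)) at_top" by (intro tendsto_sum local)
 also have "(SUM x:?M. SUM S:Pow (arcs G). if card S = n & rho ` S = ?A x & ?p (?A x) then ?K S else 0)
   = (SUM S:Pow (arcs G). SUM x:?M. if card S = n & rho ` S = ?A x & ?p (?A x) then ?K S else 0)" by (rule sum.swap)
 also have "... = (SUM S:Pow (arcs G). if S : ?F then 1 else 0)"
 proof (rule sum.cong[OF refl])
  fix S assume S: "S : Pow (arcs G)"
  have rhoS: "rho ` S \<subseteq> W" using S by (auto simp: quiver_weights_def)
  show "(SUM x:?M. if card S = n & rho ` S = ?A x & ?p (?A x) then ?K S else 0) = (if S : ?F then 1 else 0)"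
  proof (cases "card S = n & independent (rho ` S) & card (rho ` S) = n")
   case True
   obtain y where y: "y : ?M" "rho ` S \<subseteq> ?A y" using M_sing_of_basis[OF rhoS] True by blast
   have finA: "finite (?A y)" using finite_subset[OF M_sing_weights(2)[OF P y(1)] finite_W] .
   have Ay: "rho ` S = ?A y" using card_subset_eq[OF finA y(2)] True M_sing_weights(3)[OF P y(1)] by simp
   have xy: "rho ` S = ?A x \<longleftrightarrow> x = y" if "x : ?M" for x using Ay M_sing_inj[OF P] that y(1) by (auto dest: inj_onD)
   have K1: "?K S = 1" using True by (simp add: power_mult_distrib[symmetric])
   have "(SUM x:?M. if card S = n & rho ` S = ?A x & ?p (?A x) then ?K S else 0)
     = (SUM x:?M. if x = y then if ?p (rho ` S) then 1 else 0 else 0)"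
   proof (rule sum.cong[OF refl])
    fix x assume x: "x : ?M"
    show "(if card S = n & rho ` S = ?A x & ?p (?A x) then ?K S else 0) = (if x = y then if ?p (rho ` S) then 1 else 0 else 0)" using xy[OF x] True K1 by (cases "x = y") simp_all
   qed
   also have "... = (if ?p (rho ` S) then 1 else 0)" using finM y(1) by simp
   also have "?p (rho ` S) \<longleftrightarrow> S : ?F" using sgn[OF rhoS] True S by blast
   finally show ?thesis .
  next
   case False
   have "\<not> (card S = n & rho ` S = ?A x & ?p (?A x))" if "x : ?M" for x using False M_sing_weights[OF P that] by metis
   moreover have "S ~: ?F" using False by blast
   ultimately show ?thesis unfolding if_not_P[OF \<open>S ~: ?F\<close>] by (intro sum.neutral ballI) (simp only: if_False)
  qed
 qed
 also have "... = of_nat (card ?F)"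
 proof -
  have "(SUM S:Pow (arcs G). if S : ?F then 1 else 0 :: complex) = (SUM S:{S:Pow (arcs G). S : ?F}. 1)" by (rule sum.inter_filter[symmetric]) (simp add: finite_arcs)
  also have "... = of_nat (card {S:Pow (arcs G). S : ?F})" by (simp only: sum_constant mult_1_right)
  also have "{S:Pow (arcs G). S : ?F} = ?F" by blast
  finally show ?thesis .
 qed
 finally show ?thesis
 proof (rule Lim_transform_eventually)
  show "\<forall>\<^sub>F t in at_top. (SUM x:?M. JK_local (verts G) v0 (?A x) xi (?\<phi> x t)) = JK_quiver G v0 (t *\<^sub>R R) eta"
   by (rule eventually_mono[OF eventually_gt_at_top[of 0]]) (simp only: JK)
 qed
qed

lemma JK_quiver_not_spanning:
 assumes "span W ~= V" shows "JK_quiver G v0 R eta = 0"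
proof -
 have "M_sing G v0 R = {}"
 proof (rule ccontr)
  assume "M_sing G v0 R ~= {}"
  then obtain x B where B: "B \<subseteq> weights_at G v0 R x" "independent B" "card B = n" unfolding M_sing_def card_n[symmetric] by blast
  then have BW: "B \<subseteq> W" by (auto simp: weights_at_def)
  then have "span B = V" using independent_spans[OF B(2) _ B(3)] W_V by blast
  then have "V \<subseteq> span W" using span_mono[OF BW] by simp
  moreover have "span W \<subseteq> V" by (rule span_minimal[OF W_V subspace_V])
  ultimately show False using assms by blast
 qed
 then show ?thesis by (simp add: JK_quiver_def Let_def)
qed

end

section \<open>Rigid stability vectors\<close>

definition edge_fun :: "'i => 'i \<times> 'i => 'i => real" where
 "edge_fun r e = coord_fun r (snd e) - coord_fun r (fst e)"

definition biclosed :: "('i \<times> 'i) set => 'i set => bool" where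
 "biclosed E Z \<longleftrightarrow> (ALL e:E. fst e : Z \<longleftrightarrow> snd e : Z)"

lemma coord_fun_root: "coord_fun r r = 0"
 by (rule ext) (simp add: coord_fun_def)

context coordinate_space begin

text \<open>The functional \<open>\<Sum>\<^sub>x\<^sub>\<in>\<^sub>Z u\<^sub>x\<close> on differences of coordinates; it detects the arrows that leave or enter \<open>Z\<close>.\<close>
definition cut :: "'i set => ('i => real) => real" where
 "cut Z v = (SUM x:I - {r}. (of_bool (x : Z) - of_bool (r : Z)) * v x)"

lemma cut_zero: "cut Z 0 = 0" by (simp add: cut_def)
lemma cut_add: "cut Z (v + w) = cut Z v + cut Z w"
 by (simp add: cut_def distrib_left sum.distrib)
lemma cut_scale: "cut Z (c *\<^sub>R v) = c * cut Z v"
 by (simp add: cut_def scaleR_fun_def sum_distrib_left mult_ac)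
lemma cut_minus: "cut Z (- v) = - cut Z v"
 using cut_scale[of Z "-1" v] by simp
lemma cut_diff: "cut Z (v - w) = cut Z v - cut Z w"
 using cut_add[of Z v "- w"] by (simp add: cut_minus)
lemma cut_sum: "cut Z (SUM i:A. f i) = (SUM i:A. cut Z (f i))"
proof (induction A rule: infinite_finite_induct)
 case (insert x F)
 then show ?case by (simp only: sum.insert cut_add not_False_eq_True if_False)
qed (simp_all only: sum.infinite sum.empty cut_zero not_False_eq_True)

lemma cut_coord_fun:
 assumes "x : I" shows "cut Z (coord_fun r x) = of_bool (x : Z) - of_bool (r : Z)"
proof (cases "x = r")
 case False
 have "cut Z (coord_fun r x) = (SUM y:I - {r}. if y = x then of_bool (x : Z) - of_bool (r : Z) else 0)"
  unfolding cut_def by (rule sum.cong) (use False in "auto simp: coord_fun_def")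
 then show ?thesis using finite_I assms False by simp
qed (simp add: coord_fun_root cut_zero)

lemma cut_edge:
 assumes "fst e : I" "snd e : I"
 shows "cut Z (edge_fun r e) = of_bool (snd e : Z) - of_bool (fst e : Z)"
 using assms by (simp add: edge_fun_def cut_diff cut_coord_fun)

lemma cut_lift:
 assumes r: "r : I" and Z: "Z \<subseteq> I" and eta: "sum eta I = 0"
 shows "cut Z (lift I r eta) = sum eta Z"
proof -
 have "cut Z (lift I r eta) = (SUM x:I - {r}. eta x * (of_bool (x : Z) - of_bool (r : Z)))" unfolding lift_def cut_sum cut_scale by (rule sum.cong) (auto simp: cut_coord_fun)
 also have "... = (SUM x:I. eta x * (of_bool (x : Z) - of_bool (r : Z)))" using finite_I r by (simp add: sum.remove[of I r])
 also have "... = (SUM x:I. eta x * of_bool (x : Z)) - sum eta I * of_bool (r : Z)" by (simp add: right_diff_distrib sum_subtractf sum_distrib_right)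
 also have "(SUM x:I. eta x * of_bool (x : Z)) = sum eta Z"
  using finite_I Z by (simp add: of_bool_def if_distrib[of "%c. _ * c"] sum.If_cases inf.absorb2 Int_absorb1 cong: if_cong)
 finally show ?thesis using eta by simp
qed

lemma edge_V: "fst e : I ==> snd e : I ==> edge_fun r e : V"
 unfolding edge_fun_def using subspace_V by (intro real_vector.subspace_diff coord_fun_V)

lemma lift_V: "lift I r eta : V"
 unfolding lift_def using subspace_V by (intro real_vector.subspace_sum real_vector.subspace_scale coord_fun_V) auto

lemma cut_span:
 assumes "v : span T" "!!w. w : T ==> cut Z w = 0" shows "cut Z v = 0"
 using assms(1) by (rule real_vector.span_induct)
  (use assms(2) in "auto simp: real_vector.subspace_def cut_zero cut_add cut_scale")

lemma closed_sum_zero: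
 assumes r: "r : I" and E: "E \<subseteq> I \<times> I" and eta: "sum eta I = 0"
  and sp: "lift I r eta : span (edge_fun r ` E)" and Z: "Z \<subseteq> I" "biclosed E Z"
 shows "sum eta Z = 0"
proof -
 have "cut Z (lift I r eta) = 0"
 proof (rule cut_span[OF sp])
  fix w assume "w : edge_fun r ` E"
  then obtain e where e: "e : E" "w = edge_fun r e" by blast
  then have "fst e : I" "snd e : I" "fst e : Z \<longleftrightarrow> snd e : Z" using E Z(2) by (auto simp: biclosed_def)
  then show "cut Z w = 0" unfolding e(2) by (simp add: cut_edge)
 qed
 then show ?thesis using cut_lift[OF r Z(1) eta] by simp
qed

lemma biclosed_class:
 assumes E: "E \<subseteq> I \<times> I"
 shows "biclosed E {x:I. coord_fun r x - u : span (edge_fun r ` E)}"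
 unfolding biclosed_def
proof
 fix e assume e: "e : E"
 let ?s = "span (edge_fun r ` E)"
 have s: "edge_fun r e : ?s" using e by (intro span_base imageI)
 have I: "fst e : I" "snd e : I" using e E by auto
 have "coord_fun r (snd e) - u = (coord_fun r (fst e) - u) + edge_fun r e" by (simp add: edge_fun_def)
 moreover have "coord_fun r (fst e) - u = (coord_fun r (snd e) - u) - edge_fun r e" by (simp add: edge_fun_def)
 ultimately have "coord_fun r (fst e) - u : ?s \<longleftrightarrow> coord_fun r (snd e) - u : ?s" using s by (metis span_add span_diff)
 then show "fst e : {x:I. coord_fun r x - u : ?s} \<longleftrightarrow> snd e : {x:I. coord_fun r x - u : ?s}" using I by simp
qed

text \<open>The vertices whose coordinate lies in the span form a set that contains the root and is closed in both directions.\<close>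
lemma span_if_connected:
 assumes r: "r : I" and E: "E \<subseteq> I \<times> I"
  and conn: "!!Z. Z \<subseteq> I ==> biclosed E Z ==> Z = {} \<or> Z = I"
 shows "span (edge_fun r ` E) = V"
proof
 let ?s = "span (edge_fun r ` E)"
 let ?Z = "{x:I. coord_fun r x - 0 : ?s}"
 show "?s \<subseteq> V" by (rule span_minimal[OF _ subspace_V]) (use E edge_V in auto)
 have "coord_fun r r - 0 : ?s" by (simp only: coord_fun_root diff_self span_zero)
 then have "r : ?Z" using r by blast
 then have "?Z = I" using conn[OF _ biclosed_class[OF E, of 0]] by blast
 then have "coord_fun r x : ?s" if "x : I" for x using that by (metis (no_types, lifting) diff_zero mem_Collect_eq)
 then have "span (coord_fun r ` (I - {r})) \<subseteq> ?s" by (intro span_minimal) auto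
 then show "V \<subseteq> ?s" using V_spanned by blast
qed

text \<open>Replace each coordinate by the one of a representative of its class; the sums over the classes vanish.\<close>
lemma lift_in_span:
 assumes r: "r : I" and E: "E \<subseteq> I \<times> I"
  and zero: "!!Z. Z \<subseteq> I ==> biclosed E Z ==> sum eta Z = 0"
 shows "lift I r eta : span (edge_fun r ` E)"
proof -
 let ?s = "span (edge_fun r ` E)"
 let ?C = "%x. {y:I. coord_fun r y - coord_fun r x : ?s}"
 have self: "x : ?C x" if "x : I" for x using that by (simp add: span_zero)
 have eq: "?C x = ?C y" if "y : ?C x" for x y
 proof -
  have s: "coord_fun r y - coord_fun r x : ?s" using that by simp
  have "coord_fun r z - coord_fun r x : ?s \<longleftrightarrow> coord_fun r z - coord_fun r y : ?s" for z
  proof -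
   have "coord_fun r z - coord_fun r x = (coord_fun r z - coord_fun r y) + (coord_fun r y - coord_fun r x)" by simp
   moreover have "coord_fun r z - coord_fun r y = (coord_fun r z - coord_fun r x) - (coord_fun r y - coord_fun r x)" by simp
   ultimately show ?thesis using s by (metis span_add span_diff)
  qed
  then show ?thesis by blast
 qed
 define p where "p = (%x. SOME y. y : ?C x)"
 have p: "p x : ?C x" if "x : I" for x unfolding p_def by (rule someI[of "%y. y : ?C x" x]) (rule self[OF that])
 have pconst: "p x = p y" if "?C x = ?C y" for x y unfolding p_def that ..
 have fiber: "{x:I. p x = c} = ?C c" if c: "c : p ` I" for c
 proof (intro equalityI subsetI)
  fix x assume x: "x : {x:I. p x = c}"
  have "c : ?C x" using x p[of x] by simp
  then have "?C x = ?C c" by (rule eq)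
  then show "x : ?C c" using self[of x] x by blast
 next
  fix x assume x: "x : ?C c"
  obtain y where y: "y : I" "c = p y" using c by blast
  have "?C y = ?C c" using eq[OF p[OF y(1)]] y(2) by simp
  then have "?C x = ?C y" using eq[OF x] by simp
  then show "x : {x:I. p x = c}" using pconst[of x y] y x by simp
 qed
 have "lift I r eta = (SUM x:I. eta x *\<^sub>R coord_fun r x)" unfolding lift_def using finite_I r by (simp add: sum.remove[of I r] coord_fun_root)
 also have "... = (SUM x:I. eta x *\<^sub>R (coord_fun r x - coord_fun r (p x))) + (SUM x:I. eta x *\<^sub>R coord_fun r (p x))"
  by (simp add: sum.distrib[symmetric] scaleR_diff_right)
 also have "(SUM x:I. eta x *\<^sub>R coord_fun r (p x)) = (SUM c:p ` I. SUM x:{x:I. p x = c}. eta x *\<^sub>R coord_fun r (p x))" by (rule sum.image_gen[OF finite_I])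
 also have "... = (SUM c:p ` I. (SUM x:{x:I. p x = c}. eta x) *\<^sub>R coord_fun r c)" unfolding scaleR_sum_left by (intro sum.cong[OF refl]) (simp only: mem_Collect_eq)
 also have "... = 0" by (use sum.neutral ballI fiber zero biclosed_class E scaleR_zero_left in "auto")
 finally have e: "lift I r eta = (SUM x:I. eta x *\<^sub>R (coord_fun r x - coord_fun r (p x)))" by (simp only: add_0_right)
 have "coord_fun r x - coord_fun r (p x) : ?s" if "x : I" for x
 proof -
  have "coord_fun r (p x) - coord_fun r x : ?s" using p[OF that] by simp
  then have "- (coord_fun r (p x) - coord_fun r x) : ?s" by (rule span_neg)
  then show ?thesis by simp
 qed
 then show ?thesis unfolding e by (intro span_sum span_scale)
qed

end

context abelian_quiver begin

abbreviation ends :: "'b set => ('i \<times> 'i) set" where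
 "ends S \<equiv> (%a. (tail G a, head G a)) ` S"

lemma edge_arrow: "edge_fun v0 (tail G a, head G a) = rho a"
 by (simp add: edge_fun_def arrow_fun_def)

lemma edge_ends: "edge_fun v0 ` ends S = rho ` S"
 by (simp add: image_image edge_arrow)

lemma ends_in: "S \<subseteq> arcs G ==> ends S \<subseteq> verts G \<times> verts G"
 using arc_ends by auto

lemma biclosed_ends: "biclosed (ends S) Z \<longleftrightarrow> (ALL a:S. tail G a : Z \<longleftrightarrow> head G a : Z)"
 by (simp add: biclosed_def)

lemma cut_arrow: "a : arcs G ==> cut Z (rho a) = of_bool (head G a : Z) - of_bool (tail G a : Z)"
 using cut_edge[of "(tail G a, head G a)" Z] arc_ends by (simp add: edge_arrow)

text \<open>No set of arrows cuts the vertices into several classes all of weight \<open>0\<close>. This is the consequence of regularity that all later arguments use.\<close>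
definition rigid :: "('i => real) => bool" where
 "rigid eta \<longleftrightarrow> (\<forall>S\<subseteq>arcs G. (\<forall>Z\<subseteq>verts G. biclosed (ends S) Z --> sum eta Z = 0)
   --> (\<forall>Z\<subseteq>verts G. biclosed (ends S) Z --> Z = {} \<or> Z = verts G))"

lemma rigid_spans:
 assumes "rigid eta" "S \<subseteq> arcs G" "!!Z. Z \<subseteq> verts G ==> biclosed (ends S) Z ==> sum eta Z = 0"
 shows "span (rho ` S) = V"
 unfolding edge_ends[symmetric] by (rule span_if_connected[OF v0 ends_in[OF assms(2)]]) (use assms in "unfold rigid_def, blast")

lemma rigid_regular:
 assumes rig: "rigid eta" and eta: "sum eta (verts G) = 0"
 shows "- lift (verts G) v0 eta : regular_vectors (verts G) v0 W"
 unfolding regular_vectors_def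
proof (intro CollectI conjI allI impI notI)
 show "- lift (verts G) v0 eta : V" using lift_V subspace_V by (rule real_vector.subspace_neg[rotated])
 fix T assume T: "T \<subseteq> W" "finite T & card T + 1 = n" "- lift (verts G) v0 eta : span T"
 define S where "S = {a:arcs G. rho a : T}"
 have S: "S \<subseteq> arcs G" "rho ` S = T" using T(1) by (auto simp: S_def quiver_weights_def)
 have "- (- lift (verts G) v0 eta) : span T" using T(3) by (rule span_neg)
 then have sp: "lift (verts G) v0 eta : span (edge_fun v0 ` ends S)" using S(2) by (simp add: edge_ends)
 have "span T = V" unfolding S(2)[symmetric] by (rule rigid_spans[OF rig S(1)]) (rule closed_sum_zero[OF v0 ends_in[OF S(1)] eta sp])
 then show False using spanning_card_ge[of T] T(2) by simp
qed

text \<open>A class closed in both directions is a subrepresentation and so is its complement, hence both have weight \<open>0\<close>.\<close>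
lemma semistable_spans:
 assumes rig: "rigid eta" and eta: "sum eta (verts G) = 0" and S: "S \<subseteq> arcs G" "semistable_support G eta (verts G) S"
 shows "span (rho ` S) = V"
proof (rule rigid_spans[OF rig S(1)])
 fix Z assume Z: "Z \<subseteq> verts G" "biclosed (ends S) Z"
 have c: "succ_closed G S Z" using Z(2) by (simp add: biclosed_ends succ_closed_def)
 have c': "succ_closed G S (verts G - Z)" using Z(2) S(1) arc_ends by (auto simp: biclosed_ends succ_closed_def)
 have "sum eta Z <= 0" using S(2) c Z(1) unfolding semistable_support_def by blast
 moreover have "sum eta (verts G - Z) <= 0" using S(2) c' unfolding semistable_support_def by blast
 moreover have "sum eta (verts G - Z) = - sum eta Z" using eta Z(1) finite_verts by (simp add: sum_diff)
 ultimately show "sum eta Z = 0" by simp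
qed

lemma semistable_card:
 assumes "rigid eta" "sum eta (verts G) = 0" "S \<subseteq> arcs G" "semistable_support G eta (verts G) S"
 shows "card (verts G) <= Suc (card S)"
proof -
 have finS: "finite S" using assms(3) finite_arcs by (rule finite_subset)
 have "n <= card (rho ` S)" using semistable_spans[OF assms] finS by (intro spanning_card_ge) auto
 also have "... <= card S" using finS by (rule card_image_le)
 finally show ?thesis using card_n' by simp
qed

lemma sum_image_arrows:
 assumes "inj_on rho S" shows "(SUM v:rho ` S. f v) = (SUM a:S. f (rho a))"
 using sum.reindex[OF assms] by simp

text \<open>A semistable support with \<open>n\<close> arrows is a spanning tree. Removing an arrow \<open>a\<close> leaves a subrepresentation containing the head of \<open>a\<close>, and its weight is minus the coordinate of \<open>- \<eta>\<close> at \<open>a\<close>.\<close>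
theorem semistable_iff_positive:
 assumes rig: "rigid eta" and eta: "sum eta (verts G) = 0" and S: "S \<subseteq> arcs G" "card S = n"
 shows "semistable_support G eta (verts G) S \<longleftrightarrow> independent (rho ` S) & card (rho ` S) = n
  & (ALL v:rho ` S. representation (rho ` S) (- lift (verts G) v0 eta) v > 0)"
  (is "?ss \<longleftrightarrow> ?ind & ?card & ?pos")
proof -
 let ?z = "- lift (verts G) v0 eta"
 let ?c = "representation (rho ` S) ?z"
 have finS: "finite S" using S(1) finite_arcs by (rule finite_subset)
 have SV: "rho ` S \<subseteq> V" using S(1) arrow_V by blast
 have SW: "rho ` S \<subseteq> W" using S(1) by (auto simp: quiver_weights_def)
 have zV: "?z : V" using lift_V subspace_V by (rule real_vector.subspace_neg[rotated])
 have cutz: "cut Z ?z = - sum eta Z" if "Z \<subseteq> verts G" for Z using cut_lift[OF v0 that eta] by (simp add: cut_minus)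
 have expand: "- sum eta Z = (SUM a:S. ?c (rho a) * (of_bool (head G a : Z) - of_bool (tail G a : Z)))" if ind: ?ind ?card and Z: "Z \<subseteq> verts G" for Z
 proof -
  have inj: "inj_on rho S" by (rule eq_card_imp_inj_on[OF finS]) (simp add: ind(2) S(2))
  have "?z = (SUM v:rho ` S. ?c v *\<^sub>R v)" by (rule real_vector.sum_representation_eq[symmetric, OF ind(1)])
    (use zV independent_spans[OF ind(1) SV ind(2)] finS in auto)
  also have "... = (SUM a:S. ?c (rho a) *\<^sub>R rho a)" by (rule sum_image_arrows[OF inj])
  finally have "?z = (SUM a:S. ?c (rho a) *\<^sub>R rho a)" .
  from arg_cong[OF this, of "cut Z"] have "cut Z ?z = (SUM a:S. ?c (rho a) * cut Z (rho a))" unfolding cut_sum cut_scale .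
  also have "... = (SUM a:S. ?c (rho a) * (of_bool (head G a : Z) - of_bool (tail G a : Z)))" using S(1) by (intro sum.cong refl) (simp add: cut_arrow subset_iff)
  finally show ?thesis using cutz[OF Z] by simp
 qed
 show ?thesis
 proof
  assume ss: ?ss
  have sp: "span (rho ` S) = V" by (rule semistable_spans[OF rig eta S(1) ss])
  have "n <= card (rho ` S)" using sp finS by (intro spanning_card_ge) auto
  then have card: ?card using card_image_le[OF finS, of rho] S(2) by simp
  have inj: "inj_on rho S" by (rule eq_card_imp_inj_on[OF finS]) (simp add: card S(2))
  obtain g where g: "bij_betw g {0..<n} (rho ` S)" using ex_bij_betw_nat_finite[of "rho ` S"] finS unfolding card by blast
  then have gim: "g ` {..<n} = rho ` S" by (simp add: bij_betw_def atLeast0LessThan)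
  have "basis g" by (rule basis_if_spanning) (simp_all only: gim SV sp order.refl)
  then have ind: ?ind unfolding ordered_basis_def gim by blast
  have "?c (rho a) > 0" if a: "a : S" for a
  proof -
   let ?X = "{x:verts G. coord_fun v0 x - coord_fun v0 (head G a) : span (edge_fun v0 ` ends (S - {a}))}"
   have bc: "biclosed (ends (S - {a})) ?X" by (rule biclosed_class) (use S(1) ends_in[of "S - {a}"] in blast)
   have h: "head G a : ?X" using arc_ends S(1) a by (auto simp: span_zero)
   have im: "rho ` (S - {a}) = rho ` S - {rho a}" using inj a by (auto simp: inj_on_def)
   have t: "tail G a ~: ?X"
   proof
    assume "tail G a : ?X"
    then have "coord_fun v0 (tail G a) - coord_fun v0 (head G a) : span (rho ` S - {rho a})" by (simp add: edge_ends im)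
    then have "- (coord_fun v0 (tail G a) - coord_fun v0 (head G a)) : span (rho ` S - {rho a})" by (rule span_neg)
    then have "rho a : span (rho ` S - {rho a})" by (simp add: arrow_fun_def)
    then show False using ind a by (auto simp: dependent_def)
   qed
   have sc: "succ_closed G S ?X" unfolding succ_closed_def
   proof (intro ballI impI)
    fix b assume b: "b : S" "tail G b : ?X"
    show "head G b : ?X"
    proof (cases "b = a")
     case False
     then have "tail G b : ?X \<longleftrightarrow> head G b : ?X" using bc b(1) unfolding biclosed_ends by blast
     then show ?thesis using b(2) by blast
    qed (use h in blast)
   qed
   have "?X \<subseteq> verts G --> succ_closed G S ?X --> sum eta ?X <= 0" using ss unfolding semistable_support_def by (rule spec)
   moreover have "?X \<subseteq> verts G" by (rule Collect_restrict)
   ultimately have "sum eta ?X <= 0" using sc by (elim impE)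
   moreover have "- sum eta ?X = ?c (rho a)"
   proof -
    have "- sum eta ?X = (SUM b:S. ?c (rho b) * (of_bool (head G b : ?X) - of_bool (tail G b : ?X)))" by (rule expand[OF ind card]) blast
    also have "... = (SUM b:S. if b = a then ?c (rho a) else 0)"
    proof (rule sum.cong[OF refl])
     fix b assume b: "b : S"
     show "?c (rho b) * (of_bool (head G b : ?X) - of_bool (tail G b : ?X)) = (if b = a then ?c (rho a) else 0)"
     proof (cases "b = a")
      case True
      have "of_bool (head G b : ?X) - of_bool (tail G b : ?X) = (1::real)" unfolding True using h t by (simp only: of_bool_eq diff_0_right)
      then show ?thesis using True by simp
     next
      case False
      then have "tail G b : ?X \<longleftrightarrow> head G b : ?X" using bc b unfolding biclosed_ends by blast
      then have "of_bool (head G b : ?X) - of_bool (tail G b : ?X) = (0::real)" by (simp only: diff_self)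
      then show ?thesis using False by simp
     qed
    qed
    also have "... = ?c (rho a)" using finS a by simp
    finally show ?thesis .
   qed
   moreover have "?c (rho a) ~= 0" by (rule representation_regular_nonzero[OF rigid_regular[OF rig eta] SW SV ind card]) (use a in blast)
   ultimately show ?thesis by linarith
  qed
  then show "?ind & ?card & ?pos" using ind card by blast
 next
  assume a: "?ind & ?card & ?pos"
  show ?ss unfolding semistable_support_def
  proof (intro allI impI)
   fix Y assume Y: "Y \<subseteq> verts G" "succ_closed G S Y"
   have "- sum eta Y = (SUM b:S. ?c (rho b) * (of_bool (head G b : Y) - of_bool (tail G b : Y)))" by (rule expand[OF _ _ Y(1)]) (use a in blast)+
   also have "... \<ge> 0"
   proof (rule sum_nonneg)
    fix b assume b: "b : S"
    have "?c (rho b) > 0" using a b by blast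
    moreover have "of_bool (head G b : Y) - of_bool (tail G b : Y) \<ge> (0::real)" using Y(2) b by (auto simp: succ_closed_def)
    ultimately show "0 <= ?c (rho b) * (of_bool (head G b : Y) - of_bool (tail G b : Y))" by simp
   qed
   finally show "sum eta Y <= 0" by simp
  qed
 qed
qed

corollary JK_quiver_semistable_limit:
 assumes P: "is_charge_cone G v0 P" "R : P" and rig: "rigid eta" and eta: "sum eta (verts G) = 0"
 shows "((%t. JK_quiver G v0 (t *\<^sub>R R) eta) \<longlongrightarrow>
  of_nat (card {S. S \<subseteq> arcs G & semistable_support G eta (verts G) S & Suc (card S) = card (verts G)})) at_top"
proof -
 have "{S. S \<subseteq> arcs G & semistable_support G eta (verts G) S & Suc (card S) = card (verts G)}
  = {S. S \<subseteq> arcs G & card S = n & independent (rho ` S) & card (rho ` S) = n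
   & (ALL v:rho ` S. representation (rho ` S) (- lift (verts G) v0 eta) v > 0)}" using semistable_iff_positive[OF rig eta] unfolding card_n'[symmetric] nat.inject by blast
 then show ?thesis using JK_quiver_large_charge[OF P rigid_regular[OF rig eta]] by simp
qed

end

section \<open>Regularity of the lift\<close>

text \<open>A union of connected components of the support of \<open>e\<close>.\<close>
definition separated :: "('v, 'a) pre_digraph => ('v => nat) => 'v set => bool" where
 "separated Q e Y \<longleftrightarrow> Y \<subseteq> {v. e v ~= 0}
   & (ALL al:arcs Q. e (tail Q al) ~= 0 --> e (head Q al) ~= 0 --> (tail Q al : Y \<longleftrightarrow> head Q al : Y))"

definition coherent :: "('v, 'a) pre_digraph => ('v => real) => ('v => nat) => bool" where
 "coherent Q zeta e \<longleftrightarrow> (ALL Y. separated Q e Y --> (SUM v:Y. real (e v) * zeta v) = 0)"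

definition connected_support :: "('v, 'a) pre_digraph => ('v => nat) => bool" where
 "connected_support Q e \<longleftrightarrow> (ALL Y. separated Q e Y --> Y = {} \<or> Y = {v. e v ~= 0})"

text \<open>Coherent vectors stand in for the dimension vectors of semistable representations, which are all coherent.\<close>
definition indecomposable :: "('v, 'a) pre_digraph => ('v => real) => ('v => nat) => bool" where
 "indecomposable Q zeta d \<longleftrightarrow> (\<forall>e\<le>d. coherent Q zeta e --> coherent Q zeta (%v. d v - e v) --> e = (%_. 0) \<or> e = d)"

context coordinate_space begin

text \<open>Extend a basis of the smaller span by elements of \<open>S\<close> to one of \<open>V\<close> and leave one new element out.\<close>
lemma span_hyperplane_not_regular:
 assumes S: "S \<subseteq> V" "span S = V" and T: "T \<subseteq> S" "span T ~= V" and xi: "xi : span T"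
 shows "xi ~: regular_vectors I r S"
proof
 assume reg: "xi : regular_vectors I r S"
 obtain B0 where B0: "B0 \<subseteq> T" "independent B0" "T \<subseteq> span B0" by (rule real_vector.maximal_independent_subset[of T])
 have sB0: "span B0 = span T"
 proof
  show "span B0 \<subseteq> span T" by (rule span_mono[OF B0(1)])
  show "span T \<subseteq> span B0" using B0(3) by (rule span_minimal) (rule real_vector.subspace_span)
 qed
 have "B0 \<subseteq> S" using B0(1) T(1) by blast
 then obtain B where B: "B0 \<subseteq> B" "B \<subseteq> S" "independent B" "S \<subseteq> span B" by (rule real_vector.maximal_independent_subset_extend[OF _ B0(2)])
 have BV: "B \<subseteq> V" using B(2) S(1) by blast
 have finB: "finite B" "card B <= n" using independent_card_le[OF B(3) BV] by auto
 have VB: "V \<subseteq> span B" unfolding S(2)[symmetric] using B(4) by (rule span_minimal) (rule real_vector.subspace_span)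
 have cB: "card B = n" using spanning_card_ge[OF VB finB(1)] finB(2) by simp
 have "B0 ~= B"
 proof
  assume "B0 = B"
  then have "span T = V" using independent_spans[OF B(3) BV cB] sB0 by simp
  then show False using T(2) by simp
 qed
 then obtain b where b: "b : B" "b ~: B0" using B(1) by blast
 have "xi : span (B - {b})" using xi unfolding sB0[symmetric] using span_mono[of B0 "B - {b}"] B(1) b(2) by blast
 moreover have "card (B - {b}) + 1 = n" using finB(1) b(1) cB by (metis Suc_eq_plus1 card_Suc_Diff1)
 moreover have "B - {b} \<subseteq> S" "finite (B - {b})" using B(2) finB(1) by auto
 ultimately show False using reg unfolding regular_vectors_def by blast
qed

end

definition cartan_edges :: "('v, 'a) pre_digraph => ('v => nat) => (('v \<times> nat) \<times> ('v \<times> nat)) set" where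
 "cartan_edges Q d =
   {((v, i), (v, j)) | v i j. v : verts Q & i : {1..d v} & j : {1..d v} & i ~= j} \<union>
   {((tail Q al, i), (head Q al, j)) | al i j. al : arcs Q & i : {1..d (tail Q al)} & j : {1..d (head Q al)}}"

lemma roots_weights_edges: "roots_weights Q d r = edge_fun r ` cartan_edges Q d"
proof (intro equalityI subsetI)
 have e: "edge_fun r ((v, i), (w, j)) = coord_fun r (w, j) - coord_fun r (v, i)" for v w i j by (simp add: edge_fun_def)
 fix x assume "x : roots_weights Q d r"
 then consider v i j where "x = coord_fun r (v, j) - coord_fun r (v, i)" "v : verts Q" "i : {1..d v}" "j : {1..d v}" "i ~= j"
  | al i j where "x = coord_fun r (head Q al, j) - coord_fun r (tail Q al, i)" "al : arcs Q" "i : {1..d (tail Q al)}" "j : {1..d (head Q al)}"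
  unfolding roots_weights_def Un_iff mem_Collect_eq by (elim disjE exE conjE) metis+
 then show "x : edge_fun r ` cartan_edges Q d"
 proof cases
  case (1 v i j)
  have "((v, i), (v, j)) : cartan_edges Q d" unfolding cartan_edges_def using 1 by (intro UnI1 CollectI exI conjI) (rule refl | assumption)+
  then show ?thesis unfolding 1(1) e[symmetric] by (rule imageI)
 next
  case (2 al i j)
  have "((tail Q al, i), (head Q al, j)) : cartan_edges Q d" unfolding cartan_edges_def using 2 by (intro UnI2 CollectI exI conjI) (rule refl | assumption)+
  then show ?thesis unfolding 2(1) e[symmetric] by (rule imageI)
 qed
next
 have e: "edge_fun r ((v, i), (w, j)) = coord_fun r (w, j) - coord_fun r (v, i)" for v w i j by (simp add: edge_fun_def)
 fix x assume "x : edge_fun r ` cartan_edges Q d"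
 then obtain p where p: "p : cartan_edges Q d" "x = edge_fun r p" by blast
 from p(1) consider v i j where "p = ((v, i), (v, j))" "v : verts Q" "i : {1..d v}" "j : {1..d v}" "i ~= j"
  | al i j where "p = ((tail Q al, i), (head Q al, j))" "al : arcs Q" "i : {1..d (tail Q al)}" "j : {1..d (head Q al)}"
  unfolding cartan_edges_def Un_iff mem_Collect_eq by (elim disjE exE conjE) metis+
 then show "x : roots_weights Q d r"
 proof cases
  case (1 v i j)
  then show ?thesis unfolding p(2) 1(1) e roots_weights_def by (intro UnI1 CollectI exI conjI) (rule refl | assumption)+
 next
  case (2 al i j)
  then show ?thesis unfolding p(2) 2(1) e roots_weights_def by (intro UnI2 CollectI exI conjI) (rule refl | assumption)+
 qed
qed

definition block :: "('v, 'a) pre_digraph => ('v => nat) => ('v => nat) => ('v \<times> nat) set" where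
 "block Q a b = (SIGMA v:verts Q. {a v<..b v})"

lemma block_biclosed:
 assumes ab: "a <= b" "b <= d" and b: "b : dim_vectors Q"
  and E: "cartan_edges Q d \<inter> (block Q a b \<times> block Q a b) \<subseteq> E" and Q: "fin_digraph Q"
  and Z: "biclosed E Z"
 defines "Y \<equiv> {v. b v - a v ~= 0 & (v, b v) : Z}"
 shows "separated Q (%v. b v - a v) Y" "Z \<inter> block Q a b = (SIGMA v:Y. {a v<..b v})"
proof -
 interpret fin_digraph Q by (rule Q)
 have vb: "v : verts Q" if "b v - a v ~= 0" for v using that b by (cases "v : verts Q") (auto simp: dim_vectors_def)
 have bd: "b v <= d v" for v using ab(2) by (simp add: le_fun_def)
 show "separated Q (%v. b v - a v) Y" unfolding separated_def
 proof (intro conjI ballI impI)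
  show "Y \<subseteq> {v. b v - a v ~= 0}" by (auto simp: Y_def)
  fix al assume al: "al : arcs Q" "b (tail Q al) - a (tail Q al) ~= 0" "b (head Q al) - a (head Q al) ~= 0"
  let ?e = "((tail Q al, b (tail Q al)), (head Q al, b (head Q al)))"
  have "?e : cartan_edges Q d" unfolding cartan_edges_def using al bd by (intro UnI2 CollectI exI[of _ al] exI conjI) auto
  moreover have "?e : block Q a b \<times> block Q a b" using al vb by (auto simp: block_def)
  ultimately have "?e : E" using E by blast
  then have "(tail Q al, b (tail Q al)) : Z \<longleftrightarrow> (head Q al, b (head Q al)) : Z" using Z unfolding biclosed_def by fastforce
  then show "tail Q al : Y \<longleftrightarrow> head Q al : Y" using al by (simp add: Y_def)
 qed
 have same: "(v, k) : Z \<longleftrightarrow> (v, b v) : Z" if vk: "a v < k" "k <= b v" for v k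
 proof (cases "k = b v")
  case False
  have v: "v : verts Q" by (rule vb) (use vk in simp)
  let ?e = "((v, k), (v, b v))"
  have "?e : cartan_edges Q d" unfolding cartan_edges_def using v vk False bd[of v] by (intro UnI1 CollectI exI conjI) auto
  moreover have "?e : block Q a b \<times> block Q a b" using v vk by (auto simp: block_def)
  ultimately have "?e : E" using E by blast
  then show ?thesis using Z unfolding biclosed_def by fastforce
 qed simp
 show "Z \<inter> block Q a b = (SIGMA v:Y. {a v<..b v})"
 proof (intro equalityI subsetI)
  fix x assume x: "x : Z \<inter> block Q a b"
  obtain v k where vk: "x = (v, k)" by (cases x)
  then have k: "a v < k" "k <= b v" using x by (auto simp: block_def)
  then have "(v, b v) : Z" using same[OF k] x vk by simp
  then show "x : (SIGMA v:Y. {a v<..b v})" using k vk by (auto simp: Y_def)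
 next
  fix x assume "x : (SIGMA v:Y. {a v<..b v})"
  then obtain v k where vk: "x = (v, k)" "v : Y" "a v < k" "k <= b v" by auto
  then have "(v, k) : Z" using same[OF vk(3,4)] by (simp add: Y_def)
  moreover have "v : verts Q" by (rule vb) (use vk in simp)
  ultimately show "x : Z \<inter> block Q a b" using vk by (simp add: block_def)
 qed
qed

lemma block_sum_zero:
 assumes ab: "a <= b" "b <= d" and b: "b : dim_vectors Q"
  and E: "cartan_edges Q d \<inter> (block Q a b \<times> block Q a b) \<subseteq> E" and Q: "fin_digraph Q"
  and Z: "biclosed E Z" and coh: "coherent Q zeta (%v. b v - a v)"
 shows "sum (%(v, k). zeta v) (Z \<inter> block Q a b) = 0"
proof -
 interpret fin_digraph Q by (rule Q)
 let ?Y = "{v. b v - a v ~= 0 & (v, b v) : Z}"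
 note bl = block_biclosed[OF ab b E Q Z]
 have "?Y \<subseteq> verts Q" using b by (auto simp: dim_vectors_def)
 then have fin: "finite ?Y" by (rule finite_subset) simp
 have "sum (%(v, k). zeta v) (Z \<inter> block Q a b) = (SUM v:?Y. SUM k:{a v<..b v}. zeta v)" unfolding bl(2) by (subst sum.Sigma) (use fin in auto)
 also have "... = (SUM v:?Y. real (b v - a v) * zeta v)" by simp
 also have "... = 0" using coh bl(1) unfolding coherent_def by blast
 finally show ?thesis .
qed

text \<open>Distribute the indices over two blocks of sizes \<open>e\<close> and \<open>d - e\<close>. Coherence makes the lift a combination of roots and weights inside the blocks, and these do not span because no edge joins the blocks.\<close>
theorem lift_regular_indecomposable:
 assumes Q: "fin_digraph Q" and d: "d : dim_vectors Q" and r: "r : cartan_index Q d"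
  and reg: "lift_regular Q d zeta r" and conn: "connected_support Q d"
 shows "indecomposable Q zeta d"
 unfolding indecomposable_def
proof (intro allI impI)
 fix e assume e: "e <= d" and c: "coherent Q zeta e" "coherent Q zeta (%v. d v - e v)"
 interpret fin_digraph Q by (rule Q)
 let ?I = "cartan_index Q d"
 let ?E = "cartan_edges Q d"
 have I: "?I = block Q (%_. 0) d" by (auto simp: cartan_index_def block_def)
 interpret coordinate_space ?I r by unfold_locales (simp add: I block_def)
 have edim: "e : dim_vectors Q" using d e unfolding dim_vectors_def le_fun_def mem_Collect_eq by (metis le_zero_eq)
 have EI: "?E \<subseteq> ?I \<times> ?I" by (auto simp: cartan_edges_def cartan_index_def)
 have EV: "edge_fun r ` ?E \<subseteq> V" using EI edge_V by force
 have zd: "(%_. 0) <= d" "(%_. 0) <= e" by (simp_all add: le_fun_def)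
 have spanE: "span (edge_fun r ` ?E) = V"
 proof (rule span_if_connected[OF r EI])
  fix Z assume Z: "Z \<subseteq> ?I" "biclosed ?E Z"
  let ?Y = "{v. d v - 0 ~= 0 & (v, d v) : Z}"
  have bl: "separated Q (%v. d v - 0) ?Y" "Z \<inter> block Q (%_. 0) d = (SIGMA v:?Y. {0<..d v})" by (rule block_biclosed[OF zd(1) order.refl d _ Q Z(2)], blast)+
  have ZI: "Z = (SIGMA v:?Y. {0<..d v})" using bl(2) Z(1) I by blast
  have "?Y = {} \<or> ?Y = {v. d v ~= 0}" using conn bl(1) unfolding connected_support_def diff_zero by blast
  then show "Z = {} \<or> Z = ?I"
  proof
   assume "?Y = {}" then show ?thesis using ZI by (metis Sigma_empty1)
  next
   assume "?Y = {v. d v ~= 0}"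
   then have "Z = (SIGMA v:{v. d v ~= 0}. {0<..d v})" using ZI by simp
   also have "... = ?I" using d unfolding I block_def by (auto simp: dim_vectors_def)
   finally show ?thesis by simp
  qed
 qed
 let ?K = "block Q (%_. 0) e" and ?K' = "block Q e d"
 let ?F = "?E \<inter> (?K \<times> ?K \<union> ?K' \<times> ?K')"
 have IK: "?I = ?K \<union> ?K'" using e unfolding I block_def by (auto simp: le_fun_def) (metis le_trans)
 have disj: "?K \<inter> ?K' = {}" by (auto simp: block_def)
 have finK: "finite ?K" "finite ?K'" by (simp_all add: block_def)
 have liftU: "lift ?I r (%(v, k). zeta v) : span (edge_fun r ` ?F)"
 proof (rule lift_in_span[OF r])
  show "?F \<subseteq> ?I \<times> ?I" using EI by blast
  fix Z assume Z: "Z \<subseteq> ?I" "biclosed ?F Z"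
  have "sum (%(v, k). zeta v) Z = sum (%(v, k). zeta v) ((Z \<inter> ?K) \<union> (Z \<inter> ?K'))" using Z(1) IK by (intro arg_cong[of _ _ "sum _"]) blast
  also have "... = sum (%(v, k). zeta v) (Z \<inter> ?K) + sum (%(v, k). zeta v) (Z \<inter> ?K')" by (rule sum.union_disjoint) (use finK disj in auto)
  also have "sum (%(v, k). zeta v) (Z \<inter> ?K) = 0" by (rule block_sum_zero[OF zd(2) e edim _ Q Z(2)]) (use c(1) in "auto")
  also have "sum (%(v, k). zeta v) (Z \<inter> ?K') = 0" by (rule block_sum_zero[OF e order.refl d _ Q Z(2)]) (use c(2) in "auto")
  finally show "sum (%(v, k). zeta v) Z = 0" by simp
 qed
 show "e = (%_. 0) \<or> e = d"
 proof (rule ccontr)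
  assume ne: "\<not> (e = (%_. 0) \<or> e = d)"
  then obtain v w where v: "e v ~= 0" and w: "e w ~= d w" by (auto simp: fun_eq_iff)
  have w': "e w < d w" using w e by (metis le_fun_def le_neq_implies_less)
  have x: "(v, e v) : ?K" using v edim by (auto simp: block_def dim_vectors_def)
  have y: "(w, d w) : ?K'" using w' d by (auto simp: block_def dim_vectors_def)
  let ?u = "coord_fun r (v, e v) - coord_fun r (w, d w)"
  have uV: "?u : V" by (intro real_vector.subspace_diff[OF subspace_V] coord_fun_V) (use x y IK in auto)
  have "cut ?K ?u = of_bool ((v, e v) : ?K) - of_bool ((w, d w) : ?K)" unfolding cut_diff using x y IK by (subst (1 2) cut_coord_fun) auto
  also have "(v, e v) : ?K \<longleftrightarrow> True" using x by simp
  also have "(w, d w) : ?K \<longleftrightarrow> False" using y disj by blast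
  finally have cu: "cut ?K ?u = 1" by (simp only: of_bool_eq diff_0_right)
  have proper: "span (edge_fun r ` ?F) ~= V"
  proof
   assume "span (edge_fun r ` ?F) = V"
   then have "?u : span (edge_fun r ` ?F)" using uV by simp
   then have "cut ?K ?u = 0"
   proof (rule cut_span)
    fix u assume "u : edge_fun r ` ?F"
    then obtain p where p: "p : ?F" "u = edge_fun r p" by blast
    have pI: "p : ?I \<times> ?I" using p(1) EI by blast
    then have "fst p : ?I" "snd p : ?I" by (simp_all only: mem_Times_iff)
    moreover have "fst p : ?K \<longleftrightarrow> snd p : ?K" by (use p(1) disj in "auto simp: mem_Times_iff")
    ultimately show "cut ?K u = 0" unfolding p(2) by (simp only: cut_edge diff_self)
   qed
   then show False using cu by simp
  qed
  have "edge_fun r ` ?F \<subseteq> edge_fun r ` ?E" by (rule image_mono[OF Int_lower1])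
  from span_hyperplane_not_regular[OF EV spanE this proper liftU]
  show False using reg unfolding lift_regular_def roots_weights_edges by (rule notE)
 qed
qed

context abelianisation begin

lemma fst_tail_B: "fst (tail B a) = tail Q (fst a)" and fst_head_B: "fst (head B a) = head Q (fst a)"
 by (simp_all add: blowup_quiver_def split: prod.splits)

lemma fst_arcs_B: "a : arcs B ==> fst a : arcs Q"
 by (auto simp: blowup_quiver_def)

lemma ends_MPS_quiver: "tail (MPS_quiver Q m) = tail B" "head (MPS_quiver Q m) = head B"
 by (simp_all add: MPS_quiver_def)

lemma tdegree_nonzero:
 assumes "finite Z" "Z \<subseteq> verts B" "x : Z" shows "tdegree Z (fst x) ~= 0"
proof
 obtain i k l where x: "x = (i, k, l)" by (cases x)
 assume "tdegree Z (fst x) = 0"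
 then have "(case x of (j, k, l) => if j = i then l else 0) = 0" using assms(1,3) unfolding tdegree_def x fst_conv by (metis (mono_tags, lifting) sum_eq_0_iff)
 then show False using assms(2,3) x by (auto simp: verts_B)
qed

lemma tdegree_restrict:
 assumes "finite Z"
 shows "tdegree {x:Z. fst x : Y} i = (if i : Y then tdegree Z i else 0)"
proof -
 have "tdegree {x:Z. fst x : Y} i = (SUM x:Z. if fst x : Y then (case x of (j, k, l) => if j = i then l else 0) else 0)"
  unfolding tdegree_def using assms by (rule sum.inter_filter)
 also have "... = (SUM x:Z. if i : Y then (case x of (j, k, l) => if j = i then l else 0) else 0)" by (rule sum.cong) auto
 also have "... = (if i : Y then tdegree Z i else 0)" by (simp add: tdegree_def)
 finally show ?thesis .
qed

lemma coherent_total_degree: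
 assumes Z: "finite Z" "Z \<subseteq> verts B" and S: "S \<subseteq> arcs B"
  and closed: "ALL a:S. tail B a : Z \<longleftrightarrow> head B a : Z"
  and zero: "!!Z'. Z' \<subseteq> Z ==> (ALL a:S. tail B a : Z' \<longleftrightarrow> head B a : Z') ==> sum (zeta_hat zeta) Z' = 0"
 shows "coherent Q zeta (tdegree Z)"
 unfolding coherent_def
proof (intro allI impI)
 fix Y assume Y: "separated Q (tdegree Z) Y"
 have Yv: "Y \<subseteq> verts Q"
 proof
  fix v assume "v : Y"
  then have "tdegree Z v ~= 0" using Y by (auto simp: separated_def)
  then obtain x where "x : Z" "fst x = v" unfolding tdegree_def by (rule sum.not_neutral_contains_not_neutral) (auto split: if_splits)
  then show "v : verts Q" using Z(2) by (auto simp: verts_B)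
 qed
 let ?Z = "{x:Z. fst x : Y}"
 have "sum (zeta_hat zeta) ?Z = 0"
 proof (rule zero)
  show "ALL a:S. tail B a : ?Z \<longleftrightarrow> head B a : ?Z"
  proof
   fix a assume a: "a : S"
   have th: "tail B a : Z \<longleftrightarrow> head B a : Z" using closed a by blast
   show "tail B a : ?Z \<longleftrightarrow> head B a : ?Z"
   proof (cases "tail B a : Z")
    case True
    then have "tdegree Z (tail Q (fst a)) ~= 0" "tdegree Z (head Q (fst a)) ~= 0" using tdegree_nonzero[OF Z, of "tail B a"] tdegree_nonzero[OF Z, of "head B a"] th
     by (simp_all add: fst_tail_B fst_head_B)
    then have "tail Q (fst a) : Y \<longleftrightarrow> head Q (fst a) : Y" using Y fst_arcs_B S a unfolding separated_def by blast
    then show ?thesis using th by (simp add: fst_tail_B fst_head_B)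
   qed (use th in blast)
  qed
 qed blast
 moreover have "sum (zeta_hat zeta) ?Z = stab_weight Q zeta (tdegree ?Z)" by (rule weight_typed) (use Z in auto)
 moreover have "stab_weight Q zeta (tdegree ?Z) = (SUM v:verts Q. if v : Y then real (tdegree Z v) * zeta v else 0)"
  unfolding stab_weight_def by (rule sum.cong) (simp_all add: tdegree_restrict[OF Z(1)])
 moreover have "... = (SUM v:Y. real (tdegree Z v) * zeta v)" using Yv by (subst sum.inter_restrict[symmetric]) (simp_all add: Int_absorb1 inf.absorb2)
 ultimately show "(SUM v:Y. real (tdegree Z v) * zeta v) = 0" by simp
qed

lemma tdegree_model:
 assumes "m : types_of d" shows "tdegree (model m) = d"
 using tdegree_typed[OF model_verts finite_model, of m] assms type_of_model[of m] by (simp add: types_of_def)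

lemma MPS_abelian_quiver:
 assumes m: "m : types_of d" and lf: "loopfree_digraph Q" and v: "v : verts (MPS_quiver Q m)"
 shows "abelian_quiver (MPS_quiver Q m) v"
proof
 have fm: "finite (model m)" using m by (intro finite_model) (simp add: types_of_def)
 show "finite (verts (MPS_quiver Q m))" using fm by (simp add: verts_MPS_quiver)
 show "finite (arcs (MPS_quiver Q m))" using finite_arcs_within[OF fm model_verts] by (simp add: arcs_MPS_quiver)
 show "v : verts (MPS_quiver Q m)" by (rule v)
 fix a assume a: "a : arcs (MPS_quiver Q m)"
 interpret lf: loopfree_digraph Q by (rule lf)
 have "tail Q (fst a) ~= head Q (fst a)" using a fst_arcs_B lf.no_loops by (auto simp: arcs_MPS_quiver arcs_within_def)
 then have "tail B a ~= head B a" by (metis fst_tail_B fst_head_B)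
 then show "tail (MPS_quiver Q m) a : verts (MPS_quiver Q m) & head (MPS_quiver Q m) a : verts (MPS_quiver Q m)
   & tail (MPS_quiver Q m) a ~= head (MPS_quiver Q m) a" using a by (simp add: ends_MPS_quiver verts_MPS_quiver arcs_MPS_quiver arcs_within_def)
qed

text \<open>The degree of a class of vertices is coherent: arrows of \<open>Q'(m)\<close> lie over arrows of \<open>Q\<close>, so components of the support pull back to closed sets.\<close>
theorem MPS_rigid:
 assumes m: "m : types_of d" and lf: "loopfree_digraph Q" and v: "v : verts (MPS_quiver Q m)"
  and ind: "indecomposable Q zeta d"
 shows "abelian_quiver.rigid (MPS_quiver Q m) (zeta_hat zeta)"
proof -
 let ?G = "MPS_quiver Q m"
 interpret abelian_quiver ?G v by (rule MPS_abelian_quiver[OF m lf v])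
 have fm: "finite (model m)" using m by (intro finite_model) (simp add: types_of_def)
 show ?thesis unfolding rigid_def
 proof (intro allI impI)
  fix S Z assume S: "S \<subseteq> arcs ?G" and zero: "\<forall>Z\<subseteq>verts ?G. biclosed (ends S) Z --> sum (zeta_hat zeta) Z = 0"
   and Z: "Z \<subseteq> verts ?G" "biclosed (ends S) Z"
  have SB: "S \<subseteq> arcs B" using S by (auto simp: arcs_MPS_quiver arcs_within_def)
  have bc: "biclosed (ends S) Z' \<longleftrightarrow> (ALL a:S. tail B a : Z' \<longleftrightarrow> head B a : Z')" for Z' by (simp add: biclosed_def ends_MPS_quiver)
  have Zm: "Z \<subseteq> model m" using Z(1) by (simp add: verts_MPS_quiver)
  have coh: "coherent Q zeta (tdegree Z')" if Z': "Z' \<subseteq> model m" "ALL a:S. tail B a : Z' \<longleftrightarrow> head B a : Z'" for Z'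
  proof (rule coherent_total_degree[OF _ _ SB Z'(2)])
   show "finite Z'" using Z'(1) fm by (rule finite_subset)
   show "Z' \<subseteq> verts B" using Z'(1) model_verts by blast
   show "sum (zeta_hat zeta) Z'' = 0" if "Z'' \<subseteq> Z'" "ALL a:S. tail B a : Z'' \<longleftrightarrow> head B a : Z''" for Z''

   proof -
    have "Z'' \<subseteq> verts ?G" using that(1) Z'(1) by (simp add: verts_MPS_quiver)
    moreover have "biclosed (ends S) Z''" using that(2) by (simp only: bc)
    ultimately show ?thesis using zero by blast
   qed
  qed
  have Zc: "ALL a:S. tail B a : Z \<longleftrightarrow> head B a : Z" using Z(2) by (simp only: bc)
  have Zc': "ALL a:S. tail B a : model m - Z \<longleftrightarrow> head B a : model m - Z" using Zc S by (auto simp: arcs_MPS_quiver arcs_within_def)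
  have "tdegree (model m - Z) = (%i. d i - tdegree Z i)" by (rule ext) (simp add: tdegree_Diff[OF fm Zm] tdegree_model[OF m])
  then have "coherent Q zeta (%i. d i - tdegree Z i)" using coh[OF _ Zc'] by auto
  moreover have "tdegree Z <= d" unfolding tdegree_model[OF m, symmetric] le_fun_def tdegree_def using fm Zm by (intro allI sum_mono2) auto
  ultimately have "tdegree Z = (%_. 0) \<or> tdegree Z = d" using ind coh[OF Zm Zc] unfolding indecomposable_def by blast
  then show "Z = {} \<or> Z = verts ?G"
  proof
   assume z: "tdegree Z = (%_. 0)"
   have "Z = {}"
   proof (rule ccontr)
    assume "Z ~= {}"
    then obtain x where "x : Z" by blast
    then show False using tdegree_nonzero[of Z x] z Zm model_verts fm finite_subset by (metis subset_trans)
   qed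
   then show ?thesis by blast
  next
   assume z: "tdegree Z = d"
   have "model m - Z = {}"
   proof (rule ccontr)
    assume "model m - Z ~= {}"
    then obtain x where x: "x : model m - Z" by blast
    have "tdegree (model m - Z) (fst x) ~= 0" by (rule tdegree_nonzero[OF _ _ x]) (use fm model_verts in auto)
    then show False by (simp add: tdegree_Diff[OF fm Zm] tdegree_model[OF m] z)
   qed
   then show ?thesis using Zm by (auto simp: verts_MPS_quiver)
  qed
 qed
qed

end

section \<open>Multiplicativity over disconnected supports\<close>

definition support_sum :: "('x, 'b) pre_digraph => ('x => real) => real => 'x set => real" where
 "support_sum G eta y X = (SUM S | S \<subseteq> arcs_within G X & semistable_support G eta X S. y ^ card S)"

lemma semistable_support_disjoint:
 assumes fin: "finite X" "finite X'" and disj: "X \<inter> X' = {}"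
  and S: "S \<subseteq> arcs_within G X" "S' \<subseteq> arcs_within G X'"
 shows "semistable_support G eta (X \<union> X') (S \<union> S') \<longleftrightarrow> semistable_support G eta X S & semistable_support G eta X' S'"
proof (intro iffI conjI)
 assume ss: "semistable_support G eta (X \<union> X') (S \<union> S')"
 show "semistable_support G eta X S" unfolding semistable_support_def
 proof (intro allI impI)
  fix Y assume Y: "Y \<subseteq> X" "succ_closed G S Y"
  have "succ_closed G (S \<union> S') Y" using Y S(2) disj unfolding succ_closed_def arcs_within_def by blast
  then show "sum eta Y <= 0" using ss Y(1) unfolding semistable_support_def by blast
 qed
 show "semistable_support G eta X' S'" unfolding semistable_support_def
 proof (intro allI impI)
  fix Y assume Y: "Y \<subseteq> X'" "succ_closed G S' Y"
  have "succ_closed G (S \<union> S') Y" using Y S(1) disj unfolding succ_closed_def arcs_within_def by blast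
  then show "sum eta Y <= 0" using ss Y(1) unfolding semistable_support_def by blast
 qed
next
 assume ss: "semistable_support G eta X S & semistable_support G eta X' S'"
 show "semistable_support G eta (X \<union> X') (S \<union> S')" unfolding semistable_support_def
 proof (intro allI impI)
  fix Y assume Y: "Y \<subseteq> X \<union> X'" "succ_closed G (S \<union> S') Y"
  have c: "succ_closed G S (Y \<inter> X)" using Y(2) S(1) by (auto simp: succ_closed_def arcs_within_def)
  have c': "succ_closed G S' (Y \<inter> X')" using Y(2) S(2) by (auto simp: succ_closed_def arcs_within_def)
  have "sum eta Y = sum eta (Y \<inter> X \<union> Y \<inter> X')" using Y(1) by (intro arg_cong[of _ _ "sum eta"]) blast
  also have "... = sum eta (Y \<inter> X) + sum eta (Y \<inter> X')" by (rule sum.union_disjoint) (use fin disj in auto)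
  also have "... <= 0" using ss c c' unfolding semistable_support_def by (intro add_nonpos_nonpos) blast+
  finally show "sum eta Y <= 0" .
 qed
qed

lemma support_sum_disjoint:
 assumes fin: "finite X" "finite X'" and disj: "X \<inter> X' = {}"
  and A: "arcs_within G (X \<union> X') = arcs_within G X \<union> arcs_within G X'" "finite (arcs_within G (X \<union> X'))"
 shows "support_sum G eta y (X \<union> X') = support_sum G eta y X * support_sum G eta y X'"
proof -
 let ?A = "arcs_within G X" and ?A' = "arcs_within G X'"
 let ?SS = "%X. {S. S \<subseteq> arcs_within G X & semistable_support G eta X S}"
 have dA: "?A \<inter> ?A' = {}" using disj by (auto simp: arcs_within_def)
 have finA: "finite ?A" "finite ?A'" using A by auto
 have "support_sum G eta y X * support_sum G eta y X' = (SUM (S, S'):?SS X \<times> ?SS X'. y ^ card S * y ^ card S')" unfolding support_sum_def sum_product sum.cartesian_product ..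
 also have "... = (SUM S:?SS (X \<union> X'). y ^ card S)"
 proof (rule sum.reindex_bij_witness[where i = "%S. (S \<inter> ?A, S \<inter> ?A')" and j = "%(S, S'). S \<union> S'"])
  fix p assume p: "p : ?SS X \<times> ?SS X'"
  obtain S S' where pS: "p = (S, S')" by (cases p)
  have S: "S \<subseteq> ?A" "S' \<subseteq> ?A'" and ss: "semistable_support G eta X S" "semistable_support G eta X' S'" using p pS by auto
  show "(%S. (S \<inter> ?A, S \<inter> ?A')) ((%(S, S'). S \<union> S') p) = p" using S dA unfolding pS by auto
  show "(%(S, S'). S \<union> S') p : ?SS (X \<union> X')" unfolding pS A(1) using S ss semistable_support_disjoint[OF fin disj S, of eta] by auto
  have "finite S" "finite S'" "S \<inter> S' = {}" using S finA dA finite_subset by blast+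
  then show "y ^ card ((%(S, S'). S \<union> S') p) = (case p of (S, S') => y ^ card S * y ^ card S')" unfolding pS by (simp add: card_Un_disjoint power_add)
 next
  fix S assume S: "S : ?SS (X \<union> X')"
  then have SU: "S = S \<inter> ?A \<union> S \<inter> ?A'" unfolding A(1) by blast
  then show "(%(S, S'). S \<union> S') ((%S. (S \<inter> ?A, S \<inter> ?A')) S) = S" by simp
  have "semistable_support G eta (X \<union> X') (S \<inter> ?A \<union> S \<inter> ?A')" using S SU by auto
  then show "(%S. (S \<inter> ?A, S \<inter> ?A')) S : ?SS X \<times> ?SS X'" using semistable_support_disjoint[OF fin disj, of "S \<inter> ?A" G "S \<inter> ?A'" eta] by auto
 qed
 finally show ?thesis by (simp add: support_sum_def)
qed

definition part :: "'v set => ('v => nat) => 'v => nat" where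
 "part Y e v = (if v : Y then e v else 0)"

lemma part_dim_vectors: "e : dim_vectors Q ==> part Y e : dim_vectors Q"
 by (simp add: dim_vectors_def part_def)

lemma stab_weight_parts: "stab_weight Q zeta e = stab_weight Q zeta (part Y e) + stab_weight Q zeta (part (- Y) e)"
 unfolding stab_weight_def sum.distrib[symmetric] by (rule sum.cong) (auto simp: part_def)

lemma multiplicity_supported: "m : multiplicity_vectors Q d ==> m i l ~= 0 ==> i : verts Q & 1 <= l & l <= d i"
 unfolding multiplicity_vectors_def by blast

lemma multiplicity_degree: "m : multiplicity_vectors Q d ==> i : verts Q ==> (SUM l=1..d i. l * m i l) = d i"
 unfolding multiplicity_vectors_def by blast

lemma multiplicity_outside: "m : multiplicity_vectors Q (part Y d) ==> i ~: Y ==> m i l = 0"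
 using multiplicity_supported[of m Q "part Y d" i l] by (cases "m i l = 0") (simp_all add: part_def)

lemma multiplicity_part:
 assumes m: "m : multiplicity_vectors Q d"
 shows "(%i l. if i : Y then m i l else 0) : multiplicity_vectors Q (part Y d)"
 unfolding multiplicity_vectors_def mem_Collect_eq
proof (intro conjI allI impI ballI)
 fix i l assume "(if i : Y then m i l else 0) ~= 0"
 then show "i : verts Q" "1 <= l" "l <= part Y d i" using multiplicity_supported[OF m, of i l] by (simp_all add: part_def split: if_splits)
next
 fix i assume "i : verts Q"
 then show "(SUM l=1..part Y d i. l * (if i : Y then m i l else 0)) = part Y d i" using multiplicity_degree[OF m] by (simp add: part_def)
qed

lemma multiplicity_merge:
 assumes m: "m : multiplicity_vectors Q (part Y d)" "m' : multiplicity_vectors Q (part (- Y) d)"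
 shows "(%i l. if i : Y then m i l else m' i l) : multiplicity_vectors Q d"
  "(%i l. if i : Y then (if i : Y then m i l else m' i l) else 0) = m"
  "(%i l. if i : - Y then (if i : Y then m i l else m' i l) else 0) = m'"
proof -
 have z: "m i l = 0" if "i ~: Y" for i l using multiplicity_outside[OF m(1) that] .
 have z': "m' i l = 0" if "i : Y" for i l using multiplicity_outside[OF m(2), of i] that by simp
 show "(%i l. if i : Y then (if i : Y then m i l else m' i l) else 0) = m" by (intro ext) (simp add: z)
 show "(%i l. if i : - Y then (if i : Y then m i l else m' i l) else 0) = m'" by (intro ext) (simp add: z')
 show "(%i l. if i : Y then m i l else m' i l) : multiplicity_vectors Q d" unfolding multiplicity_vectors_def mem_Collect_eq
 proof (intro conjI allI impI ballI)
  fix i l assume nz: "(if i : Y then m i l else m' i l) ~= 0"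
  have "i : verts Q & 1 <= l & l <= d i" using nz multiplicity_supported[OF m(1), of i l] multiplicity_supported[OF m(2), of i l] by (cases "i : Y") (simp_all add: part_def)
  then show "i : verts Q" "1 <= l" "l <= d i" by blast+
 next
  fix i assume i: "i : verts Q"
  show "(SUM l=1..d i. l * (if i : Y then m i l else m' i l)) = d i"
  proof (cases "i : Y")
   case True
   then have "part Y d i = d i" by (simp add: part_def)
   then show ?thesis using multiplicity_degree[OF m(1) i] True by simp
  next
   case False
   then have "part (- Y) d i = d i" by (simp add: part_def)
   then show ?thesis using multiplicity_degree[OF m(2) i] False by simp
  qed
 qed
qed

lemma stack_function_support_sum:
 assumes "fin_digraph Q" "d : dim_vectors Q"
 shows "stack_function Q d zeta x = (SUM m:multiplicity_vectors Q d.
    (PROD i:verts Q. PROD l=1..d i. 1 / fact (m i l) * ((-1) ^ (l - 1) * (x - 1) / (real l * (x ^ l - 1))) ^ m i l)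
    * (support_sum (blowup_quiver Q) (zeta_hat zeta) (x - 1) (verts (MPS_quiver Q m)) / (x - 1) ^ card (verts (MPS_quiver Q m))))
   / (PROD v:verts Q. x ^ (SUM i<d v. i))"
proof -
 interpret A: abelianisation Q d zeta 2 using assms by (simp add: abelianisation_def abelianisation_axioms_def)
 show ?thesis by (simp only: stack_function_def support_sum_def A.arcs_MPS_quiver A.verts_MPS_quiver)
qed

text \<open>Collections, vertex sets and supports all decompose over the two parts, and no arrow joins them.\<close>
theorem stack_function_split:
 fixes Q :: "('v, 'a) pre_digraph"
 assumes Q: "fin_digraph Q" and d: "d : dim_vectors Q" and sep: "separated Q d Y"
 shows "stack_function Q d zeta x = stack_function Q (part Y d) zeta x * stack_function Q (part (- Y) d) zeta x"
proof -
 interpret A: abelianisation Q d zeta 2 using Q d by (simp add: abelianisation_def abelianisation_axioms_def)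
 let ?w = "%l k. 1 / fact k * ((-1) ^ (l - 1) * (x - 1) / (real l * (x ^ l - 1))) ^ k :: real"
 let ?W = "%d m. PROD i:verts Q. PROD l=1..d i. ?w l (m i l)"
 let ?X = "%m. verts (MPS_quiver Q m)"
 let ?U = "%m. support_sum (blowup_quiver Q) (zeta_hat zeta) (x - 1) (?X m) / (x - 1) ^ card (?X m)"
 let ?D = "%d. PROD v:verts Q. x ^ (SUM i<d v. i)"
 let ?M = "multiplicity_vectors Q"
 let ?merge = "%m m' i l. if i : Y then m i l else m' i l :: nat"
 have D: "?D d = ?D (part Y d) * ?D (part (- Y) d)" unfolding prod.distrib[symmetric] by (rule prod.cong) (auto simp: part_def)
 have W: "?W d (?merge m m') = ?W (part Y d) m * ?W (part (- Y) d) m'" for m m' unfolding prod.distrib[symmetric] by (rule prod.cong) (auto simp: part_def)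
 have U: "?U (?merge m m') = ?U m * ?U m'" if m: "m : ?M (part Y d)" "m' : ?M (part (- Y) d)" for m m'
 proof -
  have z: "m i l = 0" if "i ~: Y" for i l using multiplicity_outside[OF m(1) that] .
  have z': "m' i l = 0" if "i : Y" for i l using multiplicity_outside[OF m(2), of i] that by simp
  have mm: "?merge m m' : A.types" using multiplicity_merge(1)[OF m] by (simp add: A.multiplicity_vectors_eq A.types_of_def)
  have X: "?X (?merge m m') = ?X m \<union> ?X m'"
  proof (intro Set.set_eqI)
   fix p :: "'v \<times> nat \<times> nat"
   obtain i k l where p: "p = (i, k, l)" by (cases p)
   show "p : ?X (?merge m m') \<longleftrightarrow> p : ?X m \<union> ?X m'" using z[of i l] z'[of i l] by (cases "i : Y") (auto simp: p A.verts_MPS_quiver A.model_def)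
  qed
  have XY: "fst p : Y" if "p : ?X m" for p
  proof (rule ccontr)
   assume "fst p ~: Y"
   then show False using that z[of "fst p"] by (cases p) (simp add: A.verts_MPS_quiver A.model_def)
  qed
  have XY': "fst p ~: Y" if "p : ?X m'" for p
  proof
   assume "fst p : Y"
   then show False using that z'[of "fst p"] by (cases p) (simp add: A.verts_MPS_quiver A.model_def)
  qed
  have finU: "finite (?X (?merge m m'))" using A.finite_model[OF mm] by (simp add: A.verts_MPS_quiver)
  then have fin: "finite (?X m)" "finite (?X m')" unfolding X by auto
  have disj: "?X m \<inter> ?X m' = {}" using XY XY' by blast
  have nz: "d (fst p) ~= 0" if "p : ?X (?merge m m')" for p
  proof -
   obtain i k l where p: "p = (i, k, l)" by (cases p)
   have "?merge m m' i l ~= 0" using that p unfolding A.verts_MPS_quiver A.model_def by auto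
   then have "1 <= l & l <= d i" using mm unfolding A.types_def by blast
   then show ?thesis using p by simp
  qed
  have arcs: "arcs_within A.B (?X m \<union> ?X m') = arcs_within A.B (?X m) \<union> arcs_within A.B (?X m')"
  proof (intro equalityI subsetI)
   fix a assume a: "a : arcs_within A.B (?X m \<union> ?X m')"
   then have t: "tail A.B a : ?X (?merge m m')" "head A.B a : ?X (?merge m m')" "a : arcs A.B" unfolding X by (auto simp: arcs_within_def)
   have "tail Q (fst a) : Y \<longleftrightarrow> head Q (fst a) : Y" using sep nz[OF t(1)] nz[OF t(2)] A.fst_arcs_B[OF t(3)] unfolding separated_def A.fst_tail_B A.fst_head_B by blast
   then have "fst (tail A.B a) : Y \<longleftrightarrow> fst (head A.B a) : Y" by (simp only: A.fst_tail_B A.fst_head_B)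
   then show "a : arcs_within A.B (?X m) \<union> arcs_within A.B (?X m')" using a XY XY' unfolding arcs_within_def by blast
  qed (auto simp: arcs_within_def)
  have finA: "finite (arcs_within A.B (?X m \<union> ?X m'))"
   unfolding X[symmetric] unfolding A.verts_MPS_quiver[of "?merge m m'"] by (rule A.finite_arcs_within[OF A.finite_model[OF mm] A.model_verts])
  show ?thesis unfolding X support_sum_disjoint[OF fin disj arcs finA] card_Un_disjoint[OF fin disj] power_add by simp
 qed
 have "(SUM m:?M (part Y d). ?W (part Y d) m * ?U m) * (SUM m:?M (part (- Y) d). ?W (part (- Y) d) m * ?U m)
   = (SUM (m, m'):?M (part Y d) \<times> ?M (part (- Y) d). (?W (part Y d) m * ?U m) * (?W (part (- Y) d) m' * ?U m'))" unfolding sum_product sum.cartesian_product ..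
 also have "... = (SUM m:?M d. ?W d m * ?U m)"
 proof (rule sum.reindex_bij_witness[where j = "%(m, m'). ?merge m m'"
    and i = "%m. (%i l. if i : Y then m i l else 0, %i l. if i : - Y then m i l else 0)"])
  fix p assume p: "p : ?M (part Y d) \<times> ?M (part (- Y) d)"
  obtain m m' where pm: "p = (m, m')" by (cases p)
  have m: "m : ?M (part Y d)" "m' : ?M (part (- Y) d)" using p pm by auto
  show "(%m. (%i l. if i : Y then m i l else 0, %i l. if i : - Y then m i l else 0)) ((%(m, m'). ?merge m m') p) = p"
   unfolding pm prod.case multiplicity_merge(2,3)[OF m] ..
  show "(%(m, m'). ?merge m m') p : ?M d" unfolding pm prod.case by (rule multiplicity_merge(1)[OF m])
  show "?W d ((%(m, m'). ?merge m m') p) * ?U ((%(m, m'). ?merge m m') p)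
   = (case p of (m, m') => (?W (part Y d) m * ?U m) * (?W (part (- Y) d) m' * ?U m'))" unfolding pm prod.case W U[OF m] by (simp only: mult_ac)
 next
  fix m assume m: "m : ?M d"
  show "(%(m, m'). ?merge m m') ((%m. (%i l. if i : Y then m i l else 0, %i l. if i : - Y then m i l else 0)) m) = m" by (auto simp: fun_eq_iff)
  show "(%m. (%i l. if i : Y then m i l else 0, %i l. if i : - Y then m i l else 0)) m : ?M (part Y d) \<times> ?M (part (- Y) d)"
   by (intro SigmaI multiplicity_part[OF m])
 qed
 finally have N: "(SUM m:?M d. ?W d m * ?U m)
   = (SUM m:?M (part Y d). ?W (part Y d) m * ?U m) * (SUM m:?M (part (- Y) d). ?W (part (- Y) d) m * ?U m)" by (rule sym)
 show ?thesis unfolding stack_function_support_sum[OF Q d] stack_function_support_sum[OF Q part_dim_vectors[OF d]] N D by simp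
qed

text \<open>The set of all vertices is itself a subrepresentation.\<close>
lemma stack_function_unstable:
 assumes Q: "fin_digraph Q" and d: "d : dim_vectors Q" and pos: "stab_weight Q zeta d > 0"
 shows "stack_function Q d zeta x = 0"
proof -
 interpret A: abelianisation Q d zeta 2 using Q d by (simp add: abelianisation_def abelianisation_axioms_def)
 have "support_sum A.B (zeta_hat zeta) (x - 1) (verts (MPS_quiver Q m)) = 0" if m: "m : multiplicity_vectors Q d" for m
 proof -
  have mt: "m : A.types_of d" using m by (simp add: A.multiplicity_vectors_eq)
  have w: "sum (zeta_hat zeta) (A.model m) = stab_weight Q zeta d" using A.weight_typed[OF A.finite_model A.model_verts, of m] mt A.tdegree_model[OF mt] by (simp add: A.types_of_def)
  have "\<not> semistable_support A.B (zeta_hat zeta) (A.model m) S" if "S \<subseteq> arcs_within A.B (A.model m)" for S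
  proof
   assume "semistable_support A.B (zeta_hat zeta) (A.model m) S"
   moreover have "succ_closed A.B S (A.model m)" using that by (auto simp: succ_closed_def arcs_within_def)
   ultimately have "sum (zeta_hat zeta) (A.model m) <= 0" unfolding semistable_support_def by blast
   then show False using pos w by simp
  qed
  then have "{S. S \<subseteq> arcs_within A.B (A.model m) & semistable_support A.B (zeta_hat zeta) (A.model m) S} = {}" by blast
  then show ?thesis unfolding support_sum_def A.verts_MPS_quiver by (simp only: sum.empty)
 qed
 then show ?thesis unfolding stack_function_support_sum[OF Q d] by simp
qed

lemma stack_function_zero:
 assumes Q: "fin_digraph Q" shows "stack_function Q (%_. 0) zeta x = 1"
proof -
 have d: "(%_. 0) : dim_vectors Q" by (simp add: dim_vectors_def)
 interpret A: abelianisation Q "%_. 0" zeta 2 using Q d by (simp add: abelianisation_def abelianisation_axioms_def)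
 have M: "multiplicity_vectors Q (%_. 0) = {%_ _. 0}" by (auto simp: multiplicity_vectors_def fun_eq_iff)
 have X: "verts (MPS_quiver Q (%_ _. 0)) = {}" by (auto simp: A.verts_MPS_quiver A.model_def)
 have "{S. S \<subseteq> arcs_within A.B {} & semistable_support A.B (zeta_hat zeta) {} S} = {{}}" by (auto simp: arcs_within_def semistable_support_def)
 then show ?thesis unfolding stack_function_support_sum[OF Q d] M by (simp add: X support_sum_def)
qed

text \<open>The weight in the logarithm: dimension vectors of nonzero slope are left out, as in the definition of \<open>b\<^sub>d\<close>.\<close>
definition stable_part :: "('v, 'a) pre_digraph => ('v => real) => real => ('v => nat) => real" where
 "stable_part Q zeta x e = (if stab_weight Q zeta e = 0 then stack_function Q e zeta x else 0)"

lemma stable_part_split: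
 assumes Q: "fin_digraph Q" and e: "e : dim_vectors Q" and sep: "separated Q e Y"
 shows "stable_part Q zeta x e = stable_part Q zeta x (part Y e) * stable_part Q zeta x (part (- Y) e)"
proof -
 note s = stab_weight_parts[of Q zeta e Y]
 consider "stab_weight Q zeta (part Y e) = 0" | "stab_weight Q zeta (part Y e) > 0" | "stab_weight Q zeta (part Y e) < 0" by linarith
 then show ?thesis
 proof cases
  case 1
  then show ?thesis using s stack_function_split[OF Q e sep] by (simp add: stable_part_def)
 next
  case 2
  then have "stack_function Q e zeta x = 0" using stack_function_split[OF Q e sep] stack_function_unstable[OF Q part_dim_vectors[OF e]] by simp
  then show ?thesis using 2 by (simp add: stable_part_def)
 next
  case 3
  have "stable_part Q zeta x e = 0"
  proof (cases "stab_weight Q zeta e = 0")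
   case True
   then have "stab_weight Q zeta (part (- Y) e) > 0" using 3 s by linarith
   then show ?thesis using stack_function_split[OF Q e sep, of zeta x] stack_function_unstable[OF Q part_dim_vectors[OF e]] by (simp add: stable_part_def)
  qed (simp add: stable_part_def)
  then show ?thesis using 3 by (simp add: stable_part_def)
 qed
qed

lemma stable_part_incoherent:
 assumes Q: "fin_digraph Q" and e: "e : dim_vectors Q" and inc: "\<not> coherent Q zeta e"
 shows "stable_part Q zeta x e = 0"
proof -
 interpret fin_digraph Q by (rule Q)
 obtain Y where Y: "separated Q e Y" "(SUM v:Y. real (e v) * zeta v) ~= 0" using inc unfolding coherent_def by blast
 have Yv: "Y \<subseteq> verts Q" using Y(1) e unfolding separated_def dim_vectors_def by blast
 have "stab_weight Q zeta (part Y e) = (SUM v:verts Q. if v : Y then real (e v) * zeta v else 0)" unfolding stab_weight_def by (rule sum.cong) (auto simp: part_def)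
 also have "... = (SUM v:Y. real (e v) * zeta v)" using Yv by (subst sum.inter_restrict[symmetric]) (simp_all add: Int_absorb1 inf.absorb2)
 finally have "stable_part Q zeta x (part Y e) = 0" using Y(2) by (simp add: stable_part_def)
 then show ?thesis using stable_part_split[OF Q e Y(1), of zeta x] by simp
qed

lemma coherent_add:
 assumes Q: "fin_digraph Q" and e: "e : dim_vectors Q" "f : dim_vectors Q" and c: "coherent Q zeta e" "coherent Q zeta f"
 shows "coherent Q zeta (%v. e v + f v)"
 unfolding coherent_def
proof (intro allI impI)
 interpret fin_digraph Q by (rule Q)
 fix Y assume Y: "separated Q (%v. e v + f v) Y"
 have fin: "finite Y"
 proof (rule finite_subset[of _ "verts Q"])
  show "Y \<subseteq> verts Q"
  proof
   fix v assume "v : Y"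
   then have "e v + f v ~= 0" using Y by (auto simp: separated_def)
   then show "v : verts Q" using e by (cases "v : verts Q") (auto simp: dim_vectors_def)
  qed
 qed simp
 have s: "separated Q e {v:Y. e v ~= 0}" "separated Q f {v:Y. f v ~= 0}" using Y by (auto simp: separated_def)
 have "(SUM v:Y. real (e v + f v) * zeta v) = (SUM v:Y. real (e v) * zeta v) + (SUM v:Y. real (f v) * zeta v)" by (simp add: sum.distrib[symmetric] distrib_right)
 also have "(SUM v:Y. real (e v) * zeta v) = (SUM v:{v:Y. e v ~= 0}. real (e v) * zeta v)" by (rule sum.mono_neutral_right) (use fin in auto)
 also have "... = 0" using c(1) s(1) unfolding coherent_def by blast
 also have "(SUM v:Y. real (f v) * zeta v) = (SUM v:{v:Y. f v ~= 0}. real (f v) * zeta v)" by (rule sum.mono_neutral_right) (use fin in auto)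
 also have "... = 0" using c(2) s(2) unfolding coherent_def by blast
 finally show "(SUM v:Y. real (e v + f v) * zeta v) = 0" by simp
qed

section \<open>Logarithms of multiplicative series\<close>

text \<open>Tuples of length \<open>k\<close> with zero entries allowed. Unlike sums over tuples of nonzero vectors these are multiplicative in \<open>d\<close>, and they are polynomial in \<open>k\<close>.\<close>
fun tuple_sum :: "(('v => nat) => real) => (('v => nat) => ('v => nat) => real) => nat => ('v => nat) => real" where
 "tuple_sum w c 0 d = (if d = (%_. 0) then 1 else 0)"
| "tuple_sum w c (Suc k) d = (SUM e | e <= d. w e * c (%v. d v - e v) e * tuple_sum w c k (%v. d v - e v))"

fun list_sum :: "(('v => nat) => real) => (('v => nat) => ('v => nat) => real) => nat => ('v => nat) => real" where
 "list_sum w c 0 d = (if d = (%_. 0) then 1 else 0)"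
| "list_sum w c (Suc k) d = (SUM e | e <= d & e ~= (%_. 0). w e * c (%v. d v - e v) e * list_sum w c k (%v. d v - e v))"

lemma finite_le_dim_vector:
 assumes "finite {v. d v ~= 0}" shows "finite {e. e <= (d :: 'v => nat)}"
proof (rule finite_subset)
 let ?g = "%f v. if v : {v. d v ~= 0} then f v else 0"
 show "{e. e <= d} \<subseteq> ?g ` (PiE {v. d v ~= 0} (%v. {..d v}))"
 proof
  fix e assume e: "e : {e. e <= d}"
  then have ev: "e v <= d v" for v by (simp add: le_fun_def)
  have eq: "e = ?g (restrict e {v. d v ~= 0})"
  proof
   fix v show "e v = ?g (restrict e {v. d v ~= 0}) v" using ev[of v] by (cases "d v = 0") simp_all
  qed
  have "restrict e {v. d v ~= 0} : PiE {v. d v ~= 0} (%v. {..d v})" using e by (auto simp: le_fun_def)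
  then show "e : ?g ` (PiE {v. d v ~= 0} (%v. {..d v}))" by (rule image_eqI[where f = ?g and x = "restrict e {v. d v ~= 0}", OF eq])
 qed
 show "finite (?g ` (PiE {v. d v ~= 0} (%v. {..d v})))" using assms by (intro finite_imageI finite_PiE) auto
qed

lemma finite_support_diff: "finite {v. d v ~= 0} ==> finite {v. d v - e v ~= (0::nat)}"
 by (erule finite_subset[rotated]) auto

text \<open>Choose the positions of the nonzero entries.\<close>
lemma tuple_sum_binomial:
 assumes w0: "w (%_. 0) = 1" and c0: "!!f. c f (%_. 0) = 1" and fin: "finite {v. d v ~= 0}"
 shows "tuple_sum w c k d = (\<Sum>n\<le>k. real (k choose n) * list_sum w c n d)"
 using fin
proof (induction k arbitrary: d)
 case (Suc k)
 let ?t = "%e F. w e * c (%v. d v - e v) e * F (%v. d v - e v)"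
 let ?N = "%n d. list_sum w c n d"
 have finE: "finite {e. e <= d}" by (rule finite_le_dim_vector[OF Suc.prems])
 have set: "{e. e <= d} = insert (%_. 0) {e. e <= d & e ~= (%_. 0)}" by (auto simp: le_fun_def)
 have "tuple_sum w c (Suc k) d = tuple_sum w c k d + (SUM e | e <= d & e ~= (%_. 0). ?t e (tuple_sum w c k))"
  unfolding tuple_sum.simps by (subst set, subst sum.insert) (use finE in "auto simp: w0 c0")
 also have "(SUM e | e <= d & e ~= (%_. 0). ?t e (tuple_sum w c k))
   = (SUM e | e <= d & e ~= (%_. 0). \<Sum>n\<le>k. real (k choose n) * ?t e (?N n))"
 proof (rule sum.cong[OF refl])
  fix e
  have IH: "tuple_sum w c k (%v. d v - e v) = (\<Sum>n\<le>k. real (k choose n) * ?N n (%v. d v - e v))" by (rule Suc.IH) (rule finite_support_diff[OF Suc.prems])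
  show "?t e (tuple_sum w c k) = (\<Sum>n\<le>k. real (k choose n) * ?t e (?N n))" by (simp add: IH sum_distrib_left mult_ac)
 qed
 also have "... = (\<Sum>n\<le>k. real (k choose n) * ?N (Suc n) d)" by (subst sum.swap) (simp add: sum_distrib_left)
 also have "tuple_sum w c k d = (\<Sum>n\<le>k. real (k choose n) * ?N n d)" by (rule Suc.IH[OF Suc.prems])
 also have "(\<Sum>n\<le>k. real (k choose n) * ?N n d) + (\<Sum>n\<le>k. real (k choose n) * ?N (Suc n) d)
   = (\<Sum>n\<le>Suc k. real (Suc k choose n) * ?N n d)"
 proof -
  have "(\<Sum>n\<le>Suc k. real (Suc k choose n) * ?N n d) = ?N 0 d + (\<Sum>n\<le>k. real (Suc k choose Suc n) * ?N (Suc n) d)" unfolding sum.atMost_Suc_shift by (simp del: list_sum.simps)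
  also have "... = (?N 0 d + (\<Sum>n\<le>k. real (k choose Suc n) * ?N (Suc n) d)) + (\<Sum>n\<le>k. real (k choose n) * ?N (Suc n) d)"
   by (simp add: sum.distrib distrib_right del: list_sum.simps)
  also have "?N 0 d + (\<Sum>n\<le>k. real (k choose Suc n) * ?N (Suc n) d) = (\<Sum>n\<le>Suc k. real (k choose n) * ?N n d)" unfolding sum.atMost_Suc_shift by (simp del: list_sum.simps)
  also have "... = (\<Sum>n\<le>k. real (k choose n) * ?N n d)" by (simp add: binomial_eq_0 del: list_sum.simps)
  finally show ?thesis by simp
 qed
 finally show ?case .
qed simp

lemma tuple_sum_split:
 assumes w: "!!e. e <= d ==> w e = w (part Y e) * w (part (- Y) e)"
  and c: "!!f e. f <= d ==> e <= d ==> c f e = c (part Y f) (part Y e) * c (part (- Y) f) (part (- Y) e)"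
  and fin: "finite {v. d v ~= 0}"
 shows "tuple_sum w c k d = tuple_sum w c k (part Y d) * tuple_sum w c k (part (- Y) d)"
 using assms
proof (induction k arbitrary: d)
 case 0
 have "d = (%_. 0) \<longleftrightarrow> part Y d = (%_. 0) & part (- Y) d = (%_. 0)" by (auto simp: part_def fun_eq_iff)
 then show ?case by simp
next
 case (Suc k)
 let ?t = "%d e. w e * c (%v. d v - e v) e * tuple_sum w c k (%v. d v - e v)"
 have "tuple_sum w c (Suc k) (part Y d) * tuple_sum w c (Suc k) (part (- Y) d)
   = (SUM (e, e'):{e. e <= part Y d} \<times> {e. e <= part (- Y) d}. ?t (part Y d) e * ?t (part (- Y) d) e')" unfolding tuple_sum.simps sum_product sum.cartesian_product ..
 also have "... = (SUM e:{e. e <= d}. ?t d e)"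
 proof (rule sum.reindex_bij_witness[where i = "%e. (part Y e, part (- Y) e)" and j = "%(e, e') v. e v + e' v"])
  fix p assume "p : {e. e <= part Y d} \<times> {e. e <= part (- Y) d}"
  then obtain e e' where p: "p = (e, e')" "e <= part Y d" "e' <= part (- Y) d" by auto
  have ev: "e v <= (if v : Y then d v else 0)" "e' v <= (if v : Y then 0 else d v)" for v using le_funD[OF p(2), of v] le_funD[OF p(3), of v] by (auto simp: part_def split: if_splits)
  have parts: "part Y (%v. e v + e' v) = e" "part (- Y) (%v. e v + e' v) = e'"
  proof -
   show "part Y (%v. e v + e' v) = e"
   proof
    fix v show "part Y (%v. e v + e' v) v = e v" using ev[of v] by (cases "v : Y") (simp_all add: part_def)
   qed
   show "part (- Y) (%v. e v + e' v) = e'"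
   proof
    fix v show "part (- Y) (%v. e v + e' v) v = e' v" using ev[of v] by (cases "v : Y") (simp_all add: part_def)
   qed
  qed
  then show "(%e. (part Y e, part (- Y) e)) ((%(e, e') v. e v + e' v) p) = p" using p by simp
  have le: "(%v. e v + e' v) <= d"
  proof (rule le_funI)
   fix v show "e v + e' v <= d v" using ev[of v] by (auto split: if_splits)
  qed
  then show "(%(e, e') v. e v + e' v) p : {e. e <= d}" using p by simp
  let ?e = "%v. e v + e' v"
  let ?f = "%v. d v - ?e v"
  have f: "?f <= d" by (simp add: le_fun_def)
  have fparts: "part Y ?f = (%v. part Y d v - e v)" "part (- Y) ?f = (%v. part (- Y) d v - e' v)"
  proof -
   show "part Y ?f = (%v. part Y d v - e v)"
   proof
    fix v show "part Y ?f v = part Y d v - e v" using ev[of v] by (auto simp: part_def split: if_splits)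
   qed
   show "part (- Y) ?f = (%v. part (- Y) d v - e' v)"
   proof
    fix v show "part (- Y) ?f v = part (- Y) d v - e' v" using ev[of v] by (auto simp: part_def split: if_splits)
   qed
  qed
  have "tuple_sum w c k ?f = tuple_sum w c k (part Y ?f) * tuple_sum w c k (part (- Y) ?f)"
  proof (rule Suc.IH)
   show "w g = w (part Y g) * w (part (- Y) g)" if "g <= ?f" for g by (rule Suc.prems(1)[OF order_trans[OF that f]])
   show "c g h = c (part Y g) (part Y h) * c (part (- Y) g) (part (- Y) h)" if "g <= ?f" "h <= ?f" for g h by (rule Suc.prems(2)[OF order_trans[OF that(1) f] order_trans[OF that(2) f]])
   show "finite {v. ?f v ~= 0}" by (rule finite_support_diff[OF Suc.prems(3)])
  qed
  then have "?t d ?e = ?t (part Y d) e * ?t (part (- Y) d) e'" unfolding Suc.prems(1)[OF le] Suc.prems(2)[OF f le] parts fparts by (simp only: mult_ac)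
  then show "?t d ((%(e, e') v. e v + e' v) p) = (case p of (e, e') => ?t (part Y d) e * ?t (part (- Y) d) e')" unfolding p(1) prod.case .
 next
  fix e assume e: "e : {e. e <= d}"
  show "(%(e, e') v. e v + e' v) ((%e. (part Y e, part (- Y) e)) e) = e" by (auto simp: part_def fun_eq_iff)
  show "(%e. (part Y e, part (- Y) e)) e : {e. e <= part Y d} \<times> {e. e <= part (- Y) d}" using e by (auto simp: part_def le_fun_def)
 qed
 finally show ?case by (simp only: tuple_sum.simps)
qed

lemma list_sum_long:
 assumes "finite {v. d v ~= 0}" "sum d {v. d v ~= 0} < n" shows "list_sum w c n d = 0"
 using assms
proof (induction n arbitrary: d)
 case (Suc n)
 have "list_sum w c n (%v. d v - e v) = 0" if e: "e <= d" "e ~= (%_. 0)" for e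
 proof (rule Suc.IH)
  show "finite {v. d v - e v ~= 0}" by (rule finite_support_diff[OF Suc.prems(1)])
  obtain u where u: "e u ~= 0" using e(2) by auto
  have le: "e v <= d v" for v using e(1) by (simp add: le_fun_def)
  have "sum (%v. d v - e v) {v. d v - e v ~= 0} = sum (%v. d v - e v) {v. d v ~= 0}" by (rule sum.mono_neutral_left[OF Suc.prems(1)]) auto
  also have "... < sum d {v. d v ~= 0}"
  proof (rule sum_strict_mono_ex1[OF Suc.prems(1)])
   show "ALL v:{v. d v ~= 0}. d v - e v <= d v" by simp
   show "EX v:{v. d v ~= 0}. d v - e v < d v" using u le[of u] by (intro bexI[of _ u]) auto
  qed
  finally show "sum (%v. d v - e v) {v. d v - e v ~= 0} < n" using Suc.prems(2) by simp
 qed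
 then show ?case by simp
qed simp

definition binomial_poly :: "nat => real poly" where
 "binomial_poly n = Polynomial.smult (1 / fact n) (PROD i<n. [:- real i, 1:])"

lemma poly_binomial: "poly (binomial_poly n) (real k) = real (k choose n)"
proof -
 have "poly (binomial_poly n) (real k) = (PROD i<n. real k - real i) / fact n" by (simp add: binomial_poly_def poly_prod)
 also have "... = real k gchoose n" by (simp add: gbinomial_prod_rev atLeast0LessThan)
 finally show ?thesis by (simp add: binomial_gbinomial)
qed

lemma coeff_binomial_poly:
 assumes "n > 0" shows "coeff (binomial_poly n) 0 = 0" "coeff (binomial_poly n) 1 = (-1) ^ (n - 1) / real n"
proof -
 obtain m where n: "n = Suc m" using assms by (cases n) auto
 let ?p = "PROD i<m. [:- real (Suc i), 1:]"
 have p: "(PROD i<n. [:- real i, 1:]) = pCons 0 ?p" unfolding n prod.lessThan_Suc_shift by simp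
 show "coeff (binomial_poly n) 0 = 0" unfolding binomial_poly_def p by simp
 have "coeff ?p 0 = (PROD i<m. - real (Suc i))" by (simp add: coeff_0_prod_list poly_0_coeff_0[symmetric] poly_prod)
 also have "... = (-1) ^ m * (PROD i<m. real (Suc i))" by (simp only: prod_uminus card_lessThan)
 also have "(PROD i<m. real (Suc i)) = fact m" by (induction m) simp_all
 finally have "coeff (binomial_poly n) 1 = (-1) ^ m * fact m / fact n" unfolding binomial_poly_def p One_nat_def coeff_smult coeff_pCons_Suc by simp
 also have "... = (-1) ^ (n - 1) / real n" unfolding n by (simp add: divide_simps)
 finally show "coeff (binomial_poly n) 1 = (-1) ^ (n - 1) / real n" .
qed

definition tuple_poly :: "(('v => nat) => real) => (('v => nat) => ('v => nat) => real) => ('v => nat) => real poly" where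
 "tuple_poly w c d = (\<Sum>n\<le>sum d {v. d v ~= 0}. Polynomial.smult (list_sum w c n d) (binomial_poly n))"

lemma poly_tuple_poly:
 assumes w0: "w (%_. 0) = 1" and c0: "!!f. c f (%_. 0) = 1" and fin: "finite {v. d v ~= 0}"
 shows "poly (tuple_poly w c d) (real k) = tuple_sum w c k d"
proof -
 let ?M = "sum d {v. d v ~= 0}"
 have "poly (tuple_poly w c d) (real k) = (\<Sum>n\<le>?M. real (k choose n) * list_sum w c n d)" by (simp add: tuple_poly_def poly_sum poly_binomial mult.commute)
 also have "... = (\<Sum>n\<le>max k ?M. real (k choose n) * list_sum w c n d)" by (rule sum.mono_neutral_left) (auto simp: list_sum_long[OF fin])
 also have "... = (\<Sum>n\<le>k. real (k choose n) * list_sum w c n d)" by (rule sum.mono_neutral_right) (auto simp: binomial_eq_0)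
 finally show ?thesis by (simp add: tuple_sum_binomial[where w = w and c = c, OF w0 c0 fin])
qed

lemma poly_eq_on_nats:
 fixes p q :: "real poly" assumes "!!k. poly p (real k) = poly q (real k)" shows "p = q"
proof (rule ccontr)
 assume "p ~= q"
 then have "finite {x. poly (p - q) x = 0}" by (intro poly_roots_finite) simp
 moreover have "range real \<subseteq> {x. poly (p - q) x = 0}" using assms by auto
 ultimately have "finite (range real)" by (rule finite_subset[rotated])
 then show False using range_inj_infinite[of real] by (simp add: inj_on_def)
qed

lemma tuple_poly_coeffs:
 assumes d: "d ~= (%_. 0)"
 shows "coeff (tuple_poly w c d) 0 = 0"
  "coeff (tuple_poly w c d) 1 = (SUM n=1..sum d {v. d v ~= 0}. (-1) ^ (n - 1) / real n * list_sum w c n d)"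
proof -
 let ?M = "sum d {v. d v ~= 0}"
 have s: "tuple_poly w c d = (SUM n=1..?M. Polynomial.smult (list_sum w c n d) (binomial_poly n))"
  unfolding tuple_poly_def by (rule sum.mono_neutral_right) (use d in "auto simp: Suc_le_eq")
 show "coeff (tuple_poly w c d) 0 = 0" unfolding s coeff_sum by (rule sum.neutral) (simp add: coeff_binomial_poly)
 show "coeff (tuple_poly w c d) 1 = (SUM n=1..?M. (-1) ^ (n - 1) / real n * list_sum w c n d)" unfolding s coeff_sum coeff_smult
 proof (rule sum.cong[OF refl])
  fix n assume "n : {1..?M}"
  then have "n > 0" by simp
  from coeff_binomial_poly(2)[OF this] show "list_sum w c n d * coeff (binomial_poly n) 1 = (-1) ^ (n - 1) / real n * list_sum w c n d" by (simp only: mult.commute)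
 qed
qed

text \<open>The logarithm is the derivative at \<open>k = 0\<close> of the \<open>k\<close>-th power, and the polynomial of \<open>d\<close> is the product of those of the parts, which both vanish at \<open>0\<close>.\<close>
theorem log_coefficient_split:
 assumes w: "!!e. e <= d ==> w e = w (part Y e) * w (part (- Y) e)"
  and c: "!!f e. f <= d ==> e <= d ==> c f e = c (part Y f) (part Y e) * c (part (- Y) f) (part (- Y) e)"
  and w0: "w (%_. 0) = 1" and c0: "!!f. c f (%_. 0) = 1"
  and fin: "finite {v. d v ~= 0}" and ne: "part Y d ~= (%_. 0)" "part (- Y) d ~= (%_. 0)"
 shows "(SUM n=1..sum d {v. d v ~= 0}. (-1) ^ (n - 1) / real n * list_sum w c n d) = 0"
proof -
 let ?p = "tuple_poly w c"
 have fin': "finite {v. part Y d v ~= 0}" "finite {v. part (- Y) d v ~= 0}" by (rule finite_subset[OF _ fin]; auto simp: part_def)+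
 have "?p d = ?p (part Y d) * ?p (part (- Y) d)" by (rule poly_eq_on_nats)
   (simp add: poly_tuple_poly[where w = w and c = c, OF w0 c0 fin] poly_tuple_poly[where w = w and c = c, OF w0 c0 fin'(1)] poly_tuple_poly[where w = w and c = c, OF w0 c0 fin'(2)] tuple_sum_split[where w = w and c = c, OF w c fin])
 then have "coeff (?p d) 1 = coeff (?p (part Y d) * ?p (part (- Y) d)) 1" by simp
 also have "... = 0" using tuple_poly_coeffs(1)[OF ne(1), of w c] tuple_poly_coeffs(1)[OF ne(2), of w c] by (simp add: coeff_mult)
 finally have "coeff (?p d) 1 = 0" .
 moreover have "d ~= (%_. 0)" by (use ne(1) notE in "auto simp: part_def")
 ultimately show ?thesis using tuple_poly_coeffs(2)[of d w c] by metis
qed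

section \<open>The invariant as a limit of the stack function\<close>

definition twist :: "('v, 'a) pre_digraph => real => ('v => nat) => ('v => nat) => real" where
 "twist Q x f e = x powi (- euler_form Q f e)"

lemma euler_form_zero: "euler_form Q (%_. 0) e = 0" "euler_form Q f (%_. 0) = 0"
 by (simp_all add: euler_form_def)

lemma euler_form_add: "euler_form Q (f + g) e = euler_form Q f e + euler_form Q g e"
 by (simp add: euler_form_def distrib_right sum.distrib)

lemma euler_form_sum_list: "euler_form Q (sum_list es) e = (SUM j<length es. euler_form Q (es ! j) e)"
proof (induction es)
 case Nil
 show ?case using euler_form_zero(1)[of Q e] by (simp add: zero_fun_def)
next
 case (Cons f es)
 then show ?case by (simp only: sum_list.Cons euler_form_add length_Cons sum.lessThan_Suc_shift nth_Cons_0 nth_Cons_Suc)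
qed

definition list_weight :: "('v, 'a) pre_digraph => real => (('v => nat) => real) => ('v => nat) list => real" where
 "list_weight Q x w es = x powi (- (SUM j<length es. SUM i<j. euler_form Q (es ! j) (es ! i))) * (\<Prod>e\<leftarrow>es. w e)"

lemma list_weight_Cons:
 assumes "x ~= 0"
 shows "list_weight Q x w (e # es) = w e * twist Q x (sum_list es) e * list_weight Q x w es"
proof -
 have "(SUM j<length (e # es). SUM i<j. euler_form Q ((e # es) ! j) ((e # es) ! i))
   = (SUM j<length es. euler_form Q (es ! j) e + (SUM i<j. euler_form Q (es ! j) (es ! i)))" by (simp add: sum.lessThan_Suc_shift del: sum.lessThan_Suc)
 also have "... = euler_form Q (sum_list es) e + (SUM j<length es. SUM i<j. euler_form Q (es ! j) (es ! i))" by (simp add: sum.distrib euler_form_sum_list)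
 finally have "- (SUM j<length (e # es). SUM i<j. euler_form Q ((e # es) ! j) ((e # es) ! i))
   = - euler_form Q (sum_list es) e + - (SUM j<length es. SUM i<j. euler_form Q (es ! j) (es ! i))" by simp
 then show ?thesis using assms unfolding list_weight_def twist_def by (simp only: power_int_add simp_thms) (simp add: mult_ac)
qed

definition semistable_dims :: "('v, 'a) pre_digraph => ('v => real) => ('v => nat) set" where
 "semistable_dims Q zeta = {e : dim_vectors Q. e ~= 0 & stab_weight Q zeta e = 0}"

definition dim_lists :: "('v, 'a) pre_digraph => ('v => real) => nat => ('v => nat) => ('v => nat) list set" where
 "dim_lists Q zeta n d = {es. length es = n & set es \<subseteq> semistable_dims Q zeta & sum_list es = d}"

lemma finite_support: "finite (verts Q) ==> d : dim_vectors Q ==> finite {v. d v ~= 0}"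
 by (erule finite_subset[rotated]) (auto simp: dim_vectors_def)

lemma dim_lists_Suc:
 "dim_lists Q zeta (Suc n) d = (UN e:{e:semistable_dims Q zeta. e <= d}. (#) e ` dim_lists Q zeta n (d - e))"
proof (intro equalityI subsetI)
 fix es assume es: "es : dim_lists Q zeta (Suc n) d"
 then obtain e fs where f: "es = e # fs" by (cases es) (auto simp: dim_lists_def)
 have s: "e + sum_list fs = d" "e : semistable_dims Q zeta" "length fs = n" "set fs \<subseteq> semistable_dims Q zeta" using es by (auto simp: dim_lists_def f)
 have "e <= d" unfolding s(1)[symmetric] by (simp add: le_fun_def)
 moreover have "sum_list fs = d - e" unfolding s(1)[symmetric] by (simp add: fun_eq_iff)
 ultimately show "es : (UN e:{e:semistable_dims Q zeta. e <= d}. (#) e ` dim_lists Q zeta n (d - e))"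
  unfolding f using s by (intro UN_I[of e] imageI) (simp_all add: dim_lists_def)
next
 fix es assume "es : (UN e:{e:semistable_dims Q zeta. e <= d}. (#) e ` dim_lists Q zeta n (d - e))"
 then obtain e fs where f: "es = e # fs" "e : semistable_dims Q zeta" "e <= d" "fs : dim_lists Q zeta n (d - e)" by blast
 have "e + (d - e) = d" using f(3) by (simp add: fun_eq_iff le_fun_def)
 then show "es : dim_lists Q zeta (Suc n) d" using f by (simp add: dim_lists_def)
qed

lemma sum_dim_lists:
 fixes Q :: "('v, 'a) pre_digraph"
 assumes Q: "finite (verts Q)" and x: "x ~= 0" and d: "d : dim_vectors Q"
  and w: "!!e. e : dim_vectors Q ==> stab_weight Q zeta e ~= 0 ==> w e = 0"
 shows "finite (dim_lists Q zeta n d) & (SUM es:dim_lists Q zeta n d. list_weight Q x w es) = list_sum w (twist Q x) n d"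
 using d
proof (induction n arbitrary: d)
 case 0
 have "dim_lists Q zeta 0 d = (if d = (%_. 0) then {[]} else {})" by (auto simp: dim_lists_def zero_fun_def)
 then show ?case by (simp add: list_weight_def)
next
 case (Suc n)
 let ?E = "{e:semistable_dims Q zeta. e <= d}"
 have finE: "finite {e. e <= d}" by (rule finite_le_dim_vector[OF finite_support[OF Q Suc.prems]])
 have dim: "e : dim_vectors Q" if "e <= d" for e using that Suc.prems unfolding dim_vectors_def le_fun_def mem_Collect_eq by (metis le_zero_eq)
 have IH: "finite (dim_lists Q zeta n (d - e))" "(SUM es:dim_lists Q zeta n (d - e). list_weight Q x w es) = list_sum w (twist Q x) n (d - e)" for e
 proof -
  have "d - e : dim_vectors Q" by (rule dim) (simp add: le_fun_def)
  from Suc.IH[OF this] show "finite (dim_lists Q zeta n (d - e))"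
   "(SUM es:dim_lists Q zeta n (d - e). list_weight Q x w es) = list_sum w (twist Q x) n (d - e)" by blast+
 qed
 have fin: "finite (dim_lists Q zeta (Suc n) d)" unfolding dim_lists_Suc using finE IH(1) by auto
 have "(SUM es:dim_lists Q zeta (Suc n) d. list_weight Q x w es)
   = (SUM e:?E. SUM es:(#) e ` dim_lists Q zeta n (d - e). list_weight Q x w es)" unfolding dim_lists_Suc by (rule sum.UNION_disjoint) (use finE IH(1) in auto)
 also have "... = (SUM e:?E. w e * twist Q x (d - e) e * list_sum w (twist Q x) n (d - e))"
 proof (rule sum.cong[OF refl])
  fix e assume "e : ?E"
  have "(SUM es:(#) e ` dim_lists Q zeta n (d - e). list_weight Q x w es) = (SUM es:dim_lists Q zeta n (d - e). list_weight Q x w (e # es))" by (subst sum.reindex) auto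
  also have "... = (SUM es:dim_lists Q zeta n (d - e). w e * twist Q x (d - e) e * list_weight Q x w es)" by (rule sum.cong[OF refl]) (simp add: list_weight_Cons[OF x] dim_lists_def)
  also have "... = w e * twist Q x (d - e) e * list_sum w (twist Q x) n (d - e)" by (simp only: sum_distrib_left[symmetric] IH(2))
  finally show "(SUM es:(#) e ` dim_lists Q zeta n (d - e). list_weight Q x w es) = w e * twist Q x (d - e) e * list_sum w (twist Q x) n (d - e)" .
 qed
 also have "... = (SUM e | e <= d & e ~= (%_. 0). w e * twist Q x (d - e) e * list_sum w (twist Q x) n (d - e))"
 proof (rule sum.mono_neutral_left)
  show "finite {e. e <= d & e ~= (%_. 0)}" using finE by (rule finite_subset[rotated]) auto
  show "?E \<subseteq> {e. e <= d & e ~= (%_. 0)}" by (auto simp: semistable_dims_def zero_fun_def)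
  show "ALL e:{e. e <= d & e ~= (%_. 0)} - ?E. w e * twist Q x (d - e) e * list_sum w (twist Q x) n (d - e) = 0"
   using w dim by (auto simp: semistable_dims_def zero_fun_def)
 qed
 also have "... = list_sum w (twist Q x) (Suc n) d" by (simp add: fun_diff_def)
 finally show ?case using fin by blast
qed

lemma dim_list_length:
 assumes "finite (verts Q)" "set es \<subseteq> semistable_dims Q zeta"
 shows "length es <= sum (sum_list es) (verts Q)"
 using assms(2)
proof (induction es)
 case (Cons e es)
 have e: "e : dim_vectors Q" "e ~= 0" using Cons.prems by (auto simp: semistable_dims_def)
 then obtain v where v: "e v ~= 0" by (auto simp: fun_eq_iff zero_fun_def)
 then have vQ: "v : verts Q" using e(1) by (auto simp: dim_vectors_def)
 have "1 <= e v" using v by simp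
 also have "... <= sum e (verts Q)" using assms(1) vQ by (intro member_le_sum) auto
 finally have "1 <= sum e (verts Q)" .
 moreover have "length es <= sum (sum_list es) (verts Q)" using Cons by simp
 ultimately show ?case by (simp add: sum.distrib)
qed simp

text \<open>The exponent is bilinear, so that removing the first entry of a list costs the pairing of the sum of the others with it.\<close>
lemma DT_coeff_list_sum:
 assumes Q: "fin_digraph Q" and d: "d : dim_vectors Q" "d ~= 0" and x: "x ~= 0"
  and count: "!!e. e : semistable_dims Q zeta ==> e <= d ==> semistable_count Q zeta e x = stack_function Q e zeta x"
 shows "DT_coeff Q zeta d x
  = (SUM n=1..sum d {v. d v ~= 0}. (-1) ^ (n - 1) / real n * list_sum (stable_part Q zeta x) (twist Q x) n d)"
proof -
 interpret fin_digraph Q by (rule Q)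
 let ?M = "sum d {v. d v ~= 0}"
 let ?L = "%n. dim_lists Q zeta n d"
 let ?w = "stable_part Q zeta x"
 let ?f = "%es. (-1) ^ (length es - 1) / real (length es)
    * x powi (- (SUM j<length es. SUM i<j. euler_form Q (es ! j) (es ! i)))
    * (\<Prod>e\<leftarrow>es. semistable_count Q zeta e x)"
 have M: "?M = sum d (verts Q)" by (rule sum.mono_neutral_left) (use d(1) in "auto simp: dim_vectors_def")
 have set: "{es. es ~= [] & set es \<subseteq> {e : dim_vectors Q. e ~= 0 & stab_weight Q zeta e = 0} & sum_list es = d} = (UN n:{1..?M}. ?L n)"
 proof (intro equalityI subsetI)
  fix es assume "es : {es. es ~= [] & set es \<subseteq> {e : dim_vectors Q. e ~= 0 & stab_weight Q zeta e = 0} & sum_list es = d}"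
  then have es: "es ~= []" "set es \<subseteq> semistable_dims Q zeta" "sum_list es = d" by (auto simp: semistable_dims_def)
  have "length es <= ?M" using dim_list_length[OF _ es(2)] es(3) M by simp
  then show "es : (UN n:{1..?M}. ?L n)" using es by (auto simp: dim_lists_def Suc_le_eq)
 qed (auto simp: dim_lists_def semistable_dims_def)
 have ws: "?w e = 0" if "stab_weight Q zeta e ~= 0" for e using that by (simp add: stable_part_def)
 note sd = sum_dim_lists[where w = ?w and zeta = zeta and d = d and x = x, OF finite_verts x d(1) ws]
 have mem: "e <= d" if "es : ?L n" "e : set es" for es n e
 proof -
  have "e <= sum_list es" using that(2)
  proof (induction es)
   case (Cons f es)
   then show ?case by (auto simp: le_fun_def intro: add_increasing)
  qed simp
  then show ?thesis using that(1) by (simp add: dim_lists_def)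
 qed
 have f: "?f es = (-1) ^ (n - 1) / real n * list_weight Q x ?w es" if es: "es : ?L n" for es n
 proof -
  have "semistable_count Q zeta e x = ?w e" if "e : set es" for e
  proof -
   have "e : semistable_dims Q zeta" using es that by (auto simp: dim_lists_def)
   then show ?thesis using count mem[OF es that] by (simp add: stable_part_def semistable_dims_def)
  qed
  then have "(\<Prod>e\<leftarrow>es. semistable_count Q zeta e x) = (\<Prod>e\<leftarrow>es. ?w e)" by (simp cong: map_cong)
  then show ?thesis using es by (simp add: list_weight_def dim_lists_def)
 qed
 have "DT_coeff Q zeta d x = (SUM n:{1..?M}. SUM es:?L n. ?f es)" unfolding DT_coeff_def set by (rule sum.UNION_disjoint) (use sd in "auto simp: dim_lists_def")
 also have "... = (SUM n:{1..?M}. SUM es:?L n. (-1) ^ (n - 1) / real n * list_weight Q x ?w es)" by (intro sum.cong refl f)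
 also have "... = (SUM n:{1..?M}. (-1) ^ (n - 1) / real n * list_sum ?w (twist Q x) n d)"
  unfolding sum_distrib_left[symmetric] by (intro sum.cong refl arg_cong2[of _ _ _ _ "(*)"]) (rule conjunct2[OF sd])
 finally show ?thesis .
qed

lemma DT_coeff_eventually:
 assumes Q: "fin_digraph Q" and d: "d : dim_vectors Q" "d ~= 0"
 shows "\<forall>\<^sub>F x in at 1. DT_coeff Q zeta d x
  = (SUM n=1..sum d {v. d v ~= 0}. (-1) ^ (n - 1) / real n * list_sum (stable_part Q zeta x) (twist Q x) n d)"
proof -
 interpret fin_digraph Q by (rule Q)
 have "finite {e:semistable_dims Q zeta. e <= d}" by (rule finite_subset[OF _ finite_le_dim_vector[OF finite_support[OF _ d(1)]]]) auto
 then have "\<forall>\<^sub>F x in at 1. ALL e:{e:semistable_dims Q zeta. e <= d}. semistable_count Q zeta e x = stack_function Q e zeta x"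
  by (rule eventually_ball_finite) (use semistable_count_eventually[OF Q] in "auto simp: semistable_dims_def")
 moreover have "\<forall>\<^sub>F x in at (1::real). 0 < x" by (rule order_tendstoD(1)[OF tendsto_ident_at]) simp
 ultimately show ?thesis by eventually_elim (rule DT_coeff_list_sum[OF Q d]; auto)
qed

lemma stable_part_zero: "fin_digraph Q ==> stable_part Q zeta x (%_. 0) = 1"
 by (simp add: stable_part_def stab_weight_def stack_function_zero)

lemma twist_zero: "twist Q x f (%_. 0) = 1"
 by (simp add: twist_def euler_form_zero)

lemma list_sum_coherent:
 assumes Q: "fin_digraph Q" and e: "e : dim_vectors Q" and nz: "list_sum (stable_part Q zeta x) c n e ~= 0"
 shows "coherent Q zeta e"
 using e nz
proof (induction n arbitrary: e)
 case 0
 then have "e = (%_. 0)" by (simp split: if_splits)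
 then show ?case by (simp add: coherent_def)
next
 case (Suc n)
 obtain f where f: "f <= e" "stable_part Q zeta x f ~= 0" "list_sum (stable_part Q zeta x) c n (%v. e v - f v) ~= 0"
  using Suc.prems(2) unfolding list_sum.simps by (rule sum.not_neutral_contains_not_neutral) auto
 have dim: "g : dim_vectors Q" if "g <= e" for g using that Suc.prems(1) unfolding dim_vectors_def le_fun_def mem_Collect_eq by (metis le_zero_eq)
 have d2: "(%v. e v - f v) : dim_vectors Q" by (rule dim) (simp add: le_fun_def)
 have "coherent Q zeta f" using stable_part_incoherent[OF Q dim[OF f(1)]] f(2) by blast
 then have "coherent Q zeta (%v. f v + (e v - f v))" by (rule coherent_add[OF Q dim[OF f(1)] d2 _ Suc.IH[OF d2 f(3)]])
 moreover have "(%v. f v + (e v - f v)) = e" using f(1) by (simp add: fun_eq_iff le_fun_def)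
 ultimately show ?case by simp
qed

text \<open>All entries of a contributing tuple are coherent, hence so are the first entry and the sum of the others.\<close>
lemma list_sum_indecomposable:
 assumes Q: "fin_digraph Q" and d: "d : dim_vectors Q" and ind: "indecomposable Q zeta d"
 shows "list_sum (stable_part Q zeta x) c (Suc (Suc n)) d = 0"
proof (rule ccontr)
 let ?N = "list_sum (stable_part Q zeta x) c"
 assume nz: "?N (Suc (Suc n)) d ~= 0"
 have "(SUM e | e <= d & e ~= (%_. 0). stable_part Q zeta x e * c (%v. d v - e v) e * ?N (Suc n) (%v. d v - e v)) ~= 0"
  using nz by (subst (asm) list_sum.simps(2))
 then obtain e where e: "e <= d" "e ~= (%_. 0)" "stable_part Q zeta x e ~= 0" "?N (Suc n) (%v. d v - e v) ~= 0"
  by (rule sum.not_neutral_contains_not_neutral) auto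
 have dim: "g : dim_vectors Q" if "g <= d" for g using that d unfolding dim_vectors_def le_fun_def mem_Collect_eq by (metis le_zero_eq)
 have "coherent Q zeta e" using stable_part_incoherent[OF Q dim[OF e(1)]] e(3) by blast
 moreover have "coherent Q zeta (%v. d v - e v)" by (rule list_sum_coherent[OF Q dim e(4)]) (simp add: le_fun_def)
 ultimately have "e = d" using ind e(1,2) unfolding indecomposable_def by blast
 then have "?N (Suc n) (%_. 0) ~= 0" using e(4) by simp
 moreover have "{e. e <= (%_. 0::nat) & e ~= (%_. 0)} = ({} :: ('a => nat) set)" by (auto simp: le_fun_def)
 ultimately show False by simp
qed

theorem DT_coeff_indecomposable:
 assumes Q: "fin_digraph Q" and d: "d : dim_vectors Q" "d ~= 0" and zeta: "stab_weight Q zeta d = 0"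
  and ind: "indecomposable Q zeta d"
 shows "\<forall>\<^sub>F x in at 1. DT_coeff Q zeta d x = stack_function Q d zeta x"
proof -
 interpret fin_digraph Q by (rule Q)
 let ?M = "sum d {v. d v ~= 0}"
 have fin: "finite {v. d v ~= 0}" by (rule finite_support[OF _ d(1)]) simp
 have "?M ~= 0" using d(2) fin by (auto simp: fun_eq_iff zero_fun_def)
 then have M: "1 : {1..?M}" by simp
 have "(SUM n=1..?M. (-1) ^ (n - 1) / real n * list_sum (stable_part Q zeta x) (twist Q x) n d) = stack_function Q d zeta x" for x
 proof -
  let ?N = "%n. list_sum (stable_part Q zeta x) (twist Q x) n d"
  have "(SUM n=1..?M. (-1) ^ (n - 1) / real n * ?N n) = (SUM n:{1}. (-1) ^ (n - 1) / real n * ?N n)"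
  proof (rule sum.mono_neutral_right)
   show "ALL n:{1..?M} - {1}. (-1) ^ (n - 1) / real n * ?N n = 0"
   proof
    fix n assume "n : {1..?M} - {1}"
    then have "n = Suc (Suc (n - 2))" by auto
    then have "?N n = 0" using list_sum_indecomposable[OF Q d(1) ind] by metis
    then show "(-1) ^ (n - 1) / real n * ?N n = 0" by simp
   qed
  qed (use M in auto)
  also have "... = ?N (Suc 0)" by simp
  also have "... = (SUM e | e <= d & e ~= (%_. 0). if e = d then stable_part Q zeta x d else 0)" unfolding list_sum.simps
  proof (rule sum.cong[OF refl])
   fix e assume e: "e : {e. e <= d & e ~= (%_. 0)}"
   have iff: "(%v. d v - e v) = (%_. 0) \<longleftrightarrow> e = d"
   proof
    assume z: "(%v. d v - e v) = (%_. 0)"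
    show "e = d"
    proof
     fix v have "d v - e v = 0" using fun_cong[OF z, of v] .
     moreover have "e v <= d v" using e by (simp add: le_fun_def)
     ultimately show "e v = d v" by simp
    qed
   qed simp
   show "stable_part Q zeta x e * twist Q x (%v. d v - e v) e * (if (%v. d v - e v) = (%_. 0) then 1 else 0)
    = (if e = d then stable_part Q zeta x d else 0)" unfolding iff by (simp add: twist_def euler_form_zero)
  qed
  also have "... = stable_part Q zeta x d"
  proof -
   have "finite {e. e <= d & e ~= (%_. 0)}" using finite_le_dim_vector[OF fin] by (rule finite_subset[rotated]) auto
   moreover have "d : {e. e <= d & e ~= (%_. 0)}" using d(2) by (simp add: zero_fun_def)
   ultimately show ?thesis by (simp only: sum.delta if_True)
  qed
  finally show ?thesis by (simp add: stable_part_def zeta)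
 qed
 then show ?thesis using DT_coeff_eventually[OF Q d, of zeta] by simp
qed

theorem DT_coeff_disconnected:
 assumes Q: "fin_digraph Q" and d: "d : dim_vectors Q" "d ~= 0"
  and Y: "separated Q d Y" "Y ~= {}" "Y ~= {v. d v ~= 0}"
 shows "\<forall>\<^sub>F x in at 1. DT_coeff Q zeta d x = 0"
proof -
 interpret fin_digraph Q by (rule Q)
 have fin: "finite {v. d v ~= 0}" by (rule finite_support[OF _ d(1)]) simp
 have dim: "g : dim_vectors Q" if "g <= d" for g using that d(1) unfolding dim_vectors_def le_fun_def mem_Collect_eq by (metis le_zero_eq)
 have Yd: "Y \<subseteq> {v. d v ~= 0}" using Y(1) by (simp add: separated_def)
 have nz: "e v ~= 0 ==> d v ~= 0" if "e <= d" for e v using le_funD[OF that, of v] by simp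
 have ne: "part Y d ~= (%_. 0)" "part (- Y) d ~= (%_. 0)"
 proof -
  obtain v where "v : Y" using Y(2) by blast
  then have "part Y d v ~= 0" using Yd by (auto simp: part_def)
  then show "part Y d ~= (%_. 0)" by auto
  obtain u where "d u ~= 0" "u ~: Y" using Y(3) Yd by blast
  then have "part (- Y) d u ~= 0" by (simp add: part_def)
  then show "part (- Y) d ~= (%_. 0)" by auto
 qed
 have w: "stable_part Q zeta x e = stable_part Q zeta x (part Y e) * stable_part Q zeta x (part (- Y) e)" if e: "e <= d" for e x
 proof -
  let ?Y = "Y \<inter> {v. e v ~= 0}"
  have "separated Q e ?Y" using Y(1) nz[OF e] unfolding separated_def by blast
  moreover have "part ?Y e = part Y e" "part (- ?Y) e = part (- Y) e" by (auto simp: part_def)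
  ultimately show ?thesis using stable_part_split[OF Q dim[OF e]] by metis
 qed
 have c: "twist Q x f e = twist Q x (part Y f) (part Y e) * twist Q x (part (- Y) f) (part (- Y) e)" if fe: "f <= d" "e <= d" and x: "x ~= 0" for f e x
 proof -
  have "(SUM i:verts Q. int (f i) * int (e i)) = (SUM i:verts Q. int (part Y f i) * int (part Y e i)) + (SUM i:verts Q. int (part (- Y) f i) * int (part (- Y) e i))"
   unfolding sum.distrib[symmetric] by (rule sum.cong) (auto simp: part_def)
  moreover have "(SUM al:arcs Q. int (f (tail Q al)) * int (e (head Q al)))
   = (SUM al:arcs Q. int (part Y f (tail Q al)) * int (part Y e (head Q al))) + (SUM al:arcs Q. int (part (- Y) f (tail Q al)) * int (part (- Y) e (head Q al)))"
   unfolding sum.distrib[symmetric]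
  proof (rule sum.cong[OF refl])
   fix al assume al: "al : arcs Q"
   have "f (tail Q al) = 0 \<or> e (head Q al) = 0 \<or> (tail Q al : Y \<longleftrightarrow> head Q al : Y)"
    using Y(1) nz[OF fe(1)] nz[OF fe(2)] al unfolding separated_def by blast
   then show "int (f (tail Q al)) * int (e (head Q al)) = int (part Y f (tail Q al)) * int (part Y e (head Q al)) + int (part (- Y) f (tail Q al)) * int (part (- Y) e (head Q al))"
    by (auto simp: part_def)
  qed
  ultimately have "- euler_form Q f e = - euler_form Q (part Y f) (part Y e) + - euler_form Q (part (- Y) f) (part (- Y) e)" by (simp add: euler_form_def)
  then show ?thesis using x unfolding twist_def by (simp only: power_int_add simp_thms)
 qed
 have "(SUM n=1..sum d {v. d v ~= 0}. (-1) ^ (n - 1) / real n * list_sum (stable_part Q zeta x) (twist Q x) n d) = 0" if x: "x ~= 0" for x by (rule log_coefficient_split[where Y = Y])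
   (use w c[OF _ _ x] fin ne stable_part_zero[OF Q] twist_zero in "assumption | blast")+
 moreover have "\<forall>\<^sub>F x in at (1::real). x ~= 0" by (rule eventually_mono[OF order_tendstoD(1)[OF tendsto_ident_at, of 0]]) auto
 ultimately show ?thesis using DT_coeff_eventually[OF Q d, of zeta] by (auto elim: eventually_elim2)
qed

context coordinate_space begin

lemma span_disconnected:
 assumes E: "E \<subseteq> I \<times> I" and Z: "Z \<subseteq> I" "biclosed E Z" "Z ~= {}" "Z ~= I"
 shows "span (edge_fun r ` E) ~= V"
proof
 assume sp: "span (edge_fun r ` E) = V"
 obtain x y where xy: "x : Z" "y : I" "y ~: Z" using Z by blast
 let ?u = "coord_fun r x - coord_fun r y"
 have xI: "x : I" using xy Z(1) by blast
 have "?u : span (edge_fun r ` E)" unfolding sp by (intro real_vector.subspace_diff[OF subspace_V] coord_fun_V xI xy(2))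
 then have "cut Z ?u = 0"
 proof (rule cut_span)
  fix u assume "u : edge_fun r ` E"
  then obtain p where p: "p : E" "u = edge_fun r p" by blast
  have "fst p : I" "snd p : I" "fst p : Z \<longleftrightarrow> snd p : Z" using p(1) E Z(2) by (auto simp: biclosed_def)
  then show "cut Z u = 0" unfolding p(2) by (simp only: cut_edge diff_self)
 qed
 moreover have "cut Z ?u = 1" unfolding cut_diff using xy xI by (simp add: cut_coord_fun)
 ultimately show False by simp
qed

end

text \<open>The weights do not span, so there are no singular points.\<close>
theorem (in abelianisation) JK_quiver_disconnected:
 assumes m: "m : types_of d" and lf: "loopfree_digraph Q" and v: "v : verts (MPS_quiver Q m)"
  and Y: "separated Q d Y" "Y ~= {}" "Y ~= {v. d v ~= 0}"
 shows "JK_quiver (MPS_quiver Q m) v R eta = 0"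
proof -
 let ?G = "MPS_quiver Q m"
 interpret A: abelian_quiver ?G v by (rule MPS_abelian_quiver[OF m lf v])
 have deg: "tdegree (model m) = d" by (rule tdegree_model[OF m])
 have fm: "finite (model m)" using m by (intro finite_model) (simp add: types_of_def)
 have dnz: "d (fst x) ~= 0" if "x : model m" for x using tdegree_nonzero[OF fm model_verts that] by (simp add: deg)
 have ex: "EX x:model m. fst x = i" if i: "d i ~= 0" for i
 proof -
  have "tdegree (model m) i ~= 0" using i by (simp add: deg)
  then obtain x where "x : model m" "(case x of (j, k, l) => if j = i then l else 0) ~= 0" unfolding tdegree_def by (rule sum.not_neutral_contains_not_neutral)
  then show ?thesis by (intro bexI[of _ x]) (cases x, auto split: if_splits)
 qed
 let ?Z = "{x:model m. fst x : Y}"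
 have "span (edge_fun v ` A.ends (arcs ?G)) ~= A.V"
 proof (rule A.span_disconnected[OF A.ends_in[OF order.refl]])
  show "?Z \<subseteq> verts ?G" by (auto simp: verts_MPS_quiver)
  show "biclosed (A.ends (arcs ?G)) ?Z" unfolding A.biclosed_ends
  proof
   fix a assume a: "a : arcs ?G"
   then have aB: "a : arcs B" "tail B a : model m" "head B a : model m" by (auto simp: arcs_MPS_quiver arcs_within_def)
   have "tail Q (fst a) : Y \<longleftrightarrow> head Q (fst a) : Y" using Y(1) fst_arcs_B[OF aB(1)] dnz[OF aB(2)] dnz[OF aB(3)] unfolding separated_def fst_tail_B fst_head_B by blast
   then show "tail ?G a : ?Z \<longleftrightarrow> head ?G a : ?Z" using aB by (simp add: ends_MPS_quiver fst_tail_B fst_head_B)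
  qed
  obtain i where i: "i : Y" using Y(2) by blast
  then have "d i ~= 0" using Y(1) by (auto simp: separated_def)
  then show "?Z ~= {}" using ex i by blast
  obtain j where j: "d j ~= 0" "j ~: Y" using Y(1,3) unfolding separated_def by blast
  then show "?Z ~= verts ?G" using ex[OF j(1)] by (auto simp: verts_MPS_quiver)
 qed
 then have "span A.W ~= A.V" by (simp add: A.edge_ends quiver_weights_def)
 then show ?thesis by (rule A.JK_quiver_not_spanning)
qed

definition refined_weight :: "('v, 'a) pre_digraph => ('v => nat) => ('v => nat => nat) => real" where
 "refined_weight Q d m = (PROD i:verts Q. PROD l=1..d i. 1 / fact (m i l) * ((-1) ^ (l - 1) / real l ^ 2) ^ m i l)"

lemma of_real_refined_weight:
 "(PROD i:verts Q. PROD l=1..d i. 1 / fact (m i l) * ((-1) ^ (l - 1) / of_nat l ^ 2) ^ m i l) = complex_of_real (refined_weight Q d m)" by (simp add: refined_weight_def)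

lemma JK_DT_match:
 fixes Q :: "('v, 'a) pre_digraph" and v0 :: "('v => nat => nat) => 'v \<times> nat \<times> nat"
 assumes JK: "!!m. m : multiplicity_vectors Q d ==>
   ((%t. JK_quiver (MPS_quiver Q m) (v0 m) (t *\<^sub>R Rbar m) (zeta_hat \<zeta>)) \<longlongrightarrow> complex_of_real (N m)) at_top"
  and DT: "((%x. (x - 1) * DT_coeff Q \<zeta> d x) \<longlongrightarrow> (SUM m:multiplicity_vectors Q d. refined_weight Q d m * N m)) (at 1)"
 shows "(EX L. ((%t::real. JK_ab Q d \<zeta> v0 (%m. t *\<^sub>R Rbar m)) \<longlongrightarrow> L) at_top)
  & 1 / of_nat (dim_fact Q d) * JK_ab_infty Q d \<zeta> v0 Rbar = of_real (DT_invariant Q d \<zeta>)"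
proof -
 let ?T = "SUM m:multiplicity_vectors Q d. refined_weight Q d m * N m"
 let ?L = "(-1) powi moduli_dim Q d * of_nat (dim_fact Q d) * complex_of_real ?T"
 have "((%t. (-1) powi moduli_dim Q d * of_nat (dim_fact Q d) *
   (SUM m:multiplicity_vectors Q d. complex_of_real (refined_weight Q d m)
    * JK_quiver (MPS_quiver Q m) (v0 m) (t *\<^sub>R Rbar m) (zeta_hat \<zeta>)))
   \<longlongrightarrow> (-1) powi moduli_dim Q d * of_nat (dim_fact Q d) *
   (SUM m:multiplicity_vectors Q d. complex_of_real (refined_weight Q d m) * complex_of_real (N m))) at_top" by (intro tendsto_mult tendsto_const tendsto_sum JK)
 then have lim: "((%t. JK_ab Q d \<zeta> v0 (%m. t *\<^sub>R Rbar m)) \<longlongrightarrow> ?L) at_top" unfolding JK_ab_def of_real_refined_weight by simp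
 then have "JK_ab_infty Q d \<zeta> v0 Rbar = ?L" unfolding JK_ab_infty_def by (intro tendsto_Lim) simp_all
 moreover have "DT_invariant Q d \<zeta> = (-1) powi moduli_dim Q d * ?T" using tendsto_Lim[OF _ DT] by (simp add: DT_invariant_def)
 moreover have "of_nat (dim_fact Q d) ~= (0::complex)" unfolding dim_fact_def of_nat_eq_0_iff by (intro prod_nonzero) simp
 moreover have "complex_of_real ((-1) powi k) = (-1) powi k" for k by (simp add: of_real_power_int)
 ultimately show ?thesis using lim by (auto simp: field_simps)
qed

theorem theorem1p2:
  fixes Q :: "('v, 'a) pre_digraph"
    and d :: "'v \<Rightarrow> nat"
    and \<zeta> :: "'v \<Rightarrow> real"
    and vbar :: 'v and kbar :: nat
    and v0 :: "('v \<Rightarrow> nat \<Rightarrow> nat) \<Rightarrow> 'v \<times> nat \<times> nat"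
    and P :: "('v \<Rightarrow> nat \<Rightarrow> nat) \<Rightarrow> (('v \<times> nat \<times> nat \<Rightarrow> real) \<Rightarrow> real) set"
    and Rbar :: "('v \<Rightarrow> nat \<Rightarrow> nat) \<Rightarrow> ('v \<times> nat \<times> nat \<Rightarrow> real) \<Rightarrow> real"
  assumes "fin_digraph Q" and "loopfree_digraph Q" and "\<nexists>p. pre_digraph.cycle Q p"
    and "d \<in> dim_vectors Q" and "d \<noteq> 0"
    and "stab_weight Q \<zeta> d = 0"
    and "(vbar, kbar) \<in> cartan_index Q d"
    and "lift_regular Q d \<zeta> (vbar, kbar)"
    and "\<And>m. m \<in> multiplicity_vectors Q d \<Longrightarrow> v0 m \<in> verts (MPS_quiver Q m)"
    and "\<And>m. m \<in> multiplicity_vectors Q d \<Longrightarrow> is_charge_cone (MPS_quiver Q m) (v0 m) (P m)"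
    and "\<And>m. m \<in> multiplicity_vectors Q d \<Longrightarrow> Rbar m \<in> P m"
  shows "(\<exists>L. ((\<lambda>t::real. JK_ab Q d \<zeta> v0 (\<lambda>m. t *\<^sub>R Rbar m)) \<longlongrightarrow> L) at_top)
    \<and> 1 / of_nat (dim_fact Q d) * JK_ab_infty Q d \<zeta> v0 Rbar = of_real (DT_invariant Q d \<zeta>)"
proof -
 interpret fin_digraph Q by (rule assms(1))
 interpret A: abelianisation Q d \<zeta> 2 using assms(1,4) by (simp add: abelianisation_def abelianisation_axioms_def)
 have mt: "m : A.types_of d" if "m : multiplicity_vectors Q d" for m using that by (simp add: A.multiplicity_vectors_eq)
 show ?thesis
 proof (cases "connected_support Q d")
  case True
  have ind: "indecomposable Q \<zeta> d" by (rule lift_regular_indecomposable[OF assms(1,4,7,8) True])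
  have ss: "semistable_support (MPS_quiver Q m) eta X S \<longleftrightarrow> semistable_support (blowup_quiver Q) eta X S" for m eta X S
   by (simp add: semistable_support_def succ_closed_def A.ends_MPS_quiver)
  let ?N = "%m. real (card {S. S \<subseteq> arcs (MPS_quiver Q m) \<and>
   semistable_support (blowup_quiver Q) (zeta_hat \<zeta>) (verts (MPS_quiver Q m)) S & Suc (card S) = card (verts (MPS_quiver Q m))})"
  have quiver: "abelian_quiver (MPS_quiver Q m) (v0 m)" "abelian_quiver.rigid (MPS_quiver Q m) (zeta_hat \<zeta>)"
   "sum (zeta_hat \<zeta>) (verts (MPS_quiver Q m)) = 0" if m: "m : multiplicity_vectors Q d" for m
   using A.MPS_abelian_quiver[OF mt[OF m] assms(2) assms(9)[OF m]] A.MPS_rigid[OF mt[OF m] assms(2) assms(9)[OF m] ind]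
    A.weight_model[OF assms(6) mt[OF m]] by (simp_all add: A.verts_MPS_quiver)
  show ?thesis
  proof (rule JK_DT_match[where N = ?N])
   fix m assume m: "m : multiplicity_vectors Q d"
   show "((%t. JK_quiver (MPS_quiver Q m) (v0 m) (t *\<^sub>R Rbar m) (zeta_hat \<zeta>)) \<longlongrightarrow> complex_of_real (?N m)) at_top"
    using abelian_quiver.JK_quiver_semistable_limit[OF quiver(1)[OF m] assms(10,11)[OF m] quiver(2,3)[OF m]] by (simp add: ss)
  next
   have "((%x. (x - 1) * stack_function Q d \<zeta> x) \<longlongrightarrow> (SUM m:multiplicity_vectors Q d. refined_weight Q d m * ?N m)) (at 1)" unfolding refined_weight_def
   proof (rule stack_function_residue[OF assms(1,4)])
    fix m S assume m: "m : multiplicity_vectors Q d" and "S \<subseteq> arcs (MPS_quiver Q m)"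
     "semistable_support (blowup_quiver Q) (zeta_hat \<zeta>) (verts (MPS_quiver Q m)) S"
    then show "card (verts (MPS_quiver Q m)) <= Suc (card S)" using abelian_quiver.semistable_card[OF quiver(1)[OF m] quiver(2,3)[OF m]] by (simp add: ss)
   next
    fix m assume "m : multiplicity_vectors Q d"
    then show "verts (MPS_quiver Q m) ~= {}" using assms(9) by blast
   qed
   moreover have "\<forall>\<^sub>F x in at 1. (x - 1) * stack_function Q d \<zeta> x = (x - 1) * DT_coeff Q \<zeta> d x" using DT_coeff_indecomposable[OF assms(1,4,5,6) ind] by eventually_elim simp
   ultimately show "((%x. (x - 1) * DT_coeff Q \<zeta> d x) \<longlongrightarrow> (SUM m:multiplicity_vectors Q d. refined_weight Q d m * ?N m)) (at 1)"
    by (rule Lim_transform_eventually)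
  qed
 next
  case False
  then obtain Y where Y: "separated Q d Y" "Y ~= {}" "Y ~= {v. d v ~= 0}" by (auto simp: connected_support_def)
  show ?thesis
  proof (rule JK_DT_match[where N = "%_. 0"])
   fix m assume m: "m : multiplicity_vectors Q d"
   show "((%t. JK_quiver (MPS_quiver Q m) (v0 m) (t *\<^sub>R Rbar m) (zeta_hat \<zeta>)) \<longlongrightarrow> complex_of_real 0) at_top"
    by (simp add: A.JK_quiver_disconnected[OF mt[OF m] assms(2) assms(9)[OF m] Y])
  next
   have "\<forall>\<^sub>F x in at 1. 0 = (x - 1) * DT_coeff Q \<zeta> d x" using DT_coeff_disconnected[OF assms(1,4,5) Y, of \<zeta>] by eventually_elim simp
   from Lim_transform_eventually[OF tendsto_const this]
   show "((%x. (x - 1) * DT_coeff Q \<zeta> d x) \<longlongrightarrow> (SUM m:multiplicity_vectors Q d. refined_weight Q d m * 0)) (at 1)" by simp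
  qed
 qed
qed

end
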